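(* Let $K$ be an algebraically closed field of characteristic $0$ and let $(0)\neq I\subset K[x_1,\ldots,x_n]$ be a maximal-gdepth graded ideal with $\dim(I)=m<n$ and $0<\operatorname{depth}(I)=t<m-1$. Let $C$ be a maximal cone of $\operatorname{gT}(I)$. Then there exists a cone $D$ of $\mathcal{W}_n^{m,t}$ such that $\mathring{C}\subset\mathring{D}$.
   Context: $\dim I$ is the Krull dimension of $R_I=K[x_1,\ldots,x_n]/I$; $\operatorname{depth}(I)$ is the maximal length of a regular sequence of linear forms on $R_I$. $\mathring{C}$ is the relative interior of $C$. For $\omega\in\mathbb{R}^n$ the $\omega$-weight of a term $cx^\nu$ is $\omega\cdot\nu$; $\operatorname{in}_\omega(f)$ is the sum of the terms of $f$ of minimal $\omega$-weight; $\operatorname{in}_\omega(I)=(\operatorname{in}_\omega(f):f\in I)$. For a term order $\succ$, $\operatorname{in}_\succ(f)$ is the $\succ$-largest term of $f$ and $\operatorname{in}_\succ(I)$ the ideal generated by these. The Gröbner fan $\operatorname{GF}(I)$ is the complete fan in which $\omega,\omega'$ lie in the same relatively open cone iff $\operatorname{in}_\omega(I)=\operatorname{in}_{\omega'}(I)$. The tropical variety $T(I)=\{\omega\in\mathbb{R}^n:\operatorname{in}_\omega(I)\text{ contains no monomial}\}$ is a subfan of $\operatorname{GF}(I)$. A matrix $g\in\operatorname{GL}_n(K)$ acts by $x_i\mapsto\sum_j g_{ji}x_j$. It is known that if $\dim I>0$ there is a nonempty Zariski-open $U\subset\operatorname{GL}_n(K)$ such that for all $g\in U$: $\operatorname{GF}(g(I))$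 is one and the same fan, $T(g(I))$ is one and the same fan, denoted $\operatorname{gT}(I)$ (generic tropical variety), and for every term order $\succ$, $\operatorname{in}_\succ(g(I))$ is one and the same ideal $\operatorname{gin}_\succ(I)$ (generic initial ideal). $\operatorname{gdepth}(I)=\min_\succ \operatorname{depth}(\operatorname{gin}_\succ(I))$ over all generic initial ideals of $I$; $I$ is maximal-gdepth if $\operatorname{depth}(I)=\operatorname{gdepth}(I)$. $\mathcal{W}_n^m$ is the fan of all cones $C_A=\{\omega\in\mathbb{R}^n:\omega_i=\min_k\omega_k\ \forall i\in A\}$ with $A\subset\{1,\ldots,n\}$, $|A|\ge n-m+1$. For $0<t<m-1$, $\mathcal{W}_n^{m,t}$ is the refinement of $\mathcal{W}_n^m$ whose maximal cones have as relative interiors exactly the sets $\{\omega\in\mathbb{R}^n:\omega_{i_1}=\ldots=\omega_{i_{n-m+1}}<\omega_{i_{n-m+2}},\ldots,\omega_{i_{n-t}}<\omega_{i_{n-t+1}},\ldots,\omega_{i_n}\}$ for permutations $(i_1,\ldots,i_n)$ of $\{1,\ldots,n\}$ (here $a<b_1,\ldots,b_r<c_1,\ldots,c_s$ means $a<b_p$ and $b_p<c_q$ for all $p,q$). *)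

theory Defs
  imports
    "HOL-Analysis.Analysis"
    "HOL-Library.Poly_Mapping"
    "HOL-Library.Extended_Nat"
    "HOL-Algebra.Algebraic_Closure_Type"
begin

section \<open>The polynomial ring\<close>

text \<open>
  The variables are indexed by a finite type \<open>'n\<close>; the number of variables is
  \<open>CARD('n)\<close>. A monomial \<open>x^\<nu>\<close> is its exponent vector \<open>\<nu>\<close>, so the unit monomial is \<open>0\<close> and
  the product of monomials is \<open>+\<close>.
\<close>

type_synonym 'n monomial = "'n \<Rightarrow>\<^sub>0 nat"
type_synonym ('n, 'k) mpoly = "'n monomial \<Rightarrow>\<^sub>0 'k"

abbreviation mpoly_ring :: "('n, 'k::comm_ring_1) mpoly ring" where
  "mpoly_ring \<equiv> ring_of_type_algebra"

definition mdegree :: "'n::finite monomial \<Rightarrow> nat" where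
  "mdegree \<nu> = (\<Sum>i\<in>UNIV. Poly_Mapping.lookup \<nu> i)"

definition restrict_terms :: "('n monomial \<Rightarrow> bool) \<Rightarrow> ('n, 'k::comm_ring_1) mpoly \<Rightarrow> ('n, 'k) mpoly" where
  "restrict_terms P f = (\<Sum>\<nu> | \<nu> \<in> Poly_Mapping.keys f \<and> P \<nu>. Poly_Mapping.single \<nu> (Poly_Mapping.lookup f \<nu>))"

definition subst_mpoly ::
  "('k::comm_ring_1 \<Rightarrow> 'a::comm_ring_1) \<Rightarrow> ('n::finite \<Rightarrow> 'a) \<Rightarrow> ('n, 'k) mpoly \<Rightarrow> 'a" where
  "subst_mpoly c v f = (\<Sum>\<nu>\<in>Poly_Mapping.keys f. c (Poly_Mapping.lookup f \<nu>) * (\<Prod>i\<in>UNIV. v i ^ Poly_Mapping.lookup \<nu> i))"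

abbreviation const_mpoly :: "'k::comm_ring_1 \<Rightarrow> ('n, 'k) mpoly" where
  "const_mpoly c \<equiv> Poly_Mapping.single 0 c"

abbreviation var_mpoly :: "'n \<Rightarrow> ('n, 'k::comm_ring_1) mpoly" where
  "var_mpoly i \<equiv> Poly_Mapping.single (Poly_Mapping.single i 1) 1"

text \<open>Graded with respect to the standard grading: \<open>I\<close> is the sum of its homogeneous parts.\<close>

definition graded :: "('n::finite, 'k::comm_ring_1) mpoly set \<Rightarrow> bool" where
  "graded I \<longleftrightarrow> (\<forall>f\<in>I. \<forall>d. restrict_terms (\<lambda>\<nu>. mdegree \<nu> = d) f \<in> I)"

section \<open>Dimension and depth\<close>

definition krull_dim :: "('a, 'b) ring_scheme \<Rightarrow> enat" where
  "krull_dim R = Sup {enat k | k.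
     \<exists>P::nat \<Rightarrow> 'a set. (\<forall>i\<le>k. primeideal (P i) R) \<and> (\<forall>i<k. P i \<subset> P (Suc i))}"

text \<open>
  The condition on \<open>xs ! i\<close> says that it is a non-zero-divisor modulo the preceding elements.
  The quotient by the whole sequence is required to be nonzero.
\<close>

definition regular_sequence :: "('a, 'b) ring_scheme \<Rightarrow> 'a list \<Rightarrow> bool" where
  "regular_sequence R xs \<longleftrightarrow>
     set xs \<subseteq> carrier R \<and>
     (\<forall>i<length xs. \<forall>a\<in>carrier R.
        xs ! i \<otimes>\<^bsub>R\<^esub> a \<in> Idl\<^bsub>R\<^esub> (set (take i xs)) \<longrightarrow> a \<in> Idl\<^bsub>R\<^esub> (set (take i xs))) \<and>
     Idl\<^bsub>R\<^esub> (set xs) \<noteq> carrier R"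

definition linear_form :: "('n::finite, 'k::comm_ring_1) mpoly \<Rightarrow> bool" where
  "linear_form l \<longleftrightarrow> (\<forall>\<nu>\<in>Poly_Mapping.keys l. mdegree \<nu> = 1)"

abbreviation residue_ring_of :: "('n, 'k::comm_ring_1) mpoly set \<Rightarrow> ('n, 'k) mpoly set ring" where
  "residue_ring_of I \<equiv> mpoly_ring Quot I"

definition ideal_dim :: "('n, 'k::comm_ring_1) mpoly set \<Rightarrow> enat" where
  "ideal_dim I = krull_dim (residue_ring_of I)"

definition ideal_depth :: "('n::finite, 'k::comm_ring_1) mpoly set \<Rightarrow> enat" where
  "ideal_depth I = Sup {enat (length ls) | ls.
     (\<forall>l\<in>set ls. linear_form l) \<and>
     regular_sequence (residue_ring_of I) (map (\<lambda>l. I +>\<^bsub>mpoly_ring\<^esub> l) ls)}"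

section \<open>Initial ideals\<close>

definition weight :: "real ^ 'n \<Rightarrow> 'n::finite monomial \<Rightarrow> real" where
  "weight \<omega> \<nu> = (\<Sum>i\<in>UNIV. \<omega> $ i * real (Poly_Mapping.lookup \<nu> i))"

definition initial_form :: "real ^ 'n \<Rightarrow> ('n::finite, 'k::comm_ring_1) mpoly \<Rightarrow> ('n, 'k) mpoly" where
  "initial_form \<omega> f = restrict_terms (\<lambda>\<nu>. \<forall>\<mu>\<in>Poly_Mapping.keys f. weight \<omega> \<nu> \<le> weight \<omega> \<mu>) f"

definition initial_ideal :: "real ^ 'n \<Rightarrow> ('n::finite, 'k::comm_ring_1) mpoly set \<Rightarrow> ('n, 'k) mpoly set" where
  "initial_ideal \<omega> I = Idl\<^bsub>mpoly_ring\<^esub> (initial_form \<omega> ` I)"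

text \<open>A term order is given as a relation \<open>r\<close>, where \<open>(\<mu>, \<nu>) \<in> r\<close> means \<open>x^\<mu> \<preceq> x^\<nu>\<close>.\<close>

definition term_order :: "'n monomial rel \<Rightarrow> bool" where
  "term_order r \<longleftrightarrow> linear_order r \<and> (\<forall>\<nu>. (0, \<nu>) \<in> r) \<and>
     (\<forall>\<mu> \<nu> \<rho>. (\<mu>, \<nu>) \<in> r \<longrightarrow> (\<mu> + \<rho>, \<nu> + \<rho>) \<in> r)"

definition initial_term :: "'n monomial rel \<Rightarrow> ('n, 'k::comm_ring_1) mpoly \<Rightarrow> ('n, 'k) mpoly" where
  "initial_term r f = restrict_terms (\<lambda>\<nu>. \<forall>\<mu>\<in>Poly_Mapping.keys f. (\<mu>, \<nu>) \<in> r) f"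

definition term_initial_ideal :: "'n monomial rel \<Rightarrow> ('n, 'k::comm_ring_1) mpoly set \<Rightarrow> ('n, 'k) mpoly set" where
  "term_initial_ideal r I = Idl\<^bsub>mpoly_ring\<^esub> (initial_term r ` I)"

section \<open>Groebner fan and tropical variety\<close>

text \<open>A fan is represented by the set of its (closed) cones.\<close>

definition maximal_cone :: "(real ^ 'n) set set \<Rightarrow> (real ^ 'n::finite) set \<Rightarrow> bool" where
  "maximal_cone F C \<longleftrightarrow> C \<in> F \<and> (\<forall>C'\<in>F. C \<subseteq> C' \<longrightarrow> C' = C)"

text \<open>
  The relatively open cones of the Groebner fan are the classes of weights with equal initial
  ideal; the cones themselves are the closures of these classes.
\<close>

definition groebner_fan :: "('n::finite, 'k::comm_ring_1) mpoly set \<Rightarrow> (real ^ 'n) set set" where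
  "groebner_fan I = range (\<lambda>\<omega>. closure {\<omega>'. initial_ideal \<omega>' I = initial_ideal \<omega> I})"

definition tropical_variety :: "('n::finite, 'k::comm_ring_1) mpoly set \<Rightarrow> (real ^ 'n) set" where
  "tropical_variety I = {\<omega>. \<forall>\<nu>. Poly_Mapping.single \<nu> 1 \<notin> initial_ideal \<omega> I}"

text \<open>The fan structure on the tropical variety as a subfan of the Groebner fan.\<close>

definition tropical_fan :: "('n::finite, 'k::comm_ring_1) mpoly set \<Rightarrow> (real ^ 'n) set set" where
  "tropical_fan I = {C \<in> groebner_fan I. C \<subseteq> tropical_variety I}"

section \<open>Generic coordinates\<close>

definition act :: "'k ^ 'n ^ 'n \<Rightarrow> ('n::finite, 'k::comm_ring_1) mpoly \<Rightarrow> ('n, 'k) mpoly" where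
  "act g = subst_mpoly const_mpoly (\<lambda>i. \<Sum>j\<in>UNIV. const_mpoly (g $ j $ i) * var_mpoly j)"

text \<open>
  Open sets of \<open>GL\<^sub>n\<close> are the traces of Zariski-open sets of the space of all matrices, i.e. the
  complements in \<open>GL\<^sub>n\<close> of common zero sets of polynomials in the matrix entries.
\<close>

definition zariski_open_GL :: "('k::field ^ 'n ^ 'n::finite) set \<Rightarrow> bool" where
  "zariski_open_GL U \<longleftrightarrow> (\<exists>S :: ('n \<times> 'n, 'k) mpoly set.
     U = {g. invertible g \<and> (\<exists>p\<in>S. subst_mpoly id (\<lambda>(i, j). g $ i $ j) p \<noteq> 0)})"

definition generically :: "('k::field ^ 'n ^ 'n::finite \<Rightarrow> bool) \<Rightarrow> bool" where
  "generically Q \<longleftrightarrow> (\<exists>U. zariski_open_GL U \<and> U \<noteq> {} \<and> (\<forall>g\<in>U. Q g))"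

definition gin :: "'n monomial rel \<Rightarrow> ('n::finite, 'k::field) mpoly set \<Rightarrow> ('n, 'k) mpoly set" where
  "gin r I = (THE J. generically (\<lambda>g. term_initial_ideal r (act g ` I) = J))"

definition generic_tropical_fan :: "('n::finite, 'k::field) mpoly set \<Rightarrow> (real ^ 'n) set set" where
  "generic_tropical_fan I = (THE F. generically (\<lambda>g. tropical_fan (act g ` I) = F))"

text \<open>The infimum is a minimum, since term orders exist and \<open>enat\<close> is well-ordered.\<close>

definition gdepth :: "('n::finite, 'k::field) mpoly set \<Rightarrow> enat" where
  "gdepth I = Inf {ideal_depth (gin r I) | r. term_order r}"

definition maximal_gdepth :: "('n::finite, 'k::field) mpoly set \<Rightarrow> bool" where
  "maximal_gdepth I \<longleftrightarrow> ideal_depth I = gdepth I"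

section \<open>The fan \<open>W\<close> with parameters \<open>m\<close> and \<open>t\<close>\<close>

text \<open>
  \<open>W_open_cone m t \<sigma>\<close> is the set
  \<open>\<omega>\<^bsub>\<sigma> 1\<^esub> = \<dots> = \<omega>\<^bsub>\<sigma> (n-m+1)\<^esub> < \<omega>\<^bsub>\<sigma> (n-m+2)\<^esub>, \<dots>, \<omega>\<^bsub>\<sigma> (n-t)\<^esub> < \<omega>\<^bsub>\<sigma> (n-t+1)\<^esub>, \<dots>, \<omega>\<^bsub>\<sigma> n\<^esub>\<close>
  with \<open>n = CARD('n)\<close>. It is only meant for \<open>0 < t < m - 1\<close> and \<open>m \<le> n\<close>, so that all three
  blocks of indices are nonempty and no subtraction is truncated.
\<close>

definition W_open_cone :: "nat \<Rightarrow> nat \<Rightarrow> (nat \<Rightarrow> 'n) \<Rightarrow> (real ^ 'n::finite) set" where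
  "W_open_cone m t \<sigma> = (let n = CARD('n) in {\<omega>.
     (\<forall>p\<in>{1..n-m+1}. \<forall>q\<in>{1..n-m+1}. \<omega> $ \<sigma> p = \<omega> $ \<sigma> q) \<and>
     (\<forall>p\<in>{1..n-m+1}. \<forall>q\<in>{n-m+2..n-t}. \<omega> $ \<sigma> p < \<omega> $ \<sigma> q) \<and>
     (\<forall>p\<in>{n-m+2..n-t}. \<forall>q\<in>{n-t+1..n}. \<omega> $ \<sigma> p < \<omega> $ \<sigma> q)})"

lemma rel_interior_closure_W_open_cone:
  "rel_interior (closure (W_open_cone m t \<sigma>)) = W_open_cone m t (\<sigma> :: nat \<Rightarrow> 'n::finite)"
proof -
  define n where "n = CARD('n)"
  define H where "H = (\<Inter>p\<in>{1..n-m+1}. \<Inter>q\<in>{1..n-m+1}. {\<omega>::real^'n. \<omega> $ \<sigma> p = \<omega> $ \<sigma> q})"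
  define U where "U = (\<Inter>p\<in>{1..n-m+1}. \<Inter>q\<in>{n-m+2..n-t}. {\<omega>::real^'n. \<omega> $ \<sigma> p < \<omega> $ \<sigma> q}) \<inter>
    (\<Inter>p\<in>{n-m+2..n-t}. \<Inter>q\<in>{n-t+1..n}. {\<omega>. \<omega> $ \<sigma> p < \<omega> $ \<sigma> q})"
  have W: "W_open_cone m t \<sigma> = H \<inter> U"
    unfolding W_open_cone_def H_def U_def n_def Let_def by blast
  have eq: "{\<omega>::real^'n. \<omega> $ i = \<omega> $ j} = {\<omega>. (axis i 1 - axis j 1) \<bullet> \<omega> = 0}" for i j
    by (auto simp: inner_diff_left inner_axis')
  have "affine H"
    unfolding H_def eq by (auto intro!: affine_Inter simp: affine_hyperplane)
  have lt: "{\<omega>::real^'n. \<omega> $ i < \<omega> $ j} = {\<omega>. (axis i 1 - axis j 1) \<bullet> \<omega> < 0}" for i j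
    by (auto simp: inner_diff_left inner_axis')
  have "open U"
    unfolding U_def lt by (intro open_Int open_INT ballI finite_atLeastAtMost open_halfspace_lt)
  have "convex U"
    unfolding U_def lt by (intro convex_Int convex_INT convex_halfspace_lt)
  have "convex (H \<inter> U)"
    using \<open>affine H\<close> \<open>convex U\<close> by (simp add: convex_Int affine_imp_convex)
  then have "rel_interior (closure (H \<inter> U)) = rel_interior (H \<inter> U)"
    by (rule convex_rel_interior_closure)
  also have "\<dots> = H \<inter> U"
  proof (cases "H \<inter> U = {}")
    case False
    then have "affine hull (H \<inter> U) = H"
      using affine_hull_affine_Int_open[OF \<open>affine H\<close> \<open>open U\<close>] \<open>affine H\<close> by (simp add: affine_hull_eq)
    then show ?thesis
      using \<open>open U\<close> by (intro rel_interior_openin) (metis openin_open_Int)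
  qed simp
  finally show ?thesis
    unfolding W .
qed

text \<open>The fan consists of the maximal cones, which are the closures of these sets, and their faces.\<close>

definition W_fan :: "nat \<Rightarrow> nat \<Rightarrow> (real ^ 'n::finite) set set" where
  "W_fan m t = {D. D \<noteq> {} \<and>
     (\<exists>\<sigma>. bij_betw \<sigma> {1..CARD('n)} (UNIV :: 'n set) \<and> D face_of closure (W_open_cone m t \<sigma>))}"

end

theory Submission
  imports Defs "HOL-Computational_Algebra.Polynomial"
begin

text \<open>
  In generic coordinates \<open>J = g(I)\<close>, the leading monomials of \<open>J\<close> form a strongly stable set for
  every term order, by the infinitesimal action of shears in characteristic 0. Maximality of the
  gdepth then says that for every term order exactly \<open>t\<close> variables, necessarily the \<open>t\<close> smallest
  ones, occur in no minimal generator; and every set of \<open>m\<close> variables is a system of parameters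
  modulo \<open>J\<close>, which gives \<open>T(J) = {\<omega>. \<omega> attains its minimum on at least n - m + 1 coordinates}\<close>.

  A weight \<open>w\<close> in a maximal cone can be moved slightly to have its minimum on exactly a set \<open>A\<close> of
  \<open>n - m + 1\<close> coordinates and to be generic off \<open>A\<close>. Then \<open>W = in\<^sub>w(J)\<close> is homogeneous for all weights
  constant on \<open>A\<close>, so the weights with initial ideal \<open>W\<close> are stable under small perturbations by
  such weights. For any of them, the \<open>t\<close> variables that occur in no minimal generator of the leading
  monomials of \<open>W\<close> are the smallest ones for the term order refining it, that is, they have the \<open>t\<close> largest
  weights; a perturbation makes the inequalities strict.
\<close>

text \<open>One matrix \<open>g\<close> has to serve infinitely many term orders and weights at
  once. The Hilbert function of \<open>I\<close> bounds by some \<open>D\<close> the generating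
  degrees of every monomial ideal that can be an initial ideal of some \<open>g(I)\<close>, so only
  finitely many sets of monomials matter. All that is needed is linear independence of coefficient
  functionals on \<open>g(I)\<close> for such sets (\<open>Ind\<close>, \<open>Sep\<close>), and
  each independence is an open condition on \<open>g\<close>. Even the equality of two initial
  ideals can be recovered from this data, although the ideals vary with \<open>g\<close>.

  The commutative algebra rests on Noether normalization by coordinates. The inequality
  \<open>weight_filtration\<close> serves twice: it yields chains of primes of the expected length,
  and it excludes monomials from initial ideals.

  Relative interiors are monotone only among sets with the same affine hull. The freedom to move a
  weight in all directions constant on \<open>A\<close> therefore has a second use besides
  strictness: it shows that the cone and its W cone span the same linear space.\<close>

hide_const (open) up_ring.coeff up_ring.monom module.smult
no_notation fps_nth (infixl "$" 75)
no_notation Polynomials.var (\<open>X\<index>\<close>)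

declare One_nat_def [simp del]

abbreviation "lookup \<equiv> Poly_Mapping.lookup"
abbreviation "keys \<equiv> Poly_Mapping.keys"
abbreviation "single \<equiv> Poly_Mapping.single"

section \<open>Polynomials and ideals\<close>

text \<open>A ring is a module over itself whose submodules are its ideals. So
  \<open>pid.subspace\<close> reads as ideal and \<open>pid.span\<close> as generated ideal, with
  the span calculus of modules at hand.\<close>

global_interpretation pid: Modules.module "(*) :: 'a::comm_ring_1 \<Rightarrow> 'a \<Rightarrow> 'a"
  by unfold_locales (auto simp: algebra_simps)

declare pid.scale_scale [simp del]

lemma mpoly_ring_simps [simp]:
  "carrier (mpoly_ring :: ('n, 'k::comm_ring_1) mpoly ring) = UNIV"
  "x \<otimes>\<^bsub>(mpoly_ring :: ('n, 'k::comm_ring_1) mpoly ring)\<^esub> y = x * y"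
  "x \<oplus>\<^bsub>(mpoly_ring :: ('n, 'k::comm_ring_1) mpoly ring)\<^esub> y = x + y"
  "\<one>\<^bsub>(mpoly_ring :: ('n, 'k::comm_ring_1) mpoly ring)\<^esub> = 1"
  "\<zero>\<^bsub>(mpoly_ring :: ('n, 'k::comm_ring_1) mpoly ring)\<^esub> = 0"
  by (simp_all add: ring_of_type_algebra_def)

lemma cring_mpoly_ring: "cring (mpoly_ring :: ('n, 'k::comm_ring_1) mpoly ring)"
  by (rule cring_from_type_algebra)

lemma ring_mpoly_ring: "ring (mpoly_ring :: ('n, 'k::comm_ring_1) mpoly ring)"
  by (rule ring_from_type_algebra)

lemma ideal_iff_subspace:
  "ideal J (mpoly_ring :: ('n, 'k::comm_ring_1) mpoly ring) \<longleftrightarrow> pid.subspace J"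
proof
  assume J: "ideal J (mpoly_ring :: ('n, 'k) mpoly ring)"
  then interpret ideal J "mpoly_ring :: ('n, 'k) mpoly ring" .
  show "pid.subspace J"
    using additive_subgroup.zero_closed[OF is_additive_subgroup] additive_subgroup.a_closed[OF is_additive_subgroup]
      I_l_closed by (auto simp: pid.subspace_def)
next
  assume J: "pid.subspace J"
  show "ideal J (mpoly_ring :: ('n, 'k) mpoly ring)"
  proof (rule idealI[OF ring_mpoly_ring])
    interpret R: ring "mpoly_ring :: ('n, 'k) mpoly ring" by (rule ring_mpoly_ring)
    have "\<ominus>\<^bsub>mpoly_ring\<^esub> x = - x" for x :: "('n, 'k) mpoly"
      by (metis R.minus_equality UNIV_I ab_left_minus mpoly_ring_simps(1,3,5))
    then have "inv\<^bsub>add_monoid mpoly_ring\<^esub> x = - x" for x :: "('n, 'k) mpoly"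
      by (simp add: a_inv_def)
    then show "subgroup J (add_monoid (mpoly_ring :: ('n, 'k) mpoly ring))"
      using J by unfold_locales (auto simp: pid.subspace_0 pid.subspace_add pid.subspace_neg)
  qed (use J pid.subspace_scale in \<open>auto simp: mult.commute\<close>)
qed

lemma Idl_eq_span: "genideal (mpoly_ring :: ('n, 'k::comm_ring_1) mpoly ring) X = pid.span X"
  unfolding genideal_def ideal_iff_subspace pid.span_def hull_def by (simp add: conj_commute)

lemma mpoly_expansion: "f = (\<Sum>\<nu>\<in>keys f. single \<nu> (lookup f \<nu>))"
  by (rule poly_mapping_eqI) (auto simp: lookup_sum lookup_single when_def in_keys_iff)

lemma mpoly_expansion_superset:
  assumes "finite T" "keys f \<subseteq> T"
  shows "f = (\<Sum>\<nu>\<in>T. single \<nu> (lookup f \<nu>))"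
  by (subst mpoly_expansion, rule sum.mono_neutral_left) (use assms in \<open>auto simp: in_keys_iff\<close>)

lemma mpoly_induct [case_names single add]:
  assumes "\<And>\<nu> c. P (single \<nu> c)" "\<And>f g. P f \<Longrightarrow> P g \<Longrightarrow> P (f + g)"
  shows "P (f :: 'a \<Rightarrow>\<^sub>0 'b::comm_monoid_add)"
proof -
  have "P (\<Sum>\<nu>\<in>T. single \<nu> (lookup f \<nu>))" if "finite T" for T
    using that
  proof induction
    case empty
    then show ?case using assms(1)[of undefined 0] by simp
  qed (use assms in auto)
  then show ?thesis
    by (metis mpoly_expansion finite_keys)
qed

lemma lookup_restrict_terms: "lookup (restrict_terms P f) \<nu> = (if P \<nu> then lookup f \<nu> else 0)"
  by (auto simp: restrict_terms_def lookup_sum lookup_single when_def in_keys_iff)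

lemma keys_restrict_terms: "keys (restrict_terms P f) = {\<nu> \<in> keys f. P \<nu>}"
  by (auto simp: in_keys_iff lookup_restrict_terms split: if_splits)

lemma restrict_terms_add: "restrict_terms P (f + g) = restrict_terms P f + restrict_terms P g"
  by (rule poly_mapping_eqI) (simp add: lookup_restrict_terms lookup_add)

lemma restrict_terms_minus: "restrict_terms P (f - g) = restrict_terms P f - restrict_terms P g"
  by (rule poly_mapping_eqI) (simp add: lookup_restrict_terms lookup_minus)

lemma lookup_single_mult_add [simp]:
  "lookup (single \<nu> c * f) (\<nu> + \<mu>) = c * lookup f (\<mu> :: 'n monomial)"
  by (induction f rule: mpoly_induct)
    (auto simp: mult_single lookup_single when_def lookup_add ring_distribs)

lemma lookup_single_mult_eq_0:
  assumes "\<And>\<kappa>. \<mu> \<noteq> \<nu> + \<kappa>"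
  shows "lookup (single \<nu> c * f) (\<mu> :: 'n monomial) = 0"
  using assms by (induction f rule: mpoly_induct)
    (auto simp: mult_single lookup_single when_def lookup_add ring_distribs)

lemma lookup_const_mult [simp]: "lookup (single 0 c * f) (\<mu> :: 'n monomial) = c * lookup f \<mu>"
  using lookup_single_mult_add[of 0 c f \<mu>] by simp

lemma keys_const_mult: "keys (single 0 c * f) \<subseteq> keys (f :: ('n, 'k::comm_ring_1) mpoly)"
  by (auto simp: in_keys_iff)

lemma keys_single_mult: "keys (single \<nu> c * f) \<subseteq> (+) \<nu> ` keys (f :: ('n, 'k::comm_ring_1) mpoly)"
  using keys_mult[of "single \<nu> c" f] by (auto split: if_splits)

section \<open>Monomials: divisibility, degree, weight\<close>

lemma monomial_eqI: "(\<And>i. lookup \<mu> i = lookup \<nu> i) \<Longrightarrow> \<mu> = \<nu>"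
  by (rule poly_mapping_eqI)

text \<open>Divisibility of monomials.\<close>

definition mle :: "'n monomial \<Rightarrow> 'n monomial \<Rightarrow> bool" where
  "mle \<mu> \<nu> \<longleftrightarrow> (\<forall>i. lookup \<mu> i \<le> lookup \<nu> i)"

lemma mle_add [simp]: "mle \<mu> (\<mu> + \<kappa>)"
  by (simp add: mle_def lookup_add)

lemma mle_minus: "mle \<mu> \<nu> \<Longrightarrow> \<mu> + (\<nu> - \<mu>) = \<nu>"
  by (rule monomial_eqI) (simp add: mle_def lookup_add lookup_minus)

lemma mle_iff: "mle \<mu> \<nu> \<longleftrightarrow> (\<exists>\<kappa>. \<nu> = \<mu> + \<kappa>)"
  by (metis mle_add mle_minus)

lemma mle_refl [simp]: "mle \<mu> \<mu>" by (simp add: mle_def)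

lemma mle_trans: "mle \<mu> \<nu> \<Longrightarrow> mle \<nu> \<kappa> \<Longrightarrow> mle \<mu> \<kappa>"
  by (meson mle_def le_trans)

abbreviation (input) xvar :: "'n \<Rightarrow> 'n monomial" where "xvar i \<equiv> single i 1"

lemma xvar_dvd: "lookup \<nu> i > 0 \<Longrightarrow> xvar i + (\<nu> - xvar i) = (\<nu> :: 'n monomial)"
  by (rule mle_minus) (auto simp: mle_def lookup_single when_def)

lemma mdegree_add: "mdegree (\<mu> + \<nu>) = mdegree \<mu> + mdegree \<nu>"
  by (simp add: mdegree_def lookup_add sum.distrib)

lemma mdegree_0 [simp]: "mdegree 0 = 0"
  by (simp add: mdegree_def)

lemma mdegree_single [simp]: "mdegree (single i k) = k"
  by (simp add: mdegree_def lookup_single when_def)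

lemma mdegree_eq_0_iff: "mdegree \<nu> = 0 \<longleftrightarrow> \<nu> = 0"
  by (auto simp: mdegree_def intro!: monomial_eqI)

lemma lookup_le_mdegree: "lookup \<nu> i \<le> mdegree \<nu>"
  unfolding mdegree_def by (rule member_le_sum) auto

lemma mle_mdegree_eq: "mle \<mu> \<nu> \<Longrightarrow> mdegree \<nu> \<le> mdegree \<mu> \<Longrightarrow> \<mu> = \<nu>"
  unfolding mle_iff using mdegree_eq_0_iff by (fastforce simp: mdegree_add)

lemma weight_add: "weight w (\<mu> + \<nu>) = weight w \<mu> + weight w \<nu>"
  by (simp add: weight_def lookup_add sum.distrib algebra_simps)

lemma weight_0 [simp]: "weight w 0 = 0"
  by (simp add: weight_def)

lemma weight_single [simp]: "weight w (single i k) = w $ i * k"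
proof -
  have "weight w (single i k) = (\<Sum>j\<in>UNIV. if j = i then w $ i * k else 0)"
    unfolding weight_def by (rule sum.cong) (auto simp: lookup_single)
  then show ?thesis by simp
qed

lemma weight_add_left: "weight (u + v) \<nu> = weight u \<nu> + weight v \<nu>"
  by (simp add: weight_def algebra_simps sum.distrib)

lemma weight_scale: "weight (c *\<^sub>R v) \<nu> = c * weight v \<nu>"
  unfolding weight_def sum_distrib_left by (intro sum.cong refl) simp

lemma finite_monomials_le: "finite {\<nu> :: 'n::finite monomial. mdegree \<nu> \<le> d}"
proof -
  have "finite {f :: 'n \<Rightarrow> nat. \<forall>i. f i \<in> {..d}}"
    using finite_PiE[of "UNIV :: 'n set" "\<lambda>_. {..d}"] by (simp add: PiE_UNIV_domain Pi_def)
  moreover have "lookup ` {\<nu> :: 'n monomial. mdegree \<nu> \<le> d} \<subseteq> {f. \<forall>i. f i \<in> {..d}}"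
    using lookup_le_mdegree le_trans by (fastforce simp: image_iff)
  ultimately have "finite (lookup ` {\<nu> :: 'n monomial. mdegree \<nu> \<le> d})"
    by (rule rev_finite_subset)
  then show ?thesis
    by (rule finite_imageD) (metis inj_onI poly_mapping_eq_iff)
qed

lemma finite_monomials_eq: "finite {\<nu> :: 'n::finite monomial. mdegree \<nu> = d}"
  by (rule finite_subset[OF _ finite_monomials_le[of d]]) auto

abbreviation hcomp :: "nat \<Rightarrow> ('n::finite, 'k::comm_ring_1) mpoly \<Rightarrow> ('n, 'k) mpoly" where
  "hcomp d \<equiv> restrict_terms (\<lambda>\<nu>. mdegree \<nu> = d)"

lemma mono_degree_induct_add: "(\<exists>i. lookup \<nu> i > 0) \<longleftrightarrow> \<nu> \<noteq> (0 :: 'n monomial)"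
  by (metis bot_nat_0.not_eq_extremum lookup_zero poly_mapping_eqI)

lemma monomial_induct [case_names zero add]:
  assumes "P 0" "\<And>\<nu> i. P \<nu> \<Longrightarrow> P (\<nu> + xvar i)"
  shows "P (\<nu> :: 'n::finite monomial)"
proof (induction "mdegree \<nu>" arbitrary: \<nu>)
  case 0
  then show ?case using assms mdegree_eq_0_iff by metis
next
  case (Suc d)
  then have "\<nu> \<noteq> 0" by auto
  then obtain i where i: "lookup \<nu> i > 0" unfolding mono_degree_induct_add[symmetric] by (elim exE)
  then have eq: "(\<nu> - xvar i) + xvar i = \<nu>" using xvar_dvd[OF i] by (simp only: add.commute)
  have "mdegree (\<nu> - xvar i) + 1 = mdegree \<nu>"
    using mdegree_add[of "\<nu> - xvar i" "xvar i"] unfolding eq mdegree_single by (rule sym)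
  then have "d = mdegree (\<nu> - xvar i)"
    using Suc.hyps(2) by linarith
  from assms(2)[OF Suc.hyps(1)[OF this], of i] show ?case unfolding eq .
qed

lemma prod_power_add:
  fixes v :: "'n::finite \<Rightarrow> 'a::comm_ring_1" and \<mu> \<nu> :: "'n monomial"
  shows "(\<Prod>i\<in>UNIV. v i ^ lookup (\<mu> + \<nu>) i) = (\<Prod>i\<in>UNIV. v i ^ lookup \<mu> i) * (\<Prod>i\<in>UNIV. v i ^ lookup \<nu> i)"
  by (simp add: lookup_add power_add prod.distrib)

lemma prod_power_single:
  fixes v :: "'n::finite \<Rightarrow> 'a::comm_ring_1"
  shows "(\<Prod>i\<in>UNIV. v i ^ lookup (single j k) i) = v j ^ k"
proof -
  have "(\<Prod>i\<in>UNIV. v i ^ lookup (single j k) i) = (\<Prod>i\<in>UNIV. if i = j then v j ^ k else 1)"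
    by (rule prod.cong) (auto simp: lookup_single)
  then show ?thesis by simp
qed

text \<open>Solving the equation \<open>b\<close> for the unknown \<open>a0\<close> lowers both
  numbers by one. The dimension counts below (Hilbert functions, depth, chains of primes) go through
  this statement.\<close>

lemma homogeneous_system:
  fixes M :: "'b \<Rightarrow> 'a \<Rightarrow> 'k::field"
  assumes "finite B" "finite A" "card B < card A"
  shows "\<exists>c. (\<exists>a\<in>A. c a \<noteq> 0) \<and> (\<forall>b\<in>B. (\<Sum>a\<in>A. M b a * c a) = 0)"
  using assms
proof (induction B arbitrary: A M rule: finite_induct)
  case empty
  then have "A \<noteq> {}" by auto
  then show ?case by (intro exI[of _ "\<lambda>_. 1"]) auto
next
  case (insert b B)
  show ?case
  proof (cases "\<forall>a\<in>A. M b a = 0")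
    case True
    have "card B < card A" using insert.prems insert.hyps by simp
    from insert.IH[OF insert.prems(1) this] obtain c
      where "(\<exists>a\<in>A. c a \<noteq> 0) \<and> (\<forall>b\<in>B. (\<Sum>a\<in>A. M b a * c a) = 0)" ..
    then show ?thesis using True by (intro exI[of _ c]) auto
  next
    case False
    then obtain a0 where a0: "a0 \<in> A" "M b a0 \<noteq> 0" by auto
    let ?M = "\<lambda>b' a. M b' a - M b' a0 * M b a / M b a0"
    have "finite (A - {a0})" "card B < card (A - {a0})" using insert.prems insert.hyps a0 by auto
    from insert.IH[OF this, of ?M] obtain c where c: "\<exists>a\<in>A - {a0}. c a \<noteq> 0"
      "\<And>b'. b' \<in> B \<Longrightarrow> (\<Sum>a\<in>A - {a0}. ?M b' a * c a) = 0"
      by metis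
    define s where "s = (\<Sum>a\<in>A - {a0}. M b a * c a)"
    define c' where "c' = c(a0 := - s / M b a0)"
    have spl: "(\<Sum>a\<in>A. M b' a * c' a) = M b' a0 * (- s / M b a0) + (\<Sum>a\<in>A - {a0}. M b' a * c a)" for b'
    proof -
      have "(\<Sum>a\<in>A - {a0}. M b' a * c' a) = (\<Sum>a\<in>A - {a0}. M b' a * c a)"
        by (rule sum.cong) (auto simp: c'_def)
      then show ?thesis
        unfolding sum.remove[OF insert.prems(1) a0(1), of "\<lambda>a. M b' a * c' a"] by (simp add: c'_def)
    qed
    have "(\<Sum>a\<in>A. M b' a * c' a) = 0" if "b' \<in> B" for b'
    proof -
      have "(\<Sum>a\<in>A - {a0}. ?M b' a * c a) = (\<Sum>a\<in>A - {a0}. M b' a * c a) - M b' a0 / M b a0 * s"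
        unfolding s_def sum_distrib_left sum_subtractf[symmetric]
        by (intro sum.cong refl) (simp add: left_diff_distrib)
      then have "(\<Sum>a\<in>A - {a0}. M b' a * c a) = M b' a0 / M b a0 * s" unfolding c(2)[OF that] by simp
      then show ?thesis unfolding spl[of b'] by simp
    qed
    moreover have "(\<Sum>a\<in>A. M b a * c' a) = 0"
      using a0(2) unfolding spl[of b] s_def[symmetric] by simp
    moreover have "\<exists>a\<in>A. c' a \<noteq> 0" using c(1) unfolding c'_def by (metis DiffE fun_upd_other insertCI)
    ultimately show ?thesis by blast
  qed
qed

section \<open>Substitution homomorphisms\<close>

lemma subst_mpoly_superset:
  assumes "c 0 = 0" "finite T" "keys f \<subseteq> T"
  shows "subst_mpoly c v f = (\<Sum>\<nu>\<in>T. c (lookup f \<nu>) * (\<Prod>i\<in>UNIV. v i ^ lookup \<nu> i))"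
  unfolding subst_mpoly_def
  by (rule sum.mono_neutral_left) (use assms in \<open>auto simp: in_keys_iff\<close>)

lemma subst_mpoly_single:
  assumes "c 0 = 0"
  shows "subst_mpoly c v (single \<nu> a) = c a * (\<Prod>i\<in>UNIV. v i ^ lookup \<nu> i)"
  by (subst subst_mpoly_superset[where T = "{\<nu>}"]) (use assms in auto)

lemma subst_mpoly_add:
  assumes "c 0 = 0" "\<And>a b. c (a + b) = c a + c b"
  shows "subst_mpoly c v (f + g) = subst_mpoly c v f + subst_mpoly c v g"
  by (subst (1 2 3) subst_mpoly_superset[where T = "keys f \<union> keys g"])
    (use assms keys_add[of f g] in \<open>auto simp: lookup_add ring_distribs sum.distrib\<close>)

lemma subst_mpoly_mult:
  assumes c: "c 0 = 0" "\<And>a b. c (a + b) = c a + c b" "\<And>a b. c (a * b) = c a * c b"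
  shows "subst_mpoly c v (f * g) = subst_mpoly c v f * subst_mpoly c v g"
proof (induction f rule: mpoly_induct)
  case (single \<mu> a)
  show ?case
  proof (induction g rule: mpoly_induct)
    case (single \<nu> b)
    show ?case
      unfolding mult_single subst_mpoly_single[of c, OF c(1)] c(3) prod_power_add by (simp only: mult_ac)
  qed (simp only: subst_mpoly_add[of c, OF c(1,2)] ring_distribs)
qed (simp only: subst_mpoly_add[of c, OF c(1,2)] ring_distribs)

definition meval :: "('n::finite \<Rightarrow> 'k::comm_ring_1) \<Rightarrow> ('n, 'k) mpoly \<Rightarrow> 'k" where
  "meval = subst_mpoly id"

lemma meval_single: "meval v (single \<nu> a) = a * (\<Prod>i\<in>UNIV. v i ^ lookup \<nu> i)"
  by (simp add: meval_def subst_mpoly_single)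

lemma meval_add: "meval v (f + g) = meval v f + meval v g"
  unfolding meval_def by (rule subst_mpoly_add) auto

lemma meval_mult: "meval v (f * g) = meval v f * meval v g"
  unfolding meval_def by (rule subst_mpoly_mult) auto

definition lin_form_of :: "'k ^ 'n ^ 'n \<Rightarrow> 'n::finite \<Rightarrow> ('n, 'k::comm_ring_1) mpoly" where
  "lin_form_of g i = (\<Sum>j\<in>UNIV. const_mpoly (g $ j $ i) * var_mpoly j)"

lemma act_def': "act g = subst_mpoly const_mpoly (lin_form_of g)"
  unfolding act_def lin_form_of_def ..

lemma act_single: "act g (single \<nu> a) = const_mpoly a * (\<Prod>i\<in>UNIV. lin_form_of g i ^ lookup \<nu> i)"
  by (simp add: act_def' subst_mpoly_single)

lemma act_add: "act g (f + h) = act g f + act g h"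
  unfolding act_def' by (rule subst_mpoly_add) (auto simp: single_add)

lemma act_mult: "act g (f * h) = act g f * act g h"
  unfolding act_def' by (rule subst_mpoly_mult) (auto simp: single_add mult_single)

lemma act_const [simp]: "act g (single 0 a) = single 0 a"
  by (simp add: act_single)

lemma act_0 [simp]: "act g 0 = 0"
  using act_const[of g 0] by simp

lemma act_1 [simp]: "act g 1 = 1"
  using act_const[of g 1] by simp

lemma act_sum: "act g (sum f A) = (\<Sum>a\<in>A. act g (f a))"
  by (induction A rule: infinite_finite_induct) (auto simp: act_add)

lemma act_prod: "act g (prod f A) = (\<Prod>a\<in>A. act g (f a))"
  by (induction A rule: infinite_finite_induct) (auto simp: act_mult)

lemma act_power: "act g (f ^ n) = act g f ^ n"
  by (induction n) (auto simp: act_mult)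

lemma act_var: "act g (single (xvar i) 1) = lin_form_of g i"
  by (simp only: act_single prod_power_single) simp

text \<open>With the transposed index \<open>g $ j $ i\<close> in the image of \<open>x_i\<close>,
  substitution is a left action; the other convention would reverse the matrix product.\<close>

lemma act_compose: "act h (act g f) = act (h ** g) f"
proof (induction f rule: mpoly_induct)
  case (single \<nu> a)
  have "act h (lin_form_of g i) = lin_form_of (h ** g) i" for i
  proof -
    have "act h (lin_form_of g i) = (\<Sum>j\<in>UNIV. const_mpoly (g $ j $ i) * (\<Sum>k\<in>UNIV. const_mpoly (h $ k $ j) * var_mpoly k))"
      unfolding lin_form_of_def[of g] by (simp add: act_sum act_mult act_var lin_form_of_def)
    also have "\<dots> = (\<Sum>j\<in>UNIV. \<Sum>k\<in>UNIV. single (xvar k) (g $ j $ i * h $ k $ j))"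
      by (simp add: sum_distrib_left mult_single)
    also have "\<dots> = (\<Sum>k\<in>UNIV. \<Sum>j\<in>UNIV. single (xvar k) (h $ k $ j * g $ j $ i))"
      by (subst sum.swap) (simp add: mult.commute)
    also have "\<dots> = lin_form_of (h ** g) i"
    proof -
      have "(\<Sum>j\<in>A. single (xvar k) (h $ k $ j * g $ j $ i)) = single (xvar k) (\<Sum>j\<in>A. h $ k $ j * g $ j $ i)" if "finite A" for A k
        using that by induction (auto simp: single_add)
      then show ?thesis by (simp add: lin_form_of_def matrix_matrix_mult_def mult_single)
    qed
    finally show ?thesis .
  qed
  then show ?case by (simp add: act_single act_mult act_prod act_power)
qed (simp add: act_add)

lemma act_id [simp]: "act (mat 1) (f :: ('n::finite, 'k::comm_ring_1) mpoly) = f"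
proof (induction f rule: mpoly_induct)
  case (single \<nu> a)
  have l: "lin_form_of (mat 1) i = single (xvar i) (1 :: 'k)" for i :: 'n
  proof -
    have "lin_form_of (mat 1) i = (\<Sum>j\<in>UNIV. if j = i then single (xvar i) (1 :: 'k) else 0)"
      unfolding lin_form_of_def by (rule sum.cong) (auto simp: mat_def mult_single)
    then show ?thesis by simp
  qed
  have "(\<Prod>i\<in>UNIV. single (xvar i) (1 :: 'k) ^ lookup \<nu> i) = single \<nu> 1"
  proof (induction \<nu> rule: monomial_induct)
    case (add \<nu> i)
    have "(\<Prod>j\<in>UNIV. single (xvar j) (1 :: 'k) ^ lookup (\<nu> + xvar i) j) = single \<nu> 1 * single (xvar i) 1"
      unfolding prod_power_add add prod_power_single by simp
    then show ?case by (simp add: mult_single)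
  qed simp
  then show ?case by (simp add: act_single l mult_single)
qed (simp add: act_add)




lemma invertible_inverse:
  assumes "invertible (g :: 'k::field ^ 'n ^ 'n::finite)"
  obtains g' where "g ** g' = mat 1" "g' ** g = mat 1" "invertible g'"
  using assms unfolding invertible_def by blast

lemma homogeneous_prod_power:
  fixes v :: "'n::finite \<Rightarrow> ('n, 'k::comm_ring_1) mpoly"
  assumes "\<And>i. \<forall>\<mu>\<in>keys (v i). mdegree \<mu> = 1"
  shows "\<forall>\<mu>\<in>keys (\<Prod>i\<in>UNIV. v i ^ lookup \<nu> i). mdegree \<mu> = mdegree \<nu>"
proof (induction \<nu> rule: monomial_induct)
  case zero
  then show ?case using keys_one by auto
next
  case (add \<nu> i)
  show ?case
  proof
    fix \<mu> assume "\<mu> \<in> keys (\<Prod>j\<in>UNIV. v j ^ lookup (\<nu> + xvar i) j)"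
    then have "\<mu> \<in> keys ((\<Prod>j\<in>UNIV. v j ^ lookup \<nu> j) * v i)"
      by (simp only: prod_power_add prod_power_single power_one_right)
    then obtain a b where "\<mu> = a + b" "a \<in> keys (\<Prod>j\<in>UNIV. v j ^ lookup \<nu> j)" "b \<in> keys (v i)"
      using keys_mult by blast
    then show "mdegree \<mu> = mdegree (\<nu> + xvar i)"
      using add assms[of i] by (simp add: mdegree_add)
  qed
qed

lemma keys_lin_form_of: "\<mu> \<in> keys (lin_form_of g i) \<Longrightarrow> mdegree \<mu> = 1"
proof -
  assume "\<mu> \<in> keys (lin_form_of g i)"
  then have "\<mu> \<in> keys (\<Sum>j\<in>UNIV. const_mpoly (g $ j $ i) * var_mpoly j)"
    unfolding lin_form_of_def .
  from subsetD[OF keys_sum this] obtain j where "\<mu> \<in> keys (const_mpoly (g $ j $ i) * var_mpoly j)"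
    by (elim UN_E)
  then have "\<mu> \<in> keys (single (xvar j) (g $ j $ i))" by (simp only: mult_single add_0 mult_1_right)
  then have "\<mu> = xvar j" by (auto split: if_splits)
  then show ?thesis by simp
qed

lemma keys_act_degree:
  assumes "\<mu> \<in> keys (act g f)"
  shows "\<exists>\<nu>\<in>keys f. mdegree \<nu> = mdegree \<mu>"
proof -
  have "\<mu> \<in> keys (\<Sum>\<nu>\<in>keys f. const_mpoly (lookup f \<nu>) * (\<Prod>i\<in>UNIV. lin_form_of g i ^ lookup \<nu> i))"
    using assms by (simp add: act_def' subst_mpoly_def)
  from subsetD[OF keys_sum this] obtain \<nu> where \<nu>: "\<nu> \<in> keys f"
    "\<mu> \<in> keys (const_mpoly (lookup f \<nu>) * (\<Prod>i\<in>UNIV. lin_form_of g i ^ lookup \<nu> i))"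
    by (elim UN_E)
  have "\<mu> \<in> keys (\<Prod>i\<in>UNIV. lin_form_of g i ^ lookup \<nu> i)"
    by (rule subsetD[OF keys_const_mult \<nu>(2)])
  moreover have "\<forall>\<mu>\<in>keys (\<Prod>i\<in>UNIV. lin_form_of g i ^ lookup \<nu> i). mdegree \<mu> = mdegree \<nu>"
    by (rule homogeneous_prod_power) (simp add: keys_lin_form_of)
  ultimately show ?thesis using \<nu>(1) by auto
qed

lemma hcomp_act: "hcomp d (act g f) = act g (hcomp d f)"
proof -
  let ?h = "restrict_terms (\<lambda>\<nu>. mdegree \<nu> \<noteq> d) f"
  have f: "f = hcomp d f + ?h"
    by (rule poly_mapping_eqI) (simp add: lookup_restrict_terms lookup_add)
  have "act g f = act g (hcomp d f) + act g ?h"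
    by (subst f) (rule act_add)
  moreover have "lookup (act g (hcomp d f)) \<mu> = 0" if "mdegree \<mu> \<noteq> d" for \<mu>
    using keys_act_degree[of \<mu> g "hcomp d f"] that by (auto simp: keys_restrict_terms in_keys_iff)
  moreover have "lookup (act g ?h) \<mu> = 0" if "mdegree \<mu> = d" for \<mu>
    using keys_act_degree[of \<mu> g ?h] that by (auto simp: keys_restrict_terms in_keys_iff)
  ultimately show ?thesis
    by (intro poly_mapping_eqI) (simp add: lookup_restrict_terms lookup_add)
qed

lemma subspace_act:
  assumes "pid.subspace J" "invertible (g :: 'k::field ^ 'n ^ 'n::finite)"
  shows "pid.subspace (act g ` J)"
proof -
  obtain g' where g': "g ** g' = mat 1" using assms(2) invertible_inverse by blast
  \<comment> \<open>An arbitrary multiplier \<open>c\<close> is itself in the image of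
    \<open>act g\<close>; surjectivity is what makes the image an ideal.\<close>
  have mult: "c * act g f = act g (act g' c * f)" for c f
    unfolding act_mult act_compose g' act_id ..
  show ?thesis
  proof (rule pid.subspaceI)
    show "0 \<in> act g ` J"
      by (rule image_eqI[where x = 0]) (use assms(1) pid.subspace_0 in auto)
    show "x + y \<in> act g ` J" if "x \<in> act g ` J" "y \<in> act g ` J" for x y
      using that pid.subspace_add[OF assms(1)] by (auto simp: act_add[symmetric])
    show "c * x \<in> act g ` J" if "x \<in> act g ` J" for c x
      using that pid.subspace_scale[OF assms(1)] by (auto simp: mult)
  qed
qed

lemma graded_act: "graded J \<Longrightarrow> graded (act g ` J)"
  unfolding graded_def by (auto simp: hcomp_act)

lemma act_act_image: "act h ` act g ` J = act (h ** g) ` J"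
  by (auto simp: image_image act_compose)

section \<open>Generic coordinates\<close>

text \<open>Polynomial functions of the matrix entries, given by closure rules so that determinants
  and coefficients of transformed polynomials are recognised by introduction;
  \<open>polyfun_imp_mpoly\<close> returns to actual polynomials.\<close>

inductive polyfun :: "('k::field ^ 'n ^ 'n::finite \<Rightarrow> 'k) \<Rightarrow> bool" where
  polyfun_const: "polyfun (\<lambda>_. c)"
| polyfun_entry: "polyfun (\<lambda>g. g $ i $ j)"
| polyfun_add: "polyfun f \<Longrightarrow> polyfun h \<Longrightarrow> polyfun (\<lambda>g. f g + h g)"
| polyfun_mult: "polyfun f \<Longrightarrow> polyfun h \<Longrightarrow> polyfun (\<lambda>g. f g * h g)"

lemma polyfun_sum: "(\<And>a. a \<in> A \<Longrightarrow> polyfun (f a)) \<Longrightarrow> polyfun (\<lambda>g. \<Sum>a\<in>A. f a g)"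
  by (induction A rule: infinite_finite_induct) (auto intro: polyfun.intros)

lemma polyfun_prod: "(\<And>a. a \<in> A \<Longrightarrow> polyfun (f a)) \<Longrightarrow> polyfun (\<lambda>g. \<Prod>a\<in>A. f a g)"
  by (induction A rule: infinite_finite_induct) (auto intro: polyfun.intros)

lemma polyfun_power: "polyfun f \<Longrightarrow> polyfun (\<lambda>g. f g ^ k)"
  by (induction k) (auto intro: polyfun.intros)

lemma polyfun_det: "polyfun (det :: 'k::field ^ 'n ^ 'n::finite \<Rightarrow> 'k)"
  unfolding det_def [abs_def] by (intro polyfun_sum polyfun_mult polyfun_const polyfun_prod polyfun_entry)

lemma polyfun_meval: "polyfun (\<lambda>g. meval (\<lambda>(i, j). g $ i $ j) p)"
proof (induction p rule: mpoly_induct)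
  case (single \<nu> c)
  show ?case unfolding meval_single
    by (intro polyfun_mult polyfun_const polyfun_prod polyfun_power) (simp add: case_prod_beta polyfun_entry)
qed (simp only: meval_add polyfun_add)

lemma polyfun_imp_mpoly:
  "polyfun \<phi> \<Longrightarrow> \<exists>p. \<forall>g. meval (\<lambda>(i, j). g $ i $ j) p = \<phi> g"
proof (induction rule: polyfun.induct)
  case (polyfun_const c)
  show ?case by (rule exI[of _ "single 0 c"]) (simp add: meval_single)
next
  case (polyfun_entry i j)
  show ?case
    by (intro exI[of _ "single (xvar (i, j)) 1"] allI) (simp only: meval_single prod_power_single, simp)
next
  case (polyfun_add f h)
  then obtain p q where "\<forall>g. meval (\<lambda>(i, j). g $ i $ j) p = f g" "\<forall>g. meval (\<lambda>(i, j). g $ i $ j) q = h g"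
    by (elim exE)
  then show ?case by (intro exI[of _ "p + q"]) (simp add: meval_add)
next
  case (polyfun_mult f h)
  then obtain p q where "\<forall>g. meval (\<lambda>(i, j). g $ i $ j) p = f g" "\<forall>g. meval (\<lambda>(i, j). g $ i $ j) q = h g"
    by (elim exE)
  then show ?case by (intro exI[of _ "p * q"]) (simp add: meval_mult)
qed

text \<open>Restriction to a line reduces questions of nonvanishing on matrices to the finiteness of
  the roots of a univariate polynomial.\<close>

lemma polyfun_line:
  "polyfun \<phi> \<Longrightarrow> \<exists>P. \<forall>s. \<phi> (\<chi> i j. a $ i $ j + s * b $ i $ j) = poly P s"
proof (induction rule: polyfun.induct)
  case (polyfun_const c)
  show ?case by (rule exI[of _ "[:c:]"]) simp
next
  case (polyfun_entry i j)
  show ?case by (rule exI[of _ "[:a $ i $ j, b $ i $ j:]"]) simp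
next
  case (polyfun_add f h)
  then show ?case by (metis poly_add)
next
  case (polyfun_mult f h)
  then show ?case by (metis poly_mult)
qed

text \<open>A nonempty open set contains the nonvanishing locus of a single polynomial: choose a
  point of the set and a defining polynomial that is nonzero there.\<close>

lemma generically_iff:
  "generically Q \<longleftrightarrow> (\<exists>\<phi>. polyfun \<phi> \<and> (\<exists>g. invertible g \<and> \<phi> g \<noteq> 0) \<and> (\<forall>g. invertible g \<longrightarrow> \<phi> g \<noteq> 0 \<longrightarrow> Q g))"
proof
  assume "generically Q"
  then obtain U S where U: "U = {g. invertible g \<and> (\<exists>p\<in>S. meval (\<lambda>(i, j). g $ i $ j) p \<noteq> 0)}"
      "U \<noteq> {}" "\<forall>g\<in>U. Q g"
    unfolding generically_def zariski_open_GL_def meval_def[symmetric] by auto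
  then obtain g p where "invertible g" "p \<in> S" "meval (\<lambda>(i, j). g $ i $ j) p \<noteq> 0" by auto
  then show "\<exists>\<phi>. polyfun \<phi> \<and> (\<exists>g. invertible g \<and> \<phi> g \<noteq> 0) \<and> (\<forall>g. invertible g \<longrightarrow> \<phi> g \<noteq> 0 \<longrightarrow> Q g)"
    using U by (intro exI[of _ "\<lambda>g. meval (\<lambda>(i, j). g $ i $ j) p"]) (auto simp: polyfun_meval)
next
  assume "\<exists>\<phi>. polyfun \<phi> \<and> (\<exists>g. invertible g \<and> \<phi> g \<noteq> 0) \<and> (\<forall>g. invertible g \<longrightarrow> \<phi> g \<noteq> 0 \<longrightarrow> Q g)"
  then obtain \<phi> g0 where \<phi>: "polyfun \<phi>" "invertible g0" "\<phi> g0 \<noteq> 0" "\<forall>g. invertible g \<longrightarrow> \<phi> g \<noteq> 0 \<longrightarrow> Q g"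
    by auto
  from polyfun_imp_mpoly[OF \<phi>(1)] obtain p where p: "\<And>g. meval (\<lambda>(i, j). g $ i $ j) p = \<phi> g" by auto
  show "generically Q"
    unfolding generically_def zariski_open_GL_def meval_def[symmetric]
    by (rule exI[of _ "{g. invertible g \<and> (\<exists>p\<in>{p}. meval (\<lambda>(i, j). g $ i $ j) p \<noteq> 0)}"])
      (use \<phi> p in \<open>auto intro!: exI[of _ "{p}"]\<close>)
qed

text \<open>Irreducibility of GL_n, seen on one line: along the line through \<open>g1\<close> and
  \<open>g2\<close> the functions \<open>\<phi>\<close>, \<open>\<psi>\<close> and
  \<open>det\<close> become univariate polynomials, none of them zero, and an infinite field has a
  point where their product does not vanish.\<close>

lemma generically_conj:
  fixes P Q :: "'k::field_char_0 ^ 'n ^ 'n::finite \<Rightarrow> bool"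
  assumes "generically P" "generically Q"
  shows "generically (\<lambda>g. P g \<and> Q g)"
proof -
  obtain \<phi> g1 where \<phi>: "polyfun \<phi>" "invertible g1" "\<phi> g1 \<noteq> 0" "\<forall>g. invertible g \<longrightarrow> \<phi> g \<noteq> 0 \<longrightarrow> P g"
    using assms(1) unfolding generically_iff by auto
  obtain \<psi> g2 where \<psi>: "polyfun \<psi>" "invertible g2" "\<psi> g2 \<noteq> 0" "\<forall>g. invertible g \<longrightarrow> \<psi> g \<noteq> 0 \<longrightarrow> Q g"
    using assms(2) unfolding generically_iff by auto
  define ln where "ln s = (\<chi> i j. g1 $ i $ j + s * (g2 - g1) $ i $ j)" for s
  have ln: "ln 0 = g1" "ln 1 = g2" by (simp_all add: ln_def vec_eq_iff)
  obtain A where A: "\<And>s. \<phi> (ln s) = poly A s"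
    using polyfun_line[OF \<phi>(1), of g1 "g2 - g1"] unfolding ln_def by auto
  obtain B where B: "\<And>s. \<psi> (ln s) = poly B s"
    using polyfun_line[OF \<psi>(1), of g1 "g2 - g1"] unfolding ln_def by auto
  obtain C where C: "\<And>s. det (ln s) = poly C s"
    using polyfun_line[OF polyfun_det, of g1 "g2 - g1"] unfolding ln_def by auto
  have "A \<noteq> 0" using A[of 0] \<phi>(3) ln by auto
  moreover have "B \<noteq> 0" using B[of 1] \<psi>(3) ln by auto
  moreover have "C \<noteq> 0" using C[of 0] \<phi>(2) ln by (auto simp: invertible_det_nz)
  ultimately have "A * B * C \<noteq> 0" by simp
  then have "finite {s. poly (A * B * C) s = 0}" by (rule poly_roots_finite)
  then obtain s where "poly (A * B * C) s \<noteq> 0"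
    using ex_new_if_finite[OF infinite_UNIV_char_0] by blast
  then have "\<phi> (ln s) \<noteq> 0" "\<psi> (ln s) \<noteq> 0" "invertible (ln s)"
    using A B C by (auto simp: invertible_det_nz)
  then show ?thesis
    unfolding generically_iff using \<phi> \<psi> polyfun_mult by (intro exI[of _ "\<lambda>g. \<phi> g * \<psi> g"]) auto
qed

lemma generically_mono:
  "generically P \<Longrightarrow> (\<And>g. invertible g \<Longrightarrow> P g \<Longrightarrow> Q g) \<Longrightarrow> generically Q"
  unfolding generically_iff by metis

lemma generically_ex: "generically P \<Longrightarrow> \<exists>g. invertible g \<and> P g"
  unfolding generically_iff by auto

lemma generically_True: "generically (\<lambda>g::'k::field ^ 'n ^ 'n::finite. True)"
  unfolding generically_iff
  by (intro exI[of _ "\<lambda>_. 1"]) (auto simp: polyfun_const invertible_det_nz intro!: exI[of _ "mat 1"])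

lemma generically_ball:
  fixes P :: "'a \<Rightarrow> 'k::field_char_0 ^ 'n ^ 'n::finite \<Rightarrow> bool"
  assumes "finite A" "\<And>a. a \<in> A \<Longrightarrow> generically (P a)"
  shows "generically (\<lambda>g. \<forall>a\<in>A. P a g)"
  using assms
proof induction
  case empty
  then show ?case using generically_True by simp
next
  case (insert a A)
  then have "generically (\<lambda>g. P a g \<and> (\<forall>a\<in>A. P a g))" by (intro generically_conj) auto
  then show ?case by simp
qed

text \<open>Two generic conditions hold at a common matrix, so a generic value is unique. This
  evaluates the definite descriptions in \<open>gin\<close> and
  \<open>generic_tropical_fan\<close>.\<close>

lemma generically_unique:
  fixes F :: "'k::field_char_0 ^ 'n ^ 'n::finite \<Rightarrow> 'a"
  assumes "generically (\<lambda>g. F g = c)"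
  shows "(THE J. generically (\<lambda>g. F g = J)) = c"
proof (rule the_equality)
  show "generically (\<lambda>g. F g = c)" by (rule assms)
  fix J assume "generically (\<lambda>g. F g = J)"
  from generically_ex[OF generically_conj[OF this assms]] show "J = c" by auto
qed

text \<open>Families whose coefficients are polynomial in the entries of \<open>g\<close>, with
  supports in one finite set of monomials for all \<open>g\<close>.\<close>

inductive polyfam :: "('k::field ^ 'n ^ 'n::finite \<Rightarrow> ('n, 'k) mpoly) \<Rightarrow> bool" where
  polyfam_single: "polyfun \<phi> \<Longrightarrow> polyfam (\<lambda>g. single \<nu> (\<phi> g))"
| polyfam_add: "polyfam f \<Longrightarrow> polyfam h \<Longrightarrow> polyfam (\<lambda>g. f g + h g)"

lemma polyfam_const: "polyfam (\<lambda>_. f)"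
  by (induction f rule: mpoly_induct) (auto intro: polyfam.intros polyfun_const)

lemma polyfam_sum: "(\<And>a. a \<in> A \<Longrightarrow> polyfam (f a)) \<Longrightarrow> polyfam (\<lambda>g. \<Sum>a\<in>A. f a g)"
  by (induction A rule: infinite_finite_induct) (auto intro: polyfam_const polyfam_add)

lemma polyfam_single_mult: "polyfam h \<Longrightarrow> polyfun \<phi> \<Longrightarrow> polyfam (\<lambda>g. single \<nu> (\<phi> g) * h g)"
proof (induction h rule: polyfam.induct)
  case (polyfam_single \<psi> \<mu>)
  then show ?case unfolding mult_single by (intro polyfam.polyfam_single polyfun_mult)
next
  case (polyfam_add f h)
  then show ?case by (simp add: ring_distribs polyfam.polyfam_add)
qed

lemma polyfam_mult: "polyfam f \<Longrightarrow> polyfam h \<Longrightarrow> polyfam (\<lambda>g. f g * h g)"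
proof (induction f rule: polyfam.induct)
  case (polyfam_single \<phi> \<nu>)
  then show ?case by (intro polyfam_single_mult)
next
  case (polyfam_add f1 f2)
  then show ?case by (simp add: ring_distribs polyfam.polyfam_add)
qed

lemma polyfam_power: "polyfam f \<Longrightarrow> polyfam (\<lambda>g. f g ^ k)"
  by (induction k) (auto intro: polyfam_const polyfam_mult)

lemma polyfam_prod: "(\<And>a. a \<in> A \<Longrightarrow> polyfam (f a)) \<Longrightarrow> polyfam (\<lambda>g. \<Prod>a\<in>A. f a g)"
  by (induction A rule: infinite_finite_induct) (auto intro: polyfam_const polyfam_mult)

lemma polyfam_act: "polyfam (\<lambda>g. act g f)"
  unfolding act_def subst_mpoly_def
  by (intro polyfam_sum polyfam_mult polyfam_const polyfam_prod polyfam_power polyfam_single polyfun_entry)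

lemma polyfun_lookup: "polyfam f \<Longrightarrow> polyfun (\<lambda>g. lookup (f g) \<mu>)"
proof (induction rule: polyfam.induct)
  case (polyfam_single \<phi> \<nu>)
  then show ?case by (cases "\<nu> = \<mu>") (simp_all add: lookup_single polyfun_const)
qed (simp add: lookup_add polyfun_add)

section \<open>Elimination in families of vectors\<close>

definition fring :: "('x \<Rightarrow> 'k::field) set \<Rightarrow> bool" where
  "fring R \<longleftrightarrow> (\<forall>c. (\<lambda>_. c) \<in> R) \<and> (\<forall>f\<in>R. \<forall>h\<in>R. (\<lambda>x. f x + h x) \<in> R) \<and> (\<forall>f\<in>R. \<forall>h\<in>R. (\<lambda>x. f x * h x) \<in> R)"

lemma fring_polyfun: "fring (Collect polyfun)"
  by (auto simp: fring_def polyfun.intros)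

text \<open>The parameter is either a matrix (\<open>fring_polyfun\<close>) or the scalar
  \<open>s\<close> of a shear (this instance); \<open>elimination\<close> covers both.\<close>

lemma fring_poly: "fring (range (poly :: 'k::field poly \<Rightarrow> 'k \<Rightarrow> 'k))"
proof -
  have "(\<lambda>_. c) = poly [:c:]" for c :: 'k by auto
  moreover have "(\<lambda>x. poly p x + poly q x) = poly (p + q)" "(\<lambda>x. poly p x * poly q x) = poly (p * q)" for p q :: "'k poly"
    by auto
  ultimately show ?thesis unfolding fring_def by (auto intro: range_eqI)
qed

lemma fring_const: "fring R \<Longrightarrow> (\<lambda>_. c) \<in> R"
  by (simp add: fring_def)

lemma fring_add: "fring R \<Longrightarrow> f \<in> R \<Longrightarrow> h \<in> R \<Longrightarrow> (\<lambda>x. f x + h x) \<in> R"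
  by (simp add: fring_def)

lemma fring_mult: "fring R \<Longrightarrow> f \<in> R \<Longrightarrow> h \<in> R \<Longrightarrow> (\<lambda>x. f x * h x) \<in> R"
  by (simp add: fring_def)

lemma fring_diff: "fring R \<Longrightarrow> f \<in> R \<Longrightarrow> h \<in> R \<Longrightarrow> (\<lambda>x. f x - h x) \<in> R"
  using fring_add[OF _ _ fring_mult[OF _ fring_const[of R "- 1"]], of f h] by simp

lemma fring_sum:
  assumes R: "fring R" and "\<And>a. a \<in> A \<Longrightarrow> f a \<in> R"
  shows "(\<lambda>x. \<Sum>a\<in>A. f a x) \<in> R"
  using assms(2) by (induction A rule: infinite_finite_induct) (use R in \<open>auto simp: fring_def\<close>)

text \<open>Fraction-free Gaussian elimination: it replaces the minors in the semicontinuity of rank.\<close>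

lemma elimination:
  fixes f :: "'e \<Rightarrow> 'x \<Rightarrow> 'e \<Rightarrow> 'k::field"
  assumes R: "fring R" and "finite F"
    and V: "\<And>x u v a b. u \<in> V x \<Longrightarrow> v \<in> V x \<Longrightarrow> (\<lambda>c. a * u c + b * v c) \<in> V x"
    and "\<And>e c. e \<in> F \<Longrightarrow> (\<lambda>x. f e x c) \<in> R"
    and "\<And>e x. e \<in> F \<Longrightarrow> f e x \<in> V x"
    and "\<And>e c. e \<in> F \<Longrightarrow> c \<in> F \<Longrightarrow> f e x0 c = (if c = e then 1 else 0)"
  shows "\<exists>\<phi>\<in>R. \<phi> x0 \<noteq> 0 \<and> (\<exists>h. \<forall>e\<in>F. (\<forall>c. (\<lambda>x. h e x c) \<in> R) \<and>
    (\<forall>x. h e x \<in> V x \<and> (\<forall>c\<in>F. h e x c = (if c = e then \<phi> x else 0))))"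
  using assms(2,4-)
proof (induction F rule: finite_induct)
  case empty
  then show ?case using R by (intro bexI[of _ "\<lambda>_. 1"]) (auto simp: fring_def)
next
  case (insert e0 F)
  have "\<exists>\<phi>\<in>R. \<phi> x0 \<noteq> 0 \<and> (\<exists>h. \<forall>e\<in>F. (\<forall>c. (\<lambda>x. h e x c) \<in> R) \<and>
    (\<forall>x. h e x \<in> V x \<and> (\<forall>c\<in>F. h e x c = (if c = e then \<phi> x else 0))))"
    by (rule insert.IH) (use insert.prems in auto)
  then obtain \<phi> h where \<phi>: "\<phi> \<in> R" "\<phi> x0 \<noteq> 0"
    and hh: "\<forall>e\<in>F. (\<forall>c. (\<lambda>x. h e x c) \<in> R) \<and>
      (\<forall>x. h e x \<in> V x \<and> (\<forall>c\<in>F. h e x c = (if c = e then \<phi> x else 0)))"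
    by (elim bexE conjE exE)
  have h: "\<And>e c. e \<in> F \<Longrightarrow> (\<lambda>x. h e x c) \<in> R" "\<And>e x. e \<in> F \<Longrightarrow> h e x \<in> V x"
      "\<And>e x c. e \<in> F \<Longrightarrow> c \<in> F \<Longrightarrow> h e x c = (if c = e then \<phi> x else 0)"
    using hh by simp_all
  note mult = fring_mult[OF R]
  \<comment> \<open>\<open>k\<close> is row \<open>e0\<close> with its entries in the columns
    \<open>F\<close> cleared; the multiplication by \<open>\<phi>\<close> replaces a division. Its
    entry in column \<open>e0\<close> is the new pivot \<open>\<psi>\<close>.\<close>
  define k where "k x c = \<phi> x * f e0 x c - (\<Sum>e\<in>F. f e0 x e * h e x c)" for x c
  define \<psi> where "\<psi> x = k x e0" for x
  have Vsum: "(\<lambda>c. a * u c - (\<Sum>e\<in>G. b e * h e x c)) \<in> V x" if "u \<in> V x" "finite G" "G \<subseteq> F" for a b u G x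
    using that(2,3)
  proof (induction G rule: finite_induct)
    case empty
    show ?case using V[OF that(1) that(1), of a 0] by simp
  next
    case (insert e G)
    then have "(\<lambda>c. 1 * (a * u c - (\<Sum>e\<in>G. b e * h e x c)) + (- b e) * h e x c) \<in> V x"
      by (intro V h) auto
    then show ?case using insert by (simp add: algebra_simps)
  qed
  have kR: "(\<lambda>x. k x c) \<in> R" for c
    unfolding k_def by (intro fring_diff[OF R] mult fring_sum[OF R] \<phi>(1) h insert.prems) auto
  have kV: "k x \<in> V x" for x
    unfolding k_def [abs_def] by (rule Vsum) (use insert in auto)
  have kF: "k x c = 0" if "c \<in> F" for x c
  proof -
    have "(\<Sum>e\<in>F. f e0 x e * h e x c) = (\<Sum>e\<in>F. if e = c then f e0 x c * \<phi> x else 0)"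
      by (rule sum.cong) (auto simp: h(3) that)
    then show ?thesis using that insert.hyps by (simp add: k_def)
  qed
  \<comment> \<open>At \<open>x0\<close> the rows are unit vectors, so nothing is subtracted in
    column \<open>e0\<close> and the new pivot inherits the nonzero value
    \<open>\<phi> x0\<close>.\<close>
  have "(\<Sum>e\<in>F. f e0 x0 e * h e x0 e0) = 0"
    by (rule sum.neutral) (use insert in auto)
  then have \<psi>0: "\<psi> x0 = \<phi> x0" using insert.prems by (simp add: \<psi>_def k_def)
  have \<psi>R: "\<psi> \<in> R" unfolding \<psi>_def [abs_def] by (rule kR)
  \<comment> \<open>Column \<open>e0\<close> is cleared from the old rows; the extra factors give
    all rows the same pivot \<open>\<phi> x * \<psi> x\<close>.\<close>
  define h' where "h' e x c = (if e = e0 then \<phi> x * k x c else \<psi> x * h e x c - h e x e0 * k x c)" for e x c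
  have "\<phi> x0 * \<psi> x0 \<noteq> 0" using \<phi> \<psi>0 by simp
  moreover have "(\<lambda>x. h' e x c) \<in> R" if "e \<in> insert e0 F" for e c
  proof (cases "e = e0")
    case True
    then show ?thesis unfolding h'_def by (simp add: mult \<phi>(1) kR)
  next
    case False
    then have e: "e \<in> F" using that by simp
    show ?thesis unfolding h'_def using False by (simp add: fring_diff[OF R] mult \<psi>R h(1)[OF e] kR)
  qed
  moreover have "h' e x \<in> V x" if "e \<in> insert e0 F" for e x
  proof (cases "e = e0")
    case True
    then show ?thesis using V[OF kV kV, of "\<phi> x" x 0] by (simp add: h'_def [abs_def])
  next
    case False
    then have "h e x \<in> V x" using that h by auto
    from V[OF this kV, of "\<psi> x" "- h e x e0"] show ?thesis using False by (simp add: h'_def [abs_def])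
  qed
  moreover have "h' e x c = (if c = e then \<phi> x * \<psi> x else 0)" if "e \<in> insert e0 F" "c \<in> insert e0 F" for e x c
    using that insert.hyps kF h(3) unfolding h'_def by (auto simp: \<psi>_def)
  ultimately show ?case
    using mult[OF \<phi>(1) \<psi>R] by (intro bexI[of _ "\<lambda>x. \<phi> x * \<psi> x"] conjI exI[of _ h'] ballI allI) auto
qed

text \<open>For finite \<open>F\<close>: the coefficient functionals of the monomials in
  \<open>F\<close> are linearly independent on \<open>J\<close>, expressed by a dual family. This
  takes the place of a nonvanishing minor.\<close>

definition Ind :: "('n, 'k::comm_ring_1) mpoly set \<Rightarrow> 'n monomial set \<Rightarrow> bool" where
  "Ind J F \<longleftrightarrow> (\<forall>e\<in>F. \<exists>f\<in>J. \<forall>c\<in>F. lookup f c = (if c = e then 1 else 0))"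

lemma Ind_scaled:
  fixes J :: "('n, 'k::field) mpoly set"
  assumes "pid.subspace J" "a \<noteq> 0" "\<And>e. e \<in> F \<Longrightarrow> \<exists>f\<in>J. \<forall>c\<in>F. lookup f c = (if c = e then a else 0)"
  shows "Ind J F"
  unfolding Ind_def
proof
  fix e assume "e \<in> F"
  then obtain f where f: "f \<in> J" "\<forall>c\<in>F. lookup f c = (if c = e then a else 0)" using assms(3) by auto
  show "\<exists>f\<in>J. \<forall>c\<in>F. lookup f c = (if c = e then 1 else 0)"
    by (rule bexI[of _ "single 0 (1 / a) * f"]) (use f assms pid.subspace_scale in auto)
qed

lemma lincomb_lookup_image:
  assumes "pid.subspace (J :: ('n, 'k::field) mpoly set)" "u \<in> lookup ` J" "v \<in> lookup ` J"
  shows "(\<lambda>c. a * u c + b * v c) \<in> lookup ` J"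
proof -
  obtain p q where pq: "p \<in> J" "q \<in> J" "u = lookup p" "v = lookup q" using assms by auto
  have "single 0 a * p + single 0 b * q \<in> J"
    using pq assms(1) by (intro pid.subspace_add pid.subspace_scale)
  then show ?thesis using pq by (intro image_eqI[of _ _ "single 0 a * p + single 0 b * q"]) (auto simp: lookup_add)
qed

text \<open>A family dual to \<open>F\<close> at \<open>g0\<close> is carried along by
  \<open>act g\<close> and made dual again by elimination, wherever the pivot polynomial
  \<open>\<phi>\<close> is nonzero.\<close>

lemma Ind_act_open:
  fixes I :: "('n::finite, 'k::field) mpoly set"
  assumes I: "pid.subspace I" and F: "finite F" "Ind (act g0 ` I) F"
  shows "\<exists>\<phi>. polyfun \<phi> \<and> \<phi> g0 \<noteq> 0 \<and> (\<forall>g. invertible g \<longrightarrow> \<phi> g \<noteq> 0 \<longrightarrow> Ind (act g ` I) F)"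
proof -
  have "\<forall>e\<in>F. \<exists>f\<in>I. \<forall>c\<in>F. lookup (act g0 f) c = (if c = e then 1 else 0)"
    using F(2) by (auto simp: Ind_def)
  then obtain p where p: "\<And>e. e \<in> F \<Longrightarrow> p e \<in> I"
    "\<And>e c. e \<in> F \<Longrightarrow> c \<in> F \<Longrightarrow> lookup (act g0 (p e)) c = (if c = e then 1 else 0)" by metis
  have V: "(\<lambda>c. a * u c + b * v c) \<in> lookup ` act g ` I"
    if uv: "u \<in> lookup ` act g ` I" "v \<in> lookup ` act g ` I" for u v a b g
  proof -
    obtain p q where pq: "p \<in> I" "q \<in> I" "u = lookup (act g p)" "v = lookup (act g q)" using uv by auto
    have "single 0 a * p + single 0 b * q \<in> I"
      using pq I by (intro pid.subspace_add pid.subspace_scale)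
    moreover have "act g (single 0 a * p + single 0 b * q) = single 0 a * act g p + single 0 b * act g q"
      by (simp add: act_add act_mult)
    moreover have "(\<lambda>c. a * u c + b * v c) = lookup (single 0 a * act g p + single 0 b * act g q)"
      using pq by (auto simp: lookup_add)
    ultimately show ?thesis
      by (intro image_eqI[where x = "single 0 a * act g p + single 0 b * act g q"]
        image_eqI[where x = "single 0 a * p + single 0 b * q"]) simp_all
  qed
  have "\<exists>\<phi>\<in>Collect polyfun. \<phi> g0 \<noteq> 0 \<and> (\<exists>h. \<forall>e\<in>F. (\<forall>c. (\<lambda>x. h e x c) \<in> Collect polyfun) \<and>
    (\<forall>x. h e x \<in> lookup ` act x ` I \<and> (\<forall>c\<in>F. h e x c = (if c = e then \<phi> x else 0))))"
    by (rule elimination[where f = "\<lambda>e g. lookup (act g (p e))"])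
      (use V p F in \<open>auto simp: fring_polyfun intro!: polyfun_lookup polyfam_act\<close>)
  then obtain \<phi> h where \<phi>: "polyfun \<phi>" "\<phi> g0 \<noteq> 0"
    and hh: "\<forall>e\<in>F. (\<forall>c. (\<lambda>x. h e x c) \<in> Collect polyfun) \<and>
    (\<forall>x. h e x \<in> lookup ` act x ` I \<and> (\<forall>c\<in>F. h e x c = (if c = e then \<phi> x else 0)))"
    by (elim bexE conjE exE CollectE)
  have h: "\<And>e x. e \<in> F \<Longrightarrow> h e x \<in> lookup ` act x ` I"
      "\<And>e x c. e \<in> F \<Longrightarrow> c \<in> F \<Longrightarrow> h e x c = (if c = e then \<phi> x else 0)"
    using hh by simp_all
  have "Ind (act g ` I) F" if "\<phi> g \<noteq> 0" "invertible g" for g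
  proof (rule Ind_scaled[OF subspace_act[OF I that(2)] that(1)])
    fix e assume e: "e \<in> F"
    from h(1)[OF e, of g] obtain f where "f \<in> act g ` I" "h e g = lookup f" by auto
    then show "\<exists>f\<in>act g ` I. \<forall>c\<in>F. lookup f c = (if c = e then \<phi> g else 0)"
      using h(2)[OF e, of _ g] by (intro bexI[of _ f]) auto
  qed
  then show ?thesis using \<phi> by auto
qed

text \<open>Every independence in degrees at most \<open>D\<close> that is possible for some
  invertible matrix holds at \<open>g\<close>. These are finitely many nonempty open conditions, and
  they refer to no term order or weight.\<close>

definition Dgen :: "('n::finite, 'k::field) mpoly set \<Rightarrow> nat \<Rightarrow> 'k ^ 'n ^ 'n \<Rightarrow> bool" where
  "Dgen I D g \<longleftrightarrow> invertible g \<and> (\<forall>F. F \<subseteq> {\<nu>. mdegree \<nu> \<le> D} \<longrightarrow>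
     (\<exists>g'. invertible g' \<and> Ind (act g' ` I) F) \<longrightarrow> Ind (act g ` I) F)"

lemma generically_Dgen:
  fixes I :: "('n::finite, 'k::field_char_0) mpoly set"
  assumes I: "pid.subspace I"
  shows "generically (Dgen I D)"
proof -
  let ?A = "{F. F \<subseteq> {\<nu> :: 'n monomial. mdegree \<nu> \<le> D} \<and> (\<exists>g'. invertible g' \<and> Ind (act g' ` I) F)}"
  have fin: "finite F" if "F \<in> ?A" for F
    using that finite_subset[OF _ finite_monomials_le] by auto
  have "finite ?A" using finite_monomials_le by (auto intro: finite_subset[OF _ finite_Pow_iff[THEN iffD2]])
  moreover have "generically (\<lambda>g. Ind (act g ` I) F)" if F: "F \<in> ?A" for F
  proof -
    from F obtain g0 where g0: "invertible g0" "Ind (act g0 ` I) F" by auto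
    from Ind_act_open[OF I fin[OF F] g0(2)] g0(1) show ?thesis unfolding generically_iff by metis
  qed
  ultimately have "generically (\<lambda>g. \<forall>F\<in>?A. Ind (act g ` I) F)" by (rule generically_ball)
  then show ?thesis by (rule generically_mono) (auto simp: Dgen_def)
qed

section \<open>Monomial orders and leading monomials\<close>

text \<open>Leaving the position of \<open>0\<close> open admits reversed orders and orders by
  weights of any sign. The finiteness usually drawn from well-foundedness comes instead from the
  finitely many monomials in each degree of a graded ideal.\<close>

definition corder :: "'n monomial rel \<Rightarrow> bool" where
  "corder r \<longleftrightarrow> linear_order r \<and> (\<forall>\<mu> \<nu> \<rho>. (\<mu>, \<nu>) \<in> r \<longrightarrow> (\<mu> + \<rho>, \<nu> + \<rho>) \<in> r)"

lemma term_order_corder: "term_order r \<Longrightarrow> corder r"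
  by (simp add: term_order_def corder_def)

lemma corderI:
  assumes "\<And>a. (a, a) \<in> r" "\<And>a b c. (a, b) \<in> r \<Longrightarrow> (b, c) \<in> r \<Longrightarrow> (a, c) \<in> r"
    "\<And>a b. (a, b) \<in> r \<Longrightarrow> (b, a) \<in> r \<Longrightarrow> a = b" "\<And>a b. (a, b) \<in> r \<or> (b, a) \<in> r"
    "\<And>a b c. (a, b) \<in> r \<Longrightarrow> (a + c, b + c) \<in> r"
  shows "corder r"
  unfolding corder_def linear_order_on_def partial_order_on_def preorder_on_def
  using assms by (auto simp: refl_on_def antisym_def total_on_def intro: transI)

context
  fixes r :: "'n monomial rel"
  assumes r: "corder r"
begin

lemma corder_refl: "(a, a) \<in> r"
  using r by (simp add: corder_def linear_order_on_def partial_order_on_def preorder_on_def refl_on_def)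

lemma corder_trans: "(a, b) \<in> r \<Longrightarrow> (b, c) \<in> r \<Longrightarrow> (a, c) \<in> r"
  using r by (auto simp: corder_def linear_order_on_def partial_order_on_def preorder_on_def dest: transD)

lemma corder_antisym: "(a, b) \<in> r \<Longrightarrow> (b, a) \<in> r \<Longrightarrow> a = b"
  using r by (auto simp: corder_def linear_order_on_def partial_order_on_def dest: antisymD)

lemma corder_total: "(a, b) \<in> r \<or> (b, a) \<in> r"
  using r corder_refl by (cases "a = b") (auto simp: corder_def linear_order_on_def total_on_def)

lemma corder_add: "(a, b) \<in> r \<Longrightarrow> (a + c, b + c) \<in> r"
  using r by (auto simp: corder_def)

lemma corder_add_left: "(a, b) \<in> r \<Longrightarrow> (c + a, c + b) \<in> r"
  using corder_add[of a b c] by (simp add: add.commute)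

lemma corder_cancel: "(a + c, b + c) \<in> r \<Longrightarrow> (a, b) \<in> r"
  using corder_total[of a b] corder_add[of b a c] corder_antisym[of "a + c" "b + c"] corder_refl by auto

lemma corder_max: "finite A \<Longrightarrow> A \<noteq> {} \<Longrightarrow> \<exists>e\<in>A. \<forall>\<mu>\<in>A. (\<mu>, e) \<in> r"
proof (induction A rule: finite_ne_induct)
  case (singleton a)
  then show ?case using corder_refl by auto
next
  case (insert a A)
  then obtain e where e: "e \<in> A" "\<forall>\<mu>\<in>A. (\<mu>, e) \<in> r" by auto
  show ?case
  proof (cases "(a, e) \<in> r")
    case True
    then show ?thesis using e by auto
  next
    case False
    then have "(e, a) \<in> r" using corder_total by auto
    then have "\<forall>\<mu>\<in>A. (\<mu>, a) \<in> r" using e(2) corder_trans[of _ e a] by auto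
    then show ?thesis using corder_refl by auto
  qed
qed

end

definition is_lead :: "'n monomial rel \<Rightarrow> ('n::finite, 'k::comm_ring_1) mpoly \<Rightarrow> 'n monomial \<Rightarrow> bool" where
  "is_lead r f e \<longleftrightarrow> e \<in> keys f \<and> (\<forall>\<mu>\<in>keys f. (\<mu>, e) \<in> r)"

lemma is_lead_ex: "corder r \<Longrightarrow> f \<noteq> 0 \<Longrightarrow> \<exists>e. is_lead r f e"
  using corder_max[of r "keys f"] by (auto simp: is_lead_def)

text \<open>Of all products of a term of \<open>f\<close> with a term of \<open>g\<close>, only that
  of the two leading terms reaches \<open>e + e'\<close>; any other pair gives a smaller
  product.\<close>

lemma is_lead_mult_aux:
  fixes f g :: "('n::finite, 'k::comm_ring_1) mpoly"
  assumes r: "corder r" and f: "is_lead r f e" and g: "is_lead r g e'"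
  shows "lookup (f * g) (e + e') = lookup f e * lookup g e'"
proof -
  have "f * g = (\<Sum>\<mu>\<in>keys f. single \<mu> (lookup f \<mu>) * g)"
    by (subst mpoly_expansion[of f]) (rule sum_distrib_right)
  then have "lookup (f * g) (e + e') = (\<Sum>\<mu>\<in>keys f. lookup (single \<mu> (lookup f \<mu>) * g) (e + e'))"
    by (simp only: lookup_sum)
  also have "\<dots> = (\<Sum>\<mu>\<in>keys f. if \<mu> = e then lookup f e * lookup g e' else 0)"
  proof (rule sum.cong)
    fix \<mu> assume \<mu>: "\<mu> \<in> keys f"
    show "lookup (single \<mu> (lookup f \<mu>) * g) (e + e') = (if \<mu> = e then lookup f e * lookup g e' else 0)"
    proof (cases "\<mu> = e")
      case False
      have "lookup (single \<mu> (lookup f \<mu>) * g) (e + e') = 0"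
      proof (rule ccontr)
        assume *: "lookup (single \<mu> (lookup f \<mu>) * g) (e + e') \<noteq> 0"
        then obtain \<kappa> where \<kappa>: "e + e' = \<mu> + \<kappa>" using lookup_single_mult_eq_0[of "e + e'" \<mu>] by blast
        then have "\<kappa> \<in> keys g" using * by (auto simp: in_keys_iff)
        then have "(\<kappa>, e') \<in> r" "(\<mu>, e) \<in> r" using f g \<mu> by (auto simp: is_lead_def)
        then have a: "(e + \<kappa>, \<mu> + \<kappa>) \<in> r" "(\<mu> + \<kappa>, e + \<kappa>) \<in> r"
          using corder_add[OF r] corder_add_left[OF r, of \<kappa> e' e] unfolding \<kappa> by auto
        from corder_antisym[OF r a] show False using False by simp
      qed
      then show ?thesis using False by simp
    qed simp
  qed simp
  also have "\<dots> = lookup f e * lookup g e'" using f by (simp add: is_lead_def)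
  finally show ?thesis .
qed

lemma is_lead_mult:
  fixes f g :: "('n::finite, 'k::field) mpoly"
  assumes r: "corder r" and f: "is_lead r f e" and g: "is_lead r g e'"
  shows "is_lead r (f * g) (e + e')"
proof -
  have "lookup (f * g) (e + e') \<noteq> 0"
    unfolding is_lead_mult_aux[OF assms] using f g by (auto simp: is_lead_def in_keys_iff)
  moreover have "(\<mu>, e + e') \<in> r" if \<mu>: "\<mu> \<in> keys (f * g)" for \<mu>
  proof -
    from subsetD[OF keys_mult \<mu>] obtain a b where ab: "\<mu> = a + b" "a \<in> keys f" "b \<in> keys g" by auto
    then have "(a, e) \<in> r" "(b, e') \<in> r" using f g by (auto simp: is_lead_def)
    then show ?thesis unfolding ab using corder_add[OF r] corder_add_left[OF r] corder_trans[OF r] by blast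
  qed
  ultimately show ?thesis by (simp add: is_lead_def in_keys_iff)
qed

lemma is_lead_single: "corder r \<Longrightarrow> is_lead r (single \<nu> (1 :: 'k::field)) \<nu>"
  by (simp add: is_lead_def corder_refl)

lemma is_lead_power:
  fixes f :: "('n::finite, 'k::field) mpoly"
  assumes "corder r" "is_lead r f e"
  shows "\<exists>e'. is_lead r (f ^ k) e' \<and> (\<forall>w. weight w e' = real k * weight w e)"
proof (induction k)
  case 0
  have "is_lead r (1 :: ('n, 'k) mpoly) 0" using is_lead_single[OF assms(1), of 0] by simp
  then show ?case by auto
next
  case (Suc k)
  then obtain e' where e': "is_lead r (f ^ k) e'" "\<forall>w. weight w e' = real k * weight w e" by auto
  then have "is_lead r (f ^ Suc k) (e + e')" using is_lead_mult[OF assms e'(1)] by simp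
  then show ?case using e'(2) by (intro exI[of _ "e + e'"]) (auto simp: weight_add algebra_simps)
qed

text \<open>An arbitrary numbering of the variables. It orders them in \<open>lexo\<close>, where a
  smaller index means a larger variable, and supplies the exponents in
  \<open>independent_weights\<close>.\<close>

definition idx :: "'n::finite \<Rightarrow> nat" where
  "idx = (SOME f. inj f)"

lemma inj_idx: "inj (idx :: 'n::finite \<Rightarrow> nat)"
proof -
  have "\<exists>f :: 'n \<Rightarrow> nat. inj f" using finite_imp_inj_to_nat_seg[of "UNIV :: 'n set"] by auto
  then show ?thesis unfolding idx_def by (rule someI_ex)
qed

definition lexo :: "'n::finite monomial rel" where
  "lexo = {(\<mu>, \<nu>). \<mu> = \<nu> \<or> (\<exists>i. lookup \<mu> i < lookup \<nu> i \<and> (\<forall>j. idx j < idx i \<longrightarrow> lookup \<mu> j = lookup \<nu> j))}"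

lemma term_order_lexo: "term_order (lexo :: 'n::finite monomial rel)"
proof -
  let ?lt = "\<lambda>\<mu> \<nu> :: 'n monomial. \<exists>i. lookup \<mu> i < lookup \<nu> i \<and> (\<forall>j. idx j < idx i \<longrightarrow> lookup \<mu> j = lookup \<nu> j)"
  have idx_eq: "i = j" if "idx i = idx j" for i j :: 'n using that inj_idx by (auto dest: injD)
  have first: "\<exists>i. lookup \<mu> i \<noteq> lookup \<nu> i \<and> (\<forall>j. idx j < idx i \<longrightarrow> lookup \<mu> j = lookup \<nu> j)"
    if "\<mu> \<noteq> \<nu>" for \<mu> \<nu> :: "'n monomial"
  proof -
    have "\<exists>i. lookup \<mu> i \<noteq> lookup \<nu> i" using that monomial_eqI[of \<mu> \<nu>] by blast
    from exists_least_iff[THEN iffD1, of "\<lambda>k. \<exists>i. idx i = k \<and> lookup \<mu> i \<noteq> lookup \<nu> i"] this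
    show ?thesis by auto
  qed
  have trans: "?lt a c" if ab: "?lt a b" and bc: "?lt b c" for a b c
  proof -
    obtain i where i: "lookup a i < lookup b i" "\<forall>j. idx j < idx i \<longrightarrow> lookup a j = lookup b j" using ab by auto
    obtain k where k: "lookup b k < lookup c k" "\<forall>j. idx j < idx k \<longrightarrow> lookup b j = lookup c j" using bc by auto
    consider "idx i < idx k" | "i = k" | "idx k < idx i" using idx_eq by force
    then show ?thesis
    proof cases
      case 1
      then show ?thesis using i k by (intro exI[of _ i]) auto
    next
      case 2
      then show ?thesis using i k by (intro exI[of _ i]) auto
    next
      case 3
      then show ?thesis using i k by (intro exI[of _ k]) auto
    qed
  qed
  have irr: "\<not> ?lt a a" for a by auto
  have "corder (lexo :: 'n monomial rel)"
  proof (rule corderI)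
    fix a b c :: "'n monomial"
    show "(a, a) \<in> lexo" by (simp add: lexo_def)
    show "(a, c) \<in> lexo" if "(a, b) \<in> lexo" "(b, c) \<in> lexo"
    proof -
      have "a = b \<or> ?lt a b" "b = c \<or> ?lt b c" using that by (simp_all add: lexo_def)
      then have "a = c \<or> ?lt a c" using trans[of a b c] by (elim disjE) simp_all
      then show ?thesis by (simp add: lexo_def)
    qed
    show "a = b" if "(a, b) \<in> lexo" "(b, a) \<in> lexo"
    proof (rule ccontr)
      assume "a \<noteq> b"
      then have "?lt a b" "?lt b a" using that by (auto simp: lexo_def)
      from trans[OF this] show False using irr by simp
    qed
    show "(a, b) \<in> lexo \<or> (b, a) \<in> lexo"
    proof (cases "a = b")
      case False
      from first[OF this] obtain i where i: "lookup a i \<noteq> lookup b i"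
        "\<forall>j. idx j < idx i \<longrightarrow> lookup a j = lookup b j" by auto
      then consider "lookup a i < lookup b i" | "lookup b i < lookup a i" by linarith
      then show ?thesis
        by cases (use i in \<open>auto simp: lexo_def intro!: exI[of _ i]\<close>)
    qed (simp add: lexo_def)
    show "(a + c, b + c) \<in> lexo" if "(a, b) \<in> lexo"
      using that by (auto simp: lexo_def lookup_add)
  qed
  moreover have "(0, \<nu>) \<in> lexo" for \<nu> :: "'n monomial"
  proof (cases "0 = \<nu>")
    case False
    from first[OF this] show ?thesis by (auto simp: lexo_def)
  qed (simp add: lexo_def)
  ultimately show ?thesis by (simp add: term_order_def corder_def)
qed

lemma corder_lexo: "corder lexo"
  using term_order_corder[OF term_order_lexo] .

lemma mpoly_mult_eq_0:
  fixes f g :: "('n::finite, 'k::field) mpoly"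
  assumes "f * g = 0"
  shows "f = 0 \<or> g = 0"
proof (rule ccontr)
  assume "\<not> ?thesis"
  then obtain e e' where "is_lead lexo f e" "is_lead lexo g e'"
    using is_lead_ex[OF corder_lexo] by blast
  from is_lead_mult[OF corder_lexo this] show False using assms by (simp add: is_lead_def)
qed

text \<open>A smaller weight makes a monomial larger, because initial forms collect the terms of
  minimal weight; \<open>r\<close> breaks ties.\<close>

definition wordr :: "real ^ 'n \<Rightarrow> 'n::finite monomial rel \<Rightarrow> 'n monomial rel" where
  "wordr w r = {(\<mu>, \<nu>). weight w \<nu> < weight w \<mu> \<or> weight w \<nu> = weight w \<mu> \<and> (\<mu>, \<nu>) \<in> r}"

lemma corder_lex:
  fixes k :: "'n monomial \<Rightarrow> real"
  assumes r: "corder r" and k: "\<And>\<mu> \<nu>. k (\<mu> + \<nu>) = k \<mu> + k \<nu>"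
  shows "corder {(\<mu>, \<nu>). k \<mu> < k \<nu> \<or> k \<mu> = k \<nu> \<and> (\<mu>, \<nu>) \<in> r}" (is "corder ?r")
proof (rule corderI)
  fix a b c
  show "(a, a) \<in> ?r" using corder_refl[OF r] by simp
  show "(a, c) \<in> ?r" if "(a, b) \<in> ?r" "(b, c) \<in> ?r" using that corder_trans[OF r, of a b c] by auto
  show "a = b" if "(a, b) \<in> ?r" "(b, a) \<in> ?r" using that corder_antisym[OF r, of a b] by auto
  show "(a, b) \<in> ?r \<or> (b, a) \<in> ?r" using corder_total[OF r, of a b] by auto
  show "(a + c, b + c) \<in> ?r" if "(a, b) \<in> ?r" using that corder_add[OF r, of a b c] by (auto simp: k)
qed

lemma corder_wordr: "corder r \<Longrightarrow> corder (wordr w r)"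
proof -
  assume "corder r"
  from corder_lex[OF this, of "\<lambda>\<nu>. - weight w \<nu>"] show ?thesis
    by (simp add: wordr_def weight_add eq_commute)
qed

text \<open>Comparing degrees first turns the order by an arbitrary real weight into a term order.
  For graded ideals \<open>leads_initial_ideal\<close> identifies its leading monomials with those
  of the initial ideal.\<close>

definition ordr :: "real ^ 'n \<Rightarrow> 'n::finite monomial rel \<Rightarrow> 'n monomial rel" where
  "ordr w r = {(\<mu>, \<nu>). mdegree \<mu> < mdegree \<nu> \<or> mdegree \<mu> = mdegree \<nu> \<and>
     (weight w \<nu> < weight w \<mu> \<or> weight w \<nu> = weight w \<mu> \<and> (\<mu>, \<nu>) \<in> r)}"

lemma term_order_ordr: "corder r \<Longrightarrow> term_order (ordr w r)"
proof -
  assume r: "corder r"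
  from corder_lex[OF corder_wordr[OF r], of "\<lambda>\<nu>. real (mdegree \<nu>)"] have "corder (ordr w r)"
    by (simp add: ordr_def wordr_def mdegree_add)
  moreover have "(0, \<nu>) \<in> ordr w r" for \<nu>
    using corder_refl[OF r] mdegree_eq_0_iff[of \<nu>] by (cases "\<nu> = 0") (auto simp: ordr_def)
  ultimately show ?thesis by (simp add: term_order_def corder_def)
qed

lemma corder_ordr: "corder r \<Longrightarrow> corder (ordr w r)"
  by (rule term_order_corder[OF term_order_ordr])

section \<open>Leading monomials of graded ideals\<close>

definition leads :: "'n monomial rel \<Rightarrow> ('n::finite, 'k::comm_ring_1) mpoly set \<Rightarrow> 'n monomial set" where
  "leads r J = {e. \<exists>f\<in>J. is_lead r f e}"

text \<open>Monomial ideals are represented by their sets of monomials.\<close>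

definition upc :: "'n monomial set \<Rightarrow> bool" where
  "upc N \<longleftrightarrow> (\<forall>\<nu>\<in>N. \<forall>\<kappa>. \<nu> + \<kappa> \<in> N)"

lemma upcD: "upc N \<Longrightarrow> \<nu> \<in> N \<Longrightarrow> \<nu> + \<kappa> \<in> N" "upc N \<Longrightarrow> \<nu> \<in> N \<Longrightarrow> \<kappa> + \<nu> \<in> N"
  by (auto simp: upc_def add.commute)

lemma upc_mle: "upc N \<Longrightarrow> \<nu> \<in> N \<Longrightarrow> mle \<nu> \<mu> \<Longrightarrow> \<mu> \<in> N"
  by (auto simp: mle_iff upc_def)

lemma upc_leads:
  fixes J :: "('n::finite, 'k::field) mpoly set"
  assumes "pid.subspace J" "corder r"
  shows "upc (leads r J)"
  unfolding upc_def leads_def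
proof (intro ballI allI)
  fix \<nu> \<kappa> assume "\<nu> \<in> {e. \<exists>f\<in>J. is_lead r f e}"
  then obtain f where f: "f \<in> J" "is_lead r f \<nu>" by auto
  have "is_lead r (single \<kappa> 1 * f) (\<kappa> + \<nu>)"
    by (intro is_lead_mult is_lead_single assms f)
  then show "\<nu> + \<kappa> \<in> {e. \<exists>f\<in>J. is_lead r f e}"
    using pid.subspace_scale[OF assms(1) f(1)] by (auto simp: add.commute)
qed

lemma leads_mono: "J \<subseteq> J' \<Longrightarrow> leads r J \<subseteq> leads r J'"
  by (auto simp: leads_def)

text \<open>A nonzero element would contribute its own leading monomial. This is the uniqueness of
  normal forms modulo \<open>J\<close>; \<open>normal_form\<close> is their existence.\<close>

lemma zero_if_no_leads:
  assumes "corder r" "f \<in> J" "keys f \<inter> leads r J = {}"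
  shows "f = 0"
proof (rule ccontr)
  assume "f \<noteq> 0"
  then obtain e where e: "is_lead r f e" using is_lead_ex assms(1) by blast
  then have "e \<in> leads r J" "e \<in> keys f" using assms(2) by (auto simp: leads_def is_lead_def)
  then show False using assms(3) by auto
qed

lemma graded_hcomp: "graded J \<Longrightarrow> f \<in> J \<Longrightarrow> hcomp d f \<in> J"
  by (simp add: graded_def)

lemma mem_if_hcomps:
  assumes "pid.subspace J" "\<And>d. hcomp d f \<in> J"
  shows "f \<in> J"
proof -
  have "f = (\<Sum>d\<in>mdegree ` keys f. hcomp d f)"
    by (rule poly_mapping_eqI) (auto simp: lookup_sum lookup_restrict_terms in_keys_iff)
  also have "\<dots> \<in> J" by (rule pid.subspace_sum) (use assms in auto)
  finally show ?thesis .
qed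

lemma leads_homogeneous:
  fixes J :: "('n::finite, 'k::field) mpoly set"
  assumes "pid.subspace J" "graded J" "e \<in> leads r J"
  obtains f where "f \<in> J" "is_lead r f e" "lookup f e = 1" "\<And>\<mu>. \<mu> \<in> keys f \<Longrightarrow> mdegree \<mu> = mdegree e"
proof -
  from assms(3) obtain f where f: "f \<in> J" "is_lead r f e" by (auto simp: leads_def)
  define h where "h = single 0 (1 / lookup f e) * hcomp (mdegree e) f"
  have ne: "lookup f e \<noteq> 0" using f by (auto simp: is_lead_def in_keys_iff)
  have l: "lookup h \<mu> = (if mdegree \<mu> = mdegree e then lookup f \<mu> / lookup f e else 0)" for \<mu>
    by (simp add: h_def lookup_restrict_terms)
  have "h \<in> J" unfolding h_def by (intro pid.subspace_scale assms graded_hcomp f)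
  moreover have "keys h \<subseteq> keys f" by (auto simp: in_keys_iff l split: if_splits)
  then have "is_lead r h e" using f ne by (auto simp: is_lead_def in_keys_iff l)
  moreover have "lookup h e = 1" using ne by (simp add: l)
  moreover have "mdegree \<mu> = mdegree e" if "\<mu> \<in> keys h" for \<mu>
    using that by (simp add: in_keys_iff l split: if_splits)
  ultimately show ?thesis by (rule that)
qed

text \<open>Tail reduction within one degree: the leading monomials below \<open>e\<close> are
  cleared from \<open>f\<close> with their own reduced elements. The induction counts the smaller
  monomials in the degree of \<open>e\<close>, a finite number for any
  \<open>corder\<close>.\<close>

lemma reduced_element:
  fixes J :: "('n::finite, 'k::field) mpoly set"
  assumes J: "pid.subspace J" "graded J" and r: "corder r" and "e \<in> leads r J"
  shows "\<exists>f\<in>J. lookup f e = 1 \<and> (\<forall>\<mu>\<in>keys f. mdegree \<mu> = mdegree e \<and> (\<mu>, e) \<in> r) \<and> (\<forall>\<mu>\<in>keys f \<inter> leads r J. \<mu> = e)"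
  using assms(4)
proof (induction "card {\<mu>. mdegree \<mu> = mdegree e \<and> (\<mu>, e) \<in> r \<and> \<mu> \<noteq> e}" arbitrary: e rule: less_induct)
  case less
  let ?B = "\<lambda>e. {\<mu>. mdegree \<mu> = mdegree e \<and> (\<mu>, e) \<in> r \<and> \<mu> \<noteq> e}"
  let ?P = "\<lambda>e f. f \<in> J \<and> lookup f e = 1 \<and> (\<forall>\<mu>\<in>keys f. mdegree \<mu> = mdegree e \<and> (\<mu>, e) \<in> r) \<and> (\<forall>\<mu>\<in>keys f \<inter> leads r J. \<mu> = e)"
  obtain f where f: "f \<in> J" "is_lead r f e" "lookup f e = 1" "\<And>\<mu>. \<mu> \<in> keys f \<Longrightarrow> mdegree \<mu> = mdegree e"
    using leads_homogeneous[OF J less.prems] by blast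
  have finB: "finite (?B e)" by (rule finite_subset[OF _ finite_monomials_eq[of "mdegree e"]]) auto
  have "\<exists>h. ?P \<mu> h" if \<mu>: "\<mu> \<in> ?B e" "\<mu> \<in> leads r J" for \<mu>
  proof -
    have "?B \<mu> \<subset> ?B e"
    proof
      show "?B \<mu> \<subseteq> ?B e" using \<mu> corder_trans[OF r] corder_antisym[OF r] by auto
      show "?B \<mu> \<noteq> ?B e" using \<mu> by auto
    qed
    then have "card (?B \<mu>) < card (?B e)" by (rule psubset_card_mono[OF finB])
    from less.hyps[OF this \<mu>(2)] show ?thesis unfolding Bex_def .
  qed
  then have "\<forall>\<mu>\<in>?B e \<inter> leads r J. \<exists>h. ?P \<mu> h" by blast
  from bchoice[OF this] obtain h where "\<forall>\<mu>\<in>?B e \<inter> leads r J. ?P \<mu> (h \<mu>)" ..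
  note h = bspec[OF this]
  define S where "S = keys f \<inter> leads r J - {e}"
  have S: "\<mu> \<in> ?B e \<inter> leads r J" if "\<mu> \<in> S" for \<mu>
  proof -
    have "\<mu> \<in> keys f" "\<mu> \<in> leads r J" "\<mu> \<noteq> e" using that by (simp_all add: S_def)
    then show ?thesis using f(4)[of \<mu>] f(2) by (simp add: is_lead_def)
  qed
  have finS: "finite S" by (simp add: S_def)
  \<comment> \<open>The support of \<open>h \<mu>\<close> meets \<open>leads r J\<close> only in
    \<open>\<mu>\<close>, so all subtractions can be made at once with the original coefficients of
    \<open>f\<close>.\<close>
  define p where "p = f - (\<Sum>\<mu>\<in>S. single 0 (lookup f \<mu>) * h \<mu>)"
  have lp: "lookup p c = lookup f c - (\<Sum>\<mu>\<in>S. lookup f \<mu> * lookup (h \<mu>) c)" for c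
    by (simp add: p_def lookup_minus lookup_sum)
  note hc = h[OF S]
  note hS = hc[THEN conjunct1] hc[THEN conjunct2, THEN conjunct1]
    hc[THEN conjunct2, THEN conjunct2, THEN conjunct1] hc[THEN conjunct2, THEN conjunct2, THEN conjunct2]
  have "p \<in> J"
    unfolding p_def by (intro pid.subspace_diff J f(1) pid.subspace_sum pid.subspace_scale hS(1))
  moreover have keysp: "mdegree c = mdegree e \<and> (c, e) \<in> r" if c: "c \<in> keys p" for c
  proof -
    from c have "lookup f c \<noteq> 0 \<or> (\<exists>\<mu>\<in>S. lookup (h \<mu>) c \<noteq> 0)"
    proof (rule contrapos_pp)
      assume "\<not> (lookup f c \<noteq> 0 \<or> (\<exists>\<mu>\<in>S. lookup (h \<mu>) c \<noteq> 0))"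
      then have "lookup p c = 0" by (simp add: lp)
      then show "c \<notin> keys p" by (simp add: in_keys_iff)
    qed
    then show ?thesis
    proof
      assume "lookup f c \<noteq> 0"
      then have "c \<in> keys f" by (simp add: in_keys_iff)
      then show ?thesis using f(2) f(4)[of c] by (simp add: is_lead_def)
    next
      assume "\<exists>\<mu>\<in>S. lookup (h \<mu>) c \<noteq> 0"
      then obtain \<mu> where \<mu>: "\<mu> \<in> S" "c \<in> keys (h \<mu>)" by (auto simp: in_keys_iff)
      then have "mdegree c = mdegree \<mu>" "(c, \<mu>) \<in> r" using hS(3) by auto
      then show ?thesis using S[OF \<mu>(1)] corder_trans[OF r, of c \<mu> e] by simp
    qed
  qed
  moreover have he: "lookup (h \<mu>) c = (if c = \<mu> then 1 else 0)" if "\<mu> \<in> S" "c \<in> leads r J" for \<mu> c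
    using hS(2,4)[OF that(1)] that(2) not_in_keys_iff_lookup_eq_zero[of c "h \<mu>"] by auto
  have "lookup p e = 1"
  proof -
    have "(\<Sum>\<mu>\<in>S. lookup f \<mu> * lookup (h \<mu>) e) = 0"
      by (rule sum.neutral) (use he less.prems in \<open>auto simp: S_def\<close>)
    then show ?thesis using f by (simp add: lp)
  qed
  moreover have "c = e" if c: "c \<in> keys p \<inter> leads r J" for c
  proof (rule ccontr)
    assume "c \<noteq> e"
    have "(\<Sum>\<mu>\<in>S. lookup f \<mu> * lookup (h \<mu>) c) = (\<Sum>\<mu>\<in>S. if \<mu> = c then lookup f c else 0)"
      by (rule sum.cong) (use he c in auto)
    then have "lookup p c = (if c \<in> S then 0 else lookup f c)" using finS by (simp add: lp)
    also have "\<dots> = 0" using \<open>c \<noteq> e\<close> c by (auto simp: S_def in_keys_iff)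
    finally show False using c by (simp add: in_keys_iff)
  qed
  ultimately show ?case by blast
qed

text \<open>Reduced elements form a family dual to their leading monomials.\<close>

lemma Ind_leads:
  fixes J :: "('n::finite, 'k::field) mpoly set"
  assumes J: "pid.subspace J" "graded J" and r: "corder r" and F: "F \<subseteq> leads r J"
  shows "Ind J F"
  unfolding Ind_def
proof
  fix e assume e: "e \<in> F"
  then obtain f where "f \<in> J" "lookup f e = 1" "\<forall>\<mu>\<in>keys f \<inter> leads r J. \<mu> = e"
    using reduced_element[OF J r, of e] F by auto
  then show "\<exists>f\<in>J. \<forall>c\<in>F. lookup f c = (if c = e then 1 else 0)"
    using F by (intro bexI[of _ f]) (auto simp: in_keys_iff)
qed

lemma normal_form:
  fixes J :: "('n::finite, 'k::field) mpoly set"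
  assumes J: "pid.subspace J" "graded J" and r: "corder r"
  obtains f' where "f - f' \<in> J" "keys f' \<inter> leads r J = {}"
proof -
  let ?N = "leads r J"
  have "\<forall>e\<in>keys f \<inter> ?N. \<exists>h. h \<in> J \<and> lookup h e = 1 \<and> (\<forall>\<mu>\<in>keys h \<inter> ?N. \<mu> = e)"
  proof
    fix e assume "e \<in> keys f \<inter> ?N"
    with reduced_element[OF J r, of e] obtain h
      where "h \<in> J" "lookup h e = 1" "\<forall>\<mu>\<in>keys h \<inter> ?N. \<mu> = e" by auto
    then show "\<exists>h. h \<in> J \<and> lookup h e = 1 \<and> (\<forall>\<mu>\<in>keys h \<inter> ?N. \<mu> = e)" by (intro exI[of _ h] conjI)
  qed
  from bchoice[OF this] obtain h where
    h: "\<And>e. e \<in> keys f \<inter> ?N \<Longrightarrow> h e \<in> J \<and> lookup (h e) e = 1 \<and> (\<forall>\<mu>\<in>keys (h e) \<inter> ?N. \<mu> = e)" by auto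
  define p where "p = (\<Sum>e\<in>keys f \<inter> ?N. single 0 (lookup f e) * h e)"
  have "p \<in> J" unfolding p_def by (intro pid.subspace_sum pid.subspace_scale J) (use h in auto)
  moreover have "lookup (f - p) c = 0" if c: "c \<in> ?N" for c
  proof -
    have hz: "lookup (h e) c = 0" if "e \<in> keys f \<inter> ?N" "e \<noteq> c" for e
    proof (rule ccontr)
      assume "lookup (h e) c \<noteq> 0"
      then have "c \<in> keys (h e) \<inter> ?N" using c by (simp add: in_keys_iff)
      then have "c = e" using h[OF that(1)] by auto
      then show False using that(2) by simp
    qed
    have "(\<Sum>e\<in>keys f \<inter> ?N. lookup f e * lookup (h e) c) = (\<Sum>e\<in>keys f \<inter> ?N. if e = c then lookup f c else 0)"
      by (rule sum.cong) (use h hz c in auto)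
    then have "lookup p c = lookup f c"
      using c by (simp add: p_def lookup_sum in_keys_iff)
    then show ?thesis by (simp add: lookup_minus)
  qed
  then have "keys (f - p) \<inter> ?N = {}" by (auto simp: in_keys_iff)
  ultimately show ?thesis using that[of "f - p"] by simp
qed

text \<open>Leading monomials are a greedy basis, as numerous as possible in every upper segment
  \<open>U\<close> of a degree. Otherwise some nonzero combination of the family dual to
  \<open>F\<close> vanishes at all leading monomials in \<open>U\<close>; yet its own leading
  monomial lies above an element of \<open>F\<close>, hence in \<open>U\<close>.\<close>

lemma Ind_card_le:
  fixes J :: "('n::finite, 'k::field) mpoly set"
  assumes J: "pid.subspace J" "graded J" and r: "corder r"
    and U: "\<And>\<mu> \<nu>. mdegree \<mu> = d \<Longrightarrow> mdegree \<nu> = d \<Longrightarrow> U \<mu> \<Longrightarrow> (\<mu>, \<nu>) \<in> r \<Longrightarrow> U \<nu>"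
    and F: "Ind J F" "F \<subseteq> {\<nu>. mdegree \<nu> = d \<and> U \<nu>}"
  shows "card F \<le> card {\<nu>\<in>leads r J. mdegree \<nu> = d \<and> U \<nu>}"
proof (rule ccontr)
  let ?B = "{\<nu>\<in>leads r J. mdegree \<nu> = d \<and> U \<nu>}"
  assume "\<not> card F \<le> card ?B"
  moreover have fin: "finite F" "finite ?B"
    using F(2) by (auto intro: finite_subset[OF _ finite_monomials_eq[of d]])
  have "\<forall>e\<in>F. \<exists>f. f \<in> J \<and> (\<forall>c\<in>F. lookup f c = (if c = e then 1 else 0))" using F(1) unfolding Ind_def by blast
  from bchoice[OF this] obtain f where
    f: "\<And>e. e \<in> F \<Longrightarrow> f e \<in> J" "\<And>e c. e \<in> F \<Longrightarrow> c \<in> F \<Longrightarrow> lookup (f e) c = (if c = e then 1 else 0)" by auto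
  ultimately obtain a where a: "\<exists>e\<in>F. a e \<noteq> 0" "\<forall>b\<in>?B. (\<Sum>e\<in>F. lookup (f e) b * a e) = 0"
    using homogeneous_system[OF fin(2,1), of "\<lambda>b e. lookup (f e) b"] by auto
  define p where "p = hcomp d (\<Sum>e\<in>F. single 0 (a e) * f e)"
  have pJ: "p \<in> J"
    unfolding p_def by (intro graded_hcomp J pid.subspace_sum pid.subspace_scale) (use f in auto)
  have lp: "lookup p c = (if mdegree c = d then \<Sum>e\<in>F. lookup (f e) c * a e else 0)" for c
    by (simp add: p_def lookup_restrict_terms lookup_sum) (simp add: mult.commute)
  from a(1) obtain e where e: "e \<in> F" "a e \<noteq> 0" by auto
  have "(\<Sum>e'\<in>F. lookup (f e') e * a e') = (\<Sum>e'\<in>F. if e' = e then a e else 0)"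
    by (rule sum.cong) (use f e in auto)
  then have ek: "e \<in> keys p" using e F(2) fin by (auto simp: in_keys_iff lp)
  then have "p \<noteq> 0" by auto
  then obtain e' where e': "is_lead r p e'" using is_lead_ex r by blast
  then have "mdegree e' = d" "(e, e') \<in> r" using ek by (auto simp: is_lead_def in_keys_iff lp split: if_splits)
  then have "e' \<in> ?B" using U[of e e'] e F(2) e' pJ by (auto simp: leads_def)
  then have "lookup p e' = 0" using a(2) by (simp add: lp)
  then show False using e' by (simp add: is_lead_def in_keys_iff)
qed

text \<open>The dimension of the degree \<open>d\<close> part of \<open>J\<close> itself, not of its
  quotient; by \<open>hilb_eq\<close> every order gives the same count.\<close>

definition hilb :: "('n::finite, 'k::comm_ring_1) mpoly set \<Rightarrow> nat \<Rightarrow> nat" where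
  "hilb J d = card {\<nu>\<in>leads lexo J. mdegree \<nu> = d}"

lemma hilb_le:
  fixes J :: "('n::finite, 'k::field) mpoly set"
  assumes J: "pid.subspace J" "graded J" and r: "corder r" and r': "corder r'"
  shows "card {\<nu>\<in>leads r J. mdegree \<nu> = d} \<le> card {\<nu>\<in>leads r' J. mdegree \<nu> = d}"
  using Ind_card_le[OF J r', where d = d and U = "\<lambda>_. True" and F = "{\<nu>\<in>leads r J. mdegree \<nu> = d}"]
    Ind_leads[OF J r] by auto

lemma hilb_eq:
  fixes J :: "('n::finite, 'k::field) mpoly set"
  assumes J: "pid.subspace J" "graded J" and r: "corder r"
  shows "card {\<nu>\<in>leads r J. mdegree \<nu> = d} = hilb J d"
  unfolding hilb_def using hilb_le[OF J r corder_lexo] hilb_le[OF J corder_lexo r] by (simp add: le_antisym)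

text \<open>A family in \<open>g(I)\<close> dual to its leading monomials pulls back to linearly
  independent elements of \<open>I\<close>, of which there cannot be more than leading monomials of
  \<open>I\<close> in that degree.\<close>

lemma hilb_act_le:
  fixes I :: "('n::finite, 'k::field) mpoly set"
  assumes I: "pid.subspace I" "graded I" and g: "invertible g"
  shows "hilb (act g ` I) d \<le> hilb I d"
proof (rule ccontr)
  let ?J = "act g ` I"
  have J: "pid.subspace ?J" "graded ?J" using I g subspace_act graded_act by auto
  let ?F = "{\<nu>\<in>leads lexo ?J. mdegree \<nu> = d}" and ?B = "{\<nu>\<in>leads lexo I. mdegree \<nu> = d}"
  assume "\<not> hilb ?J d \<le> hilb I d"
  then have card: "card ?B < card ?F" by (simp add: hilb_def)
  have fin: "finite ?F" "finite ?B" by (auto intro: finite_subset[OF _ finite_monomials_eq[of d]])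
  have "\<forall>e\<in>?F. \<exists>p. p \<in> I \<and> (\<forall>c\<in>?F. lookup (act g p) c = (if c = e then 1 else 0))"
  proof
    fix e assume e: "e \<in> ?F"
    have "Ind ?J ?F" by (rule Ind_leads[OF J corder_lexo]) auto
    from bspec[OF this[unfolded Ind_def] e]
    show "\<exists>p. p \<in> I \<and> (\<forall>c\<in>?F. lookup (act g p) c = (if c = e then 1 else 0))" by blast
  qed
  from bchoice[OF this] obtain p where
    p: "\<And>e. e \<in> ?F \<Longrightarrow> p e \<in> I" "\<And>e c. e \<in> ?F \<Longrightarrow> c \<in> ?F \<Longrightarrow> lookup (act g (p e)) c = (if c = e then 1 else 0)" by auto
  obtain a where a: "\<exists>e\<in>?F. a e \<noteq> 0" "\<forall>b\<in>?B. (\<Sum>e\<in>?F. lookup (p e) b * a e) = 0"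
    using homogeneous_system[OF fin(2,1) card, of "\<lambda>b e. lookup (p e) b"] by auto
  define q where "q = hcomp d (\<Sum>e\<in>?F. single 0 (a e) * p e)"
  have qI: "q \<in> I"
    unfolding q_def by (intro graded_hcomp I pid.subspace_sum pid.subspace_scale) (use p in auto)
  have lq: "lookup q c = (if mdegree c = d then \<Sum>e\<in>?F. lookup (p e) c * a e else 0)" for c
    by (simp add: q_def lookup_restrict_terms lookup_sum) (simp add: mult.commute)
  have "keys q \<inter> leads lexo I = {}"
    using a(2) by (auto simp: in_keys_iff lq split: if_splits)
  then have "q = 0" using zero_if_no_leads[OF corder_lexo qI] by simp
  then have "hcomp d (\<Sum>e\<in>?F. single 0 (a e) * act g (p e)) = 0"
    using hcomp_act[of d g "\<Sum>e\<in>?F. single 0 (a e) * p e"] by (simp add: q_def act_sum act_mult)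
  then have z: "(\<Sum>e\<in>?F. a e * lookup (act g (p e)) c) = 0" if "mdegree c = d" for c
  proof -
    have "lookup (hcomp d (\<Sum>e\<in>?F. single 0 (a e) * act g (p e))) c = 0" for c
      by (simp only: \<open>hcomp d (\<Sum>e\<in>?F. single 0 (a e) * act g (p e)) = 0\<close> lookup_zero)
    from this[of c] show ?thesis unfolding lookup_restrict_terms if_P[OF that] lookup_sum lookup_const_mult .
  qed
  from a(1) obtain e where e: "e \<in> ?F" "a e \<noteq> 0" by auto
  have "(\<Sum>e'\<in>?F. a e' * lookup (act g (p e')) e) = (\<Sum>e'\<in>?F. if e' = e then a e else 0)"
    by (rule sum.cong) (use p(2)[OF _ e(1)] in auto)
  also have "\<dots> = a e" using e(1) fin(1) by (simp add: sum.delta)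
  finally show False using z[of e] e by simp
qed

lemma hilb_act:
  fixes I :: "('n::finite, 'k::field) mpoly set"
  assumes I: "pid.subspace I" "graded I" and g: "invertible g"
  shows "hilb (act g ` I) d = hilb I d"
proof (rule le_antisym[OF hilb_act_le[OF assms]])
  obtain g' where g': "g' ** g = mat 1" "invertible g'" using g invertible_inverse by metis
  have "hilb (act g' ` act g ` I) d \<le> hilb (act g ` I) d"
    by (rule hilb_act_le) (use subspace_act graded_act I g g' in auto)
  then show "hilb I d \<le> hilb (act g ` I) d" unfolding act_act_image g' by simp
qed

text \<open>The normal form modulo \<open>J\<close> of an element of \<open>J'\<close> stays in
  \<open>J'\<close> and contains no leading monomial of \<open>J'\<close>, so it is 0.\<close>

lemma ideal_eq_if_leads_eq:
  fixes J :: "('n::finite, 'k::field) mpoly set"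
  assumes r: "corder r" and J: "pid.subspace J" "graded J" "J \<subseteq> J'" "pid.subspace J'" and "leads r J' \<subseteq> leads r J"
  shows "J = J'"
proof
  show "J' \<subseteq> J"
  proof
    fix f assume f: "f \<in> J'"
    obtain f' where f': "f - f' \<in> J" "keys f' \<inter> leads r J = {}" using normal_form[OF J(1,2) r] .
    have "f - (f - f') \<in> J'" by (rule pid.subspace_diff[OF J(4) f]) (use f' J in auto)
    then have "f' \<in> J'" by simp
    then have "f' = 0" using zero_if_no_leads[OF r, of f' J'] f'(2) assms(6) by auto
    then show "f \<in> J" using f' by simp
  qed
qed (rule J)

lemma Ind_insert:
  fixes J :: "('n::finite, 'k::field) mpoly set"
  assumes J: "pid.subspace J" and Y: "Ind J Y" and f: "f \<in> J" "\<And>c. c \<in> Y \<Longrightarrow> lookup f c = 0" "lookup f x \<noteq> 0"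
  shows "Ind J (insert x Y)"
proof (rule Ind_scaled[OF J f(3)])
  fix e assume e: "e \<in> insert x Y"
  have x: "x \<notin> Y" using f by auto
  show "\<exists>h\<in>J. \<forall>c\<in>insert x Y. lookup h c = (if c = e then lookup f x else 0)"
  proof (cases "e = x")
    case True
    then show ?thesis using f x by (intro bexI[of _ f]) auto
  next
    case False
    then obtain h where h: "h \<in> J" "\<forall>c\<in>Y. lookup h c = (if c = e then 1 else 0)"
      using e Y by (auto simp: Ind_def)
    show ?thesis
      by (rule bexI[of _ "single 0 (lookup f x) * h - single 0 (lookup h x) * f"])
        (use False x h f in \<open>auto simp: lookup_minus intro!: pid.subspace_diff pid.subspace_scale J\<close>)
  qed
qed

text \<open>In the matroid of coefficient functionals on \<open>J\<close>, \<open>e\<close> lies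
  outside the closure of \<open>Y\<close> (for finite \<open>Y\<close>).\<close>

definition Sep :: "('n::finite, 'k::comm_ring_1) mpoly set \<Rightarrow> 'n monomial set \<Rightarrow> 'n monomial \<Rightarrow> bool" where
  "Sep J Y e \<longleftrightarrow> (\<exists>f\<in>J. (\<forall>c\<in>Y. lookup f c = 0) \<and> lookup f e = 1)"

lemma SepI:
  fixes J :: "('n::finite, 'k::field) mpoly set"
  assumes "pid.subspace J" "f \<in> J" "\<And>c. c \<in> Y \<Longrightarrow> lookup f c = 0" "lookup f e \<noteq> 0"
  shows "Sep J Y e"
  unfolding Sep_def
  by (rule bexI[of _ "single 0 (1 / lookup f e) * f"]) (use assms in \<open>auto intro: pid.subspace_scale\<close>)

text \<open>Matroid closure expressed by independent sets, with \<open>Y'\<close> a maximal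
  independent subset of \<open>Y\<close>: an element of \<open>J\<close> vanishing on
  \<open>Y'\<close> vanishes on \<open>Y\<close>, since otherwise \<open>Y'\<close> could be
  enlarged. Hence \<open>Ind\<close> determines \<open>Sep\<close>.\<close>

lemma Sep_iff_Ind:
  fixes J :: "('n::finite, 'k::field) mpoly set"
  assumes J: "pid.subspace J" and Y: "finite Y"
  shows "Sep J Y e \<longleftrightarrow> e \<notin> Y \<and> (\<exists>Y'\<subseteq>Y. Ind J Y' \<and> (\<forall>x\<in>Y - Y'. \<not> Ind J (insert x Y')) \<and> Ind J (insert e Y'))"
proof
  assume "Sep J Y e"
  then obtain f where f: "f \<in> J" "\<And>c. c \<in> Y \<Longrightarrow> lookup f c = 0" "lookup f e = 1" by (auto simp: Sep_def)
  let ?A = "{Y'. Y' \<subseteq> Y \<and> Ind J Y'}"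
  have "finite ?A" using Y by auto
  moreover have "{} \<in> ?A" by (auto simp: Ind_def)
  ultimately obtain Y' where Y': "Y' \<in> ?A" "\<And>Z. Z \<in> ?A \<Longrightarrow> Y' \<subseteq> Z \<Longrightarrow> Y' = Z"
    using finite_has_maximal[of ?A] by auto
  have "\<not> Ind J (insert x Y')" if "x \<in> Y - Y'" for x
    using Y'(2)[of "insert x Y'"] Y'(1) that by auto
  moreover have "Ind J (insert e Y')"
    by (rule Ind_insert[OF J _ f(1)]) (use Y' f in auto)
  moreover have "e \<notin> Y" using f by auto
  ultimately show "e \<notin> Y \<and> (\<exists>Y'\<subseteq>Y. Ind J Y' \<and> (\<forall>x\<in>Y - Y'. \<not> Ind J (insert x Y')) \<and> Ind J (insert e Y'))"
    using Y'(1) by blast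
next
  assume "e \<notin> Y \<and> (\<exists>Y'\<subseteq>Y. Ind J Y' \<and> (\<forall>x\<in>Y - Y'. \<not> Ind J (insert x Y')) \<and> Ind J (insert e Y'))"
  then obtain Y' where Y': "e \<notin> Y" "Y' \<subseteq> Y" "Ind J Y'" "\<And>x. x \<in> Y - Y' \<Longrightarrow> \<not> Ind J (insert x Y')" "Ind J (insert e Y')"
    by auto
  then obtain f where f: "f \<in> J" "\<forall>c\<in>insert e Y'. lookup f c = (if c = e then 1 else 0)" by (auto simp: Ind_def)
  have fY': "lookup f c = 0" if "c \<in> Y'" for c using f(2) that Y' by auto
  have "lookup f x = 0" if "x \<in> Y" for x
    using that Y'(4)[of x] Ind_insert[OF J Y'(3) f(1) fY', of x] fY' by (cases "x \<in> Y'") auto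
  then show "Sep J Y e" using f unfolding Sep_def by auto
qed

lemma Sep_homogeneous:
  fixes J :: "('n::finite, 'k::field) mpoly set"
  assumes J: "graded J" and "Sep J Y e"
  obtains f where "f \<in> J" "\<And>c. c \<in> Y \<Longrightarrow> lookup f c = 0" "lookup f e = 1" "\<And>\<mu>. \<mu> \<in> keys f \<Longrightarrow> mdegree \<mu> = mdegree e"
proof -
  from assms obtain f where f: "f \<in> J" "\<And>c. c \<in> Y \<Longrightarrow> lookup f c = 0" "lookup f e = 1" by (auto simp: Sep_def)
  show ?thesis
    by (rule that[of "hcomp (mdegree e) f"])
      (use f graded_hcomp[OF J] in \<open>auto simp: lookup_restrict_terms keys_restrict_terms\<close>)
qed

text \<open>By gradedness a leading monomial is witnessed by a homogeneous element, so only the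
  finitely many larger monomials of the same degree have to be avoided.\<close>

lemma leads_iff_Sep:
  fixes J :: "('n::finite, 'k::field) mpoly set"
  assumes J: "pid.subspace J" "graded J" and r: "corder r"
  shows "e \<in> leads r J \<longleftrightarrow> Sep J {\<nu>. mdegree \<nu> = mdegree e \<and> (e, \<nu>) \<in> r \<and> \<nu> \<noteq> e} e"
proof
  assume "e \<in> leads r J"
  then obtain f where "f \<in> J" "is_lead r f e" by (auto simp: leads_def)
  then show "Sep J {\<nu>. mdegree \<nu> = mdegree e \<and> (e, \<nu>) \<in> r \<and> \<nu> \<noteq> e} e"
    by (intro SepI[OF J(1), of f]) (use corder_antisym[OF r, of _ e] in \<open>auto simp: is_lead_def simp flip: not_in_keys_iff_lookup_eq_zero\<close>)
next
  assume sep: "Sep J {\<nu>. mdegree \<nu> = mdegree e \<and> (e, \<nu>) \<in> r \<and> \<nu> \<noteq> e} e"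
  obtain f where f: "f \<in> J"
    "\<And>c. c \<in> {\<nu>. mdegree \<nu> = mdegree e \<and> (e, \<nu>) \<in> r \<and> \<nu> \<noteq> e} \<Longrightarrow> lookup f c = 0" "lookup f e = 1"
    "\<And>\<mu>. \<mu> \<in> keys f \<Longrightarrow> mdegree \<mu> = mdegree e" by (rule Sep_homogeneous[OF J(2) sep]) (rule that, assumption+)
  have "(\<mu>, e) \<in> r" if "\<mu> \<in> keys f" for \<mu>
    using f(2)[of \<mu>] f(4)[OF that] that corder_total[OF r, of \<mu> e] corder_refl[OF r] by (auto simp: in_keys_iff)
  then have "is_lead r f e" using f(3) by (simp add: is_lead_def in_keys_iff)
  then show "e \<in> leads r J" using f(1) unfolding leads_def by blast
qed

lemma Sep_Dgen:
  fixes I :: "('n::finite, 'k::field) mpoly set"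
  assumes I: "pid.subspace I" and g: "Dgen I D g" "Dgen I D g'" and Y: "Y \<subseteq> {\<nu>. mdegree \<nu> \<le> D}" "mdegree e \<le> D"
  shows "Sep (act g ` I) Y e \<longleftrightarrow> Sep (act g' ` I) Y e"
proof -
  have inv: "invertible g" "invertible g'" using g by (auto simp: Dgen_def)
  have "Ind (act g ` I) F \<longleftrightarrow> Ind (act g' ` I) F" if "F \<subseteq> {\<nu>. mdegree \<nu> \<le> D}" for F
    using g that by (auto simp: Dgen_def)
  moreover have "finite Y" using Y finite_subset finite_monomials_le by auto
  ultimately show ?thesis
    using Y by (simp add: Sep_iff_Ind subspace_act I inv subset_iff cong: conj_cong)
qed

section \<open>Monomial ideals with a given Hilbert function\<close>

lemma nat_seq_incseq_subseq:
  fixes g :: "nat \<Rightarrow> nat"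
  shows "\<exists>\<psi>. strict_mono \<psi> \<and> incseq (g \<circ> \<psi>)"
proof -
  obtain \<psi> where \<psi>: "strict_mono \<psi>" "monoseq (\<lambda>n. g (\<psi> n))" using seq_monosub by blast
  show ?thesis
  proof (cases "incseq (\<lambda>n. g (\<psi> n))")
    case True
    then show ?thesis using \<psi>(1) by (auto simp: o_def)
  next
    case False
    then have dec: "decseq (\<lambda>n. g (\<psi> n))" using \<psi>(2) by (auto simp: monoseq_iff)
    obtain N where N: "\<And>n. g (\<psi> N) \<le> g (\<psi> n)"
      using ex_has_least_nat[of "\<lambda>_. True" 0 "\<lambda>n. g (\<psi> n)"] by auto
    have const: "g (\<psi> (n + N)) = g (\<psi> N)" for n
      using N[of "n + N"] decseqD[OF dec, of N "n + N"] by auto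
    have "strict_mono (\<psi> \<circ> (\<lambda>n. n + N))"
      using \<psi>(1) by (auto simp: strict_mono_def)
    moreover have "incseq (g \<circ> (\<psi> \<circ> (\<lambda>n. n + N)))"
      by (auto simp: incseq_def const)
    ultimately show ?thesis by blast
  qed
qed

text \<open>Passing to monotone subsequences one coordinate after another keeps the monotonicity
  already gained.\<close>

lemma dickson_sequence:
  fixes f :: "nat \<Rightarrow> 'n \<Rightarrow> nat"
  assumes "finite A"
  shows "\<exists>\<phi>. strict_mono \<phi> \<and> (\<forall>i\<in>A. incseq (\<lambda>k. f (\<phi> k) i))"
  using assms
proof (induction A rule: finite_induct)
  case empty
  then show ?case by (intro exI[of _ id]) (auto simp: strict_mono_def)
next
  case (insert i A)
  then obtain \<phi> where \<phi>: "strict_mono \<phi>" "\<forall>i\<in>A. incseq (\<lambda>k. f (\<phi> k) i)" by auto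
  obtain \<psi> where \<psi>: "strict_mono \<psi>" "incseq ((\<lambda>k. f (\<phi> k) i) \<circ> \<psi>)" using nat_seq_incseq_subseq by blast
  have "incseq (\<lambda>k. f ((\<phi> \<circ> \<psi>) k) l)" if "l \<in> insert i A" for l
  proof (cases "l = i")
    case True
    then show ?thesis using \<psi>(2) by (simp add: o_def)
  next
    case False
    then have "incseq (\<lambda>k. f (\<phi> k) l)" using \<phi>(2) that by auto
    then show ?thesis using \<psi>(1) by (auto simp: incseq_def strict_mono_less_eq)
  qed
  moreover have "strict_mono (\<phi> \<circ> \<psi>)" using \<phi>(1) \<psi>(1) by (auto simp: strict_mono_def)
  ultimately show ?case by blast
qed

definition min_gens :: "'n monomial set \<Rightarrow> 'n monomial set" where
  "min_gens N = {b \<in> N. \<forall>c\<in>N. mle c b \<longrightarrow> c = b}"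

lemma min_gens_below:
  assumes "\<nu> \<in> (N :: 'n::finite monomial set)"
  shows "\<exists>b\<in>min_gens N. mle b \<nu>"
proof -
  from ex_has_least_nat[of "\<lambda>b. b \<in> N \<and> mle b \<nu>" \<nu> mdegree] assms
  obtain b where b: "b \<in> N" "mle b \<nu>" "\<And>c. c \<in> N \<Longrightarrow> mle c \<nu> \<Longrightarrow> mdegree b \<le> mdegree c" by auto
  have "c = b" if "c \<in> N" "mle c b" for c
    using mle_mdegree_eq[OF that(2)] b(3)[OF that(1) mle_trans[OF that(2) b(2)]] by simp
  then show ?thesis using b by (auto simp: min_gens_def)
qed

lemma finite_min_gens: "finite (min_gens (N :: 'n::finite monomial set))"
proof (rule ccontr)
  assume "infinite (min_gens N)"
  then obtain f :: "nat \<Rightarrow> 'n monomial" where f: "inj f" "range f \<subseteq> min_gens N"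
    using infinite_countable_subset by blast
  have "finite (UNIV :: 'n set)" by simp
  from dickson_sequence[OF this, of "\<lambda>k. lookup (f k)"]
  obtain \<phi> where \<phi>: "strict_mono \<phi>" "\<forall>i\<in>UNIV. incseq (\<lambda>k. lookup (f (\<phi> k)) i)" by (elim exE conjE)
  have "mle (f (\<phi> 0)) (f (\<phi> 1))"
    unfolding mle_def
  proof
    fix i
    have "incseq (\<lambda>k. lookup (f (\<phi> k)) i)" using \<phi>(2) by simp
    from incseqD[OF this, of 0 1] show "lookup (f (\<phi> 0)) i \<le> lookup (f (\<phi> 1)) i" by simp
  qed
  moreover have "f (\<phi> 0) \<in> min_gens N" "f (\<phi> 1) \<in> min_gens N" using f(2) by (auto intro: subsetD)
  ultimately have "f (\<phi> 0) = f (\<phi> 1)" unfolding min_gens_def by simp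
  then have "\<phi> 0 = \<phi> 1" using f(1) by (auto dest: injD)
  then show False using strict_monoD[OF \<phi>(1), of 0 1] by simp
qed

text \<open>The union of an increasing sequence of monomial ideals has finitely many minimal
  generators, and all of them lie in one member of the sequence.\<close>

lemma wf_upc: "wf {(B, A). upc A \<and> upc B \<and> A \<subset> (B :: 'n::finite monomial set)}"
  unfolding wf_iff_no_infinite_down_chain
proof
  assume "\<exists>f. \<forall>i. (f (Suc i), f i) \<in> {(B, A). upc A \<and> upc B \<and> A \<subset> (B :: 'n monomial set)}"
  then obtain f :: "nat \<Rightarrow> 'n monomial set"
    where "\<forall>i. (f (Suc i), f i) \<in> {(B, A). upc A \<and> upc B \<and> A \<subset> B}" ..
  then have f: "\<And>i. upc (f i)" "\<And>i. f i \<subset> f (Suc i)" by simp_all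
  have mono: "f i \<subseteq> f j" if "i \<le> j" for i j
    using that by (rule lift_Suc_mono_le[rotated]) (use f in auto)
  define U where "U = (\<Union>i. f i)"
  have "\<forall>b\<in>min_gens U. \<exists>k. b \<in> f k" by (auto simp: min_gens_def U_def)
  from bchoice[OF this] obtain k where k: "\<And>b. b \<in> min_gens U \<Longrightarrow> b \<in> f (k b)" by auto
  define K where "K = Max (insert 0 (k ` min_gens U))"
  have K: "b \<in> f K" if "b \<in> min_gens U" for b
  proof -
    have "k b \<le> K" unfolding K_def using that finite_min_gens by (intro Max_ge) auto
    then show ?thesis using k[OF that] mono by auto
  qed
  have "U \<subseteq> f K"
  proof
    fix \<nu> assume "\<nu> \<in> U"
    then obtain b where "b \<in> min_gens U" "mle b \<nu>" using min_gens_below by blast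
    then show "\<nu> \<in> f K" using K f(1) upc_mle by blast
  qed
  then have "f (Suc K) \<subseteq> f K" by (auto simp: U_def)
  then show False using f(2)[of K] by auto
qed

definition deg_gen :: "nat \<Rightarrow> 'n::finite monomial set \<Rightarrow> bool" where
  "deg_gen D N \<longleftrightarrow> (\<forall>\<nu>\<in>N. \<exists>b\<in>N. mdegree b \<le> D \<and> mle b \<nu>)"

lemma deg_gen_mono: "deg_gen D N \<Longrightarrow> D \<le> D' \<Longrightarrow> deg_gen D' N"
  unfolding deg_gen_def by (meson le_trans)

lemma deg_gen_ex: "\<exists>D. deg_gen D N"
proof -
  have "deg_gen (Max (insert 0 (mdegree ` min_gens N))) N"
    unfolding deg_gen_def
  proof
    fix \<nu> assume "\<nu> \<in> N"
    then obtain b where b: "b \<in> min_gens N" "mle b \<nu>" using min_gens_below by blast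
    have "mdegree b \<le> Max (insert 0 (mdegree ` min_gens N))"
      using b finite_min_gens by (intro Max_ge) auto
    then show "\<exists>b\<in>N. mdegree b \<le> Max (insert 0 (mdegree ` min_gens N)) \<and> mle b \<nu>"
      using b by (intro bexI[of _ b]) (auto simp: min_gens_def)
  qed
  then show ?thesis by blast
qed

definition hilb_set :: "(nat \<Rightarrow> nat) \<Rightarrow> 'n::finite monomial set \<Rightarrow> bool" where
  "hilb_set H N \<longleftrightarrow> upc N \<and> (\<forall>d. card {\<nu>\<in>N. mdegree \<nu> = d} = H d)"

lemma hilb_set_subset_eq:
  assumes "hilb_set H N" "hilb_set H N'" "N \<subseteq> N'"
  shows "N = N'"
proof -
  have "{\<nu>\<in>N. mdegree \<nu> = d} = {\<nu>\<in>N'. mdegree \<nu> = d}" for d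
    by (rule card_subset_eq)
      (use assms in \<open>auto simp: hilb_set_def intro: finite_subset[OF _ finite_monomials_eq[of d]]\<close>)
  then show ?thesis by blast
qed

text \<open>
  Noetherian induction on the monomial ideals contained in \<open>N\<close>: as long as \<open>A\<close> is too small in
  some degree \<open>d\<close>, every competitor contains one of the finitely many further monomials of degree \<open>d\<close>.
\<close>

lemma hilbert_degree_bound: "\<exists>D. \<forall>N :: 'n::finite monomial set. hilb_set H N \<longrightarrow> deg_gen D N"
proof -
  have "upc A \<longrightarrow> (\<exists>D. \<forall>N :: 'n monomial set. A \<subseteq> N \<longrightarrow> hilb_set H N \<longrightarrow> deg_gen D N)" for A
  proof (induction A rule: wf_induct_rule[OF wf_upc])
    case (1 A)
    show ?case
    proof
      assume A: "upc A"
      show "\<exists>D. \<forall>N. A \<subseteq> N \<longrightarrow> hilb_set H N \<longrightarrow> deg_gen D N"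
      proof (cases "hilb_set H A")
        case True
        from deg_gen_ex[of A] obtain D where "deg_gen D A" ..
        \<comment> \<open>\<open>A\<close> already has the Hilbert function \<open>H\<close>, so
          \<open>N = A\<close> is the only competitor.\<close>
        then show ?thesis using hilb_set_subset_eq[OF True] by (intro exI[of _ D]) auto
      next
        case False
        then obtain d where d: "card {\<nu>\<in>A. mdegree \<nu> = d} \<noteq> H d" using A by (auto simp: hilb_set_def)
        let ?M = "{m. mdegree m = d \<and> m \<notin> A}"
        have fin: "finite ?M" by (rule finite_subset[OF _ finite_monomials_eq[of d]]) auto
        have "\<forall>m\<in>?M. \<exists>D. \<forall>N. A \<union> {m + \<kappa> | \<kappa>. True} \<subseteq> N \<longrightarrow> hilb_set H N \<longrightarrow> deg_gen D N"
        proof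
          fix m assume m: "m \<in> ?M"
          let ?A = "A \<union> {m + \<kappa> | \<kappa>. True}"
          have up: "upc ?A" using A by (auto simp: upc_def add.assoc)
          have "m \<in> ?A" by (auto intro!: exI[of _ 0])
          then have "(?A, A) \<in> {(B, A). upc A \<and> upc B \<and> A \<subset> B}" using m A up by blast
          from "1.IH"[OF this] up show "\<exists>D. \<forall>N. ?A \<subseteq> N \<longrightarrow> hilb_set H N \<longrightarrow> deg_gen D N" by blast
        qed
        from bchoice[OF this] obtain D where
          "\<forall>m\<in>?M. \<forall>N. A \<union> {m + \<kappa> | \<kappa>. True} \<subseteq> N \<longrightarrow> hilb_set H N \<longrightarrow> deg_gen (D m) N" ..
        note D = this[THEN bspec, THEN spec, THEN mp, THEN mp]
        have "deg_gen (Max (insert 0 (D ` ?M))) N" if N: "A \<subseteq> N" "hilb_set H N" for N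
        proof -
          have "{\<nu>\<in>A. mdegree \<nu> = d} \<noteq> {\<nu>\<in>N. mdegree \<nu> = d}" using d N(2) by (auto simp: hilb_set_def)
          then obtain m where m: "m \<in> N" "m \<in> ?M" using N(1) by blast
          then have "A \<union> {m + \<kappa> | \<kappa>. True} \<subseteq> N" using N by (auto simp: hilb_set_def upc_def)
          from D[OF m(2) this N(2)] have "deg_gen (D m) N" .
          moreover have "D m \<le> Max (insert 0 (D ` ?M))" using m fin by (intro Max_ge) auto
          ultimately show ?thesis by (rule deg_gen_mono)
        qed
        then show ?thesis by blast
      qed
    qed
  qed
  from this[of "{}"] show ?thesis by (simp add: upc_def)
qed

lemma hilb_set_leads:
  fixes J :: "('n::finite, 'k::field) mpoly set"
  assumes J: "pid.subspace J" "graded J" and r: "corder r"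
  shows "hilb_set (hilb J) (leads r J)"
  unfolding hilb_set_def using hilb_eq[OF J r] upc_leads[OF J(1) r] by simp

section \<open>Generic initial ideals\<close>

definition monoid_ideal :: "'n monomial set \<Rightarrow> ('n::finite, 'k::field) mpoly set" where
  "monoid_ideal N = {p. keys p \<subseteq> N}"

lemma single_mem_monoid_ideal [simp]: "single \<nu> (1 :: 'k::field) \<in> monoid_ideal N \<longleftrightarrow> \<nu> \<in> N"
  by (simp add: monoid_ideal_def)

lemma subspace_monoid_ideal:
  assumes "upc N"
  shows "pid.subspace (monoid_ideal N :: ('n::finite, 'k::field) mpoly set)"
proof (rule pid.subspaceI)
  show "0 \<in> monoid_ideal N" by (simp add: monoid_ideal_def)
  show "x + y \<in> monoid_ideal N" if "x \<in> monoid_ideal N" "y \<in> monoid_ideal N" for x y :: "('n, 'k) mpoly"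
    using that keys_add[of x y] by (auto simp: monoid_ideal_def)
  show "c * x \<in> monoid_ideal N" if "x \<in> monoid_ideal N" for c x :: "('n, 'k) mpoly"
    unfolding monoid_ideal_def
  proof safe
    fix \<mu> assume "\<mu> \<in> keys (c * x)"
    from subsetD[OF keys_mult this] obtain a b where "\<mu> = a + b" "b \<in> keys x" by auto
    then show "\<mu> \<in> N" using that upcD[OF assms] by (auto simp: monoid_ideal_def)
  qed
qed

lemma graded_monoid_ideal: "graded (monoid_ideal N)"
  by (auto simp: graded_def monoid_ideal_def keys_restrict_terms)

lemma initial_term_lead:
  assumes r: "corder r" and f: "is_lead r f e"
  shows "initial_term r f = single e (lookup f e)"
proof (rule poly_mapping_eqI)
  fix \<mu>
  have "(\<forall>\<nu>\<in>keys f. (\<nu>, \<mu>) \<in> r) \<longleftrightarrow> \<mu> = e" if "\<mu> \<in> keys f"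
    using that f corder_antisym[OF r, of \<mu> e] by (auto simp: is_lead_def)
  then show "lookup (initial_term r f) \<mu> = lookup (single e (lookup f e)) \<mu>"
    using f by (cases "\<mu> \<in> keys f")
      (auto simp: initial_term_def lookup_restrict_terms lookup_single when_def not_in_keys_iff_lookup_eq_zero is_lead_def)
qed

lemma term_initial_ideal_eq:
  fixes J :: "('n::finite, 'k::field) mpoly set"
  assumes J: "pid.subspace J" and r: "corder r"
  shows "term_initial_ideal r J = monoid_ideal (leads r J)"
proof -
  let ?N = "leads r J"
  have "pid.span (initial_term r ` J) \<subseteq> monoid_ideal ?N"
  proof (rule pid.span_minimal[OF _ subspace_monoid_ideal[OF upc_leads[OF J r]]], rule image_subsetI)
    fix f assume f: "f \<in> J"
    show "initial_term r f \<in> monoid_ideal ?N"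
    proof (cases "f = 0")
      case True
      then have "initial_term r f = 0" by (simp add: initial_term_def restrict_terms_def)
      then show ?thesis by (simp add: monoid_ideal_def)
    next
      case False
      then obtain e where e: "is_lead r f e" using is_lead_ex[OF r] by blast
      then have "e \<in> ?N" using f unfolding leads_def by blast
      then show ?thesis unfolding initial_term_lead[OF r e] by (simp add: monoid_ideal_def)
    qed
  qed
  moreover have "p \<in> pid.span (initial_term r ` J)" if p: "p \<in> monoid_ideal ?N" for p
  proof -
    have "single \<nu> (lookup p \<nu>) \<in> pid.span (initial_term r ` J)" if "\<nu> \<in> keys p" for \<nu>
    proof -
      from that p have "\<nu> \<in> ?N" by (auto simp: monoid_ideal_def)
      then obtain f where f: "f \<in> J" "is_lead r f \<nu>" unfolding leads_def by blast
      then have ne: "lookup f \<nu> \<noteq> 0" by (simp add: is_lead_def in_keys_iff)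
      have "single 0 (lookup p \<nu> / lookup f \<nu>) * initial_term r f \<in> pid.span (initial_term r ` J)"
        by (intro pid.span_scale pid.span_base imageI f)
      then show ?thesis unfolding initial_term_lead[OF r f(2)] using ne by (simp add: mult_single)
    qed
    then have "(\<Sum>\<nu>\<in>keys p. single \<nu> (lookup p \<nu>)) \<in> pid.span (initial_term r ` J)" by (rule pid.span_sum)
    then show ?thesis by (subst mpoly_expansion)
  qed
  ultimately show ?thesis unfolding term_initial_ideal_def Idl_eq_span by blast
qed

definition gen_bound :: "('n::finite, 'k::field) mpoly set \<Rightarrow> nat \<Rightarrow> bool" where
  "gen_bound I D \<longleftrightarrow> (\<forall>N :: 'n monomial set. hilb_set (hilb I) N \<longrightarrow> deg_gen D N)"

lemma gen_bound_ex: "\<exists>D. gen_bound I D"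
  unfolding gen_bound_def by (rule hilbert_degree_bound)

lemma hilb_act_fun:
  fixes I :: "('n::finite, 'k::field) mpoly set"
  assumes I: "pid.subspace I" "graded I" and g: "invertible g"
  shows "hilb (act g ` I) = hilb I"
  using hilb_act[OF assms] by auto

text \<open>Coordinate changes and the passage to leading monomials both keep the Hilbert function,
  so one \<open>D\<close> bounds the generating degrees for every invertible \<open>g\<close> and
  every order.\<close>

lemma deg_gen_leads:
  fixes I :: "('n::finite, 'k::field) mpoly set"
  assumes I: "pid.subspace I" "graded I" and D: "gen_bound I D" and g: "invertible g" and r: "corder r"
  shows "deg_gen D (leads r (act g ` I))"
  using hilb_set_leads[OF subspace_act[OF I(1) g] graded_act[OF I(2)] r] D
  unfolding gen_bound_def hilb_act_fun[OF I g] by blast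

lemma deg_gen_eq:
  assumes "deg_gen D N" "deg_gen D N'" "upc N" "upc N'" "\<And>\<nu>. mdegree \<nu> \<le> D \<Longrightarrow> \<nu> \<in> N \<longleftrightarrow> \<nu> \<in> N'"
  shows "N = N'"
proof -
  have "A \<subseteq> B" if *: "deg_gen D A" "upc B" "\<And>\<nu>. mdegree \<nu> \<le> D \<Longrightarrow> \<nu> \<in> A \<Longrightarrow> \<nu> \<in> B" for A B
  proof
    fix \<nu> assume "\<nu> \<in> A"
    then obtain b where "b \<in> A" "mdegree b \<le> D" "mle b \<nu>" using *(1) by (auto simp: deg_gen_def)
    then show "\<nu> \<in> B" using *(2,3) upc_mle by blast
  qed
  from this[of N N'] this[of N' N] show ?thesis using assms by blast
qed

text \<open>Up to degree \<open>D\<close> membership is a \<open>Sep\<close> condition, on which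
  generic matrices agree; above \<open>D\<close> the generators decide.\<close>

lemma leads_Dgen:
  fixes I :: "('n::finite, 'k::field) mpoly set"
  assumes I: "pid.subspace I" "graded I" and D: "gen_bound I D" and g: "Dgen I D g" "Dgen I D g'" and r: "corder r"
  shows "leads r (act g ` I) = leads r (act g' ` I)"
proof (rule deg_gen_eq[of D])
  have inv: "invertible g" "invertible g'" using g by (auto simp: Dgen_def)
  show "deg_gen D (leads r (act g ` I))" "deg_gen D (leads r (act g' ` I))"
    by (rule deg_gen_leads[OF I D _ r], rule inv)+
  show "upc (leads r (act g ` I))" "upc (leads r (act g' ` I))"
    by (rule upc_leads[OF subspace_act[OF I(1)] r], rule inv)+
  fix \<nu> :: "'n monomial" assume \<nu>: "mdegree \<nu> \<le> D"
  have "Sep (act g ` I) {\<mu>. mdegree \<mu> = mdegree \<nu> \<and> (\<nu>, \<mu>) \<in> r \<and> \<mu> \<noteq> \<nu>} \<nu> =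
        Sep (act g' ` I) {\<mu>. mdegree \<mu> = mdegree \<nu> \<and> (\<nu>, \<mu>) \<in> r \<and> \<mu> \<noteq> \<nu>} \<nu>"
    by (rule Sep_Dgen[OF I(1) g]) (use \<nu> in auto)
  then show "\<nu> \<in> leads r (act g ` I) \<longleftrightarrow> \<nu> \<in> leads r (act g' ` I)"
    unfolding leads_iff_Sep[OF subspace_act[OF I(1) inv(1)] graded_act[OF I(2)] r]
      leads_iff_Sep[OF subspace_act[OF I(1) inv(2)] graded_act[OF I(2)] r] .
qed

lemma gin_eq:
  fixes I :: "('n::finite, 'k::field_char_0) mpoly set"
  assumes I: "pid.subspace I" "graded I" and D: "gen_bound I D" and g: "Dgen I D g" and r: "corder r"
  shows "gin r I = monoid_ideal (leads r (act g ` I))"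
  unfolding gin_def
proof (rule generically_unique)
  show "generically (\<lambda>g'. term_initial_ideal r (act g' ` I) = monoid_ideal (leads r (act g ` I)))"
  proof (rule generically_mono[OF generically_Dgen[OF I(1), of D]])
    fix g' assume g': "invertible g'" "Dgen I D g'"
    show "term_initial_ideal r (act g' ` I) = monoid_ideal (leads r (act g ` I))"
      unfolding term_initial_ideal_eq[OF subspace_act[OF I(1) g'(1)] r] leads_Dgen[OF I D g g'(2) r] ..
  qed
qed



section \<open>Strong stability of generic initial ideals\<close>

text \<open>For \<open>i \<noteq> j\<close> this is the substitution
  \<open>x_i -> x_i + s x_j\<close> fixing the other variables.\<close>

definition shear :: "'n \<Rightarrow> 'n \<Rightarrow> 'k \<Rightarrow> 'k::field ^ 'n ^ 'n::finite" where
  "shear i j s = (\<chi> k l. (if k = l then 1 else 0) + (if k = j \<and> l = i then s else 0))"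

lemma shear_mult: "i \<noteq> j \<Longrightarrow> shear i j s ** shear i j s' = shear i j (s + s')"
proof -
  assume "i \<noteq> j"
  then have "(\<Sum>k\<in>UNIV. ((if a = k then 1 else 0) + (if a = j \<and> k = i then s else 0)) *
      ((if k = b then 1 else 0) + (if k = j \<and> b = i then s' else 0))) =
      (\<Sum>k\<in>UNIV. (if k = a then (if a = b then 1 else 0) else 0) + (if k = j then (if a = j \<and> b = i then s' else 0) else 0)
       + (if k = i then (if a = j \<and> b = i then s else 0) else 0))" for a b
    by (intro sum.cong) auto
  then show ?thesis
    by (simp add: shear_def vec_eq_iff matrix_matrix_mult_def sum.distrib)
qed

lemma shear_0: "shear i j 0 = mat 1"
  by (simp add: shear_def vec_eq_iff mat_def)

lemma invertible_shear: "i \<noteq> j \<Longrightarrow> invertible (shear i j s)"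
  unfolding invertible_def
  by (rule exI[of _ "shear i j (- s)"]) (simp add: shear_mult shear_0)

lemma lin_form_of_shear:
  "i \<noteq> j \<Longrightarrow> lin_form_of (shear i j s) k = (if k = i then single (xvar i) 1 + single (xvar j) s else single (xvar k) 1)"
proof -
  assume ij: "i \<noteq> j"
  have "lin_form_of (shear i j s) k =
    (\<Sum>l\<in>UNIV. (if l = k then single (xvar k) 1 else 0) + (if l = j then (if k = i then single (xvar j) s else 0) else 0))"
    unfolding lin_form_of_def by (rule sum.cong) (use ij in \<open>auto simp: shear_def mult_single single_add\<close>)
  then show ?thesis by (simp add: sum.distrib)
qed

lemma lookup_single_xvar_mult:
  "lookup (single (xvar k) c * f) \<mu> = (if lookup \<mu> k > 0 then c * lookup f (\<mu> - xvar k) else 0)"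
proof (cases "lookup \<mu> k > 0")
  case True
  show ?thesis
    using lookup_single_mult_add[of "xvar k" c f "\<mu> - xvar k"] True unfolding xvar_dvd[OF True] by simp
next
  case False
  have "\<mu> \<noteq> xvar k + \<kappa>" for \<kappa> using False by (auto simp: lookup_add)
  then show ?thesis using False lookup_single_mult_eq_0[of \<mu> "xvar k"] by simp
qed

lemma xvar_swap: "lookup e i > 0 \<Longrightarrow> (e - xvar i + xvar j) + xvar i = e + xvar j"
proof -
  assume "lookup e i > 0"
  have "(e - xvar i + xvar j) + xvar i = (xvar i + (e - xvar i)) + xvar j" by (simp only: ac_simps)
  then show ?thesis unfolding xvar_dvd[OF \<open>lookup e i > 0\<close>] .
qed

text \<open>To first order in \<open>s\<close> the shear acts as the derivation
  \<open>x_j d/dx_i\<close>, and the induction is the product rule. The condition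
  \<open>\<mu> + xvar i = \<nu> + xvar j\<close> says that \<open>x^\<mu>\<close> is
  \<open>x^\<nu> x_j / x_i\<close> without truncated subtraction.\<close>

lemma act_shear_monomial:
  fixes i j :: "'n::finite"
  assumes ij: "i \<noteq> j"
  shows "\<exists>Q. \<forall>\<mu>. (\<forall>s. lookup (act (shear i j s) (single \<nu> (1 :: 'k::field))) \<mu> = poly (Q \<mu>) s) \<and>
    coeff (Q \<mu>) 0 = (if \<mu> = \<nu> then 1 else 0) \<and>
    coeff (Q \<mu>) 1 = (if \<mu> + xvar i = \<nu> + xvar j then of_nat (lookup \<nu> i) else 0)"
proof (induction \<nu> rule: monomial_induct)
  case zero
  show ?case
  proof (intro exI allI conjI)
    fix \<mu> :: "'n monomial" and s :: 'k
    show "lookup (act (shear i j s) (single 0 1)) \<mu> = poly ([:if \<mu> = 0 then 1 else 0:]) s"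
      by (simp add: lookup_single when_def lookup_one)
  qed (auto simp: One_nat_def)
next
  case (add \<nu> k)
  then obtain Q where Q: "\<And>\<mu> s. lookup (act (shear i j s) (single \<nu> (1 :: 'k))) \<mu> = poly (Q \<mu>) s"
    "\<And>\<mu>. coeff (Q \<mu>) 0 = (if \<mu> = \<nu> then 1 else 0)"
    "\<And>\<mu>. coeff (Q \<mu>) 1 = (if \<mu> + xvar i = \<nu> + xvar j then of_nat (lookup \<nu> i) else 0)" by auto
  define R where "R \<mu> = (if lookup \<mu> k > 0 then Q (\<mu> - xvar k) else 0) +
    (if k = i \<and> lookup \<mu> j > 0 then pCons 0 (Q (\<mu> - xvar j)) else 0)" for \<mu>
  have "lookup (act (shear i j s) (single (\<nu> + xvar k) 1)) \<mu> = poly (R \<mu>) s" for \<mu> s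
  proof -
    have "single (\<nu> + xvar k) (1 :: 'k) = single (xvar k) 1 * single \<nu> 1"
      by (simp add: mult_single add.commute)
    then have "act (shear i j s) (single (\<nu> + xvar k) 1) = lin_form_of (shear i j s) k * act (shear i j s) (single \<nu> 1)"
      by (simp only: act_mult act_var)
    then show ?thesis
      by (simp add: lin_form_of_shear[OF ij] R_def ring_distribs lookup_add lookup_single_xvar_mult Q)
  qed
  moreover have "coeff (R \<mu>) 0 = (if \<mu> = \<nu> + xvar k then 1 else 0)" for \<mu>
  proof (cases "lookup \<mu> k > 0")
    case True
    have "\<mu> - xvar k = \<nu> \<longleftrightarrow> \<mu> = \<nu> + xvar k" using xvar_dvd[OF True] by (metis add.commute add_diff_cancel_right')
    then show ?thesis using True by (simp add: R_def Q)
  next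
    case False
    then have "\<mu> \<noteq> \<nu> + xvar k" by (auto simp: lookup_add)
    then show ?thesis using False by (simp add: R_def)
  qed
  moreover have "coeff (R \<mu>) 1 = (if \<mu> + xvar i = \<nu> + xvar k + xvar j then of_nat (lookup (\<nu> + xvar k) i) else 0)" for \<mu>
  proof -
    have shift: "\<mu> - xvar k + xvar i = \<nu> + xvar j \<longleftrightarrow> \<mu> + xvar i = \<nu> + xvar k + xvar j" if "lookup \<mu> k > 0"
    proof -
      have "\<mu> + xvar i = (\<mu> - xvar k + xvar i) + xvar k"
        by (subst (1) xvar_dvd[OF that, symmetric]) (simp add: ac_simps)
      moreover have "\<nu> + xvar k + xvar j = (\<nu> + xvar j) + xvar k" by (simp add: ac_simps)
      ultimately show ?thesis by (metis add_right_cancel)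
    qed
    have shift': "\<mu> - xvar j = \<nu> \<longleftrightarrow> \<mu> = \<nu> + xvar j" if "lookup \<mu> j > 0"
      using xvar_dvd[OF that] by (metis add.commute add_diff_cancel_right')
    have c1: "coeff (pCons 0 q) 1 = coeff q 0" for q :: "'k poly" by (simp add: One_nat_def)
    show ?thesis
    proof (cases "k = i")
      case False
      have "\<mu> + xvar i \<noteq> \<nu> + xvar k + xvar j" if "lookup \<mu> k = 0"
      proof
        assume "\<mu> + xvar i = \<nu> + xvar k + xvar j"
        from arg_cong[OF this, of "\<lambda>x. lookup x k"] show False
          using that False by (simp add: lookup_add lookup_single when_def)
      qed
      then show ?thesis using False shift by (auto simp: R_def Q(3) lookup_add lookup_single when_def)
    next
      case True
      have cond: "\<mu> + xvar i = \<nu> + xvar k + xvar j \<longleftrightarrow> \<mu> = \<nu> + xvar j"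
      proof -
        have "\<nu> + xvar i + xvar j = (\<nu> + xvar j) + xvar i" by (simp only: ac_simps)
        then show ?thesis unfolding True by (simp only: add_right_cancel)
      qed
      show ?thesis
      proof (cases "\<mu> = \<nu> + xvar j")
        case mu: True
        have j: "lookup \<mu> j > 0" by (simp add: mu lookup_add)
        have "lookup \<nu> i = 0" if "lookup \<mu> i = 0" using that by (simp add: mu lookup_add)
        have a1: "coeff (if lookup \<mu> k > 0 then Q (\<mu> - xvar k) else 0) 1 = of_nat (lookup \<nu> i)"
          using mu True shift cond \<open>lookup \<mu> i = 0 \<Longrightarrow> lookup \<nu> i = 0\<close> by (cases "lookup \<mu> i = 0") (simp_all add: Q(3))
        have a2: "coeff (if k = i \<and> lookup \<mu> j > 0 then pCons 0 (Q (\<mu> - xvar j)) else 0) 1 = 1"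
          using True j by (simp only: c1 Q(2) if_True simp_thms) (simp add: mu)
        show ?thesis unfolding R_def coeff_add a1 a2 cond if_P[OF mu] by (simp add: True lookup_add)
      next
        case mu: False
        have "coeff (if lookup \<mu> k > 0 then Q (\<mu> - xvar k) else 0) 1 = 0"
          using mu True shift cond by (simp add: Q(3))
        moreover have "coeff (if k = i \<and> lookup \<mu> j > 0 then pCons 0 (Q (\<mu> - xvar j)) else 0) 1 = 0"
          using mu shift' by (simp add: c1 Q(2))
        ultimately show ?thesis using mu cond by (simp only: R_def coeff_add if_False) simp
      qed
    qed
  qed
  ultimately show ?case by (intro exI[of _ R] allI conjI)
qed

lemma act_shear:
  fixes f :: "('n::finite, 'k::field) mpoly"
  assumes ij: "i \<noteq> j"
  shows "\<exists>Q. \<forall>\<mu>. (\<forall>s. lookup (act (shear i j s) f) \<mu> = poly (Q \<mu>) s) \<and>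
    coeff (Q \<mu>) 0 = lookup f \<mu> \<and>
    coeff (Q \<mu>) 1 = (\<Sum>\<nu>\<in>keys f. if \<mu> + xvar i = \<nu> + xvar j then of_nat (lookup \<nu> i) * lookup f \<nu> else 0)"
proof -
  obtain Q where Q: "\<And>\<nu> \<mu> s. lookup (act (shear i j s) (single \<nu> (1 :: 'k))) \<mu> = poly (Q \<nu> \<mu>) s"
    "\<And>\<nu> \<mu>. coeff (Q \<nu> \<mu>) 0 = (if \<mu> = \<nu> then 1 else 0)"
    "\<And>\<nu> \<mu>. coeff (Q \<nu> \<mu>) 1 = (if \<mu> + xvar i = \<nu> + xvar j then of_nat (lookup \<nu> i) else 0)"
    using act_shear_monomial[OF ij, where 'k = 'k] by metis
  define R where "R \<mu> = (\<Sum>\<nu>\<in>keys f. smult (lookup f \<nu>) (Q \<nu> \<mu>))" for \<mu>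
  have "lookup (act (shear i j s) f) \<mu> = poly (R \<mu>) s" for \<mu> s
  proof -
    have "f = (\<Sum>\<nu>\<in>keys f. single 0 (lookup f \<nu>) * single \<nu> 1)"
      by (simp add: mult_single mpoly_expansion[symmetric])
    then have "act (shear i j s) f = (\<Sum>\<nu>\<in>keys f. single 0 (lookup f \<nu>) * act (shear i j s) (single \<nu> 1))"
      by (metis (no_types, lifting) act_const act_mult act_sum sum.cong)
    then show ?thesis by (simp add: lookup_sum Q R_def poly_sum)
  qed
  moreover have "coeff (R \<mu>) 0 = lookup f \<mu>" for \<mu>
  proof -
    have "coeff (R \<mu>) 0 = (\<Sum>\<nu>\<in>keys f. if \<mu> = \<nu> then lookup f \<nu> else 0)"
      unfolding R_def coeff_sum by (rule sum.cong) (auto simp: Q(2))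
    then show ?thesis by (simp add: in_keys_iff)
  qed
  moreover have "coeff (R \<mu>) 1 = (\<Sum>\<nu>\<in>keys f. if \<mu> + xvar i = \<nu> + xvar j then of_nat (lookup \<nu> i) * lookup f \<nu> else 0)" for \<mu>
    unfolding R_def coeff_sum by (rule sum.cong) (auto simp: Q(3))
  ultimately show ?thesis by (intro exI[of _ R]) auto
qed

lemma coeff_mult_1: "coeff (p * q) 1 = coeff p 0 * coeff q 1 + coeff p 1 * coeff q (0::nat)"
  by (simp add: coeff_mult One_nat_def)

text \<open>If \<open>e' = e x_j / x_i\<close> were not a leading monomial, a shear would show that
  generic coordinates allow more. Let \<open>P\<close> be the leading monomials of this degree from
  \<open>e'\<close> upwards. The sheared reduced element of \<open>e\<close> has at
  \<open>e'\<close> a coefficient with linear term \<open>s * lookup e i\<close>, while its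
  coefficients on \<open>P\<close> are of order two in \<open>s\<close>. So for some
  \<open>s\<close> the set \<open>insert e' P\<close> is independent for the sheared ideal, by
  genericity also for \<open>J\<close>, against the greedy count \<open>Ind_card_le\<close>.\<close>

theorem leads_strongly_stable:
  fixes I :: "('n::finite, 'k::field_char_0) mpoly set"
  assumes I: "pid.subspace I" "graded I" and g: "Dgen I D g" and r: "corder r"
    and e: "e \<in> leads r (act g ` I)" "mdegree e \<le> D" "lookup e i > 0"
    and ij: "i \<noteq> j" "(xvar i, xvar j) \<in> r"
  shows "e - xvar i + xvar j \<in> leads r (act g ` I)"
proof (rule ccontr)
  let ?J = "act g ` I"
  have inv: "invertible g" using g by (simp add: Dgen_def)
  have J: "pid.subspace ?J" "graded ?J" using I inv subspace_act graded_act by auto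
  define e' where "e' = e - xvar i + xvar j"
  assume "e - xvar i + xvar j \<notin> leads r ?J"
  then have e'N: "e' \<notin> leads r ?J" by (simp add: e'_def)
  have ee': "e' + xvar i = e + xvar j" unfolding e'_def by (rule xvar_swap[OF e(3)])
  have deg: "mdegree e' = mdegree e" using arg_cong[OF ee', of mdegree] by (simp add: mdegree_add)
  have "e' \<noteq> e" using e e'N by auto
  have le: "(e, e') \<in> r"
  proof -
    have "(e + xvar i, e + xvar j) \<in> r" using corder_add_left[OF r ij(2)] .
    then show ?thesis unfolding ee'[symmetric] by (rule corder_cancel[OF r])
  qed
  define P where "P = {\<nu> \<in> leads r ?J. mdegree \<nu> = mdegree e \<and> (e', \<nu>) \<in> r}"
  have finP: "finite P" unfolding P_def by (rule finite_subset[OF _ finite_monomials_eq[of "mdegree e"]]) auto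
  have eP: "e \<notin> P" using le corder_antisym[OF r, of e e'] \<open>e' \<noteq> e\<close> by (auto simp: P_def)
  have e'P: "e' \<notin> P" using e'N by (auto simp: P_def)
  obtain f where f: "f \<in> ?J" "lookup f e = 1" "\<And>\<mu>. \<mu> \<in> keys f \<Longrightarrow> (\<mu>, e) \<in> r"
    "\<And>\<mu>. \<mu> \<in> keys f \<Longrightarrow> \<mu> \<in> leads r ?J \<Longrightarrow> \<mu> = e"
    using reduced_element[OF J r e(1)] by auto
  have "Ind ?J P" by (rule Ind_leads[OF J r]) (auto simp: P_def)
  then have "\<forall>p\<in>P. \<exists>h. h \<in> ?J \<and> (\<forall>c\<in>P. lookup h c = (if c = p then 1 else 0))" unfolding Ind_def by blast
  from bchoice[OF this] obtain h where h: "\<And>p. p \<in> P \<Longrightarrow> h p \<in> ?J"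
    "\<And>p c. p \<in> P \<Longrightarrow> c \<in> P \<Longrightarrow> lookup (h p) c = (if c = p then 1 else 0)" by auto
  let ?V = "\<lambda>s. lookup ` act (shear i j s) ` ?J"
  have sJ: "pid.subspace (act (shear i j s) ` ?J)" for s
    by (rule subspace_act[OF J(1) invertible_shear[OF ij(1)]])
  have lookR: "(\<lambda>s. lookup (act (shear i j s) q) c) \<in> range poly" for q :: "('n, 'k) mpoly" and c
  proof -
    obtain Q where "\<And>s. lookup (act (shear i j s) q) c = poly (Q c) s" using act_shear[OF ij(1), of q] by auto
    then have "(\<lambda>s. lookup (act (shear i j s) q) c) = poly (Q c)" by auto
    then show ?thesis by simp
  qed
  \<comment> \<open>The family dual to \<open>P\<close> at \<open>s = 0\<close> is kept dual along
    the shear, up to the factor \<open>\<phi> s\<close>.\<close>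
  have "\<exists>\<phi>\<in>range poly. \<phi> 0 \<noteq> 0 \<and> (\<exists>H. \<forall>p\<in>P. (\<forall>c. (\<lambda>s. H p s c) \<in> range poly) \<and>
    (\<forall>s. H p s \<in> ?V s \<and> (\<forall>c\<in>P. H p s c = (if c = p then \<phi> s else 0))))"
  proof (rule elimination[where f = "\<lambda>p s. lookup (act (shear i j s) (h p))" and V = ?V])
    show "fring (range (poly :: 'k poly \<Rightarrow> _))" by (rule fring_poly)
    show "finite P" by (rule finP)
    show "(\<lambda>c. a * u c + b * v c) \<in> ?V x" if "u \<in> ?V x" "v \<in> ?V x" for x u v a b
      using lincomb_lookup_image[OF sJ that] .
  qed (use lookR h in \<open>auto simp: shear_0\<close>)
  then obtain \<phi> H where \<phi>: "\<phi> \<in> range poly" "\<phi> 0 \<noteq> 0"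
    and HH: "\<forall>p\<in>P. (\<forall>c. (\<lambda>s. H p s c) \<in> range poly) \<and>
    (\<forall>s. H p s \<in> ?V s \<and> (\<forall>c\<in>P. H p s c = (if c = p then \<phi> s else 0)))"
    by (elim bexE conjE exE)
  obtain \<Phi> where \<Phi>: "\<And>s. \<phi> s = poly \<Phi> s" using \<phi>(1) by auto
  have H: "\<And>p s. p \<in> P \<Longrightarrow> H p s \<in> ?V s"
    "\<And>p s c. p \<in> P \<Longrightarrow> c \<in> P \<Longrightarrow> H p s c = (if c = p then \<phi> s else 0)" using HH by simp_all
  have "\<forall>p\<in>P. \<exists>G. \<forall>s. H p s e' = poly G s"
  proof
    fix p assume "p \<in> P"
    then have "(\<lambda>s. H p s e') \<in> range poly" using HH by blast
    then obtain G where "(\<lambda>s. H p s e') = poly G" by auto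
    then show "\<exists>G. \<forall>s. H p s e' = poly G s" by (metis)
  qed
  from bchoice[OF this] obtain G where G: "\<And>p s. p \<in> P \<Longrightarrow> H p s e' = poly (G p) s" by auto
  obtain Q where Q: "\<And>\<mu> s. lookup (act (shear i j s) f) \<mu> = poly (Q \<mu>) s" "\<And>\<mu>. coeff (Q \<mu>) 0 = lookup f \<mu>"
    "\<And>\<mu>. coeff (Q \<mu>) 1 = (\<Sum>\<nu>\<in>keys f. if \<mu> + xvar i = \<nu> + xvar j then of_nat (lookup \<nu> i) * lookup f \<nu> else 0)"
    using act_shear[OF ij(1), of f] by auto
  \<comment> \<open>A term \<open>\<nu>\<close> of \<open>f\<close> contributing to \<open>p\<close>
    at first order satisfies \<open>p = \<nu> x_j / x_i\<close>. Since \<open>\<nu>\<close> is at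
    most \<open>e\<close>, this puts \<open>p\<close> at or below \<open>e'\<close>, whereas
    elements of \<open>P\<close> lie strictly above it.\<close>
  have Qp: "coeff (Q p) 0 = 0" "coeff (Q p) 1 = 0" if p: "p \<in> P" for p
  proof -
    have "p \<notin> keys f" using f(4)[of p] p eP by (auto simp: P_def)
    then show "coeff (Q p) 0 = 0" by (simp add: Q in_keys_iff)
    have "p + xvar i \<noteq> \<nu> + xvar j" if \<nu>: "\<nu> \<in> keys f" for \<nu>
    proof
      assume eq: "p + xvar i = \<nu> + xvar j"
      have "(\<nu> + xvar j, e + xvar j) \<in> r" using corder_add[OF r f(3)[OF \<nu>]] .
      then have "(p + xvar i, e' + xvar i) \<in> r" unfolding eq ee' .
      then have "(p, e') \<in> r" by (rule corder_cancel[OF r])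
      then show False using p e'P corder_antisym[OF r, of p e'] by (auto simp: P_def)
    qed
    then show "coeff (Q p) 1 = 0" unfolding Q by (intro sum.neutral) auto
  qed
  have "e' \<notin> keys f" using f(3)[of e'] le corder_antisym[OF r, of e e'] \<open>e' \<noteq> e\<close> by auto
  then have Qe0: "coeff (Q e') 0 = 0" by (simp add: Q in_keys_iff)
  have "coeff (Q e') 1 = (\<Sum>\<nu>\<in>keys f. if \<nu> = e then of_nat (lookup e i) * lookup f e else 0)"
    unfolding Q(3) by (rule sum.cong) (auto simp: ee')
  then have Qe1: "coeff (Q e') 1 = of_nat (lookup e i)" using f(2) by (simp add: in_keys_iff)
  \<comment> \<open>The coefficient at \<open>e'\<close> after clearing \<open>P\<close> from the
    sheared \<open>f\<close>. Its linear coefficient is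
    \<open>coeff \<Phi> 0 * of_nat (lookup e i)\<close>, which is nonzero in characteristic
    0.\<close>
  define \<Psi> where "\<Psi> = \<Phi> * Q e' - (\<Sum>p\<in>P. Q p * G p)"
  have "coeff \<Psi> 1 = coeff \<Phi> 0 * of_nat (lookup e i)"
    by (simp add: \<Psi>_def coeff_mult_1 coeff_sum Qp Qe0 Qe1)
  moreover have "coeff \<Phi> 0 \<noteq> 0" using \<phi>(2) by (simp add: \<Phi> poly_0_coeff_0)
  ultimately have "\<Psi> \<noteq> 0" "\<Phi> \<noteq> 0" using e(3) by auto
  then have "\<Psi> * \<Phi> \<noteq> 0" by simp
  then have "finite {s. poly (\<Psi> * \<Phi>) s = 0}" by (rule poly_roots_finite)
  then obtain s where "poly (\<Psi> * \<Phi>) s \<noteq> 0"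
    using ex_new_if_finite[OF infinite_UNIV_char_0] by blast
  then have s: "poly \<Psi> s \<noteq> 0" "\<phi> s \<noteq> 0" by (auto simp: \<Phi>)
  let ?K = "act (shear i j s) ` ?J"
  have "\<forall>p\<in>P. \<exists>q. q \<in> ?K \<and> H p s = lookup q" using H(1)[of _ s] by blast
  from bchoice[OF this] obtain q where q: "\<And>p. p \<in> P \<Longrightarrow> q p \<in> ?K" "\<And>p. p \<in> P \<Longrightarrow> H p s = lookup (q p)" by auto
  have IndP: "Ind ?K P"
  proof (rule Ind_scaled[OF sJ s(2)])
    fix p assume p: "p \<in> P"
    have "\<forall>c\<in>P. lookup (q p) c = (if c = p then \<phi> s else 0)"
      using H(2)[OF p, of _ s] q(2)[OF p] by simp
    then show "\<exists>f\<in>?K. \<forall>c\<in>P. lookup f c = (if c = p then \<phi> s else 0)" using q(1)[OF p] by blast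
  qed
  define k where "k = single 0 (\<phi> s) * act (shear i j s) f - (\<Sum>p\<in>P. single 0 (lookup (act (shear i j s) f) p) * q p)"
  have kK: "k \<in> ?K"
    unfolding k_def by (intro pid.subspace_diff pid.subspace_scale pid.subspace_sum sJ imageI f(1) q(1))
  have lk: "lookup k c = \<phi> s * lookup (act (shear i j s) f) c - (\<Sum>p\<in>P. lookup (act (shear i j s) f) p * H p s c)" for c
  proof -
    have "(\<Sum>p\<in>P. lookup (act (shear i j s) f) p * lookup (q p) c) = (\<Sum>p\<in>P. lookup (act (shear i j s) f) p * H p s c)"
      by (rule sum.cong) (simp_all add: q(2))
    then show ?thesis by (simp add: k_def lookup_minus lookup_sum)
  qed
  have kP: "lookup k c = 0" if c: "c \<in> P" for c
  proof -
    have "(\<Sum>p\<in>P. lookup (act (shear i j s) f) p * H p s c) = (\<Sum>p\<in>P. if p = c then \<phi> s * lookup (act (shear i j s) f) c else 0)"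
      by (rule sum.cong) (auto simp: H(2)[OF _ c])
    then show ?thesis using c finP by (simp add: lk)
  qed
  have "lookup k e' = poly \<Psi> s"
    by (simp add: lk Q(1) \<Phi> G \<Psi>_def poly_sum)
  then have "Ind ?K (insert e' P)"
    using s by (intro Ind_insert[OF sJ IndP kK kP]) auto
  \<comment> \<open>The sheared ideal is \<open>h(I)\<close> for the invertible matrix
    \<open>h = shear i j s ** g\<close>, so \<open>Dgen\<close> brings the independence back to
    \<open>g\<close>.\<close>
  then have "Ind (act (shear i j s ** g) ` I) (insert e' P)" unfolding act_act_image .
  moreover have "invertible (shear i j s ** g)" by (intro invertible_mult invertible_shear ij inv)
  moreover have sub: "insert e' P \<subseteq> {\<nu>. mdegree \<nu> \<le> D}" using e(2) deg by (auto simp: P_def)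
  ultimately have Ind: "Ind ?J (insert e' P)" using g unfolding Dgen_def by blast
  have "card (insert e' P) \<le> card {\<nu> \<in> leads r ?J. mdegree \<nu> = mdegree e \<and> (e', \<nu>) \<in> r}"
    by (rule Ind_card_le[OF J r _ Ind]) (use corder_trans[OF r, of e'] corder_refl[OF r] deg in \<open>auto simp: P_def\<close>)
  then show False using e'P finP unfolding P_def[symmetric] by simp
qed



section \<open>Depth\<close>

lemma hcomp_mult_homogeneous:
  assumes l: "\<And>\<mu>. \<mu> \<in> keys l \<Longrightarrow> mdegree \<mu> = e"
  shows "hcomp (e + d) (l * b) = l * hcomp d (b :: ('n::finite, 'k::field) mpoly)"
proof (rule poly_mapping_eqI)
  fix \<mu>
  let ?b = "restrict_terms (\<lambda>\<nu>. mdegree \<nu> \<noteq> d) b"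
  have "b = hcomp d b + ?b"
    by (rule poly_mapping_eqI) (simp add: lookup_restrict_terms lookup_add)
  then have "l * b = l * hcomp d b + l * ?b" by (metis distrib_left)
  then have eq: "lookup (l * b) \<mu> = lookup (l * hcomp d b) \<mu> + lookup (l * ?b) \<mu>" by (metis lookup_add)
  have 1: "mdegree \<mu> = e + d" if k: "\<mu> \<in> keys (l * hcomp d b)"
  proof -
    from subsetD[OF keys_mult k] obtain x y where "\<mu> = x + y" "x \<in> keys l" "y \<in> keys (hcomp d b)" by auto
    then show ?thesis using l by (auto simp: keys_restrict_terms mdegree_add)
  qed
  have 2: "mdegree \<mu> \<noteq> e + d" if k: "\<mu> \<in> keys (l * ?b)"
  proof -
    from subsetD[OF keys_mult k] obtain x y where "\<mu> = x + y" "x \<in> keys l" "y \<in> keys ?b" by auto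
    then show ?thesis using l by (auto simp: keys_restrict_terms mdegree_add)
  qed
  show "lookup (hcomp (e + d) (l * b)) \<mu> = lookup (l * hcomp d b) \<mu>"
    using 1 2 eq by (auto simp: lookup_restrict_terms in_keys_iff)
qed

lemma hcomp_mult_homogeneous_lt:
  assumes l: "\<And>\<mu>. \<mu> \<in> keys l \<Longrightarrow> mdegree \<mu> = e" and "d < e"
  shows "hcomp d (l * b) = (0 :: ('n::finite, 'k::field) mpoly)"
proof (rule poly_mapping_eqI)
  fix \<mu>
  have "mdegree \<mu> \<noteq> d" if k: "\<mu> \<in> keys (l * b)"
  proof -
    from subsetD[OF keys_mult k] obtain x y where "\<mu> = x + y" "x \<in> keys l" by auto
    then show ?thesis using l \<open>d < e\<close> by (auto simp: mdegree_add)
  qed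
  then show "lookup (hcomp d (l * b)) \<mu> = lookup 0 \<mu>"
    by (auto simp: lookup_restrict_terms in_keys_iff)
qed

lemma hcomp_add: "hcomp d (f + g) = hcomp d f + hcomp d g"
  by (rule restrict_terms_add)

lemma hcomp_0 [simp]: "hcomp d 0 = 0"
  by (simp add: restrict_terms_def)

lemma graded_span:
  fixes S :: "('n::finite, 'k::field) mpoly set"
  assumes S: "\<And>x d. x \<in> S \<Longrightarrow> hcomp d x \<in> pid.span S"
  shows "graded (pid.span S)"
  unfolding graded_def
proof safe
  fix f d assume "f \<in> pid.span S"
  then show "hcomp d f \<in> pid.span S"
  proof (induction rule: pid.span_induct_alt)
    case base
    show ?case using pid.span_zero by simp
  next
    case (step c x y)
    have "hcomp d (c * x) \<in> pid.span S"
    proof (induction c rule: mpoly_induct)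
      case (single \<nu> a)
      have k: "mdegree \<mu> = mdegree \<nu>" if "\<mu> \<in> keys (single \<nu> a)" for \<mu>
        using that by (auto split: if_splits)
      show ?case
      proof (cases "mdegree \<nu> \<le> d")
        case True
        have "hcomp (mdegree \<nu> + (d - mdegree \<nu>)) (single \<nu> a * x) = single \<nu> a * hcomp (d - mdegree \<nu>) x"
          by (rule hcomp_mult_homogeneous[OF k])
        then show ?thesis using True S[OF step(1)] by (simp add: pid.span_scale)
      next
        case False
        then have "hcomp d (single \<nu> a * x) = 0" by (intro hcomp_mult_homogeneous_lt[OF k]) auto
        then show ?thesis using pid.span_zero by simp
      qed
    next
      case (add f g)
      then show ?case by (simp add: ring_distribs hcomp_add pid.span_add)
    qed
    then show ?case using step(2) by (simp add: hcomp_add pid.span_add)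
  qed
qed

lemma linear_form_hcomp: "linear_form l \<Longrightarrow> hcomp d l = (if d = 1 then l else 0)"
  by (rule poly_mapping_eqI) (auto simp: linear_form_def lookup_restrict_terms in_keys_iff)

lemma graded_span_linear:
  fixes M :: "('n::finite, 'k::field) mpoly set"
  assumes "graded M" "\<And>l. l \<in> L \<Longrightarrow> linear_form l"
  shows "graded (pid.span (M \<union> L))"
proof (rule graded_span)
  fix x d assume "x \<in> M \<union> L"
  then show "hcomp d x \<in> pid.span (M \<union> L)"
  proof
    assume "x \<in> M"
    then show ?thesis using graded_hcomp[OF assms(1)] by (intro pid.span_base) auto
  next
    assume "x \<in> L"
    then show ?thesis using linear_form_hcomp[OF assms(2)] pid.span_zero by (auto intro: pid.span_base)
  qed
qed

section \<open>Regular sequences of linear forms\<close>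

definition regseq :: "('n::finite, 'k::field) mpoly set \<Rightarrow> ('n, 'k) mpoly list \<Rightarrow> bool" where
  "regseq J ls \<longleftrightarrow> (\<forall>i<length ls. \<forall>a. ls ! i * a \<in> pid.span (J \<union> set (take i ls)) \<longrightarrow> a \<in> pid.span (J \<union> set (take i ls))) \<and>
     pid.span (J \<union> set ls) \<noteq> UNIV"

lemma linear_form_combination:
  fixes l :: "('n::finite, 'k::field) mpoly"
  assumes "linear_form l" "\<And>j. j \<in> A \<Longrightarrow> linear_form (h j)"
  shows "linear_form (l + (\<Sum>j\<in>A. single 0 (c j) * h j))"
  unfolding linear_form_def
proof
  fix \<nu> assume "\<nu> \<in> keys (l + (\<Sum>j\<in>A. single 0 (c j) * h j))"
  from subsetD[OF keys_add this] have "\<nu> \<in> keys l \<or> \<nu> \<in> keys (\<Sum>j\<in>A. single 0 (c j) * h j)" by simp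
  then show "mdegree \<nu> = 1"
  proof
    assume "\<nu> \<in> keys (\<Sum>j\<in>A. single 0 (c j) * h j)"
    from subsetD[OF keys_sum this] obtain j where j: "j \<in> A" "\<nu> \<in> keys (single 0 (c j) * h j)" by (elim UN_E)
    then have "\<nu> \<in> keys (h j)" using subsetD[OF keys_const_mult] by blast
    then show ?thesis using assms(2)[OF j(1)] by (simp add: linear_form_def)
  qed (use assms(1) in \<open>simp add: linear_form_def\<close>)
qed

lemma cancel_aux: "v * a - v * (a - l * b) = l * (v * (b :: 'a::comm_ring_1))"
  by (simp add: algebra_simps)

text \<open>With \<open>A j\<close> generated by \<open>M\<close> and the first \<open>j\<close>
  forms, \<open>v\<close> agrees with \<open>ls ! i\<close> modulo \<open>A i\<close> and so is a
  nonzerodivisor there. The property descends from \<open>A (Suc j)\<close> to \<open>A j\<close>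
  because \<open>ls ! j\<close> is a nonzerodivisor modulo \<open>A j\<close>; this is the graded
  argument by which members of a regular sequence can be exchanged.\<close>

lemma regular_combination:
  fixes M :: "('n::finite, 'k::field) mpoly set"
  assumes M: "pid.subspace M" "graded M" and ls: "\<And>l. l \<in> set ls \<Longrightarrow> linear_form l" and reg: "regseq M ls"
    and i: "i < length ls" and v: "v = ls ! i + (\<Sum>j<i. single 0 (c j) * ls ! j)"
  shows "v * a \<in> M \<Longrightarrow> a \<in> M"
proof -
  define A where "A j = pid.span (M \<union> set (take j ls))" for j
  have A0: "A 0 = M" unfolding A_def using pid.span_eq_iff[THEN iffD2, OF M(1)] by simp
  have sA: "pid.subspace (A j)" for j unfolding A_def by (rule pid.subspace_span)
  have gA: "graded (A j)" for j unfolding A_def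
    by (rule graded_span_linear[OF M(2)]) (use ls set_take_subset in fast)
  have lin: "linear_form (ls ! j)" if "j < length ls" for j using ls that by simp
  have linv: "linear_form v" unfolding v by (rule linear_form_combination) (use lin i in auto)
  have regA: "a \<in> A j" if "ls ! j * a \<in> A j" "j < length ls" for j a
    using reg that unfolding regseq_def A_def by blast
  have ASuc: "f \<in> A (Suc j) \<longleftrightarrow> (\<exists>k. f - k * ls ! j \<in> A j)" if "j < length ls" for f j
    unfolding A_def take_Suc_conv_app_nth[OF that] by (simp add: pid.span_breakdown_eq)
  have Amono: "A j \<subseteq> A (Suc j)" if "j < length ls" for j
    unfolding A_def take_Suc_conv_app_nth[OF that] by (intro pid.span_mono) auto
  have "\<forall>a. v * a \<in> A j \<longrightarrow> a \<in> A j" if "j \<le> i" for j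
    using that
  proof (induction rule: inc_induct)
    case base
    show ?case
    proof (intro allI impI)
      fix a assume a: "v * a \<in> A i"
      have "(\<Sum>j<i. single 0 (c j) * ls ! j) \<in> A i"
        by (intro pid.subspace_sum pid.subspace_scale sA)
          (use i in \<open>auto simp: A_def in_set_conv_nth intro!: pid.span_base\<close>)
      from pid.subspace_scale[OF sA this, of a] have "a * (\<Sum>j<i. single 0 (c j) * ls ! j) \<in> A i" .
      from pid.subspace_diff[OF sA a this] have "ls ! i * a \<in> A i" unfolding v by (simp add: ring_distribs mult.commute)
      then show "a \<in> A i" using regA i by blast
    qed
  next
    case (step j)
    then have j: "j < length ls" using i by simp
    \<comment> \<open>Descent on the degree: if \<open>v * a\<close> is in \<open>A j\<close>, then
      modulo \<open>A j\<close> the element \<open>a\<close> is \<open>ls ! j * b\<close> with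
      \<open>b\<close> of smaller degree, and again \<open>v * b\<close> is in
      \<open>A j\<close>.\<close>
    have hom: "(\<forall>\<mu>\<in>keys a. mdegree \<mu> = d) \<longrightarrow> v * a \<in> A j \<longrightarrow> a \<in> A j" for d a
    proof (induction d arbitrary: a rule: less_induct)
      case (less d)
      show ?case
      proof (intro impI)
        assume a: "\<forall>\<mu>\<in>keys a. mdegree \<mu> = d" "v * a \<in> A j"
        then have "a \<in> A (Suc j)" using step.IH Amono[OF j] by blast
        then obtain k where k: "a - k * ls ! j \<in> A j" using ASuc[OF j] by blast
        have ha: "hcomp d a = a"
          by (rule poly_mapping_eqI) (use a(1) in \<open>auto simp: lookup_restrict_terms in_keys_iff\<close>)
        have hd: "hcomp d (a - k * ls ! j) \<in> A j" by (rule graded_hcomp[OF gA k])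
        have ldeg: "\<mu> \<in> keys (ls ! j) \<Longrightarrow> mdegree \<mu> = 1" for \<mu> using lin[OF j] by (simp add: linear_form_def)
        show "a \<in> A j"
        proof (cases d)
          case 0
          have "hcomp 0 (ls ! j * k) = 0" by (rule hcomp_mult_homogeneous_lt[OF ldeg]) auto
          then show ?thesis using hd ha 0 by (simp add: restrict_terms_minus mult.commute)
        next
          case (Suc d')
          define b where "b = hcomp d' k"
          have "hcomp (Suc d') (ls ! j * k) = ls ! j * b"
            unfolding b_def using hcomp_mult_homogeneous[where l = "ls ! j" and e = 1 and d = d' and b = k, OF ldeg] by (simp only: plus_1_eq_Suc)
          then have ab: "a - ls ! j * b \<in> A j" using hd ha Suc by (simp add: restrict_terms_minus mult.commute)
          have "v * (a - ls ! j * b) \<in> A j" by (rule pid.subspace_scale[OF sA ab])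
          from pid.subspace_diff[OF sA a(2) this] have "ls ! j * (v * b) \<in> A j"
            unfolding cancel_aux .
          then have "v * b \<in> A j" using regA j by blast
          moreover have "\<forall>\<mu>\<in>keys b. mdegree \<mu> = d'" by (auto simp: b_def keys_restrict_terms)
          ultimately have "b \<in> A j" using less.IH[of d' b] Suc by blast
          then have "ls ! j * b \<in> A j" by (rule pid.subspace_scale[OF sA])
          from pid.subspace_add[OF sA ab this] show ?thesis by simp
        qed
      qed
    qed
    show ?case
    proof (intro allI impI)
      fix a assume a: "v * a \<in> A j"
      show "a \<in> A j"
      proof (rule mem_if_hcomps[OF sA])
        fix d
        have "hcomp (1 + d) (v * a) \<in> A j" by (rule graded_hcomp[OF gA a])
        also have "hcomp (1 + d) (v * a) = v * hcomp d a"
          by (rule hcomp_mult_homogeneous) (use linv in \<open>simp add: linear_form_def\<close>)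
        finally show "hcomp d a \<in> A j" using hom[of "hcomp d a" d] by (simp add: keys_restrict_terms)
      qed
    qed
  qed
  from this[of 0] show "v * a \<in> M \<Longrightarrow> a \<in> M" unfolding A0 by simp
qed

lemma mdegree_1_xvar: "mdegree \<nu> = 1 \<Longrightarrow> \<exists>i. \<nu> = xvar i"
proof -
  assume d: "mdegree \<nu> = 1"
  then have "\<nu> \<noteq> 0" by auto
  then obtain i where i: "lookup \<nu> i > 0" unfolding mono_degree_induct_add[symmetric] by (elim exE)
  then have "mle (xvar i) \<nu>" by (auto simp: mle_def lookup_single when_def)
  from mle_mdegree_eq[OF this] d show ?thesis by auto
qed

lemma xvar_inject: "xvar i = xvar j \<Longrightarrow> i = j"
proof -
  assume "xvar i = xvar j"
  from arg_cong[OF this, of keys] show "i = j" by simp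
qed

lemma xvar_neq_0 [simp]: "xvar i \<noteq> (0 :: 'n::finite monomial)"
  using mdegree_single[of i 1] by (metis mdegree_0 zero_neq_one)

lemma linear_form_expand:
  fixes l :: "('n::finite, 'k::field) mpoly"
  assumes "linear_form l"
  shows "l = (\<Sum>i\<in>UNIV. single (xvar i) (lookup l (xvar i)))"
proof -
  have "l = (\<Sum>\<nu>\<in>range xvar. single \<nu> (lookup l \<nu>))"
    by (rule mpoly_expansion_superset) (use assms in \<open>auto simp: linear_form_def dest!: mdegree_1_xvar\<close>)
  also have "\<dots> = (\<Sum>i\<in>UNIV. single (xvar i) (lookup l (xvar i)))"
    by (subst sum.reindex) (auto intro!: inj_onI dest: xvar_inject)
  finally show ?thesis .
qed

text \<open>\<open>w\<close> is annihilated modulo \<open>M\<close> by all variables of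
  \<open>B\<close>. In a sequence longer than the number of other variables, some combination of the
  forms involves only variables of \<open>B\<close>; it annihilates \<open>w\<close>, against
  \<open>regular_combination\<close>.\<close>

lemma regseq_length_le:
  fixes M :: "('n::finite, 'k::field) mpoly set"
  assumes M: "pid.subspace M" "graded M" and ls: "\<And>l. l \<in> set ls \<Longrightarrow> linear_form l" and reg: "regseq M ls"
    and w: "w \<notin> M" "\<And>i. i \<in> B \<Longrightarrow> single (xvar i) 1 * w \<in> M"
  shows "length ls \<le> card (- B)"
proof (rule ccontr)
  assume "\<not> ?thesis"
  then have "card (- B) < card {..<length ls}" by simp
  from homogeneous_system[OF _ _ this, of "\<lambda>i k. lookup (ls ! k) (xvar i)"]
  obtain c where c: "\<exists>k\<in>{..<length ls}. c k \<noteq> 0"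
    "\<forall>i\<in>- B. (\<Sum>k<length ls. lookup (ls ! k) (xvar i) * c k) = 0" by auto
  define S where "S = {k. k < length ls \<and> c k \<noteq> 0}"
  have S: "finite S" "S \<noteq> {}" using c(1) by (auto simp: S_def)
  define i where "i = Max S"
  have i: "i < length ls" "c i \<noteq> 0" using Max_in[OF S] by (auto simp: i_def S_def)
  have above: "c k = 0" if "i < k" "k < length ls" for k
  proof (rule ccontr)
    assume "c k \<noteq> 0"
    then have "k \<in> S" using that by (simp add: S_def)
    from Max_ge[OF S(1) this] show False using that by (simp add: i_def)
  qed
  \<comment> \<open>Normalised so that the last form with nonzero coefficient has coefficient 1, the
    shape expected by \<open>regular_combination\<close>.\<close>
  define v where "v = ls ! i + (\<Sum>j<i. single 0 (c j / c i) * ls ! j)"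
  have linv: "linear_form v" unfolding v_def by (rule linear_form_combination) (use ls i in auto)
  have "lookup v (xvar m) = 0" if m: "m \<notin> B" for m
  proof -
    have "0 = (\<Sum>k<length ls. lookup (ls ! k) (xvar m) * c k)" using c(2) m by simp
    also have "\<dots> = (\<Sum>k<Suc i. lookup (ls ! k) (xvar m) * c k)"
      by (rule sum.mono_neutral_right) (use i above in auto)
    also have "\<dots> = c i * lookup v (xvar m)"
    proof -
      have "lookup v (xvar m) = lookup (ls ! i) (xvar m) + (\<Sum>k<i. c k / c i * lookup (ls ! k) (xvar m))"
        by (simp add: v_def lookup_add lookup_sum)
      then have "c i * lookup v (xvar m) = c i * lookup (ls ! i) (xvar m) + (\<Sum>k<i. c i * (c k / c i * lookup (ls ! k) (xvar m)))"
        by (simp only: distrib_left sum_distrib_left)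
      also have "(\<Sum>k<i. c i * (c k / c i * lookup (ls ! k) (xvar m))) = (\<Sum>k<i. lookup (ls ! k) (xvar m) * c k)"
        by (rule sum.cong) (use i(2) in auto)
      finally show ?thesis by (simp add: mult.commute)
    qed
    finally show ?thesis using i(2) by simp
  qed
  then have lv: "v = (\<Sum>m\<in>B. single 0 (lookup v (xvar m)) * single (xvar m) 1)"
    by (subst linear_form_expand[OF linv]) (auto simp: mult_single intro: sum.mono_neutral_right)
  have "(\<Sum>m\<in>B. single 0 (lookup v (xvar m)) * (single (xvar m) 1 * w)) \<in> M"
    by (intro pid.subspace_sum pid.subspace_scale M w(2))
  moreover have "v * w = (\<Sum>m\<in>B. single 0 (lookup v (xvar m)) * single (xvar m) 1) * w"
    using arg_cong[OF lv, of "\<lambda>u. u * w"] .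
  ultimately have vw: "v * w \<in> M" by (simp only: sum_distrib_right mult.assoc)
  have "w \<in> M" by (rule regular_combination[OF M _ reg i(1) v_def vw]) (rule ls)
  then show False using w(1) by simp
qed

lemma var_mpoly_inject: "single (xvar i) (1 :: 'k::field) = single (xvar j) 1 \<Longrightarrow> i = j"
proof -
  assume "single (xvar i) (1 :: 'k) = single (xvar j) 1"
  from arg_cong[OF this, of keys] have "xvar i = xvar j" by simp
  then show "i = j" by (rule xvar_inject)
qed

text \<open>Multiplication by these variables keeps normal forms normal, so a relation modulo
  \<open>J\<close> between normal forms holds exactly. What remains is divisibility of monomials by
  distinct variables.\<close>

lemma vars_regular:
  fixes J :: "('n::finite, 'k::field) mpoly set"
  assumes J: "pid.subspace J" "graded J" and r: "corder r" and "J \<noteq> UNIV"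
    and T: "\<And>\<nu> i. i \<in> set is \<Longrightarrow> \<nu> + xvar i \<in> leads r J \<Longrightarrow> \<nu> \<in> leads r J" and dist: "distinct is"
  shows "regseq J (map (\<lambda>i. single (xvar i) 1) is)"
proof -
  let ?N = "leads r J"
  let ?x = "\<lambda>i. single (xvar i) (1 :: 'k)"
  have 1: "1 \<notin> J"
  proof
    assume "1 \<in> J"
    then have "f \<in> J" for f using pid.subspace_scale[OF J(1), of 1 f] by simp
    then show False using \<open>J \<noteq> UNIV\<close> by blast
  qed
  have shift: "keys (?x i * h) \<inter> ?N = {}" if "i \<in> set is" "keys h \<inter> ?N = {}" for i h
  proof (rule ccontr)
    assume "keys (?x i * h) \<inter> ?N \<noteq> {}"
    then obtain \<mu> where \<mu>: "\<mu> \<in> keys (?x i * h)" "\<mu> \<in> ?N" by auto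
    from subsetD[OF keys_single_mult \<mu>(1)] obtain \<kappa> where "\<mu> = xvar i + \<kappa>" "\<kappa> \<in> keys h" by auto
    then show False using T[of i \<kappa>] \<mu>(2) that by (auto simp: add.commute)
  qed
  have main: "a \<in> pid.span (J \<union> ?x ` T')" if a: "?x i * a \<in> pid.span (J \<union> ?x ` T')"
    and i: "i \<in> set is" "i \<notin> T'" "T' \<subseteq> set is" for a i T'
  proof -
    have finT': "finite T'" using i(3) finite_subset by blast
    from a have "?x i * a \<in> {x + y |x y. x \<in> pid.span J \<and> y \<in> pid.span (?x ` T')}"
      unfolding pid.span_Un .
    then obtain p q where pq: "?x i * a = p + q" "p \<in> pid.span J" "q \<in> pid.span (?x ` T')" by auto
    have pJ: "p \<in> J" using pq(2) J(1) by (simp add: pid.span_eq_iff[THEN iffD2])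
    have "q \<in> range (\<lambda>u. \<Sum>v\<in>?x ` T'. u v * v)" using pq(3) finT' by (simp add: pid.span_finite)
    then obtain u where "q = (\<Sum>v\<in>?x ` T'. u v * v)" by auto
    also have "\<dots> = (\<Sum>k\<in>T'. u (?x k) * ?x k)"
      by (rule sum.reindex_cong[of ?x]) (auto intro!: inj_onI dest: var_mpoly_inject)
    finally have q: "q = (\<Sum>k\<in>T'. u (?x k) * ?x k)" .
    obtain a' where a': "a - a' \<in> J" "keys a' \<inter> ?N = {}" by (rule normal_form[OF J r])
    have "\<forall>k. \<exists>h. u (?x k) - h \<in> J \<and> keys h \<inter> ?N = {}" using normal_form[OF J r] by metis
    then obtain h where h: "\<And>k. u (?x k) - h k \<in> J" "\<And>k. keys (h k) \<inter> ?N = {}" by metis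
    \<comment> \<open>A relation among normal forms: \<open>z\<close> lies in \<open>J\<close> and
      has no leading monomial of \<open>J\<close> in its support, so it is 0.\<close>
    define z where "z = ?x i * a' - (\<Sum>k\<in>T'. ?x k * h k)"
    have "z = p - ?x i * (a - a') + (\<Sum>k\<in>T'. ?x k * (u (?x k) - h k))"
    proof -
      have "(\<Sum>k\<in>T'. ?x k * (u (?x k) - h k)) = q - (\<Sum>k\<in>T'. ?x k * h k)"
        by (simp add: q right_diff_distrib sum_subtractf mult.commute)
      then show ?thesis using pq(1) by (simp add: z_def algebra_simps)
    qed
    also have "\<dots> \<in> J"
      by (intro pid.subspace_add pid.subspace_diff pid.subspace_sum pid.subspace_scale J pJ a' h)
    finally have zJ: "z \<in> J" .
    have "keys z \<inter> ?N = {}"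
    proof -
      have "lookup (?x i * a') \<mu> = 0" if "\<mu> \<in> ?N" for \<mu>
        using shift[OF i(1) a'(2)] that by (auto simp: in_keys_iff)
      moreover have "lookup (?x k * h k) \<mu> = 0" if "\<mu> \<in> ?N" "k \<in> T'" for \<mu> k
      proof -
        have "k \<in> set is" using that i(3) by auto
        from shift[OF this h(2), of k] that(1) have "\<mu> \<notin> keys (?x k * h k)" by auto
        then show ?thesis by (simp add: in_keys_iff)
      qed
      ultimately have "lookup z \<mu> = 0" if "\<mu> \<in> ?N" for \<mu>
        using that by (simp add: z_def lookup_minus lookup_sum)
      then show ?thesis by (auto simp: in_keys_iff)
    qed
    then have "z = 0" by (rule zero_if_no_leads[OF r zJ])
    then have eq: "?x i * a' = (\<Sum>k\<in>T'. ?x k * h k)" by (simp add: z_def)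
    have "single \<nu> (lookup a' \<nu>) \<in> pid.span (?x ` T')" if \<nu>: "\<nu> \<in> keys a'" for \<nu>
    proof -
      have "lookup (?x i * a') (xvar i + \<nu>) \<noteq> 0" using \<nu> by (simp add: in_keys_iff)
      then have "\<exists>k\<in>T'. lookup (?x k * h k) (xvar i + \<nu>) \<noteq> 0"
        unfolding eq lookup_sum using sum.not_neutral_contains_not_neutral by blast
      then obtain k where k: "k \<in> T'" "xvar i + \<nu> \<in> keys (?x k * h k)" by (auto simp: in_keys_iff)
      from subsetD[OF keys_single_mult k(2)] obtain \<kappa> where "xvar i + \<nu> = xvar k + \<kappa>" by auto
      from arg_cong[OF this, of "\<lambda>m. lookup m k"] have "lookup \<nu> k > 0"
        using k(1) i(2) by (auto simp: lookup_add lookup_single when_def split: if_splits)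
      from xvar_dvd[OF this] have "single \<nu> (lookup a' \<nu>) = single (\<nu> - xvar k) (lookup a' \<nu>) * ?x k"
        by (simp add: mult_single add.commute)
      then show ?thesis using k(1) by (simp add: pid.span_scale pid.span_base)
    qed
    then have "(\<Sum>\<nu>\<in>keys a'. single \<nu> (lookup a' \<nu>)) \<in> pid.span (?x ` T')" by (rule pid.span_sum)
    then have "a' \<in> pid.span (?x ` T')" by (simp only: mpoly_expansion[symmetric])
    then have "a' \<in> pid.span (J \<union> ?x ` T')" using pid.span_mono[of "?x ` T'" "J \<union> ?x ` T'"] by auto
    moreover have "a - a' \<in> pid.span (J \<union> ?x ` T')" using a'(1) by (intro pid.span_base) auto
    ultimately have "(a - a') + a' \<in> pid.span (J \<union> ?x ` T')" by (intro pid.span_add)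
    then show ?thesis by simp
  qed
  \<comment> \<open>\<open>J\<close> is graded and proper, and variables have no constant term, so
    constant coefficients vanish throughout the generated ideal.\<close>
  have "1 \<notin> pid.span (J \<union> ?x ` set is)"
  proof
    assume one: "1 \<in> pid.span (J \<union> ?x ` set is)"
    have "lookup f 0 = 0" if "f \<in> pid.span (J \<union> ?x ` set is)" for f
      using that
    proof (induction rule: pid.span_induct_alt)
      case (step c x y)
      have "lookup (c * x) 0 = 0"
      proof -
        have x0: "lookup x 0 = 0"
          using step(1)
        proof
          assume "x \<in> J"
          then have hx: "hcomp 0 x \<in> J" by (rule graded_hcomp[OF J(2)])
          have "hcomp 0 x = single 0 (lookup x 0)"
            by (rule poly_mapping_eqI) (auto simp: lookup_restrict_terms mdegree_eq_0_iff lookup_single when_def)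
          then have "single 0 (1 / lookup x 0) * single 0 (lookup x 0) \<in> J"
            using pid.subspace_scale[OF J(1) hx] by simp
          then show ?thesis using 1 by (cases "lookup x 0 = 0") (auto simp: mult_single)
        next
          assume "x \<in> ?x ` set is"
          then show ?thesis by (auto simp: lookup_single when_def)
        qed
        show ?thesis
        proof (rule ccontr)
          assume "lookup (c * x) 0 \<noteq> 0"
          then have "0 \<in> keys (c * x)" by (simp add: in_keys_iff)
          from subsetD[OF keys_mult this] obtain s t where st: "0 = s + t" "t \<in> keys x" by auto
          from arg_cong[OF st(1), of mdegree] have "t = 0" using mdegree_eq_0_iff[of t] by (simp add: mdegree_add)
          then show False using st(2) x0 by (simp add: in_keys_iff)
        qed
      qed
      then show ?case using step(2) by (simp add: lookup_add)
    qed simp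
    from this[OF one] show False by simp
  qed
  then have "pid.span (J \<union> ?x ` set is) \<noteq> UNIV" by blast
  moreover have "a \<in> pid.span (J \<union> ?x ` set (take k is))"
    if "k < length is" "?x (is ! k) * a \<in> pid.span (J \<union> ?x ` set (take k is))" for k a
  proof (rule main[OF that(2)])
    show "is ! k \<in> set is" using that(1) by simp
    show "is ! k \<notin> set (take k is)" using dist that(1) by (auto simp: in_set_conv_nth nth_eq_iff_index_eq)
    show "set (take k is) \<subseteq> set is" by (rule set_take_subset)
  qed
  ultimately show ?thesis unfolding regseq_def by (simp add: take_map)
qed

section \<open>Depth under coordinate changes and in residue rings\<close>

lemma span_act:
  fixes g :: "'k::field ^ 'n ^ 'n::finite"
  assumes g: "invertible g"
  shows "pid.span (act g ` S) = act g ` pid.span S"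
proof
  show "pid.span (act g ` S) \<subseteq> act g ` pid.span S"
    by (rule pid.span_minimal) (auto intro: pid.span_base subspace_act[OF pid.subspace_span g])
  show "act g ` pid.span S \<subseteq> pid.span (act g ` S)"
  proof (rule image_subsetI)
    fix f assume "f \<in> pid.span S"
    then show "act g f \<in> pid.span (act g ` S)"
      by (induction rule: pid.span_induct_alt)
        (auto simp: act_add act_mult pid.span_zero intro: pid.span_add pid.span_scale pid.span_base)
  qed
qed

lemma act_mem_iff:
  fixes g :: "'k::field ^ 'n ^ 'n::finite"
  assumes "invertible g"
  shows "act g f \<in> act g ` S \<longleftrightarrow> f \<in> S"
proof -
  obtain g' where g': "g' ** g = mat 1" using assms invertible_inverse by metis
  have "inj (act g)" by (rule inj_on_inverseI[of _ "act g'"]) (simp add: act_compose g')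
  then show ?thesis by (simp add: inj_image_mem_iff)
qed

lemma regseq_act:
  fixes g :: "'k::field ^ 'n ^ 'n::finite"
  assumes g: "invertible g" and reg: "regseq (act g ` I) (map (act g) ls)"
  shows "regseq I ls"
proof -
  have *: "pid.span (act g ` I \<union> act g ` S) = act g ` pid.span (I \<union> S)" for S
    unfolding image_Un[symmetric] by (rule span_act[OF g])
  have "a \<in> pid.span (I \<union> set (take i ls))" if "i < length ls" "ls ! i * a \<in> pid.span (I \<union> set (take i ls))" for i a
  proof -
    have "map (act g) ls ! i * act g a \<in> pid.span (act g ` I \<union> set (take i (map (act g) ls)))"
      using that by (simp add: take_map * act_mult[symmetric] act_mem_iff[OF g])
    then have "act g a \<in> pid.span (act g ` I \<union> set (take i (map (act g) ls)))"
      using reg that(1) unfolding regseq_def by (metis length_map)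
    then show ?thesis by (simp add: take_map * act_mem_iff[OF g])
  qed
  moreover have "pid.span (I \<union> set ls) \<noteq> UNIV"
  proof
    assume "pid.span (I \<union> set ls) = UNIV"
    then have "pid.span (act g ` I \<union> set (map (act g) ls)) = act g ` UNIV" by (simp add: *)
    also have "\<dots> = UNIV"
    proof -
      obtain g' where g': "g ** g' = mat 1" using g invertible_inverse by metis
      have "f = act g (act g' f)" for f :: "('n, 'k) mpoly" by (simp add: act_compose g')
      then show ?thesis by (metis surj_def)
    qed
    finally show False using reg by (simp add: regseq_def)
  qed
  ultimately show ?thesis unfolding regseq_def by blast
qed

lemma a_minus_mpoly_ring: "a \<ominus>\<^bsub>mpoly_ring\<^esub> b = a - (b :: ('n::finite, 'k::field) mpoly)"
proof -
  interpret R: ring "mpoly_ring :: ('n, 'k) mpoly ring" by (rule ring_mpoly_ring)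
  have "\<ominus>\<^bsub>mpoly_ring\<^esub> b = - b"
    by (metis R.minus_equality UNIV_I ab_left_minus mpoly_ring_simps(1,3,5))
  then show ?thesis by (simp add: a_minus_def)
qed

context
  fixes J :: "('n::finite, 'k::field) mpoly set"
  assumes J: "pid.subspace J"
begin

abbreviation (input) cst :: "('n, 'k) mpoly \<Rightarrow> ('n, 'k) mpoly set" where
  "cst a \<equiv> J +>\<^bsub>mpoly_ring\<^esub> a"

lemma ideal_J: "ideal J mpoly_ring"
  using J by (simp add: ideal_iff_subspace)

lemma cst_hom: "ring_hom_ring mpoly_ring (residue_ring_of J) (\<lambda>a. cst a)"
  using ideal.rcos_ring_hom_ring[OF ideal_J] .

lemma cst_eq_iff: "cst a = cst b \<longleftrightarrow> a - b \<in> J"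
  using ring.quotient_eq_iff_same_a_r_cos[OF ring_mpoly_ring ideal_J, of a b] by (simp add: a_minus_mpoly_ring)

lemma carrier_residue: "carrier (residue_ring_of J) = range (\<lambda>a. cst a)"
  by (auto simp: FactRing_def A_RCOSETS_def')

lemma cst_mult: "cst a \<otimes>\<^bsub>residue_ring_of J\<^esub> cst b = cst (a * b)"
  using ring_hom_mult[OF ring_hom_ring.homh[OF cst_hom], of a b] by simp

lemma cst_image_mem_iff:
  assumes "pid.subspace K" "J \<subseteq> K"
  shows "cst a \<in> (\<lambda>a. cst a) ` K \<longleftrightarrow> a \<in> K"
proof
  assume "cst a \<in> (\<lambda>a. cst a) ` K"
  then obtain b where b: "b \<in> K" "cst a = cst b" by auto
  then have "a - b \<in> K" using cst_eq_iff assms(2) by auto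
  from pid.subspace_add[OF assms(1) this b(1)] show "a \<in> K" by simp
qed auto

lemma ideal_cst_image:
  assumes "pid.subspace K"
  shows "ideal ((\<lambda>a. cst a) ` K) (residue_ring_of J)"
  using ring.ring_ideal_imp_quot_ideal[OF ring_mpoly_ring ideal_J, of K] assms by (simp add: ideal_iff_subspace)

lemma subspace_cst_vimage:
  assumes "ideal Q (residue_ring_of J)"
  shows "pid.subspace {a. cst a \<in> Q}"
  using ring_hom_ring.ideal_vimage[OF cst_hom assms] by (simp add: ideal_iff_subspace)

lemma genideal_residue:
  "genideal (residue_ring_of J) ((\<lambda>a. cst a) ` L) = (\<lambda>a. cst a) ` pid.span (J \<union> L)"
proof
  interpret Q: ring "residue_ring_of J" by (rule ideal.quotient_is_ring[OF ideal_J])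
  show "genideal (residue_ring_of J) ((\<lambda>a. cst a) ` L) \<subseteq> (\<lambda>a. cst a) ` pid.span (J \<union> L)"
    by (rule Q.genideal_minimal[OF ideal_cst_image[OF pid.subspace_span]]) (auto intro: pid.span_base)
  have "ideal (genideal (residue_ring_of J) ((\<lambda>a. cst a) ` L)) (residue_ring_of J)"
    by (rule Q.genideal_ideal) (auto simp: carrier_residue)
  from subspace_cst_vimage[OF this]
  have s: "pid.subspace {a. cst a \<in> genideal (residue_ring_of J) ((\<lambda>a. cst a) ` L)}" (is "pid.subspace ?S") .
  have "L \<subseteq> ?S"
    using Q.genideal_self[of "(\<lambda>a. cst a) ` L"] by (auto simp: carrier_residue)
  moreover have "J \<subseteq> ?S"
  proof
    fix a assume "a \<in> J"
    then have "cst a = cst 0" using cst_eq_iff by simp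
    then show "a \<in> ?S" using pid.subspace_0[OF s] by simp
  qed
  ultimately have "pid.span (J \<union> L) \<subseteq> ?S" using s by (intro pid.span_minimal) auto
  then show "(\<lambda>a. cst a) ` pid.span (J \<union> L) \<subseteq> genideal (residue_ring_of J) ((\<lambda>a. cst a) ` L)" by auto
qed

lemma regular_sequence_iff_regseq:
  "regular_sequence (residue_ring_of J) (map (\<lambda>l. cst l) ls) \<longleftrightarrow> regseq J ls"
proof -
  have sub: "J \<subseteq> pid.span (J \<union> S)" for S using pid.span_superset[of "J \<union> S"] by auto
  have "(\<lambda>a. cst a) ` K = range (\<lambda>a. cst a) \<longleftrightarrow> K = UNIV" if "pid.subspace K" "J \<subseteq> K" for K
    using cst_image_mem_iff[OF that] by (metis UNIV_eq_I rangeI)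
  then show ?thesis
    unfolding regular_sequence_def regseq_def
    by (simp add: carrier_residue take_map genideal_residue cst_mult cst_image_mem_iff[OF pid.subspace_span sub]
        sub image_subset_iff cong: conj_cong)
qed

end

lemma ideal_depth_eq:
  fixes J :: "('n::finite, 'k::field) mpoly set"
  assumes "pid.subspace J"
  shows "ideal_depth J = Sup {enat (length ls) | ls. (\<forall>l\<in>set ls. linear_form l) \<and> regseq J ls}"
  unfolding ideal_depth_def regular_sequence_iff_regseq[OF assms] ..

section \<open>Initial ideals with respect to weights\<close>

definition wcomp :: "real ^ 'n \<Rightarrow> nat \<Rightarrow> real \<Rightarrow> ('n::finite, 'k::field) mpoly \<Rightarrow> ('n, 'k) mpoly" where
  "wcomp w d c = restrict_terms (\<lambda>\<nu>. mdegree \<nu> = d \<and> weight w \<nu> = c)"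

lemma lookup_wcomp: "lookup (wcomp w d c f) \<nu> = (if mdegree \<nu> = d \<and> weight w \<nu> = c then lookup f \<nu> else 0)"
  by (simp add: wcomp_def lookup_restrict_terms)

lemma keys_wcomp: "keys (wcomp w d c f) = {\<nu> \<in> keys f. mdegree \<nu> = d \<and> weight w \<nu> = c}"
  by (simp add: wcomp_def keys_restrict_terms)

lemma wcomp_add: "wcomp w d c (f + g) = wcomp w d c f + wcomp w d c g"
  by (simp add: wcomp_def restrict_terms_add)

lemma wcomp_0 [simp]: "wcomp w d c 0 = 0"
  by (rule poly_mapping_eqI) (simp add: lookup_wcomp)

lemma wcomp_single_mult:
  "wcomp w d c (single \<nu> a * f) = (if mdegree \<nu> \<le> d then single \<nu> a * wcomp w (d - mdegree \<nu>) (c - weight w \<nu>) f else 0)"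
proof (rule poly_mapping_eqI)
  fix \<mu>
  show "lookup (wcomp w d c (single \<nu> a * f)) \<mu> =
    lookup (if mdegree \<nu> \<le> d then single \<nu> a * wcomp w (d - mdegree \<nu>) (c - weight w \<nu>) f else 0) \<mu>"
  proof (cases "\<exists>\<kappa>. \<mu> = \<nu> + \<kappa>")
    case True
    then obtain \<kappa> where \<mu>: "\<mu> = \<nu> + \<kappa>" ..
    show ?thesis unfolding \<mu> by (auto simp: lookup_wcomp mdegree_add weight_add)
  next
    case False
    then have "lookup (single \<nu> a * h) \<mu> = 0" for h by (intro lookup_single_mult_eq_0) auto
    then show ?thesis by (simp add: lookup_wcomp)
  qed
qed

text \<open>The part of the initial ideal of degree \<open>d\<close> and weight \<open>c\<close>.
  Each of its elements comes from a single homogeneous \<open>f\<close> in \<open>J\<close>, so that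
  membership involves no sums of initial forms.\<close>

definition init_comp :: "('n::finite, 'k::field) mpoly set \<Rightarrow> real ^ 'n \<Rightarrow> nat \<Rightarrow> real \<Rightarrow> ('n, 'k) mpoly set" where
  "init_comp J w d c = {q. \<exists>f\<in>J. (\<forall>\<nu>\<in>keys f. mdegree \<nu> = d \<and> c \<le> weight w \<nu>) \<and> q = wcomp w d c f}"

context
  fixes J :: "('n::finite, 'k::field) mpoly set"
  assumes J: "pid.subspace J" "graded J"
begin

lemma init_comp_0: "0 \<in> init_comp J w d c"
  unfolding init_comp_def using pid.subspace_0[OF J(1)] by (auto intro!: bexI[of _ 0])

lemma init_comp_add:
  assumes "p \<in> init_comp J w d c" "q \<in> init_comp J w d c"
  shows "p + q \<in> init_comp J w d c"
proof -
  obtain f where f: "f \<in> J" "\<forall>\<nu>\<in>keys f. mdegree \<nu> = d \<and> c \<le> weight w \<nu>" "p = wcomp w d c f"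
    using assms(1) by (auto simp: init_comp_def)
  obtain g where g: "g \<in> J" "\<forall>\<nu>\<in>keys g. mdegree \<nu> = d \<and> c \<le> weight w \<nu>" "q = wcomp w d c g"
    using assms(2) by (auto simp: init_comp_def)
  have "\<forall>\<nu>\<in>keys (f + g). mdegree \<nu> = d \<and> c \<le> weight w \<nu>" using keys_add[of f g] f(2) g(2) by auto
  then show ?thesis
    unfolding init_comp_def using pid.subspace_add[OF J(1) f(1) g(1)] f(3) g(3)
    by (auto simp: wcomp_add)
qed

lemma init_comp_single_mult:
  assumes "p \<in> init_comp J w d c"
  shows "single \<nu> a * p \<in> init_comp J w (mdegree \<nu> + d) (weight w \<nu> + c)"
proof -
  obtain f where f: "f \<in> J" "\<forall>\<nu>\<in>keys f. mdegree \<nu> = d \<and> c \<le> weight w \<nu>" "p = wcomp w d c f"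
    using assms(1) by (auto simp: init_comp_def)
  have "single \<nu> a * p = wcomp w (mdegree \<nu> + d) (weight w \<nu> + c) (single \<nu> a * f)"
    by (simp add: wcomp_single_mult f(3))
  moreover have "\<forall>\<mu>\<in>keys (single \<nu> a * f). mdegree \<mu> = mdegree \<nu> + d \<and> weight w \<nu> + c \<le> weight w \<mu>"
    using keys_single_mult[of \<nu> a f] f(2) by (auto simp: mdegree_add weight_add)
  ultimately show ?thesis
    unfolding init_comp_def using pid.subspace_scale[OF J(1) f(1)] by blast
qed

lemma wcomp_initial_form:
  assumes "f \<in> J"
  shows "wcomp w d c (initial_form w f) \<in> init_comp J w d c"
proof (cases "\<exists>\<nu>\<in>keys f. weight w \<nu> = c \<and> (\<forall>\<mu>\<in>keys f. weight w \<nu> \<le> weight w \<mu>)")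
  case True
  then have c: "c \<le> weight w \<mu>" if "\<mu> \<in> keys f" for \<mu> using that by auto
  have "wcomp w d c (initial_form w f) = wcomp w d c (hcomp d f)"
    by (rule poly_mapping_eqI) (use c in \<open>auto simp: lookup_wcomp initial_form_def lookup_restrict_terms\<close>)
  moreover have "hcomp d f \<in> J" by (rule graded_hcomp[OF J(2) assms])
  ultimately show ?thesis
    unfolding init_comp_def using c by (auto simp: keys_restrict_terms intro!: bexI[of _ "hcomp d f"])
next
  case False
  then have "wcomp w d c (initial_form w f) = 0"
    by (intro poly_mapping_eqI) (auto simp: lookup_wcomp initial_form_def lookup_restrict_terms in_keys_iff)
  then show ?thesis using init_comp_0 by simp
qed

lemma init_comp_subset_initial_ideal:
  assumes "q \<in> init_comp J w d c"
  shows "q \<in> initial_ideal w J"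
proof (cases "q = 0")
  case True
  then show ?thesis unfolding initial_ideal_def Idl_eq_span using pid.span_zero by simp
next
  case False
  obtain f where f: "f \<in> J" "\<forall>\<nu>\<in>keys f. mdegree \<nu> = d \<and> c \<le> weight w \<nu>" "q = wcomp w d c f"
    using assms by (auto simp: init_comp_def)
  from False have "keys q \<noteq> {}" by simp
  then obtain \<kappa> where \<kappa>: "\<kappa> \<in> keys q" by blast
  then have \<kappa>': "\<kappa> \<in> keys f" "weight w \<kappa> = c" by (auto simp: f(3) keys_wcomp)
  have "q = initial_form w f"
  proof (rule poly_mapping_eqI)
    fix \<nu>
    show "lookup q \<nu> = lookup (initial_form w f) \<nu>"
    proof (cases "\<nu> \<in> keys f")
      case True
      then have "(\<forall>\<mu>\<in>keys f. weight w \<nu> \<le> weight w \<mu>) \<longleftrightarrow> weight w \<nu> = c"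
        using f(2) \<kappa>' by force
      then show ?thesis using f(2) True by (simp add: f(3) lookup_wcomp initial_form_def lookup_restrict_terms)
    next
      case False
      then have "lookup f \<nu> = 0" by (simp add: in_keys_iff)
      then show ?thesis by (simp add: f(3) lookup_wcomp initial_form_def lookup_restrict_terms)
    qed
  qed
  then show ?thesis unfolding initial_ideal_def Idl_eq_span using f(1) by (simp add: pid.span_base)
qed

lemma subspace_initial_ideal: "pid.subspace (initial_ideal w J)"
  unfolding initial_ideal_def Idl_eq_span by (rule pid.subspace_span)

text \<open>Multiplication by terms and addition within a bidegree stay inside the sets
  \<open>init_comp\<close>, so forming the generated ideal adds nothing to the components.\<close>

lemma initial_ideal_iff: "p \<in> initial_ideal w J \<longleftrightarrow> (\<forall>d c. wcomp w d c p \<in> init_comp J w d c)"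
proof
  assume "p \<in> initial_ideal w J"
  then have "p \<in> pid.span (initial_form w ` J)" unfolding initial_ideal_def Idl_eq_span .
  then show "\<forall>d c. wcomp w d c p \<in> init_comp J w d c"
  proof (induction rule: pid.span_induct_alt)
    case base
    show ?case using init_comp_0 by simp
  next
    case (step h x y)
    from step(1) obtain f where f: "f \<in> J" "x = initial_form w f" by auto
    have "wcomp w d c (h * x) \<in> init_comp J w d c" for d c
    proof (induction h rule: mpoly_induct)
      case (single \<nu> a)
      show ?case
      proof (cases "mdegree \<nu> \<le> d")
        case True
        from init_comp_single_mult[OF wcomp_initial_form[OF f(1), of w "d - mdegree \<nu>" "c - weight w \<nu>"], of \<nu> a]
        show ?thesis using True by (simp add: wcomp_single_mult f(2))
      next
        case False
        then show ?thesis using init_comp_0 by (simp add: wcomp_single_mult)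
      qed
    next
      case (add h1 h2)
      then show ?case unfolding distrib_right wcomp_add by (rule init_comp_add)
    qed
    then show ?case using step(2) by (simp add: wcomp_add init_comp_add)
  qed
next
  assume *: "\<forall>d c. wcomp w d c p \<in> init_comp J w d c"
  have "p = (\<Sum>(d, c)\<in>(\<lambda>\<nu>. (mdegree \<nu>, weight w \<nu>)) ` keys p. wcomp w d c p)"
  proof (rule poly_mapping_eqI)
    fix \<nu>
    let ?A = "(\<lambda>\<nu>. (mdegree \<nu>, weight w \<nu>)) ` keys p"
    have "lookup (\<Sum>(d, c)\<in>?A. wcomp w d c p) \<nu> = (\<Sum>x\<in>?A. if x = (mdegree \<nu>, weight w \<nu>) then lookup p \<nu> else 0)"
      unfolding lookup_sum by (rule sum.cong) (auto simp: lookup_wcomp split: if_splits)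
    also have "\<dots> = lookup p \<nu>" by (auto simp: in_keys_iff)
    finally show "lookup p \<nu> = lookup (\<Sum>(d, c)\<in>?A. wcomp w d c p) \<nu>" ..
  qed
  also have "\<dots> \<in> initial_ideal w J"
  proof (rule pid.subspace_sum[OF subspace_initial_ideal], clarify)
    fix \<nu>
    show "wcomp w (mdegree \<nu>) (weight w \<nu>) p \<in> initial_ideal w J"
      by (rule init_comp_subset_initial_ideal[OF *[rule_format]])
  qed
  finally show "p \<in> initial_ideal w J" .
qed

lemma wcomp_mem_initial_ideal: "p \<in> initial_ideal w J \<Longrightarrow> wcomp w d c p \<in> initial_ideal w J"
  using init_comp_subset_initial_ideal initial_ideal_iff by blast

lemma graded_initial_ideal: "graded (initial_ideal w J)"
  unfolding graded_def
proof safe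
  fix p d assume p: "p \<in> initial_ideal w J"
  have "wcomp w d' c (hcomp d p) = (if d' = d then wcomp w d c p else 0)" for d' c
    by (rule poly_mapping_eqI) (auto simp: lookup_wcomp lookup_restrict_terms)
  then show "hcomp d p \<in> initial_ideal w J"
    using p init_comp_0 unfolding initial_ideal_iff by simp
qed

lemma wcomp_initial_mem:
  assumes "f \<in> J" "\<And>\<nu>. \<nu> \<in> keys f \<Longrightarrow> mdegree \<nu> = d \<and> c \<le> weight w \<nu>"
  shows "wcomp w d c f \<in> initial_ideal w J"
  by (rule init_comp_subset_initial_ideal[where d = d and c = c]) (use assms in \<open>auto simp: init_comp_def\<close>)

lemma initial_ideal_lift:
  assumes "p \<in> initial_ideal w J"
  obtains f where "f \<in> J" "\<And>\<nu>. \<nu> \<in> keys f \<Longrightarrow> mdegree \<nu> = d \<and> c \<le> weight w \<nu>" "wcomp w d c p = wcomp w d c f"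
  using assms unfolding initial_ideal_iff init_comp_def by blast

text \<open>A component of the initial ideal lifts to a homogeneous element of \<open>J\<close> with
  the same leading monomial, and conversely such an element can be cut down to its part of minimal
  weight.\<close>

lemma leads_initial_ideal:
  assumes r: "corder r"
  shows "leads r (initial_ideal w J) = leads (ordr w r) J"
proof safe
  fix e assume "e \<in> leads r (initial_ideal w J)"
  then obtain p where p: "p \<in> initial_ideal w J" "is_lead r p e" by (auto simp: leads_def)
  obtain f where f: "f \<in> J" "\<And>\<nu>. \<nu> \<in> keys f \<Longrightarrow> mdegree \<nu> = mdegree e \<and> weight w e \<le> weight w \<nu>"
    "wcomp w (mdegree e) (weight w e) p = wcomp w (mdegree e) (weight w e) f"
    by (rule initial_ideal_lift[OF p(1), where d = "mdegree e" and c = "weight w e"]) (rule that, assumption+)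
  have eq: "lookup p \<nu> = lookup f \<nu>" if "mdegree \<nu> = mdegree e" "weight w \<nu> = weight w e" for \<nu>
    using arg_cong[OF f(3), of "\<lambda>h. lookup h \<nu>"] that by (simp add: lookup_wcomp)
  have "e \<in> keys f" using p(2) eq[of e] by (simp add: is_lead_def in_keys_iff)
  moreover have "(\<mu>, e) \<in> ordr w r" if \<mu>: "\<mu> \<in> keys f" for \<mu>
  proof (cases "weight w \<mu> = weight w e")
    case True
    then have "\<mu> \<in> keys p" using eq[of \<mu>] f(2)[OF \<mu>] \<mu> by (simp add: in_keys_iff)
    then show ?thesis using p(2) f(2)[OF \<mu>] True by (simp add: is_lead_def ordr_def)
  next
    case False
    then show ?thesis using f(2)[OF \<mu>] by (simp add: ordr_def)
  qed
  ultimately show "e \<in> leads (ordr w r) J" using f(1) by (auto simp: leads_def is_lead_def)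
next
  fix e assume e: "e \<in> leads (ordr w r) J"
  obtain f where f: "f \<in> J" "is_lead (ordr w r) f e" "lookup f e = 1" "\<And>\<mu>. \<mu> \<in> keys f \<Longrightarrow> mdegree \<mu> = mdegree e"
    by (rule leads_homogeneous[OF J e]) (rule that, assumption+)
  let ?q = "wcomp w (mdegree e) (weight w e) f"
  have "?q \<in> initial_ideal w J"
  proof (rule wcomp_initial_mem[OF f(1)])
    fix \<nu> assume \<nu>: "\<nu> \<in> keys f"
    then have "(\<nu>, e) \<in> ordr w r" using f(2) by (simp add: is_lead_def)
    then show "mdegree \<nu> = mdegree e \<and> weight w e \<le> weight w \<nu>"
      using f(4)[OF \<nu>] by (auto simp: ordr_def)
  qed
  moreover have "is_lead r ?q e"
    using f(2) by (auto simp: is_lead_def keys_wcomp ordr_def)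
  ultimately show "e \<in> leads r (initial_ideal w J)" by (auto simp: leads_def)
qed

text \<open>A component of weight \<open>weight w e\<close> in the initial ideal lifts to an element
  of \<open>J\<close> without terms of smaller weight. Adding those monomials to the avoided set
  turns \<open>Sep\<close> for the initial ideal into \<open>Sep\<close> for
  \<open>J\<close>.\<close>

lemma Sep_initial_ideal:
  assumes Y: "\<And>\<nu>. \<nu> \<in> Y \<Longrightarrow> mdegree \<nu> = mdegree e"
  shows "Sep (initial_ideal w J) Y e \<longleftrightarrow>
    Sep J ({\<nu>. mdegree \<nu> = mdegree e \<and> weight w \<nu> < weight w e} \<union> {\<nu>\<in>Y. weight w \<nu> = weight w e}) e"
    (is "_ \<longleftrightarrow> Sep J ?Z e")
proof
  assume "Sep (initial_ideal w J) Y e"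
  then obtain p where p: "p \<in> initial_ideal w J" "\<And>c. c \<in> Y \<Longrightarrow> lookup p c = 0" "lookup p e = 1"
    by (auto simp: Sep_def)
  obtain f where f: "f \<in> J" "\<And>\<nu>. \<nu> \<in> keys f \<Longrightarrow> mdegree \<nu> = mdegree e \<and> weight w e \<le> weight w \<nu>"
    "wcomp w (mdegree e) (weight w e) p = wcomp w (mdegree e) (weight w e) f"
    by (rule initial_ideal_lift[OF p(1), where d = "mdegree e" and c = "weight w e"]) (rule that, assumption+)
  have eq: "lookup p \<nu> = lookup f \<nu>" if "mdegree \<nu> = mdegree e" "weight w \<nu> = weight w e" for \<nu>
    using arg_cong[OF f(3), of "\<lambda>h. lookup h \<nu>"] that by (simp add: lookup_wcomp)
  show "Sep J ?Z e"
  proof (rule SepI[OF J(1) f(1)])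
    show "lookup f e \<noteq> 0" using eq[of e] p(3) by simp
    fix c assume "c \<in> ?Z"
    then show "lookup f c = 0"
    proof
      assume "c \<in> {\<nu>. mdegree \<nu> = mdegree e \<and> weight w \<nu> < weight w e}"
      then have "c \<notin> keys f" using f(2)[of c] by auto
      then show ?thesis by (simp add: in_keys_iff)
    next
      assume "c \<in> {\<nu>\<in>Y. weight w \<nu> = weight w e}"
      then show ?thesis using eq[of c] p(2)[of c] Y[of c] by simp
    qed
  qed
next
  assume sep: "Sep J ?Z e"
  obtain f where f: "f \<in> J" "\<And>c. c \<in> ?Z \<Longrightarrow> lookup f c = 0" "lookup f e = 1" "\<And>\<mu>. \<mu> \<in> keys f \<Longrightarrow> mdegree \<mu> = mdegree e"
    by (rule Sep_homogeneous[OF J(2) sep]) (rule that, assumption+)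
  have wt: "weight w e \<le> weight w \<nu>" if "\<nu> \<in> keys f" for \<nu>
    using f(2)[of \<nu>] f(4)[OF that] that by (force simp: in_keys_iff)
  let ?q = "wcomp w (mdegree e) (weight w e) f"
  have q: "?q \<in> initial_ideal w J" by (rule wcomp_initial_mem[OF f(1)]) (use f(4) wt in auto)
  show "Sep (initial_ideal w J) Y e"
    by (rule SepI[OF subspace_initial_ideal q]) (use f(2,3) in \<open>auto simp: lookup_wcomp\<close>)
qed

lemma single_mem_initial_ideal:
  "single \<nu> 1 \<in> initial_ideal w J \<longleftrightarrow>
    (\<exists>f\<in>J. lookup f \<nu> = 1 \<and> (\<forall>\<mu>\<in>keys f. mdegree \<mu> = mdegree \<nu> \<and> (\<mu> \<noteq> \<nu> \<longrightarrow> weight w \<nu> < weight w \<mu>)))"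
proof
  assume s: "single \<nu> 1 \<in> initial_ideal w J"
  obtain f where f: "f \<in> J" "\<And>\<mu>. \<mu> \<in> keys f \<Longrightarrow> mdegree \<mu> = mdegree \<nu> \<and> weight w \<nu> \<le> weight w \<mu>"
    "wcomp w (mdegree \<nu>) (weight w \<nu>) (single \<nu> 1) = wcomp w (mdegree \<nu>) (weight w \<nu>) f"
    by (rule initial_ideal_lift[OF s, where d = "mdegree \<nu>" and c = "weight w \<nu>"]) (rule that, assumption+)
  have eq: "lookup f \<mu> = lookup (single \<nu> 1) \<mu>" if "mdegree \<mu> = mdegree \<nu>" "weight w \<mu> = weight w \<nu>" for \<mu>
    using arg_cong[OF f(3), of "\<lambda>h. lookup h \<mu>"] that by (simp add: lookup_wcomp)
  have "weight w \<nu> < weight w \<mu>" if "\<mu> \<in> keys f" "\<mu> \<noteq> \<nu>" for \<mu>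
    using f(2)[OF that(1)] eq[of \<mu>] that by (auto simp: in_keys_iff lookup_single when_def order_le_less split: if_splits)
  then show "\<exists>f\<in>J. lookup f \<nu> = 1 \<and> (\<forall>\<mu>\<in>keys f. mdegree \<mu> = mdegree \<nu> \<and> (\<mu> \<noteq> \<nu> \<longrightarrow> weight w \<nu> < weight w \<mu>))"
    using f(1,2) eq[of \<nu>] by (intro bexI[of _ f]) auto
next
  assume "\<exists>f\<in>J. lookup f \<nu> = 1 \<and> (\<forall>\<mu>\<in>keys f. mdegree \<mu> = mdegree \<nu> \<and> (\<mu> \<noteq> \<nu> \<longrightarrow> weight w \<nu> < weight w \<mu>))"
  then obtain f where f: "f \<in> J" "lookup f \<nu> = 1"
    "\<And>\<mu>. \<mu> \<in> keys f \<Longrightarrow> mdegree \<mu> = mdegree \<nu> \<and> (\<mu> \<noteq> \<nu> \<longrightarrow> weight w \<nu> < weight w \<mu>)" by auto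
  have "wcomp w (mdegree \<nu>) (weight w \<nu>) f \<in> initial_ideal w J"
    by (rule wcomp_initial_mem[OF f(1)]) (use f(3) in force)
  moreover have "wcomp w (mdegree \<nu>) (weight w \<nu>) f = single \<nu> 1"
  proof (rule poly_mapping_eqI)
    fix \<mu>
    show "lookup (wcomp w (mdegree \<nu>) (weight w \<nu>) f) \<mu> = lookup (single \<nu> 1) \<mu>"
      using f(2) f(3)[of \<mu>] by (cases "lookup f \<mu> = 0") (auto simp: lookup_wcomp lookup_single when_def in_keys_iff)
  qed
  ultimately show "single \<nu> 1 \<in> initial_ideal w J" by simp
qed

end

section \<open>Comparison of initial ideals\<close>

lemma ideal_eq_by_leads:
  fixes A B :: "('n::finite, 'k::field) mpoly set"
  assumes r: "corder r" and A: "pid.subspace A" "graded A" and B: "pid.subspace B"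
    and gen: "deg_gen D (leads r A)" and low: "\<And>e. e \<in> leads r A \<Longrightarrow> mdegree e \<le> D \<Longrightarrow> e \<in> leads r (A \<inter> B)"
    and gB: "graded B"
  shows "A \<subseteq> B" "leads r A \<subseteq> leads r B"
proof -
  have AB: "pid.subspace (A \<inter> B)" by (rule pid.subspace_inter[OF A(1) B])
  have gAB: "graded (A \<inter> B)" using A(2) gB by (auto simp: graded_def)
  have sub: "leads r A \<subseteq> leads r (A \<inter> B)"
  proof
    fix \<nu> assume "\<nu> \<in> leads r A"
    then obtain b where "b \<in> leads r A" "mdegree b \<le> D" "mle b \<nu>" using gen by (auto simp: deg_gen_def)
    then show "\<nu> \<in> leads r (A \<inter> B)" using low upc_mle[OF upc_leads[OF AB r]] by blast
  qed
  have "A \<inter> B = A" by (rule ideal_eq_if_leads_eq[OF r AB gAB _ A(1) sub]) auto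
  then show "A \<subseteq> B" by blast
  then show "leads r A \<subseteq> leads r B" by (rule leads_mono)
qed

text \<open>\<open>Sep\<close> records supports but no coefficients. It suffices because both
  initial ideals have the same leading monomials, so that their reduced elements for
  \<open>e\<close> are parts of one reduced \<open>f\<close> in \<open>J\<close>; such parts agree
  as soon as their supports do.\<close>

lemma initial_ideal_eq_if_Sep_aux:
  fixes J :: "('n::finite, 'k::field) mpoly set"
  assumes J: "pid.subspace J" "graded J" and r: "corder r"
    and gen: "deg_gen D (leads r (initial_ideal w J))" and eqN: "leads r (initial_ideal w J) = leads r (initial_ideal w' J)"
    and sep: "\<And>Y e. mdegree e \<le> D \<Longrightarrow> (\<And>\<nu>. \<nu> \<in> Y \<Longrightarrow> mdegree \<nu> = mdegree e) \<Longrightarrow>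
      Sep (initial_ideal w J) Y e \<Longrightarrow> Sep (initial_ideal w' J) Y e"
    and sep': "\<And>Y e. mdegree e \<le> D \<Longrightarrow> (\<And>\<nu>. \<nu> \<in> Y \<Longrightarrow> mdegree \<nu> = mdegree e) \<Longrightarrow>
      Sep (initial_ideal w' J) Y e \<Longrightarrow> Sep (initial_ideal w J) Y e"
  shows "initial_ideal w J \<subseteq> initial_ideal w' J"
proof -
  let ?N = "leads r (initial_ideal w J)"
  have red: "\<exists>p f. f \<in> J \<and> p \<in> initial_ideal u J \<and> lookup f e = 1 \<and> keys f \<inter> ?N \<subseteq> {e} \<and> (\<forall>\<mu>\<in>keys f. mdegree \<mu> = mdegree e)
      \<and> p = wcomp u (mdegree e) (weight u e) f \<and> is_lead r p e"
    if e: "e \<in> ?N" and u: "?N = leads r (initial_ideal u J)" for e u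
  proof -
    have Nu: "?N = leads (ordr u r) J" unfolding u by (rule leads_initial_ideal[OF J r])
    then have "e \<in> leads (ordr u r) J" using e by simp
    from reduced_element[OF J corder_ordr[OF r] this] obtain f where
      f: "f \<in> J" "lookup f e = 1" "\<forall>\<mu>\<in>keys f. mdegree \<mu> = mdegree e \<and> (\<mu>, e) \<in> ordr u r"
      "\<forall>\<mu>\<in>keys f \<inter> leads (ordr u r) J. \<mu> = e"
      by (elim bexE conjE)
    have fo: "(\<mu>, e) \<in> ordr u r" "mdegree \<mu> = mdegree e" if "\<mu> \<in> keys f" for \<mu>
      using f(3) that by auto
    let ?p = "wcomp u (mdegree e) (weight u e) f"
    have "?p \<in> initial_ideal u J"
    proof (rule wcomp_initial_mem[OF J f(1)])
      fix \<nu> assume "\<nu> \<in> keys f"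
      from fo[OF this] show "mdegree \<nu> = mdegree e \<and> weight u e \<le> weight u \<nu>" by (auto simp: ordr_def)
    qed
    moreover have "is_lead r ?p e"
      unfolding is_lead_def keys_wcomp
    proof (intro conjI ballI)
      show "e \<in> {\<nu> \<in> keys f. mdegree \<nu> = mdegree e \<and> weight u \<nu> = weight u e}"
        using f(2) by (simp add: in_keys_iff)
      fix \<mu> assume "\<mu> \<in> {\<nu> \<in> keys f. mdegree \<nu> = mdegree e \<and> weight u \<nu> = weight u e}"
      then show "(\<mu>, e) \<in> r" using fo(1)[of \<mu>] by (auto simp: ordr_def)
    qed
    moreover have "keys f \<inter> ?N \<subseteq> {e}" unfolding Nu using f(4) by auto
    moreover have "\<forall>\<mu>\<in>keys f. mdegree \<mu> = mdegree e" using fo by simp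
    ultimately show ?thesis using f(1,2) by (intro exI[of _ ?p] exI[of _ f] conjI refl)
  qed
  \<comment> \<open>A homogeneous member of the initial ideal that avoids all leading monomials
    except \<open>e\<close> is a multiple of the reduced \<open>p\<close>. So \<open>Sep\<close>
    with these monomials avoided tests membership in the support of \<open>p\<close>.\<close>
  have supp: "\<nu> \<in> keys p" if p: "p \<in> initial_ideal u J" "lookup p e = 1" "keys p \<inter> ?N \<subseteq> {e}" "\<And>\<mu>. \<mu> \<in> keys p \<Longrightarrow> mdegree \<mu> = mdegree e"
    and u: "?N = leads r (initial_ideal u J)"
    and s: "Sep (initial_ideal u J) {\<mu>\<in>?N. mdegree \<mu> = mdegree e \<and> \<mu> \<noteq> e} \<nu>" "mdegree \<nu> = mdegree e" for p e \<nu> u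
  proof -
    obtain h where h: "h \<in> initial_ideal u J" "\<And>c. c \<in> {\<mu>\<in>?N. mdegree \<mu> = mdegree e \<and> \<mu> \<noteq> e} \<Longrightarrow> lookup h c = 0"
      "lookup h \<nu> = 1" "\<And>\<mu>. \<mu> \<in> keys h \<Longrightarrow> mdegree \<mu> = mdegree \<nu>"
      by (rule Sep_homogeneous[OF graded_initial_ideal[OF J] s(1)]) (rule that, assumption+)
    define z where "z = h - single 0 (lookup h e) * p"
    have zW: "z \<in> initial_ideal u J"
      unfolding z_def by (intro pid.subspace_diff pid.subspace_scale subspace_initial_ideal[OF J] h p)
    have "lookup z \<mu> = 0" if \<mu>: "\<mu> \<in> ?N" for \<mu>
    proof (cases "\<mu> = e")
      case True
      then show ?thesis by (simp add: z_def lookup_minus p(2))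
    next
      case False
      have "\<mu> \<notin> keys p" using p(3) \<mu> False by auto
      moreover have "lookup h \<mu> = 0"
      proof (cases "mdegree \<mu> = mdegree e")
        case True
        then show ?thesis using h(2) \<mu> False by simp
      next
        case deg: False
        then have "\<mu> \<notin> keys h" using h(4)[of \<mu>] s(2) by auto
        then show ?thesis by (simp add: in_keys_iff)
      qed
      ultimately show ?thesis by (simp add: z_def lookup_minus in_keys_iff)
    qed
    then have "keys z \<inter> leads r (initial_ideal u J) = {}" unfolding u[symmetric] by (auto simp: in_keys_iff)
    then have "z = 0" by (rule zero_if_no_leads[OF r zW])
    then have "lookup z \<nu> = 0" by simp
    then show ?thesis using h(3) by (auto simp: z_def lookup_minus in_keys_iff)
  qed
  show ?thesis
  proof (rule ideal_eq_by_leads(1)[OF r subspace_initial_ideal[OF J] graded_initial_ideal[OF J] subspace_initial_ideal[OF J] gen])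
    show "graded (initial_ideal w' J)" by (rule graded_initial_ideal[OF J])
    fix e assume e: "e \<in> ?N" "mdegree e \<le> D"
    from red[OF e(1) refl] obtain p f where
      f: "f \<in> J" "p \<in> initial_ideal w J" "lookup f e = 1" "keys f \<inter> ?N \<subseteq> {e}" "\<forall>\<mu>\<in>keys f. mdegree \<mu> = mdegree e"
      "p = wcomp w (mdegree e) (weight w e) f" "is_lead r p e" by (elim exE conjE)
    from red[OF e(1) eqN] obtain p' f' where
      f': "f' \<in> J" "p' \<in> initial_ideal w' J" "lookup f' e = 1" "keys f' \<inter> ?N \<subseteq> {e}" "\<forall>\<mu>\<in>keys f'. mdegree \<mu> = mdegree e"
      "p' = wcomp w' (mdegree e) (weight w' e) f'" "is_lead r p' e" by (elim exE conjE)
    \<comment> \<open>Both are reduced with respect to the same set of leading monomials and have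
      coefficient 1 at \<open>e\<close>.\<close>
    have "f - f' = 0"
    proof (rule zero_if_no_leads[OF corder_ordr[OF r] pid.subspace_diff[OF J(1) f(1) f'(1)]])
      have "lookup (f - f') \<mu> = 0" if "\<mu> \<in> ?N" for \<mu>
      proof (cases "\<mu> = e")
        case False
        then have "\<mu> \<notin> keys f" "\<mu> \<notin> keys f'" using that f(4) f'(4) by auto
        then show ?thesis by (simp add: lookup_minus in_keys_iff)
      qed (simp add: lookup_minus f(3) f'(3))
      then show "keys (f - f') \<inter> leads (ordr w r) J = {}"
        unfolding leads_initial_ideal[OF J r, symmetric] by (auto simp: in_keys_iff)
    qed
    then have ff: "f' = f" by simp
    have pe: "lookup p e = 1" "lookup p' e = 1" using f(3) f'(3) by (simp_all add: f(6) f'(6) lookup_wcomp)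
    have kp: "keys p \<subseteq> keys f" "keys p' \<subseteq> keys f" by (auto simp: f(6) f'(6) ff keys_wcomp)
    let ?Y = "{\<mu>\<in>?N. mdegree \<mu> = mdegree e \<and> \<mu> \<noteq> e}"
    have zero: "lookup h c = 0" if "keys h \<subseteq> keys f" "c \<in> ?Y" for h c
      using that f(4) by (auto simp: in_keys_iff)
    have deg: "mdegree \<nu> = mdegree e" if "\<nu> \<in> keys f" for \<nu> using f(5) that by auto
    have "keys p = keys p'"
    proof
      show "keys p \<subseteq> keys p'"
      proof
        fix \<nu> assume \<nu>: "\<nu> \<in> keys p"
        then have d: "mdegree \<nu> = mdegree e" using kp deg by auto
        have "Sep (initial_ideal w J) ?Y \<nu>"
          by (rule SepI[OF subspace_initial_ideal[OF J] f(2)]) (use zero[OF kp(1)] \<nu> in \<open>auto simp: in_keys_iff\<close>)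
        then have "Sep (initial_ideal w' J) ?Y \<nu>" by (intro sep) (use d e(2) in auto)
        then show "\<nu> \<in> keys p'"
          by (intro supp[OF f'(2) pe(2) _ _ eqN _ d]) (use kp f(4) deg in auto)
      qed
      show "keys p' \<subseteq> keys p"
      proof
        fix \<nu> assume \<nu>: "\<nu> \<in> keys p'"
        then have d: "mdegree \<nu> = mdegree e" using kp deg by auto
        have "Sep (initial_ideal w' J) ?Y \<nu>"
          by (rule SepI[OF subspace_initial_ideal[OF J] f'(2)]) (use zero[OF kp(2)] \<nu> in \<open>auto simp: in_keys_iff\<close>)
        then have "Sep (initial_ideal w J) ?Y \<nu>" by (intro sep') (use d e(2) in auto)
        then show "\<nu> \<in> keys p"
          by (intro supp[OF f(2) pe(1) _ _ refl _ d]) (use kp f(4) deg in auto)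
      qed
    qed
    have lp: "lookup h \<nu> = (if \<nu> \<in> keys h then lookup f \<nu> else 0)" if "h = p \<or> h = p'" for h \<nu>
      using that by (auto simp: f(6) f'(6) ff lookup_wcomp in_keys_iff)
    have "p = p'"
      by (rule poly_mapping_eqI) (simp add: lp \<open>keys p = keys p'\<close>)
    then have "p \<in> initial_ideal w J \<inter> initial_ideal w' J" using f(2) f'(2) by simp
    then show "e \<in> leads r (initial_ideal w J \<inter> initial_ideal w' J)" using f(7) unfolding leads_def by blast
  qed
qed

lemma initial_ideal_eq_iff_Sep:
  fixes J :: "('n::finite, 'k::field) mpoly set"
  assumes J: "pid.subspace J" "graded J"
    and gen: "\<And>r. corder r \<Longrightarrow> deg_gen D (leads r J)"
  shows "initial_ideal w J = initial_ideal w' J \<longleftrightarrow>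
    (\<forall>Y e. mdegree e \<le> D \<longrightarrow> (\<forall>\<nu>\<in>Y. mdegree \<nu> = mdegree e) \<longrightarrow>
      (Sep (initial_ideal w J) Y e \<longleftrightarrow> Sep (initial_ideal w' J) Y e))"
proof
  assume sep: "\<forall>Y e. mdegree e \<le> D \<longrightarrow> (\<forall>\<nu>\<in>Y. mdegree \<nu> = mdegree e) \<longrightarrow>
      (Sep (initial_ideal w J) Y e \<longleftrightarrow> Sep (initial_ideal w' J) Y e)"
  have gen': "deg_gen D (leads lexo (initial_ideal u J))" for u
    unfolding leads_initial_ideal[OF J corder_lexo] by (rule gen[OF corder_ordr[OF corder_lexo]])
  have N: "leads lexo (initial_ideal w J) = leads lexo (initial_ideal w' J)"
  proof (rule deg_gen_eq[OF gen' gen'])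
    show "upc (leads lexo (initial_ideal w J))" "upc (leads lexo (initial_ideal w' J))"
      by (intro upc_leads subspace_initial_ideal J corder_lexo)+
    fix \<nu> :: "'n monomial" assume "mdegree \<nu> \<le> D"
    then show "\<nu> \<in> leads lexo (initial_ideal w J) \<longleftrightarrow> \<nu> \<in> leads lexo (initial_ideal w' J)"
      unfolding leads_iff_Sep[OF subspace_initial_ideal[OF J] graded_initial_ideal[OF J] corder_lexo]
      using sep by simp
  qed
  show "initial_ideal w J = initial_ideal w' J"
  proof
    show "initial_ideal w J \<subseteq> initial_ideal w' J"
      by (rule initial_ideal_eq_if_Sep_aux[OF J corder_lexo gen' N]) (use sep in blast)+
    show "initial_ideal w' J \<subseteq> initial_ideal w J"
      by (rule initial_ideal_eq_if_Sep_aux[OF J corder_lexo gen' N[symmetric]]) (use sep in blast)+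
  qed
qed simp

text \<open>The ideals change with \<open>g\<close>, but whether two weights give the same one is a
  matter of \<open>Sep\<close> in degrees at most \<open>D\<close>, which generic matrices
  share.\<close>

lemma initial_ideal_eq_Dgen:
  fixes I :: "('n::finite, 'k::field) mpoly set"
  assumes I: "pid.subspace I" "graded I" and D: "gen_bound I D" and g: "Dgen I D g" "Dgen I D g'"
  shows "initial_ideal w (act g ` I) = initial_ideal w' (act g ` I) \<longleftrightarrow>
    initial_ideal w (act g' ` I) = initial_ideal w' (act g' ` I)"
proof -
  have inv: "invertible g" "invertible g'" using g by (auto simp: Dgen_def)
  note s = subspace_act[OF I(1) inv(1)] graded_act[OF I(2)]
  note s' = subspace_act[OF I(1) inv(2)] graded_act[OF I(2)]
  have "Sep (initial_ideal u (act g ` I)) Y e \<longleftrightarrow> Sep (initial_ideal u (act g' ` I)) Y e"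
    if "mdegree e \<le> D" "\<forall>\<nu>\<in>Y. mdegree \<nu> = mdegree e" for Y e u
  proof -
    let ?Z = "{\<nu>. mdegree \<nu> = mdegree e \<and> weight u \<nu> < weight u e} \<union> {\<nu>\<in>Y. weight u \<nu> = weight u e}"
    have "Sep (initial_ideal u (act g ` I)) Y e \<longleftrightarrow> Sep (act g ` I) ?Z e"
      by (rule Sep_initial_ideal[OF s]) (use that in auto)
    also have "\<dots> \<longleftrightarrow> Sep (act g' ` I) ?Z e"
      by (intro Sep_Dgen[OF I(1) g]) (use that in auto)
    also have "\<dots> \<longleftrightarrow> Sep (initial_ideal u (act g' ` I)) Y e"
      by (rule Sep_initial_ideal[OF s', symmetric]) (use that in auto)
    finally show ?thesis .
  qed
  note sep = this
  have iff: "initial_ideal w (act h ` I) = initial_ideal w' (act h ` I) \<longleftrightarrow>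
    (\<forall>Y e. mdegree e \<le> D \<longrightarrow> (\<forall>\<nu>\<in>Y. mdegree \<nu> = mdegree e) \<longrightarrow>
      (Sep (initial_ideal w (act h ` I)) Y e \<longleftrightarrow> Sep (initial_ideal w' (act h ` I)) Y e))" if "invertible h" for h
    by (rule initial_ideal_eq_iff_Sep[OF subspace_act[OF I(1) that] graded_act[OF I(2)]])
      (rule deg_gen_leads[OF I D that])
  show ?thesis
    unfolding iff[OF inv(1)] iff[OF inv(2)] using sep by (simp cong: imp_cong)
qed

lemma groebner_fan_Dgen:
  fixes I :: "('n::finite, 'k::field) mpoly set"
  assumes I: "pid.subspace I" "graded I" and D: "gen_bound I D" and g: "Dgen I D g" "Dgen I D g'"
  shows "groebner_fan (act g ` I) = groebner_fan (act g' ` I)"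
  unfolding groebner_fan_def initial_ideal_eq_Dgen[OF I D g] ..

text \<open>The iterated initial forms of finitely many elements of \<open>J\<close> become initial
  forms for \<open>w + \<epsilon> *\<^sub>R v\<close> once \<open>\<epsilon>\<close> is small. So
  the iterated initial ideal is contained in that of the perturbed weight, and equal Hilbert
  functions turn the inclusion into equality.\<close>

lemma initial_ideal_perturb:
  fixes J :: "('n::finite, 'k::field) mpoly set"
  assumes J: "pid.subspace J" "graded J"
  shows "eventually (\<lambda>\<epsilon>. initial_ideal (w + \<epsilon> *\<^sub>R v) J = initial_ideal v (initial_ideal w J)) (at_right (0::real))"
proof -
  note r = corder_lexo
  note sW = subspace_initial_ideal[OF J, of w] graded_initial_ideal[OF J, of w]
  let ?Z = "initial_ideal v (initial_ideal w J)"
  note sZ = subspace_initial_ideal[OF sW, of v] graded_initial_ideal[OF sW, of v]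
  let ?R = "ordr w (ordr v lexo)"
  have N: "leads lexo ?Z = leads ?R J"
    unfolding leads_initial_ideal[OF sW r] leads_initial_ideal[OF J corder_ordr[OF r]] ..
  obtain D where D: "deg_gen D (leads lexo ?Z)" using deg_gen_ex by blast
  define A where "A = {e \<in> leads lexo ?Z. mdegree e \<le> D}"
  have finA: "finite A" unfolding A_def by (rule finite_subset[OF _ finite_monomials_le[of D]]) auto
  have "\<forall>e\<in>A. \<exists>f. f \<in> J \<and> lookup f e = 1 \<and> (\<forall>\<mu>\<in>keys f. mdegree \<mu> = mdegree e \<and> (\<mu>, e) \<in> ?R)"
    using reduced_element[OF J corder_ordr[OF corder_ordr[OF r]]] unfolding A_def N by blast
  from bchoice[OF this] obtain f where ff:
    "\<forall>e\<in>A. f e \<in> J \<and> lookup (f e) e = 1 \<and> (\<forall>\<mu>\<in>keys (f e). mdegree \<mu> = mdegree e \<and> (\<mu>, e) \<in> ?R)" ..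
  have f: "\<And>e. e \<in> A \<Longrightarrow> f e \<in> J" "\<And>e. e \<in> A \<Longrightarrow> lookup (f e) e = 1"
    "\<And>e \<mu>. e \<in> A \<Longrightarrow> \<mu> \<in> keys (f e) \<Longrightarrow> mdegree \<mu> = mdegree e"
    "\<And>e \<mu>. e \<in> A \<Longrightarrow> \<mu> \<in> keys (f e) \<Longrightarrow> (\<mu>, e) \<in> ?R"
    using ff by simp_all
  define q where "q e = wcomp v (mdegree e) (weight v e) (wcomp w (mdegree e) (weight w e) (f e))" for e
  have kq: "keys (q e) = {\<mu> \<in> keys (f e). mdegree \<mu> = mdegree e \<and> weight w \<mu> = weight w e \<and> weight v \<mu> = weight v e}" for e
    by (auto simp: q_def keys_wcomp)
  have qZ: "q e \<in> ?Z" if e: "e \<in> A" for e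
  proof -
    have "wcomp w (mdegree e) (weight w e) (f e) \<in> initial_ideal w J"
      by (rule wcomp_initial_mem[OF J f(1)[OF e]]) (use f(3,4)[OF e] in \<open>force simp: ordr_def\<close>)
    then show ?thesis
      unfolding q_def by (rule wcomp_initial_mem[OF sW]) (use f(3,4)[OF e] in \<open>force simp: ordr_def keys_wcomp\<close>)
  qed
  have ql: "is_lead lexo (q e) e" if e: "e \<in> A" for e
    unfolding is_lead_def kq
  proof (intro conjI ballI)
    show "e \<in> {\<mu> \<in> keys (f e). mdegree \<mu> = mdegree e \<and> weight w \<mu> = weight w e \<and> weight v \<mu> = weight v e}"
      using f(2)[OF e] by (simp add: in_keys_iff)
    fix \<mu> assume "\<mu> \<in> {\<mu> \<in> keys (f e). mdegree \<mu> = mdegree e \<and> weight w \<mu> = weight w e \<and> weight v \<mu> = weight v e}"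
    then show "(\<mu>, e) \<in> lexo" using f(4)[OF e, of \<mu>] by (auto simp: ordr_def)
  qed
  \<comment> \<open>Only strict inequalities between \<open>w\<close>-weights could be upset by the
    perturbation, and finitely many occur in the \<open>f e\<close>; ties are decided by
    \<open>v\<close> for every positive \<open>\<epsilon>\<close>.\<close>
  have "eventually (\<lambda>\<epsilon>. \<forall>e\<in>A. \<forall>\<mu>\<in>keys (f e). weight w e < weight w \<mu> \<longrightarrow>
      weight (w + \<epsilon> *\<^sub>R v) e < weight (w + \<epsilon> *\<^sub>R v) \<mu>) (at_right (0::real))"
  proof (intro eventually_ball_finite finA finite_keys ballI)
    fix e \<mu>
    show "eventually (\<lambda>\<epsilon>. weight w e < weight w \<mu> \<longrightarrow> weight (w + \<epsilon> *\<^sub>R v) e < weight (w + \<epsilon> *\<^sub>R v) \<mu>) (at_right (0::real))"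
    proof (cases "weight w e < weight w \<mu>")
      case True
      have "((\<lambda>\<epsilon>. (weight w \<mu> - weight w e) + \<epsilon> * (weight v \<mu> - weight v e)) \<longlongrightarrow>
          (weight w \<mu> - weight w e) + 0 * (weight v \<mu> - weight v e)) (at_right 0)"
        by (intro tendsto_intros)
      then have "eventually (\<lambda>\<epsilon>. 0 < (weight w \<mu> - weight w e) + \<epsilon> * (weight v \<mu> - weight v e)) (at_right (0::real))"
        by (rule order_tendstoD(1)) (use True in simp)
      then show ?thesis by eventually_elim (simp add: weight_add_left weight_scale algebra_simps)
    qed simp
  qed
  moreover have "eventually (\<lambda>\<epsilon>. \<epsilon> > (0::real)) (at_right 0)" by (rule eventually_at_right_less)
  ultimately show ?thesis
  proof eventually_elim
    case (elim \<epsilon>)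
    let ?u = "w + \<epsilon> *\<^sub>R v"
    let ?U = "initial_ideal ?u J"
    note sU = subspace_initial_ideal[OF J, of ?u] graded_initial_ideal[OF J, of ?u]
    have qU: "q e \<in> ?U" if e: "e \<in> A" for e
    proof -
      have wt: "weight ?u e \<le> weight ?u \<mu>" "weight ?u \<mu> = weight ?u e \<longrightarrow> weight w \<mu> = weight w e \<and> weight v \<mu> = weight v e"
        if \<mu>: "\<mu> \<in> keys (f e)" for \<mu>
      proof -
        consider "weight w e < weight w \<mu>" | "weight w \<mu> = weight w e" "weight v e \<le> weight v \<mu>"
          using f(3,4)[OF e \<mu>] by (auto simp: ordr_def)
        then have "weight ?u e \<le> weight ?u \<mu> \<and> (weight ?u \<mu> = weight ?u e \<longrightarrow> weight w \<mu> = weight w e \<and> weight v \<mu> = weight v e)"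
        proof cases
          case 1
          then have "weight ?u e < weight ?u \<mu>" using elim(1) e \<mu> by blast
          then show ?thesis by simp
        next
          case 2
          then show ?thesis using elim(2) by (simp add: weight_add_left weight_scale)
        qed
        then show "weight ?u e \<le> weight ?u \<mu>" "weight ?u \<mu> = weight ?u e \<longrightarrow> weight w \<mu> = weight w e \<and> weight v \<mu> = weight v e"
          by auto
      qed
      have "wcomp ?u (mdegree e) (weight ?u e) (f e) \<in> ?U"
        by (rule wcomp_initial_mem[OF J f(1)[OF e]]) (use f(3)[OF e] wt(1) in auto)
      moreover have "wcomp ?u (mdegree e) (weight ?u e) (f e) = q e"
      proof (rule poly_mapping_eqI)
        fix \<mu>
        show "lookup (wcomp ?u (mdegree e) (weight ?u e) (f e)) \<mu> = lookup (q e) \<mu>"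
          using wt(2)[of \<mu>] by (auto simp: q_def lookup_wcomp in_keys_iff weight_add_left weight_scale)
      qed
      ultimately show ?thesis by simp
    qed
    have low: "e \<in> leads lexo (?Z \<inter> ?U)" if "e \<in> leads lexo ?Z" "mdegree e \<le> D" for e
    proof -
      have "e \<in> A" using that by (simp add: A_def)
      then show ?thesis using qZ qU ql unfolding leads_def by blast
    qed
    note sub = ideal_eq_by_leads[OF r sZ sU(1) D low sU(2)]
    have "leads lexo ?Z = leads lexo ?U"
    proof (rule hilb_set_subset_eq[OF _ _ sub(2)])
      show "hilb_set (hilb J) (leads lexo ?Z)"
        unfolding N by (rule hilb_set_leads[OF J corder_ordr[OF corder_ordr[OF r]]])
      show "hilb_set (hilb J) (leads lexo ?U)"
        unfolding leads_initial_ideal[OF J r] by (rule hilb_set_leads[OF J corder_ordr[OF r]])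
    qed auto
    then have "?Z = ?U" by (intro ideal_eq_if_leads_eq[OF r sZ sub(1) sU(1)]) auto
    then show ?case by simp
  qed
qed



section \<open>Krull dimension\<close>

definition isprime :: "('n::finite, 'k::field) mpoly set \<Rightarrow> bool" where
  "isprime P \<longleftrightarrow> pid.subspace P \<and> 1 \<notin> P \<and> (\<forall>a b. a * b \<in> P \<longrightarrow> a \<in> P \<or> b \<in> P)"

lemma one_mem_subspace: "pid.subspace P \<Longrightarrow> 1 \<in> P \<longleftrightarrow> P = UNIV"
  using pid.subspace_scale[of P 1] by auto

lemma isprime_power: "isprime P \<Longrightarrow> a ^ k \<in> P \<Longrightarrow> a \<in> P"
  by (induction k) (auto simp: isprime_def)

definition chain_of_primes :: "('n::finite, 'k::field) mpoly set \<Rightarrow> nat \<Rightarrow> (nat \<Rightarrow> ('n, 'k) mpoly set) \<Rightarrow> bool" where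
  "chain_of_primes J k P \<longleftrightarrow> (\<forall>i\<le>k. isprime (P i) \<and> J \<subseteq> P i) \<and> (\<forall>i<k. P i \<subset> P (Suc i))"

lemma prime_vimage:
  fixes J :: "('n::finite, 'k::field) mpoly set"
  assumes J: "pid.subspace J" and Q: "primeideal Q (residue_ring_of J)"
  shows "isprime {a. J +>\<^bsub>mpoly_ring\<^esub> a \<in> Q}" "J \<subseteq> {a. J +>\<^bsub>mpoly_ring\<^esub> a \<in> Q}"
    "Q = (\<lambda>a. J +>\<^bsub>mpoly_ring\<^esub> a) ` {a. J +>\<^bsub>mpoly_ring\<^esub> a \<in> Q}"
proof -
  let ?S = "{a. J +>\<^bsub>mpoly_ring\<^esub> a \<in> Q}"
  have idQ: "ideal Q (residue_ring_of J)" using Q by (simp add: primeideal_def)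
  have s: "pid.subspace ?S" by (rule subspace_cst_vimage[OF J idQ])
  have Qsub: "Q \<subseteq> carrier (residue_ring_of J)"
    using ideal.Icarr[OF idQ] by blast
  show eq: "Q = (\<lambda>a. J +>\<^bsub>mpoly_ring\<^esub> a) ` ?S"
    using Qsub unfolding carrier_residue[OF J] by auto
  have "1 \<notin> ?S"
  proof
    assume "1 \<in> ?S"
    then have "?S = UNIV" using one_mem_subspace[OF s] by simp
    then have "Q = carrier (residue_ring_of J)" unfolding carrier_residue[OF J] by (subst eq) simp
    then show False using primeideal.I_notcarr[OF Q] by simp
  qed
  moreover have "a \<in> ?S \<or> b \<in> ?S" if ab: "a * b \<in> ?S" for a b
    using primeideal.I_prime[OF Q, of "J +>\<^bsub>mpoly_ring\<^esub> a" "J +>\<^bsub>mpoly_ring\<^esub> b"] ab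
    unfolding cst_mult[OF J] carrier_residue[OF J] by blast
  ultimately show "isprime ?S" using s unfolding isprime_def by blast
  show "J \<subseteq> ?S"
  proof
    fix a assume "a \<in> J"
    then have "J +>\<^bsub>mpoly_ring\<^esub> a = J +>\<^bsub>mpoly_ring\<^esub> 0" using cst_eq_iff[OF J] by simp
    then show "a \<in> ?S" using pid.subspace_0[OF s] by simp
  qed
qed

lemma prime_image:
  fixes J :: "('n::finite, 'k::field) mpoly set"
  assumes J: "pid.subspace J" and P: "isprime P" "J \<subseteq> P"
  shows "primeideal ((\<lambda>a. J +>\<^bsub>mpoly_ring\<^esub> a) ` P) (residue_ring_of J)"
proof (rule primeidealI)
  have sP: "pid.subspace P" using P by (simp add: isprime_def)
  show "ideal ((\<lambda>a. J +>\<^bsub>mpoly_ring\<^esub> a) ` P) (residue_ring_of J)" by (rule ideal_cst_image[OF J sP])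
  show "cring (residue_ring_of J)"
    by (rule ideal.quotient_is_cring[OF ideal_J[OF J] cring_mpoly_ring])
  show "carrier (residue_ring_of J) \<noteq> (\<lambda>a. J +>\<^bsub>mpoly_ring\<^esub> a) ` P"
  proof
    assume "carrier (residue_ring_of J) = (\<lambda>a. J +>\<^bsub>mpoly_ring\<^esub> a) ` P"
    then have "J +>\<^bsub>mpoly_ring\<^esub> 1 \<in> (\<lambda>a. J +>\<^bsub>mpoly_ring\<^esub> a) ` P" unfolding carrier_residue[OF J] by blast
    then show False using P(1) unfolding cst_image_mem_iff[OF J sP P(2)] by (simp add: isprime_def)
  qed
  fix x y assume "x \<in> carrier (residue_ring_of J)" "y \<in> carrier (residue_ring_of J)"
    and xy: "x \<otimes>\<^bsub>residue_ring_of J\<^esub> y \<in> (\<lambda>a. J +>\<^bsub>mpoly_ring\<^esub> a) ` P"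
  then obtain a b where ab: "x = J +>\<^bsub>mpoly_ring\<^esub> a" "y = J +>\<^bsub>mpoly_ring\<^esub> b" unfolding carrier_residue[OF J] by blast
  have "a * b \<in> P" using xy unfolding ab cst_mult[OF J] cst_image_mem_iff[OF J sP P(2)] .
  then show "x \<in> (\<lambda>a. J +>\<^bsub>mpoly_ring\<^esub> a) ` P \<or> y \<in> (\<lambda>a. J +>\<^bsub>mpoly_ring\<^esub> a) ` P"
    using P(1) unfolding ab isprime_def by blast
qed

lemma ideal_dim_eq:
  fixes J :: "('n::finite, 'k::field) mpoly set"
  assumes J: "pid.subspace J"
  shows "ideal_dim J = Sup {enat k | k. \<exists>P. chain_of_primes J k P}"
proof -
  let ?c = "\<lambda>a. J +>\<^bsub>mpoly_ring\<^esub> a"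
  have "(\<exists>P::nat \<Rightarrow> ('n, 'k) mpoly set set. (\<forall>i\<le>k. primeideal (P i) (residue_ring_of J)) \<and> (\<forall>i<k. P i \<subset> P (Suc i)))
    \<longleftrightarrow> (\<exists>P. chain_of_primes J k P)" for k
  proof
    assume "\<exists>P::nat \<Rightarrow> ('n, 'k) mpoly set set. (\<forall>i\<le>k. primeideal (P i) (residue_ring_of J)) \<and> (\<forall>i<k. P i \<subset> P (Suc i))"
    then obtain P :: "nat \<Rightarrow> ('n, 'k) mpoly set set" where P: "\<And>i. i \<le> k \<Longrightarrow> primeideal (P i) (residue_ring_of J)"
      "\<And>i. i < k \<Longrightarrow> P i \<subset> P (Suc i)" by auto
    have "{a. ?c a \<in> P i} \<subset> {a. ?c a \<in> P (Suc i)}" if i: "i < k" for i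
    proof
      show "{a. ?c a \<in> P i} \<subseteq> {a. ?c a \<in> P (Suc i)}" using P(2)[OF i] by auto
      show "{a. ?c a \<in> P i} \<noteq> {a. ?c a \<in> P (Suc i)}"
      proof
        assume eq: "{a. ?c a \<in> P i} = {a. ?c a \<in> P (Suc i)}"
        have "P i = ?c ` {a. ?c a \<in> P i}" by (rule prime_vimage(3)[OF J P(1)]) (use i in simp)
        also have "\<dots> = ?c ` {a. ?c a \<in> P (Suc i)}" unfolding eq ..
        also have "\<dots> = P (Suc i)" by (rule prime_vimage(3)[OF J P(1), symmetric]) (use i in simp)
        finally show False using P(2)[OF i] by simp
      qed
    qed
    then have "chain_of_primes J k (\<lambda>i. {a. ?c a \<in> P i})"
      unfolding chain_of_primes_def using prime_vimage(1,2)[OF J P(1)] by auto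
    then show "\<exists>P. chain_of_primes J k P" by (rule exI[of "chain_of_primes J k"])
  next
    assume "\<exists>P. chain_of_primes J k P"
    then obtain P where P: "\<And>i. i \<le> k \<Longrightarrow> isprime (P i)" "\<And>i. i \<le> k \<Longrightarrow> J \<subseteq> P i" "\<And>i. i < k \<Longrightarrow> P i \<subset> P (Suc i)"
      by (auto simp: chain_of_primes_def)
    have "?c ` P i \<subset> ?c ` P (Suc i)" if i: "i < k" for i
    proof -
      from P(3)[OF i] obtain a where a: "a \<in> P (Suc i)" "a \<notin> P i" by blast
      have "pid.subspace (P i)" using P(1)[of i] i by (simp add: isprime_def)
      from cst_image_mem_iff[OF J this P(2)] a(2) i have "?c a \<notin> ?c ` P i" by simp
      then show ?thesis using a(1) P(3)[OF i] by blast
    qed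
    then show "\<exists>P::nat \<Rightarrow> ('n, 'k) mpoly set set. (\<forall>i\<le>k. primeideal (P i) (residue_ring_of J)) \<and> (\<forall>i<k. P i \<subset> P (Suc i))"
      by (intro exI[of _ "\<lambda>i. ?c ` P i"]) (auto intro: prime_image[OF J P(1,2)])
  qed
  then show ?thesis unfolding ideal_dim_def krull_dim_def by simp
qed

lemma isprime_act:
  fixes g :: "'k::field ^ 'n ^ 'n::finite"
  assumes g: "invertible g" and P: "isprime P"
  shows "isprime (act g ` P)"
proof -
  obtain g' where g': "g ** g' = mat 1" "g' ** g = mat 1" using g invertible_inverse by metis
  have mem: "f \<in> act g ` P \<longleftrightarrow> act g' f \<in> P" for f
    using act_mem_iff[OF g, of "act g' f" P] by (simp add: act_compose g')
  show ?thesis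
    using P subspace_act[OF _ g, of P] unfolding isprime_def mem by (simp add: act_mult)
qed

lemma ideal_dim_act_le:
  fixes g :: "'k::field ^ 'n ^ 'n::finite"
  assumes I: "pid.subspace I" and g: "invertible g"
  shows "ideal_dim I \<le> ideal_dim (act g ` I)"
proof -
  have "chain_of_primes (act g ` I) k (\<lambda>i. act g ` P i)" if P: "chain_of_primes I k P" for k P
  proof -
    have "act g ` P i \<subset> act g ` P (Suc i)" if "i < k" for i
    proof -
      have "P i \<subset> P (Suc i)" using P that by (simp add: chain_of_primes_def)
      then obtain a where "a \<in> P (Suc i)" "a \<notin> P i" "P i \<subseteq> P (Suc i)" by blast
      then show ?thesis using act_mem_iff[OF g] by blast
    qed
    then show ?thesis using P isprime_act[OF g] unfolding chain_of_primes_def by (simp add: image_mono)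
  qed
  then have "{enat k | k. \<exists>P. chain_of_primes I k P} \<subseteq> {enat k | k. \<exists>P. chain_of_primes (act g ` I) k P}" by blast
  then show ?thesis unfolding ideal_dim_eq[OF I] ideal_dim_eq[OF subspace_act[OF I g]] by (rule Sup_subset_mono)
qed

lemma ideal_dim_act:
  fixes g :: "'k::field ^ 'n ^ 'n::finite"
  assumes I: "pid.subspace I" and g: "invertible g"
  shows "ideal_dim (act g ` I) = ideal_dim I"
proof (rule antisym[OF _ ideal_dim_act_le[OF assms]])
  obtain g' where g': "g' ** g = mat 1" "invertible g'" using g invertible_inverse by metis
  from ideal_dim_act_le[OF subspace_act[OF I g] g'(2)] show "ideal_dim (act g ` I) \<le> ideal_dim I"
    by (simp add: act_act_image g')
qed

subsection \<open>Finiteness over a polynomial subring\<close>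

definition mrestr :: "'n set \<Rightarrow> 'n::finite monomial \<Rightarrow> 'n monomial" where
  "mrestr B \<mu> = (\<Sum>i\<in>B. single i (lookup \<mu> i))"

lemma lookup_mrestr: "lookup (mrestr B \<mu>) i = (if i \<in> B then lookup \<mu> i else 0)"
proof -
  have "lookup (mrestr B \<mu>) i = (\<Sum>j\<in>B. if j = i then lookup \<mu> i else 0)"
    unfolding mrestr_def lookup_sum by (rule sum.cong) (auto simp: lookup_single when_def)
  then show ?thesis by simp
qed

lemma mrestr_split: "mrestr B \<mu> + mrestr (- B) \<mu> = \<mu>"
  by (rule monomial_eqI) (simp add: lookup_add lookup_mrestr)

text \<open>The subring \<open>K[x_b | b \<in> B]\<close> of the polynomial ring.\<close>

definition polyB :: "'n set \<Rightarrow> ('n::finite, 'k::field) mpoly set" where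
  "polyB B = {p. \<forall>\<mu>\<in>keys p. \<forall>i. i \<notin> B \<longrightarrow> lookup \<mu> i = 0}"

text \<open>The condition on \<open>B\<close>-exponents makes the reduction compatible with every weight supported on \<open>B\<close>.\<close>

definition fin_over :: "('n::finite, 'k::field) mpoly set \<Rightarrow> 'n set \<Rightarrow> 'n monomial set \<Rightarrow> bool" where
  "fin_over J B E \<longleftrightarrow> finite E \<and> (\<forall>\<nu>. \<exists>p. single \<nu> 1 - p \<in> J \<and>
     (\<forall>\<mu>\<in>keys p. mrestr (- B) \<mu> \<in> E \<and> mdegree \<mu> = mdegree \<nu> \<and> (\<forall>b\<in>B. lookup \<nu> b \<le> lookup \<mu> b)))"

lemma fin_over_poly:
  fixes f :: "('n::finite, 'k::field) mpoly"
  assumes J: "pid.subspace J" and fin: "fin_over J B E"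
  shows "\<exists>p. f - p \<in> J \<and> (\<forall>\<mu>\<in>keys p. mrestr (- B) \<mu> \<in> E \<and>
    (\<exists>\<nu>\<in>keys f. mdegree \<mu> = mdegree \<nu> \<and> (\<forall>b\<in>B. lookup \<nu> b \<le> lookup \<mu> b)))"
proof -
  have "\<forall>\<nu>. \<exists>p. single \<nu> 1 - p \<in> J \<and> (\<forall>\<mu>\<in>keys p. mrestr (- B) \<mu> \<in> E \<and> mdegree \<mu> = mdegree \<nu> \<and> (\<forall>b\<in>B. lookup \<nu> b \<le> lookup \<mu> b))"
    using fin by (simp add: fin_over_def)
  from choice[OF this] obtain p where p: "\<And>\<nu>. single \<nu> 1 - p \<nu> \<in> J"
    "\<And>\<nu> \<mu>. \<mu> \<in> keys (p \<nu>) \<Longrightarrow> mrestr (- B) \<mu> \<in> E \<and> mdegree \<mu> = mdegree \<nu> \<and> (\<forall>b\<in>B. lookup \<nu> b \<le> lookup \<mu> b)"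
    by blast
  define q where "q = (\<Sum>\<nu>\<in>keys f. single 0 (lookup f \<nu>) * p \<nu>)"
  have "f - q = (\<Sum>\<nu>\<in>keys f. single 0 (lookup f \<nu>) * (single \<nu> 1 - p \<nu>))"
    by (simp add: q_def right_diff_distrib sum_subtractf mult_single mpoly_expansion[symmetric])
  also have "\<dots> \<in> J" by (intro pid.subspace_sum pid.subspace_scale J p)
  finally have "f - q \<in> J" .
  moreover have "mrestr (- B) \<mu> \<in> E \<and> (\<exists>\<nu>\<in>keys f. mdegree \<mu> = mdegree \<nu> \<and> (\<forall>b\<in>B. lookup \<nu> b \<le> lookup \<mu> b))"
    if \<mu>: "\<mu> \<in> keys q" for \<mu>
  proof -
    from subsetD[OF keys_sum \<mu>[unfolded q_def]] obtain \<nu> where \<nu>: "\<nu> \<in> keys f" "\<mu> \<in> keys (single 0 (lookup f \<nu>) * p \<nu>)"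
      by (elim UN_E)
    then have "\<mu> \<in> keys (p \<nu>)" using subsetD[OF keys_const_mult] by blast
    from p(2)[OF this] show ?thesis using \<nu>(1) by blast
  qed
  ultimately show ?thesis by blast
qed

definition polyBw :: "'n set \<Rightarrow> real ^ 'n \<Rightarrow> real \<Rightarrow> ('n::finite, 'k::field) mpoly set" where
  "polyBw B w c = {p. \<forall>\<mu>\<in>keys p. (\<forall>i. i \<notin> B \<longrightarrow> lookup \<mu> i = 0) \<and> c \<le> weight w \<mu>}"

lemma polyBw_0: "0 \<in> polyBw B w c"
  by (simp add: polyBw_def)

lemma polyBw_add: "p \<in> polyBw B w c \<Longrightarrow> q \<in> polyBw B w c \<Longrightarrow> p + q \<in> polyBw B w c"
  unfolding polyBw_def using keys_add[of p q] by blast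

lemma polyBw_sum: "(\<And>a. a \<in> A \<Longrightarrow> f a \<in> polyBw B w c) \<Longrightarrow> sum f A \<in> polyBw B w c"
  by (induction A rule: infinite_finite_induct) (auto intro: polyBw_0 polyBw_add)

lemma polyBw_mult:
  assumes "p \<in> polyBw B w c" "q \<in> polyBw B w c'"
  shows "p * q \<in> polyBw B w (c + c')"
  unfolding polyBw_def
proof safe
  fix \<mu> assume "\<mu> \<in> keys (p * q)"
  from subsetD[OF keys_mult this] obtain a b where ab: "\<mu> = a + b" "a \<in> keys p" "b \<in> keys q" by auto
  show "c + c' \<le> weight w \<mu>" using ab assms by (auto simp: polyBw_def weight_add intro: add_mono)
  show "lookup \<mu> i = 0" if "i \<notin> B" for i using ab assms that by (simp add: polyBw_def lookup_add)
qed

lemma weight_nonneg_mono: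
  assumes "\<And>i. i \<notin> B \<Longrightarrow> w $ i = 0" "\<And>i. i \<in> B \<Longrightarrow> 0 \<le> w $ i" "\<And>b. b \<in> B \<Longrightarrow> lookup \<nu> b \<le> lookup \<mu> b"
  shows "weight w \<nu> \<le> weight w \<mu>"
  unfolding weight_def
proof (rule sum_mono)
  fix i show "w $ i * real (lookup \<nu> i) \<le> w $ i * real (lookup \<mu> i)"
    using assms by (cases "i \<in> B") (auto intro: mult_left_mono)
qed

lemma polyB_eq_polyBw:
  assumes "\<And>i. i \<notin> B \<Longrightarrow> w $ i = 0" "\<And>i. i \<in> B \<Longrightarrow> 0 \<le> w $ i"
  shows "polyB B = polyBw B w 0"
proof -
  have "0 \<le> weight w \<mu>" for \<mu> using weight_nonneg_mono[of B w 0 \<mu>] assms by simp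
  then show ?thesis by (auto simp: polyB_def polyBw_def)
qed

lemma polyB_1: "1 \<in> polyB B"
  using keys_one by (auto simp: polyB_def)

lemma polyB_mult:
  fixes p q :: "('n::finite, 'k::field) mpoly"
  assumes "p \<in> polyB B" "q \<in> polyB B"
  shows "p * q \<in> polyB B"
proof -
  have "polyB B = (polyBw B 0 0 :: ('n, 'k) mpoly set)" by (rule polyB_eq_polyBw) auto
  then show ?thesis using polyBw_mult[of p B 0 0 q 0] assms by simp
qed

lemma polyB_prod: "(\<And>a. a \<in> A \<Longrightarrow> f a \<in> polyB B) \<Longrightarrow> prod f A \<in> polyB B"
  by (induction A rule: infinite_finite_induct) (auto intro: polyB_1 polyB_mult)

lemma polyB_uminus: "p \<in> polyB B \<Longrightarrow> - p \<in> polyB B"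
  by (simp add: polyB_def)

lemma mpoly_prod_nonzero:
  fixes f :: "'a \<Rightarrow> ('n::finite, 'k::field) mpoly"
  shows "finite A \<Longrightarrow> (\<And>a. a \<in> A \<Longrightarrow> f a \<noteq> 0) \<Longrightarrow> prod f A \<noteq> 0"
proof (induction A rule: finite_induct)
  case (insert a A)
  then show ?case using mpoly_mult_eq_0[of "f a" "prod f A"] by auto
qed simp

text \<open>Reduction modulo \<open>J\<close> never lowers an exponent in \<open>B\<close>, and
  \<open>w\<close> is nonnegative and supported on \<open>B\<close>. Hence the coefficients in
  \<open>K[x_b | b \<in> B]\<close> of the monomials of \<open>E\<close> inherit the weight bound of
  \<open>f\<close>.\<close>

lemma fin_over_rep:
  fixes f :: "('n::finite, 'k::field) mpoly"
  assumes J: "pid.subspace J" and fin: "fin_over J B E"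
    and w: "\<And>i. i \<notin> B \<Longrightarrow> w $ i = 0" "\<And>i. i \<in> B \<Longrightarrow> 0 \<le> w $ i"
    and f: "\<And>\<mu>. \<mu> \<in> keys f \<Longrightarrow> c \<le> weight w \<mu>"
  shows "\<exists>q. (\<forall>e\<in>E. q e \<in> polyBw B w c) \<and> f - (\<Sum>e\<in>E. q e * single e 1) \<in> J"
proof -
  from fin_over_poly[OF J fin, of f] obtain p where p: "f - p \<in> J"
    "\<forall>\<mu>\<in>keys p. mrestr (- B) \<mu> \<in> E \<and>
    (\<exists>\<nu>\<in>keys f. mdegree \<mu> = mdegree \<nu> \<and> (\<forall>b\<in>B. lookup \<nu> b \<le> lookup \<mu> b))" by auto
  have finE: "finite E" using fin by (simp add: fin_over_def)
  define q where "q e = (\<Sum>\<mu> | \<mu> \<in> keys p \<and> mrestr (- B) \<mu> = e. single (mrestr B \<mu>) (lookup p \<mu>))" for e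
  have wr: "weight w (mrestr B \<mu>) = weight w \<mu>" for \<mu>
    unfolding weight_def by (rule sum.cong) (auto simp: lookup_mrestr w)
  have "q e \<in> polyBw B w c" for e
    unfolding q_def
  proof (rule polyBw_sum)
    fix \<mu> assume "\<mu> \<in> {\<mu>. \<mu> \<in> keys p \<and> mrestr (- B) \<mu> = e}"
    then have \<mu>: "\<mu> \<in> keys p" by simp
    with p(2) obtain \<nu> where \<nu>: "\<nu> \<in> keys f" "\<forall>b\<in>B. lookup \<nu> b \<le> lookup \<mu> b" by blast
    have "c \<le> weight w \<mu>" using f[OF \<nu>(1)] weight_nonneg_mono[of B w \<nu> \<mu>] w \<nu>(2) by fastforce
    then show "single (mrestr B \<mu>) (lookup p \<mu>) \<in> polyBw B w c"
      by (auto simp: polyBw_def lookup_mrestr wr)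
  qed
  moreover have "(\<Sum>e\<in>E. q e * single e 1) = p"
  proof -
    have "(\<Sum>e\<in>E. q e * single e 1) = (\<Sum>e\<in>E. \<Sum>\<mu> | \<mu> \<in> keys p \<and> mrestr (- B) \<mu> = e. single \<mu> (lookup p \<mu>))"
      unfolding q_def sum_distrib_right
    proof (intro sum.cong refl)
      fix e \<mu> assume "\<mu> \<in> {\<mu>. \<mu> \<in> keys p \<and> mrestr (- B) \<mu> = e}"
      then have "mrestr B \<mu> + e = \<mu>" using mrestr_split[of B \<mu>] by auto
      then show "single (mrestr B \<mu>) (lookup p \<mu>) * single e 1 = single \<mu> (lookup p \<mu>)" by (simp add: mult_single)
    qed
    also have "\<dots> = (\<Sum>\<mu>\<in>keys p. single \<mu> (lookup p \<mu>))"
      by (rule sum.group) (use finE p(2) in auto)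
    also have "\<dots> = p" by (rule mpoly_expansion[symmetric])
    finally show ?thesis .
  qed
  ultimately show ?thesis using p(1) by (intro exI[of _ q]) simp
qed

text \<open>
  The valuation given by the weight of lowest terms on \<open>K[x\<^sub>b | b \<in> B]\<close> is dominated by the weight
  filtration of the ring modulo \<open>J\<close>. Some \<open>Q \<noteq> 0\<close> maps the finite extension into a free
  submodule containing \<open>1\<close>; applying this to all powers of \<open>a\<close> makes the loss caused by \<open>Q\<close> negligible.
\<close>

theorem weight_filtration:
  fixes J :: "('n::finite, 'k::field) mpoly set"
  assumes J: "pid.subspace J" and fin: "fin_over J B E" and inj: "J \<inter> polyB B = {0}"
    and w: "\<And>i. i \<notin> B \<Longrightarrow> w $ i = 0" "\<And>i. i \<in> B \<Longrightarrow> 0 \<le> w $ i"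
    and a: "a \<in> polyB B" "a - h \<in> J" and h: "\<And>\<mu>. \<mu> \<in> keys h \<Longrightarrow> c \<le> weight w \<mu>"
    and \<mu>: "\<mu> \<in> keys a"
  shows "c \<le> weight w \<mu>"
proof -
  have finE: "finite E" using fin by (simp add: fin_over_def)
  have Bw: "(polyB B :: ('n, 'k) mpoly set) = polyBw B w 0" by (rule polyB_eq_polyBw) (use w in auto)
  let ?x = "\<lambda>e. single e (1 :: 'k)"
  \<comment> \<open>Independence over \<open>K[x_b | b \<in> B]\<close> modulo \<open>J\<close>. A
    maximal independent \<open>F\<close> containing the monomial 1 (exponent \<open>0\<close>) spans
    a free submodule into which a common denominator moves the whole extension.\<close>
  define indep where "indep F \<longleftrightarrow> (\<forall>q. (\<forall>e\<in>F. q e \<in> polyB B) \<longrightarrow> (\<Sum>e\<in>F. q e * ?x e) \<in> J \<longrightarrow> (\<forall>e\<in>F. q e = 0))" for F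
  define FF where "FF = {F. F \<subseteq> insert 0 E \<and> 0 \<in> F \<and> indep F}"
  have finF: "finite FF"
    unfolding FF_def using finE by (auto intro: finite_subset[OF _ finite_Pow_iff[THEN iffD2, of "insert 0 E"]])
  have "indep {0}"
    unfolding indep_def
  proof (intro allI impI)
    fix q assume q: "\<forall>e\<in>{0}. q e \<in> polyB B" "(\<Sum>e\<in>{0}. q e * ?x e) \<in> J"
    then have "q 0 \<in> J \<inter> polyB B" by simp
    then show "\<forall>e\<in>{0}. q e = 0" unfolding inj by simp
  qed
  then have "{0} \<in> FF" by (simp add: FF_def)
  then have "FF \<noteq> {}" by blast
  from finite_has_maximal[OF finF this] obtain F where Fm: "F \<in> FF" "\<forall>F'\<in>FF. F \<subseteq> F' \<longrightarrow> F = F'" by blast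
  then have F: "F \<subseteq> insert 0 E \<and> 0 \<in> F \<and> indep F" by (simp add: FF_def)
  have finFF: "finite F" using F finE finite_subset by blast
  have "\<exists>d s. d \<in> polyB B \<and> d \<noteq> 0 \<and> (\<forall>e'\<in>F. s e' \<in> polyB B) \<and> d * ?x e - (\<Sum>e'\<in>F. s e' * ?x e') \<in> J"
    if e: "e \<in> E" for e
  proof (cases "e \<in> F")
    case True
    have "(\<Sum>e'\<in>F. (if e' = e then 1 else 0) * ?x e') = (\<Sum>e'\<in>F. if e' = e then ?x e else 0)"
      by (rule sum.cong) auto
    also have "\<dots> = ?x e" using True finFF by simp
    finally have "1 * ?x e - (\<Sum>e'\<in>F. (if e' = e then 1 else 0) * ?x e') \<in> J" using pid.subspace_0[OF J] by simp
    then show ?thesis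
      by (intro exI[of _ 1] exI[of _ "\<lambda>e'. if e' = e then 1 else 0"]) (auto simp: polyB_1 polyB_def)
  next
    case False
    have "\<not> indep (insert e F)"
    proof
      assume "indep (insert e F)"
      then have "insert e F \<in> FF" using F e by (simp add: FF_def)
      then show False using Fm(2) False by blast
    qed
    then obtain q where q: "\<forall>e\<in>insert e F. q e \<in> polyB B" "(\<Sum>e\<in>insert e F. q e * ?x e) \<in> J" "\<exists>e'\<in>insert e F. q e' \<noteq> 0"
      unfolding indep_def by blast
    have s: "q e * ?x e + (\<Sum>e\<in>F. q e * ?x e) \<in> J" using q(2) False finFF by simp
    have "q e \<noteq> 0"
    proof
      assume "q e = 0"
      then have "(\<Sum>e\<in>F. q e * ?x e) \<in> J" using s by simp
      then have "\<forall>e\<in>F. q e = 0" using F q(1) unfolding indep_def by blast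
      then show False using q(3) \<open>q e = 0\<close> by blast
    qed
    moreover have "q e * ?x e - (\<Sum>e'\<in>F. - q e' * ?x e') \<in> J" using s by (simp add: sum_negf)
    ultimately show ?thesis
      using q(1) by (intro exI[of _ "q e"] exI[of _ "\<lambda>e'. - q e'"]) (auto intro: polyB_uminus)
  qed
  note ex = this
  have "\<forall>e\<in>E. \<exists>ds. fst ds \<in> polyB B \<and> fst ds \<noteq> 0 \<and> (\<forall>e'\<in>F. snd ds e' \<in> polyB B) \<and>
    fst ds * ?x e - (\<Sum>e'\<in>F. snd ds e' * ?x e') \<in> J"
  proof
    fix e assume "e \<in> E"
    from ex[OF this] obtain d s where "d \<in> polyB B \<and> d \<noteq> 0 \<and> (\<forall>e'\<in>F. s e' \<in> polyB B) \<and>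
      d * ?x e - (\<Sum>e'\<in>F. s e' * ?x e') \<in> J" by (elim exE)
    then show "\<exists>ds. fst ds \<in> polyB B \<and> fst ds \<noteq> 0 \<and> (\<forall>e'\<in>F. snd ds e' \<in> polyB B) \<and>
      fst ds * ?x e - (\<Sum>e'\<in>F. snd ds e' * ?x e') \<in> J" by (intro exI[of _ "(d, s)"]) simp
  qed
  from bchoice[OF this] obtain ds where ds: "\<forall>e\<in>E. fst (ds e) \<in> polyB B \<and> fst (ds e) \<noteq> 0 \<and> (\<forall>e'\<in>F. snd (ds e) e' \<in> polyB B) \<and>
    fst (ds e) * ?x e - (\<Sum>e'\<in>F. snd (ds e) e' * ?x e') \<in> J" ..
  define d where "d e = fst (ds e)" for e
  define s where "s e = snd (ds e)" for e
  have ds': "\<And>e. e \<in> E \<Longrightarrow> d e \<in> polyB B" "\<And>e. e \<in> E \<Longrightarrow> d e \<noteq> 0" "\<And>e e'. e \<in> E \<Longrightarrow> e' \<in> F \<Longrightarrow> s e e' \<in> polyB B"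
    "\<And>e. e \<in> E \<Longrightarrow> d e * ?x e - (\<Sum>e'\<in>F. s e e' * ?x e') \<in> J"
    using ds by (simp_all add: d_def s_def)
  \<comment> \<open>The product of the denominators \<open>d e\<close>; modulo \<open>J\<close>,
    \<open>Q\<close> times any monomial of \<open>E\<close> lies in the free module on
    \<open>F\<close>, with coefficients \<open>t\<close>.\<close>
  define Q where "Q = (\<Prod>e\<in>E. d e)"
  define t where "t e e' = (\<Prod>e''\<in>E - {e}. d e'') * s e e'" for e e'
  have QB: "Q \<in> polyB B" "Q \<noteq> 0" unfolding Q_def using ds' finE by (auto intro: polyB_prod simp: mpoly_prod_nonzero)
  have tB: "t e e' \<in> polyB B" if "e \<in> E" "e' \<in> F" for e e'
    unfolding t_def by (intro polyB_mult polyB_prod ds') (use that in auto)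
  have Qx: "Q * ?x e - (\<Sum>e'\<in>F. t e e' * ?x e') \<in> J" if e: "e \<in> E" for e
  proof -
    have "(\<Prod>e''\<in>E - {e}. d e'') * (d e * ?x e - (\<Sum>e'\<in>F. s e e' * ?x e')) \<in> J"
      by (intro pid.subspace_scale J ds' e)
    also have "(\<Prod>e''\<in>E - {e}. d e'') * (d e * ?x e - (\<Sum>e'\<in>F. s e e' * ?x e')) = Q * ?x e - (\<Sum>e'\<in>F. t e e' * ?x e')"
      by (simp add: Q_def t_def prod.remove[OF finE e] right_diff_distrib sum_distrib_left mult_ac)
    finally show ?thesis .
  qed
  have main: "Q * a ^ N \<in> polyBw B w (real N * c)" for N
  proof -
    have hN: "real N * c \<le> weight w \<mu>" if "\<mu> \<in> keys (h ^ N)" for \<mu>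
      using that
    proof (induction N arbitrary: \<mu>)
      case 0
      then show ?case using keys_one by auto
    next
      case (Suc N)
      then have "\<mu> \<in> keys (h * h ^ N)" by simp
      from subsetD[OF keys_mult this] obtain x y where "\<mu> = x + y" "x \<in> keys h" "y \<in> keys (h ^ N)" by auto
      then show ?case using h Suc.IH by (force simp: weight_add algebra_simps)
    qed
    obtain q where q: "\<forall>e\<in>E. q e \<in> polyBw B w (real N * c)" "h ^ N - (\<Sum>e\<in>E. q e * ?x e) \<in> J"
      using fin_over_rep[OF J fin w hN] by blast
    have "a ^ N - h ^ N \<in> J"
    proof (induction N)
      case (Suc N)
      have "a ^ Suc N - h ^ Suc N = a * (a ^ N - h ^ N) + h ^ N * (a - h)" by (simp add: algebra_simps)
      also have "\<dots> \<in> J" by (intro pid.subspace_add pid.subspace_scale J Suc a)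
      finally show ?case .
    qed (use pid.subspace_0[OF J] in simp)
    from pid.subspace_add[OF J this q(2)] have aq: "a ^ N - (\<Sum>e\<in>E. q e * ?x e) \<in> J" by simp
    define z where "z e' = (\<Sum>e\<in>E. q e * t e e')" for e'
    have "Q * (a ^ N - (\<Sum>e\<in>E. q e * ?x e)) + (\<Sum>e\<in>E. q e * (Q * ?x e - (\<Sum>e'\<in>F. t e e' * ?x e'))) \<in> J"
      by (intro pid.subspace_add pid.subspace_scale pid.subspace_sum J aq Qx)
    also have "Q * (a ^ N - (\<Sum>e\<in>E. q e * ?x e)) + (\<Sum>e\<in>E. q e * (Q * ?x e - (\<Sum>e'\<in>F. t e e' * ?x e')))
      = Q * a ^ N - (\<Sum>e\<in>E. \<Sum>e'\<in>F. q e * (t e e' * ?x e'))"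
      by (simp add: right_diff_distrib sum_subtractf sum_distrib_left mult.left_commute)
    also have "(\<Sum>e\<in>E. \<Sum>e'\<in>F. q e * (t e e' * ?x e')) = (\<Sum>e'\<in>F. z e' * ?x e')"
      by (subst sum.swap) (simp add: z_def sum_distrib_right mult.assoc)
    finally have zJ: "Q * a ^ N - (\<Sum>e'\<in>F. z e' * ?x e') \<in> J" .
    have aN: "a ^ N \<in> polyB B" for N by (induction N) (auto intro: polyB_1 polyB_mult a)
    have zB: "z e' \<in> polyBw B w (real N * c)" if "e' \<in> F" for e'
      unfolding z_def
    proof (rule polyBw_sum)
      fix e assume e: "e \<in> E"
      have "q e * t e e' \<in> polyBw B w (real N * c + 0)"
        by (rule polyBw_mult) (use q(1) e tB[OF e that] Bw in auto)
      then show "q e * t e e' \<in> polyBw B w (real N * c)" by simp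
    qed
    have zB0: "z e' \<in> polyB B" if "e' \<in> F" for e'
      using zB[OF that] by (auto simp: polyBw_def polyB_def)
    have F0: "0 \<in> F" "indep F" using F by auto
    \<comment> \<open>The difference of two expansions of \<open>Q * a ^ N\<close> in the free
      module on \<open>F\<close>; its coordinate at the monomial 1 gives
      \<open>Q * a ^ N = z 0\<close>.\<close>
    define u where "u e' = (if e' = 0 then Q * a ^ N - z 0 else - z e')" for e'
    have uB: "\<forall>e'\<in>F. u e' \<in> polyB B"
    proof
      fix e' assume e': "e' \<in> F"
      have "Q * a ^ N + - z 0 \<in> polyB B"
        using polyBw_add[of "Q * a ^ N" B w 0 "- z 0"] polyB_mult[OF QB(1) aN] polyB_uminus[OF zB0[OF F0(1)]] Bw by simp
      then show "u e' \<in> polyB B" using polyB_uminus[OF zB0[OF e']] by (simp add: u_def)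
    qed
    have "(\<Sum>e'\<in>F. u e' * ?x e') = Q * a ^ N - (\<Sum>e'\<in>F. z e' * ?x e')"
    proof -
      have "(\<Sum>e'\<in>F. u e' * ?x e') = (\<Sum>e'\<in>F. (if e' = 0 then Q * a ^ N else 0) - z e' * ?x e')"
        by (rule sum.cong) (auto simp: u_def left_diff_distrib)
      then show ?thesis using F0(1) finFF by (simp add: sum_subtractf)
    qed
    then have "(\<Sum>e'\<in>F. u e' * ?x e') \<in> J" using zJ by simp
    then have "\<forall>e\<in>F. u e = 0" using F0(2) uB unfolding indep_def by blast
    then have "u 0 = 0" using F0(1) by simp
    then have "Q * a ^ N = z 0" by (simp add: u_def)
    then show ?thesis using zB[OF F0(1)] by simp
  qed
  have r: "corder (wordr w lexo)" by (rule corder_wordr[OF corder_lexo])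
  have "a \<noteq> 0" using \<mu> by auto
  then obtain e where e: "is_lead (wordr w lexo) a e" using is_lead_ex[OF r] by blast
  obtain e0 where e0: "is_lead (wordr w lexo) Q e0" using is_lead_ex[OF r QB(2)] by blast
  \<comment> \<open>The loss \<open>weight w e0\<close> caused by \<open>Q\<close> does not grow
    with \<open>N\<close>, and \<open>e\<close> is a term of \<open>a\<close> of least
    weight.\<close>
  have lb: "real N * c \<le> weight w e0 + real N * weight w e" for N
  proof -
    obtain e' where e': "is_lead (wordr w lexo) (a ^ N) e'" "weight w e' = real N * weight w e"
      using is_lead_power[OF r e, of N] by blast
    have "e0 + e' \<in> keys (Q * a ^ N)" using is_lead_mult[OF r e0 e'(1)] by (simp add: is_lead_def)
    then show ?thesis using main[of N] e'(2) by (auto simp: polyBw_def weight_add)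
  qed
  have "c \<le> weight w e"
  proof (rule ccontr)
    assume "\<not> c \<le> weight w e"
    then have "0 < c - weight w e" by simp
    then obtain N where "weight w e0 < real N * (c - weight w e)" using reals_Archimedean3 by blast
    then show False using lb[of N] by (simp add: algebra_simps)
  qed
  moreover have "weight w e \<le> weight w \<mu>" using e \<mu> by (auto simp: is_lead_def wordr_def)
  ultimately show ?thesis by simp
qed

section \<open>Finiteness from independence of pure monomials\<close>

lemma mrestr_add: "mrestr B (\<mu> + \<nu>) = mrestr B \<mu> + mrestr B \<nu>"
  by (rule monomial_eqI) (simp add: lookup_mrestr lookup_add)

lemma mdegree_mrestr: "mdegree (mrestr B \<mu>) + mdegree (mrestr (- B) \<mu>) = mdegree \<mu>"
  unfolding mdegree_add[symmetric] mrestr_split ..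

lemma submonomial_of_degree:
  assumes "N \<le> mdegree \<nu>"
  shows "\<exists>\<kappa>. mle \<kappa> \<nu> \<and> mdegree \<kappa> = N"
  using assms
proof (induction "mdegree \<nu> - N" arbitrary: \<nu>)
  case 0
  then show ?case by (intro exI[of _ \<nu>]) simp
next
  case (Suc k)
  then have "\<nu> \<noteq> 0" by auto
  then obtain i where i: "lookup \<nu> i > 0" unfolding mono_degree_induct_add[symmetric] by (elim exE)
  have d: "mdegree \<nu> = 1 + mdegree (\<nu> - xvar i)"
    using arg_cong[OF xvar_dvd[OF i], of mdegree] by (simp add: mdegree_add)
  have "k = mdegree (\<nu> - xvar i) - N" "N \<le> mdegree (\<nu> - xvar i)" using Suc.hyps(2) d by linarith+
  from Suc.hyps(1)[OF this] obtain \<kappa> where "mle \<kappa> (\<nu> - xvar i)" "mdegree \<kappa> = N" by (elim exE conjE)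
  moreover have "mle (\<nu> - xvar i) \<nu>" by (simp add: mle_def lookup_minus)
  ultimately show ?case using mle_trans by blast
qed

definition pure_monomials :: "nat \<Rightarrow> 'n set \<Rightarrow> 'n::finite monomial set" where
  "pure_monomials N B = {\<kappa>. mdegree \<kappa> = N \<and> (\<forall>b\<in>B. lookup \<kappa> b = 0)}"

text \<open>A monomial of degree at least \<open>N\<close> off \<open>B\<close> has a divisor
  \<open>\<kappa>\<close> of degree \<open>N\<close> free of \<open>B\<close>. An element of
  \<open>J\<close> dual to \<open>\<kappa>\<close> replaces it by monomials of the same degree, each
  divisible by a variable of \<open>B\<close>; so the degree off \<open>B\<close> drops while the
  exponents in \<open>B\<close> only grow.\<close>

lemma fin_over_if_Ind:
  fixes J :: "('n::finite, 'k::field) mpoly set"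
  assumes J: "pid.subspace J" "graded J" and Ind: "Ind J (pure_monomials N B)"
  shows "fin_over J B {e. mdegree e < N}"
  unfolding fin_over_def
proof (intro conjI allI)
  show "finite {e :: 'n monomial. mdegree e < N}"
    by (rule finite_subset[OF _ finite_monomials_le[of N]]) auto
  fix \<nu> :: "'n monomial"
  let ?G = "\<lambda>\<nu> p. \<forall>\<mu>\<in>keys p. mrestr (- B) \<mu> \<in> {e. mdegree e < N} \<and> mdegree \<mu> = mdegree \<nu> \<and> (\<forall>b\<in>B. lookup \<nu> b \<le> lookup \<mu> b)"
  show "\<exists>p. single \<nu> 1 - p \<in> J \<and> ?G \<nu> p"
  proof (induction "mdegree (mrestr (- B) \<nu>)" arbitrary: \<nu> rule: less_induct)
    case less
    show ?case
    proof (cases "mdegree (mrestr (- B) \<nu>) < N")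
      case True
      then show ?thesis using pid.subspace_0[OF J(1)] by (intro exI[of _ "single \<nu> 1"]) simp
    next
      case False
      then obtain \<kappa> where \<kappa>: "mle \<kappa> (mrestr (- B) \<nu>)" "mdegree \<kappa> = N"
        using submonomial_of_degree[of N "mrestr (- B) \<nu>"] by auto
      have \<kappa>B: "lookup \<kappa> b = 0" if "b \<in> B" for b
        using \<kappa>(1) that unfolding mle_def by (metis ComplD le_zero_eq lookup_mrestr)
      have "mle \<kappa> \<nu>" using \<kappa>(1) unfolding mle_def lookup_mrestr by (metis le_zero_eq zero_le)
      define \<tau> where "\<tau> = \<nu> - \<kappa>"
      have \<nu>: "\<nu> = \<kappa> + \<tau>" using mle_minus[OF \<open>mle \<kappa> \<nu>\<close>] by (simp add: \<tau>_def)
      have mem: "\<kappa> \<in> pure_monomials N B" using \<kappa>(2) \<kappa>B by (simp add: pure_monomials_def)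
      obtain f0 where f0: "f0 \<in> J" "\<forall>c\<in>pure_monomials N B. lookup f0 c = (if c = \<kappa> then 1 else 0)"
        using Ind mem unfolding Ind_def by blast
      define f where "f = hcomp N f0"
      have f: "f \<in> J" "lookup f \<kappa> = 1" "\<And>\<mu>. \<mu> \<in> keys f \<Longrightarrow> mdegree \<mu> = N"
        "\<And>c. c \<in> pure_monomials N B \<Longrightarrow> c \<noteq> \<kappa> \<Longrightarrow> lookup f c = 0"
        using graded_hcomp[OF J(2) f0(1)] f0(2) mem \<kappa>(2)
        by (auto simp: f_def lookup_restrict_terms keys_restrict_terms)
      define f' where "f' = f - single \<kappa> 1"
      have lf': "lookup f' \<mu> = (if \<mu> = \<kappa> then 0 else lookup f \<mu>)" for \<mu>
        using f(2) by (simp add: f'_def lookup_minus lookup_single when_def)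
      have kf': "mdegree \<mu> = N" "\<mu> \<notin> pure_monomials N B" if \<mu>: "\<mu> \<in> keys f'" for \<mu>
      proof -
        have "\<mu> \<noteq> \<kappa>" "\<mu> \<in> keys f" using \<mu> by (auto simp: in_keys_iff lf' split: if_splits)
        then show "mdegree \<mu> = N" "\<mu> \<notin> pure_monomials N B" using f(3,4)[of \<mu>] by (auto simp: in_keys_iff)
      qed
      have "\<forall>\<mu>\<in>keys f'. \<exists>p. single (\<tau> + \<mu>) 1 - p \<in> J \<and> ?G (\<tau> + \<mu>) p"
      proof
        fix \<mu> assume \<mu>: "\<mu> \<in> keys f'"
        obtain b where b: "b \<in> B" "lookup \<mu> b > 0" using kf'[OF \<mu>] by (auto simp: pure_monomials_def)
        have "lookup (mrestr B \<mu>) b \<le> mdegree (mrestr B \<mu>)" by (rule lookup_le_mdegree)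
        then have "mdegree (mrestr (- B) \<mu>) < N"
          using mdegree_mrestr[of B \<mu>] kf'(1)[OF \<mu>] b by (simp add: lookup_mrestr)
        moreover have "mrestr (- B) \<kappa> = \<kappa>"
          by (rule monomial_eqI) (simp add: lookup_mrestr \<kappa>B)
        ultimately have "mdegree (mrestr (- B) (\<tau> + \<mu>)) < mdegree (mrestr (- B) \<nu>)"
          unfolding \<nu> mrestr_add mdegree_add using \<kappa>(2) by simp
        from less.hyps[OF this] show "\<exists>p. single (\<tau> + \<mu>) 1 - p \<in> J \<and> ?G (\<tau> + \<mu>) p" .
      qed
      from bchoice[OF this] obtain p where "\<forall>\<mu>\<in>keys f'. single (\<tau> + \<mu>) 1 - p \<mu> \<in> J \<and> ?G (\<tau> + \<mu>) (p \<mu>)" ..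
      then have p: "\<And>\<mu>. \<mu> \<in> keys f' \<Longrightarrow> single (\<tau> + \<mu>) 1 - p \<mu> \<in> J" "\<And>\<mu>. \<mu> \<in> keys f' \<Longrightarrow> ?G (\<tau> + \<mu>) (p \<mu>)" by blast+
      define q where "q = (\<Sum>\<mu>\<in>keys f'. single 0 (- lookup f' \<mu>) * p \<mu>)"
      have "single \<tau> 1 * f = single \<nu> 1 + (\<Sum>\<mu>\<in>keys f'. single 0 (lookup f' \<mu>) * single (\<tau> + \<mu>) 1)"
      proof -
        have "single \<tau> 1 * f = single \<tau> 1 * single \<kappa> 1 + single \<tau> 1 * f'" by (simp add: f'_def right_diff_distrib)
        also have "single \<tau> (1 :: 'k) * single \<kappa> 1 = single \<nu> 1" by (simp add: mult_single \<nu> add.commute)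
        also have "single \<tau> 1 * f' = (\<Sum>\<mu>\<in>keys f'. single \<tau> 1 * single \<mu> (lookup f' \<mu>))"
          by (subst mpoly_expansion[of f']) (rule sum_distrib_left)
        finally show ?thesis by (simp add: mult_single)
      qed
      then have "single \<nu> 1 - q = single \<tau> 1 * f - (\<Sum>\<mu>\<in>keys f'. single 0 (lookup f' \<mu>) * (single (\<tau> + \<mu>) 1 - p \<mu>))"
        by (simp add: q_def right_diff_distrib sum_subtractf single_uminus sum_negf)
      also have "\<dots> \<in> J" by (intro pid.subspace_diff pid.subspace_scale pid.subspace_sum J f p)
      finally have "single \<nu> 1 - q \<in> J" .
      moreover have "?G \<nu> q"
      proof
        fix \<rho> assume "\<rho> \<in> keys q"
        from subsetD[OF keys_sum this[unfolded q_def]] obtain \<mu> where \<mu>: "\<mu> \<in> keys f'" "\<rho> \<in> keys (single 0 (- lookup f' \<mu>) * p \<mu>)"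
          by (elim UN_E)
        from subsetD[OF keys_const_mult \<mu>(2)] have "\<rho> \<in> keys (p \<mu>)" .
        with p(2)[OF \<mu>(1)] have \<rho>: "mrestr (- B) \<rho> \<in> {e. mdegree e < N}" "mdegree \<rho> = mdegree (\<tau> + \<mu>)"
          "\<forall>b\<in>B. lookup (\<tau> + \<mu>) b \<le> lookup \<rho> b" by blast+
        have "mdegree \<rho> = mdegree \<nu>" using \<rho>(2) kf'(1)[OF \<mu>(1)] \<kappa>(2) by (simp add: mdegree_add \<nu>)
        moreover have "\<forall>b\<in>B. lookup \<nu> b \<le> lookup \<rho> b" using \<rho>(3) \<kappa>B by (auto simp: \<nu> lookup_add)
        ultimately show "mrestr (- B) \<rho> \<in> {e. mdegree e < N} \<and> mdegree \<rho> = mdegree \<nu> \<and> (\<forall>b\<in>B. lookup \<nu> b \<le> lookup \<rho> b)"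
          using \<rho>(1) by blast
      qed
      ultimately show ?thesis by blast
    qed
  qed
qed

section \<open>Chains of primes\<close>

lemma summand_mem: "pid.subspace P \<Longrightarrow> x \<in> P \<Longrightarrow> x = y + z \<Longrightarrow> z \<in> P \<Longrightarrow> y \<in> P"
  using pid.subspace_diff[of P x z] by simp

text \<open>In a relation modulo \<open>P j\<close> the lowest power of \<open>f j\<close> can be
  cancelled, since \<open>f j\<close> is not in the prime \<open>P j\<close>. The rest, read modulo
  \<open>P (Suc j)\<close>, loses all terms still containing \<open>f j\<close> and becomes a
  relation among the later elements.\<close>

lemma chain_algebraically_independent:
  fixes P :: "nat \<Rightarrow> ('n::finite, 'k::field) mpoly set"
  assumes P: "\<And>i. i \<le> k \<Longrightarrow> isprime (P i)" "\<And>i. i < k \<Longrightarrow> P i \<subseteq> P (Suc i)"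
    and f: "\<And>i. i < k \<Longrightarrow> f i \<in> P (Suc i)" "\<And>i. i < k \<Longrightarrow> f i \<notin> P i"
    and "j \<le> k" "finite A" "\<And>\<alpha> i. \<alpha> \<in> A \<Longrightarrow> i \<notin> {j..<k} \<Longrightarrow> \<alpha> i = 0"
    and "(\<Sum>\<alpha>\<in>A. single 0 (c \<alpha>) * (\<Prod>i\<in>{j..<k}. f i ^ \<alpha> i)) \<in> P j"
  shows "\<forall>\<alpha>\<in>A. c \<alpha> = 0"
  using assms(5-)
proof (induction j arbitrary: A c rule: inc_induct)
  case base
  have sP: "pid.subspace (P k)" "1 \<notin> P k" using P(1)[of k] by (auto simp: isprime_def)
  show ?case
  proof (rule ccontr)
    assume "\<not> ?thesis"
    then obtain \<alpha> where \<alpha>: "\<alpha> \<in> A" "c \<alpha> \<noteq> 0" by auto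
    have "\<beta> = \<alpha>" if "\<beta> \<in> A" for \<beta> using base(2)[OF that] base(2)[OF \<alpha>(1)] by auto
    then have "A = {\<alpha>}" using \<alpha>(1) by blast
    then have "single 0 (c \<alpha>) \<in> P k" using base(3) by simp
    from pid.subspace_scale[OF sP(1) this, of "single 0 (1 / c \<alpha>)"] \<alpha>(2) show False using sP(2) by (simp add: mult_single)
  qed
next
  case (step j)
  have j: "j < k" using step by simp
  have sP: "pid.subspace (P (Suc j))" using P(1)[of "Suc j"] j by (auto simp: isprime_def)
  have pj: "isprime (P j)" using P(1)[of j] j by simp
  show ?case
  proof (rule ccontr)
    assume nz: "\<not> (\<forall>\<alpha>\<in>A. c \<alpha> = 0)"
    define A1 where "A1 = {\<alpha>\<in>A. c \<alpha> \<noteq> 0}"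
    have A1: "finite A1" "A1 \<noteq> {}" using nz step.prems(1) by (auto simp: A1_def)
    define s where "s = Min ((\<lambda>\<alpha>. \<alpha> j) ` A1)"
    have smin: "s \<le> \<alpha> j" if "\<alpha> \<in> A1" for \<alpha> using that A1 by (simp add: s_def)
    let ?p = "\<lambda>\<alpha>. \<Prod>i\<in>{Suc j..<k}. f i ^ \<alpha> i"
    define inner where "inner = (\<Sum>\<alpha>\<in>A1. single 0 (c \<alpha>) * (f j ^ (\<alpha> j - s) * ?p \<alpha>))"
    have "(\<Sum>\<alpha>\<in>A. single 0 (c \<alpha>) * (\<Prod>i\<in>{j..<k}. f i ^ \<alpha> i)) = (\<Sum>\<alpha>\<in>A1. single 0 (c \<alpha>) * (\<Prod>i\<in>{j..<k}. f i ^ \<alpha> i))"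
      by (rule sum.mono_neutral_right) (use step.prems(1) in \<open>auto simp: A1_def\<close>)
    also have "\<dots> = f j ^ s * inner"
      unfolding inner_def sum_distrib_left
    proof (rule sum.cong)
      fix \<alpha> assume \<alpha>: "\<alpha> \<in> A1"
      have "(\<Prod>i\<in>{j..<k}. f i ^ \<alpha> i) = f j ^ \<alpha> j * ?p \<alpha>" by (rule prod.atLeast_Suc_lessThan[OF j])
      also have "f j ^ \<alpha> j = f j ^ s * f j ^ (\<alpha> j - s)" using smin[OF \<alpha>] by (simp flip: power_add)
      finally show "single 0 (c \<alpha>) * (\<Prod>i\<in>{j..<k}. f i ^ \<alpha> i) = f j ^ s * (single 0 (c \<alpha>) * (f j ^ (\<alpha> j - s) * ?p \<alpha>))"
        by (simp only: mult_ac)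
    qed simp
    finally have "f j ^ s * inner \<in> P j" using step.prems(3) by simp
    then have "f j ^ s \<in> P j \<or> inner \<in> P j" using pj unfolding isprime_def by blast
    then have "inner \<in> P j" using isprime_power[OF pj] f(2)[OF j] by blast
    then have inner: "inner \<in> P (Suc j)" using P(2)[OF j] by blast
    define A2 where "A2 = {\<alpha>\<in>A1. \<alpha> j = s}"
    have "inner = (\<Sum>\<alpha>\<in>A2. single 0 (c \<alpha>) * (f j ^ (\<alpha> j - s) * ?p \<alpha>)) + (\<Sum>\<alpha>\<in>A1 - A2. single 0 (c \<alpha>) * (f j ^ (\<alpha> j - s) * ?p \<alpha>))"
      unfolding inner_def using A1(1) by (subst add.commute) (rule sum.subset_diff, auto simp: A2_def)
    moreover have "(\<Sum>\<alpha>\<in>A1 - A2. single 0 (c \<alpha>) * (f j ^ (\<alpha> j - s) * ?p \<alpha>)) \<in> P (Suc j)"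
    proof (rule pid.subspace_sum[OF sP])
      fix \<alpha> assume \<alpha>: "\<alpha> \<in> A1 - A2"
      then have "\<alpha> j - s > 0" using smin[of \<alpha>] by (auto simp: A2_def)
      then obtain m where m: "\<alpha> j - s = Suc m" using gr0_implies_Suc by blast
      have "(single 0 (c \<alpha>) * (f j ^ m * ?p \<alpha>)) * f j \<in> P (Suc j)" by (rule pid.subspace_scale[OF sP f(1)[OF j]])
      then show "single 0 (c \<alpha>) * (f j ^ (\<alpha> j - s) * ?p \<alpha>) \<in> P (Suc j)" unfolding m power_Suc by (simp only: mult_ac)
    qed
    ultimately have "(\<Sum>\<alpha>\<in>A2. single 0 (c \<alpha>) * (f j ^ (\<alpha> j - s) * ?p \<alpha>)) \<in> P (Suc j)"
      by (rule summand_mem[OF sP inner])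
    also have "(\<Sum>\<alpha>\<in>A2. single 0 (c \<alpha>) * (f j ^ (\<alpha> j - s) * ?p \<alpha>)) = (\<Sum>\<alpha>\<in>A2. single 0 (c \<alpha>) * ?p \<alpha>)"
      by (rule sum.cong) (auto simp: A2_def)
    \<comment> \<open>Exponent vectors get entry 0 at \<open>j\<close>, as the induction hypothesis
      expects; on \<open>A2\<close> this entry is constantly \<open>s\<close>, so nothing is
      lost.\<close>
    also have "\<dots> = (\<Sum>\<beta>\<in>(\<lambda>\<alpha>. \<alpha>(j := 0)) ` A2. single 0 (c (\<beta>(j := s))) * ?p \<beta>)"
    proof (rule sum.reindex_cong[where l = "\<lambda>\<beta>. \<beta>(j := s)"])
      show "inj_on (\<lambda>\<beta>. \<beta>(j := s)) ((\<lambda>\<alpha>. \<alpha>(j := 0)) ` A2)"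
        by (rule inj_on_inverseI[of _ "\<lambda>\<alpha>. \<alpha>(j := 0)"]) auto
      show "A2 = (\<lambda>\<beta>. \<beta>(j := s)) ` (\<lambda>\<alpha>. \<alpha>(j := 0)) ` A2"
        by (auto simp: A2_def image_image fun_upd_idem)
    qed (auto intro!: prod.cong)
    finally have sm: "(\<Sum>\<beta>\<in>(\<lambda>\<alpha>. \<alpha>(j := 0)) ` A2. single 0 (c (\<beta>(j := s))) * ?p \<beta>) \<in> P (Suc j)" .
    have "\<forall>\<beta>\<in>(\<lambda>\<alpha>. \<alpha>(j := 0)) ` A2. c (\<beta>(j := s)) = 0"
    proof (rule step.IH[OF _ _ sm])
      show "finite ((\<lambda>\<alpha>. \<alpha>(j := 0)) ` A2)" using A1 by (simp add: A2_def)
      fix \<beta> i assume "\<beta> \<in> (\<lambda>\<alpha>. \<alpha>(j := 0)) ` A2" "i \<notin> {Suc j..<k}"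
      then show "\<beta> i = 0" using step.prems(2)[of _ i] by (cases "i = j") (auto simp: A2_def A1_def)
    qed
    moreover have "s \<in> (\<lambda>\<alpha>. \<alpha> j) ` A1" unfolding s_def by (rule Min_in) (use A1 in auto)
    then obtain \<alpha> where \<alpha>: "\<alpha> \<in> A2" by (auto simp: A2_def)
    ultimately have "c (\<alpha>(j := 0, j := s)) = 0" by blast
    then have "c \<alpha> = 0" using \<alpha> by (simp add: A2_def fun_upd_idem)
    then show False using \<alpha> by (simp add: A2_def A1_def)
  qed
qed

text \<open>A monomial is determined by its exponents on \<open>B\<close> and its part off
  \<open>B\<close>. The point is growth in \<open>L\<close> of order \<open>card B\<close>.\<close>

lemma card_monomials_fin_over:
  fixes B :: "'n::finite set"
  assumes "finite E"
  shows "card {\<mu>. mdegree \<mu> \<le> L \<and> mrestr (- B) \<mu> \<in> E} \<le> (L + 1) ^ card B * card E"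
proof -
  let ?M = "{\<mu> :: 'n monomial. mdegree \<mu> \<le> L \<and> mrestr (- B) \<mu> \<in> E}"
  let ?h = "\<lambda>\<mu> :: 'n monomial. (restrict (lookup \<mu>) B, mrestr (- B) \<mu>)"
  have inj: "inj_on ?h ?M"
  proof (rule inj_onI)
    fix \<mu> \<nu> :: "'n monomial" assume eq: "?h \<mu> = ?h \<nu>"
    show "\<mu> = \<nu>"
    proof (rule monomial_eqI)
      fix i
      show "lookup \<mu> i = lookup \<nu> i"
      proof (cases "i \<in> B")
        case True
        have "restrict (lookup \<mu>) B i = restrict (lookup \<nu>) B i" using eq by simp
        then show ?thesis using True by simp
      next
        case False
        have "lookup (mrestr (- B) \<mu>) i = lookup (mrestr (- B) \<nu>) i" using eq by simp
        then show ?thesis using False by (simp add: lookup_mrestr)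
      qed
    qed
  qed
  have "?h ` ?M \<subseteq> (PiE B (\<lambda>_. {..L})) \<times> E"
    using lookup_le_mdegree le_trans by (fastforce simp: PiE_def)
  then have "card ?M \<le> card ((PiE B (\<lambda>_. {..L})) \<times> E)"
    by (rule card_inj_on_le[OF inj]) (intro finite_cartesian_product finite_PiE assms, auto)
  also have "\<dots> = (L + 1) ^ card B * card E"
    by (simp only: card_cartesian_product card_PiE[OF finite] prod_constant card_atMost Suc_eq_plus1)
  finally show ?thesis .
qed

lemma keys_power_degree:
  assumes "\<And>\<mu>. \<mu> \<in> keys f \<Longrightarrow> mdegree \<mu> \<le> e" "\<mu> \<in> keys (f ^ k)"
  shows "mdegree \<mu> \<le> k * e"
  using assms(2)
proof (induction k arbitrary: \<mu>)
  case 0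
  then show ?case using keys_one by auto
next
  case (Suc k)
  then have "\<mu> \<in> keys (f * f ^ k)" by simp
  from subsetD[OF keys_mult this] obtain x y where "\<mu> = x + y" "x \<in> keys f" "y \<in> keys (f ^ k)" by auto
  then show ?case using assms(1)[of x] Suc.IH[of y] by (simp add: mdegree_add)
qed

lemma keys_prod_degree:
  assumes "finite A" "\<And>i \<mu>. i \<in> A \<Longrightarrow> \<mu> \<in> keys (f i) \<Longrightarrow> mdegree \<mu> \<le> e" "\<mu> \<in> keys (prod f A)"
  shows "mdegree \<mu> \<le> card A * e"
  using assms
proof (induction A arbitrary: \<mu> rule: finite_induct)
  case empty
  then show ?case using keys_one by auto
next
  case (insert a A)
  then have "\<mu> \<in> keys (f a * prod f A)" by simp
  from subsetD[OF keys_mult this] obtain x y where xy: "\<mu> = x + y" "x \<in> keys (f a)" "y \<in> keys (prod f A)" by auto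
  have "mdegree x \<le> e" using insert.prems(1)[of a x] xy by simp
  moreover have "mdegree y \<le> card A * e" by (rule insert.IH) (use insert.prems xy in auto)
  ultimately show ?case using insert.hyps xy(1) by (simp add: mdegree_add)
qed

text \<open>There are \<open>T ^ k\<close> products of the \<open>k\<close> separating elements with
  exponents below \<open>T\<close>, but modulo \<open>J\<close> they live in a space of dimension at
  most \<open>C * T ^ card B\<close>. For \<open>k > card B\<close> and \<open>T > C\<close> this
  forces a relation, against algebraic independence along the chain.\<close>

lemma chain_length_le:
  fixes J :: "('n::finite, 'k::field) mpoly set"
  assumes J: "pid.subspace J" and fin: "fin_over J B E" and ch: "chain_of_primes J k P"
  shows "k \<le> card B"
proof (rule ccontr)
  assume "\<not> k \<le> card B"
  let ?d = "card B"
  have P: "\<And>i. i \<le> k \<Longrightarrow> isprime (P i)" "\<And>i. i \<le> k \<Longrightarrow> J \<subseteq> P i" "\<And>i. i < k \<Longrightarrow> P i \<subset> P (Suc i)"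
    using ch by (auto simp: chain_of_primes_def)
  have "\<forall>i\<in>{..<k}. \<exists>f. f \<in> P (Suc i) \<and> f \<notin> P i" using P(3) by blast
  from bchoice[OF this] obtain f where f: "\<And>i. i < k \<Longrightarrow> f i \<in> P (Suc i)" "\<And>i. i < k \<Longrightarrow> f i \<notin> P i" by auto
  define e where "e = Max (insert 0 (mdegree ` (\<Union>i<k. keys (f i))))"
  have e: "mdegree \<mu> \<le> e" if "i < k" "\<mu> \<in> keys (f i)" for i \<mu>
    unfolding e_def by (rule Max_ge) (use that in auto)
  have finE: "finite E" using fin by (simp add: fin_over_def)
  \<comment> \<open>\<open>L\<close> bounds the degrees of the products. As
    \<open>L + 1 \<le> (k * e + 1) * T\<close>, the number of reduced monomials is at most
    \<open>C * T ^ card B\<close>, and \<open>T = C + 1\<close> makes this less than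
    \<open>T ^ Suc (card B)\<close>.\<close>
  define C where "C = card E * (k * e + 1) ^ ?d"
  define T where "T = C + 1"
  define L where "L = k * (T * e)"
  \<comment> \<open>Exponent vectors extended by 0, the form expected by
    \<open>chain_algebraically_independent\<close>.\<close>
  define A where "A = (\<lambda>\<beta> i. if i < k then \<beta> i else 0) ` PiE {..<k} (\<lambda>_. {..<T})"
  have "inj_on (\<lambda>\<beta> i. if i < k then \<beta> i else (0::nat)) (PiE {..<k} (\<lambda>_. {..<T}))"
  proof (rule inj_onI)
    fix \<beta> \<gamma> assume \<beta>: "\<beta> \<in> PiE {..<k} (\<lambda>_. {..<T})" "\<gamma> \<in> PiE {..<k} (\<lambda>_. {..<T})"
      and eq: "(\<lambda>i. if i < k then \<beta> i else (0::nat)) = (\<lambda>i. if i < k then \<gamma> i else 0)"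
    show "\<beta> = \<gamma>"
    proof (rule PiE_ext[OF \<beta>])
      fix i assume "i \<in> {..<k}"
      then show "\<beta> i = \<gamma> i" using fun_cong[OF eq, of i] by simp
    qed
  qed
  then have cardA: "card A = T ^ k" unfolding A_def by (simp add: card_image card_PiE)
  have finA: "finite A" unfolding A_def by (intro finite_imageI finite_PiE) auto
  let ?M = "{\<mu>. mdegree \<mu> \<le> L \<and> mrestr (- B) \<mu> \<in> E}"
  have finM: "finite ?M" by (rule finite_subset[OF _ finite_monomials_le[of L]]) auto
  have "card ?M \<le> (L + 1) ^ ?d * card E" by (rule card_monomials_fin_over[OF finE])
  also have "\<dots> \<le> ((k * e + 1) * T) ^ ?d * card E"
    by (intro mult_right_mono power_mono) (auto simp: L_def T_def algebra_simps)
  also have "\<dots> = C * T ^ ?d" by (simp add: C_def power_mult_distrib)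
  also have "\<dots> < T * T ^ ?d" by (simp add: T_def)
  also have "\<dots> \<le> T ^ k"
    using power_increasing[of "Suc ?d" k T] \<open>\<not> k \<le> card B\<close> by (simp add: T_def)
  finally have less: "card ?M < card A" unfolding cardA .
  let ?F = "\<lambda>\<alpha>. \<Prod>i\<in>{0..<k}. f i ^ \<alpha> i"
  have "\<exists>q. ?F \<alpha> - q \<in> J \<and> keys q \<subseteq> ?M" if \<alpha>: "\<alpha> \<in> A" for \<alpha>
  proof -
    have \<alpha>T: "\<alpha> i \<le> T" if "i < k" for i using \<alpha> that by (auto simp: A_def PiE_def Pi_def less_imp_le)
    have deg: "mdegree \<mu> \<le> L" if "\<mu> \<in> keys (?F \<alpha>)" for \<mu>
    proof -
      have "mdegree \<mu> \<le> card {0..<k} * (T * e)"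
      proof (rule keys_prod_degree[OF _ _ that])
        fix i \<nu> assume i: "i \<in> {0..<k}" "\<nu> \<in> keys (f i ^ \<alpha> i)"
        have "mdegree \<nu> \<le> \<alpha> i * e" by (rule keys_power_degree[OF _ i(2)]) (use e i in auto)
        also have "\<dots> \<le> T * e" using \<alpha>T i by simp
        finally show "mdegree \<nu> \<le> T * e" .
      qed simp
      then show ?thesis by (simp add: L_def)
    qed
    from fin_over_poly[OF J fin, of "?F \<alpha>"] obtain q where q: "?F \<alpha> - q \<in> J"
      "\<forall>\<mu>\<in>keys q. mrestr (- B) \<mu> \<in> E \<and> (\<exists>\<nu>\<in>keys (?F \<alpha>). mdegree \<mu> = mdegree \<nu> \<and> (\<forall>b\<in>B. lookup \<nu> b \<le> lookup \<mu> b))"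
      by (elim exE conjE)
    have "keys q \<subseteq> ?M"
    proof
      fix \<mu> assume "\<mu> \<in> keys q"
      with q(2) obtain \<nu> where "mrestr (- B) \<mu> \<in> E" "\<nu> \<in> keys (?F \<alpha>)" "mdegree \<mu> = mdegree \<nu>" by blast
      then show "\<mu> \<in> ?M" using deg by simp
    qed
    then show ?thesis using q(1) by blast
  qed
  then have "\<forall>\<alpha>\<in>A. \<exists>q. ?F \<alpha> - q \<in> J \<and> keys q \<subseteq> ?M" by blast
  from bchoice[OF this] obtain q where "\<forall>\<alpha>\<in>A. ?F \<alpha> - q \<alpha> \<in> J \<and> keys (q \<alpha>) \<subseteq> ?M" ..
  then have q: "\<And>\<alpha>. \<alpha> \<in> A \<Longrightarrow> ?F \<alpha> - q \<alpha> \<in> J" "\<And>\<alpha>. \<alpha> \<in> A \<Longrightarrow> keys (q \<alpha>) \<subseteq> ?M" by blast+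
  from homogeneous_system[OF finM finA less, of "\<lambda>\<mu> \<alpha>. lookup (q \<alpha>) \<mu>"]
  obtain c where c: "\<exists>\<alpha>\<in>A. c \<alpha> \<noteq> 0" "\<forall>\<mu>\<in>?M. (\<Sum>\<alpha>\<in>A. lookup (q \<alpha>) \<mu> * c \<alpha>) = 0" by (elim exE conjE)
  have "(\<Sum>\<alpha>\<in>A. single 0 (c \<alpha>) * q \<alpha>) = 0"
  proof (rule poly_mapping_eqI)
    fix \<mu>
    show "lookup (\<Sum>\<alpha>\<in>A. single 0 (c \<alpha>) * q \<alpha>) \<mu> = lookup 0 \<mu>"
    proof (cases "\<mu> \<in> ?M")
      case True
      then show ?thesis using c(2) by (simp add: lookup_sum mult.commute[of "c _"])
    next
      case False
      have "lookup (q \<alpha>) \<mu> = 0" if "\<alpha> \<in> A" for \<alpha> using q(2)[OF that] False by (auto simp: in_keys_iff)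
      then show ?thesis by (simp add: lookup_sum)
    qed
  qed
  then have "(\<Sum>\<alpha>\<in>A. single 0 (c \<alpha>) * ?F \<alpha>) = (\<Sum>\<alpha>\<in>A. single 0 (c \<alpha>) * (?F \<alpha> - q \<alpha>))"
    by (simp add: right_diff_distrib sum_subtractf)
  also have "\<dots> \<in> J" by (intro pid.subspace_sum pid.subspace_scale J q)
  finally have "(\<Sum>\<alpha>\<in>A. single 0 (c \<alpha>) * ?F \<alpha>) \<in> J" .
  from subsetD[OF P(2)[OF le0] this] have sum0: "(\<Sum>\<alpha>\<in>A. single 0 (c \<alpha>) * ?F \<alpha>) \<in> P 0" .
  have "\<forall>\<alpha>\<in>A. c \<alpha> = 0"
  proof (rule chain_algebraically_independent[where P = P and f = f and k = k and j = 0])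
    show "isprime (P i)" if "i \<le> k" for i by (rule P(1)[OF that])
    show "P i \<subseteq> P (Suc i)" if "i < k" for i using P(3)[OF that] by blast
    show "f i \<in> P (Suc i)" "f i \<notin> P i" if "i < k" for i by (rule f(1)[OF that], rule f(2)[OF that])
    show "\<alpha> i = 0" if \<alpha>: "\<alpha> \<in> A" "i \<notin> {0..<k}" for \<alpha> i
    proof -
      obtain \<beta> where "\<alpha> = (\<lambda>i. if i < k then \<beta> i else 0)" using \<alpha>(1) unfolding A_def by (rule imageE)
      then show ?thesis using \<alpha>(2) by simp
    qed
  qed (use finA sum0 in auto)
  then show False using c(1) by blast
qed

text \<open>Zorn's lemma: an ideal maximal among those disjoint from a multiplicatively closed set
  is prime.\<close>

lemma prime_avoiding:
  fixes J :: "('n::finite, 'k::field) mpoly set"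
  assumes J: "pid.subspace J" and S: "1 \<in> S" "\<And>a b. a \<in> S \<Longrightarrow> b \<in> S \<Longrightarrow> a * b \<in> S" and dis: "J \<inter> S = {}"
  shows "\<exists>P. isprime P \<and> J \<subseteq> P \<and> P \<inter> S = {}"
proof -
  define QQ where "QQ = {Q. pid.subspace Q \<and> J \<subseteq> Q \<and> Q \<inter> S = {}}"
  have "QQ \<noteq> {}" using J dis by (auto simp: QQ_def)
  moreover have "\<Union>C \<in> QQ" if C: "C \<noteq> {}" "subset.chain QQ C" for C
  proof -
    have CQ: "Q \<in> QQ" if "Q \<in> C" for Q using C(2) that by (auto simp: subset.chain_def)
    have ch: "Q \<subseteq> Q' \<or> Q' \<subseteq> Q" if "Q \<in> C" "Q' \<in> C" for Q Q'
      using C(2) that by (auto simp: subset.chain_def)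
    have "pid.subspace (\<Union>C)"
    proof (rule pid.subspaceI)
      obtain Q where "Q \<in> C" using C(1) by blast
      moreover from this have "pid.subspace Q" using CQ by (simp add: QQ_def)
      ultimately show "0 \<in> \<Union>C" using pid.subspace_0 by blast
      show "x + y \<in> \<Union>C" if xy: "x \<in> \<Union>C" "y \<in> \<Union>C" for x y
      proof -
        obtain Q Q' where Q: "Q \<in> C" "x \<in> Q" "Q' \<in> C" "y \<in> Q'" using xy by blast
        obtain R where "R \<in> C" "x \<in> R" "y \<in> R" using ch[OF Q(1,3)] Q by blast
        then show ?thesis using CQ[of R] pid.subspace_add[of R x y] by (auto simp: QQ_def)
      qed
      show "c * x \<in> \<Union>C" if x: "x \<in> \<Union>C" for c x
      proof -
        obtain R where "R \<in> C" "x \<in> R" using x by blast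
        then show ?thesis using CQ[of R] pid.subspace_scale[of R x c] by (auto simp: QQ_def)
      qed
    qed
    then show ?thesis using CQ C(1) unfolding QQ_def by blast
  qed
  ultimately obtain M where M: "M \<in> QQ" "\<forall>Q\<in>QQ. M \<subseteq> Q \<longrightarrow> Q = M"
    using subset_Zorn_nonempty[of QQ] by blast
  have sM: "pid.subspace M" "J \<subseteq> M" "M \<inter> S = {}" using M(1) by (simp_all add: QQ_def)
  have meet: "\<exists>k m. m \<in> M \<and> m + k * a \<in> S" if a: "a \<notin> M" for a
  proof -
    have "pid.span (insert a M) \<notin> QQ"
    proof
      assume "pid.span (insert a M) \<in> QQ"
      then have "pid.span (insert a M) = M" using M(2) pid.span_superset[of "insert a M"] by blast
      then show False using a pid.span_superset[of "insert a M"] by blast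
    qed
    then have "pid.span (insert a M) \<inter> S \<noteq> {}"
      using sM(2) pid.span_superset[of "insert a M"] unfolding QQ_def by blast
    then obtain s where s: "s \<in> pid.span (insert a M)" "s \<in> S" by blast
    then obtain k where "s - k * a \<in> pid.span M" using pid.span_breakdown_eq by blast
    then have "s - k * a \<in> M" using pid.span_eq_iff[THEN iffD2, OF sM(1)] by simp
    then show ?thesis using s(2) by (intro exI[of _ k] exI[of _ "s - k * a"]) simp
  qed
  have "a \<in> M \<or> b \<in> M" if ab: "a * b \<in> M" for a b
  proof (rule ccontr)
    assume "\<not> (a \<in> M \<or> b \<in> M)"
    then obtain k m k' m' where km: "m \<in> M" "m + k * a \<in> S" "m' \<in> M" "m' + k' * b \<in> S" using meet by metis
    have "(m + k * a) * (m' + k' * b) = (m' + k' * b) * m + (k * a) * m' + (k * k') * (a * b)"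
      by (simp add: algebra_simps)
    also have "\<dots> \<in> M" by (intro pid.subspace_add pid.subspace_scale sM km ab)
    finally show False using S(2)[OF km(2,4)] sM(3) by blast
  qed
  then have "isprime M" using sM S(1) unfolding isprime_def by blast
  then show ?thesis using sM by blast
qed

lemma prime_avoiding_polyB:
  fixes J :: "('n::finite, 'k::field) mpoly set"
  assumes J: "pid.subspace J" and dis: "J \<inter> polyB B = {0}"
  shows "\<exists>P. isprime P \<and> J \<subseteq> P \<and> P \<inter> polyB B = {0}"
proof -
  have "\<exists>P. isprime P \<and> J \<subseteq> P \<and> P \<inter> (polyB B - {0}) = {}"
  proof (rule prime_avoiding[OF J])
    show "1 \<in> polyB B - {0}" using polyB_1 by simp
    show "a * b \<in> polyB B - {0}" if "a \<in> polyB B - {0}" "b \<in> polyB B - {0}" for a b :: "('n, 'k) mpoly"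
      using that polyB_mult mpoly_mult_eq_0[of a b] by auto
    show "J \<inter> (polyB B - {0}) = {}" using dis by blast
  qed
  then obtain P where P: "isprime P" "J \<subseteq> P" "P \<inter> (polyB B - {0}) = {}" by blast
  have "0 \<in> P \<inter> polyB B" using P(1) pid.subspace_0 by (auto simp: isprime_def polyB_def)
  then show ?thesis using P by blast
qed

lemma fin_over_mono: "fin_over J B E \<Longrightarrow> J \<subseteq> J' \<Longrightarrow> fin_over J' B E"
  unfolding fin_over_def by (meson subsetD)

text \<open>Killing one parameter \<open>x_b\<close> keeps the others independent: if a polynomial
  in the others is a multiple of \<open>x_b\<close> modulo \<open>P\<close>, then
  \<open>weight_filtration\<close> for the weight counting \<open>x_b\<close> makes each of its
  terms divisible by \<open>x_b\<close>. A prime over \<open>P\<close> and \<open>x_b\<close> that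
  avoids the remaining parameters continues the chain.\<close>

lemma chain_of_primes_ex:
  fixes P :: "('n::finite, 'k::field) mpoly set"
  assumes "finite B" "isprime P" "fin_over P B E" "P \<inter> polyB B = {0}"
  shows "\<exists>Q. Q 0 = P \<and> chain_of_primes P (card B) Q"
  using assms
proof (induction B arbitrary: P rule: finite_induct)
  case empty
  then show ?case by (intro exI[of _ "\<lambda>_. P"]) (simp add: chain_of_primes_def)
next
  case (insert b B)
  have sP: "pid.subspace P" using insert.prems(1) by (simp add: isprime_def)
  have finE: "finite E" using insert.prems(2) by (simp add: fin_over_def)
  let ?x = "single (xvar b) (1 :: 'k)"
  let ?J = "pid.span (insert ?x P)"
  have "a = 0" if a: "a \<in> ?J" "a \<in> polyB B" for a
  proof (rule ccontr)
    assume "a \<noteq> 0"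
    then have "keys a \<noteq> {}" by simp
    then obtain \<mu> where \<mu>: "\<mu> \<in> keys a" by blast
    from a(1) obtain h where "a - h * ?x \<in> pid.span P" using pid.span_breakdown_eq by blast
    then have h: "a - ?x * h \<in> P" using pid.span_eq_iff[THEN iffD2, OF sP] by (simp add: mult.commute)
    define w :: "real ^ 'n" where "w = (\<chi> i. if i = b then 1 else 0)"
    have ww: "weight w \<nu> = real (lookup \<nu> b)" for \<nu>
    proof -
      have "weight w \<nu> = (\<Sum>i\<in>UNIV. if i = b then real (lookup \<nu> b) else 0)"
        unfolding weight_def by (rule sum.cong) (auto simp: w_def)
      then show ?thesis by simp
    qed
    have "1 \<le> weight w \<mu>"
    proof (rule weight_filtration[OF sP insert.prems(2,3) _ _ _ h _ \<mu>])
      show "a \<in> polyB (insert b B)" using a(2) by (auto simp: polyB_def)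
      fix \<nu> assume "\<nu> \<in> keys (?x * h)"
      from subsetD[OF keys_single_mult this] show "1 \<le> weight w \<nu>" by (auto simp: ww lookup_add)
    qed (auto simp: w_def)
    moreover have "lookup \<mu> b = 0" using a(2) \<mu> insert.hyps by (simp add: polyB_def)
    ultimately show False by (simp add: ww)
  qed
  moreover have "0 \<in> ?J \<inter> polyB B" using pid.span_zero by (simp add: polyB_def)
  ultimately have "?J \<inter> polyB B = {0}" by blast
  from prime_avoiding_polyB[OF pid.subspace_span this] obtain P' where
    P': "isprime P'" "?J \<subseteq> P'" "P' \<inter> polyB B = {0}" by (elim exE conjE)
  have xP': "?x \<in> P'" and PP': "P \<subseteq> P'" using P'(2) pid.span_superset[of "insert ?x P"] by blast+
  have sP': "pid.subspace P'" using P'(1) by (simp add: isprime_def)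
  have "?x \<in> polyB (insert b B)" by (auto simp: polyB_def lookup_single when_def)
  moreover have "?x \<noteq> 0" by (metis keys_single keys_zero insert_not_empty one_neq_zero)
  ultimately have "?x \<notin> P" using insert.prems(3) by blast
  then have strict: "P \<subset> P'" using xP' PP' by blast
  have bP': "single \<mu> a \<in> P'" if "lookup \<mu> b > 0" for \<mu> a
  proof -
    have "single (\<mu> - xvar b) a * ?x \<in> P'" by (rule pid.subspace_scale[OF sP' xP'])
    then show ?thesis using xvar_dvd[OF that] by (simp add: mult_single add.commute)
  qed
  have "fin_over P' B E"
    unfolding fin_over_def
  proof (intro conjI finE allI)
    fix \<nu> :: "'n monomial"
    show "\<exists>p. single \<nu> 1 - p \<in> P' \<and> (\<forall>\<mu>\<in>keys p. mrestr (- B) \<mu> \<in> E \<and> mdegree \<mu> = mdegree \<nu> \<and> (\<forall>b\<in>B. lookup \<nu> b \<le> lookup \<mu> b))"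
    proof -
      obtain p where p: "single \<nu> 1 - p \<in> P" "\<forall>\<mu>\<in>keys p. mrestr (- insert b B) \<mu> \<in> E \<and> mdegree \<mu> = mdegree \<nu> \<and> (\<forall>c\<in>insert b B. lookup \<nu> c \<le> lookup \<mu> c)"
        using insert.prems(2) unfolding fin_over_def by blast
      \<comment> \<open>Terms containing \<open>x_b\<close> lie in \<open>P'\<close>. In the others
        the part off \<open>B\<close> equals the part off \<open>insert b B\<close>, so the same
        \<open>E\<close> works.\<close>
      define q where "q = restrict_terms (\<lambda>\<mu>. lookup \<mu> b = 0) p"
      have "p - q = (\<Sum>\<mu>\<in>keys (p - q). single \<mu> (lookup (p - q) \<mu>))" by (rule mpoly_expansion)
      also have "\<dots> \<in> P'"
        by (intro pid.subspace_sum sP' bP') (auto simp: q_def in_keys_iff lookup_minus lookup_restrict_terms split: if_splits)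
      finally have "(single \<nu> 1 - p) + (p - q) \<in> P'" using p(1) PP' by (intro pid.subspace_add[OF sP']) auto
      then have "single \<nu> 1 - q \<in> P'" by simp
      moreover have "mrestr (- B) \<mu> \<in> E \<and> mdegree \<mu> = mdegree \<nu> \<and> (\<forall>c\<in>B. lookup \<nu> c \<le> lookup \<mu> c)"
        if "\<mu> \<in> keys q" for \<mu>
      proof -
        have \<mu>: "\<mu> \<in> keys p" "lookup \<mu> b = 0" using that by (simp_all add: q_def keys_restrict_terms)
        have "mrestr (- B) \<mu> = mrestr (- insert b B) \<mu>"
          by (rule monomial_eqI) (use \<mu>(2) in \<open>auto simp: lookup_mrestr\<close>)
        then show ?thesis using p(2) \<mu>(1) by simp
      qed
      ultimately show ?thesis by blast
    qed
  qed
  from insert.IH[OF P'(1) this P'(3)] obtain Q where Q: "Q 0 = P'" "chain_of_primes P' (card B) Q" by blast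
  define Q' where "Q' i = (case i of 0 \<Rightarrow> P | Suc j \<Rightarrow> Q j)" for i
  have "chain_of_primes P (Suc (card B)) Q'"
    unfolding chain_of_primes_def
  proof (intro conjI allI impI)
    fix i
    show "isprime (Q' i)" "P \<subseteq> Q' i" if "i \<le> Suc (card B)"
      using Q(2) that insert.prems(1) PP' by (auto simp: Q'_def chain_of_primes_def split: nat.split)
    show "Q' i \<subset> Q' (Suc i)" if "i < Suc (card B)"
      using Q that strict by (cases i) (auto simp: Q'_def chain_of_primes_def)
  qed
  moreover have "Q' 0 = P" by (simp add: Q'_def)
  ultimately show ?case using insert.hyps by (intro exI[of _ Q'] conjI) simp_all
qed

text \<open>Noether normalization by coordinates: finiteness bounds all chains of primes, and
  injectivity of \<open>K[x_b | b \<in> B]\<close> provides one of full length.\<close>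

theorem ideal_dim_fin_over:
  fixes J :: "('n::finite, 'k::field) mpoly set"
  assumes J: "pid.subspace J" and fin: "fin_over J B E" and inj: "J \<inter> polyB B = {0}"
  shows "ideal_dim J = enat (card B)"
  unfolding ideal_dim_eq[OF J]
proof (rule antisym)
  show "Sup {enat k | k. \<exists>P. chain_of_primes J k P} \<le> enat (card B)"
    by (rule Sup_least) (use chain_length_le[OF J fin] in auto)
  from prime_avoiding_polyB[OF J inj] obtain P where P: "isprime P" "J \<subseteq> P" "P \<inter> polyB B = {0}"
    by (elim exE conjE)
  obtain Q where Q: "chain_of_primes P (card B) Q"
    using chain_of_primes_ex[OF _ P(1) fin_over_mono[OF fin P(2)] P(3)] by auto
  then have "chain_of_primes J (card B) Q" using P(2) unfolding chain_of_primes_def by blast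
  then show "enat (card B) \<le> Sup {enat k | k. \<exists>P. chain_of_primes J k P}" by (intro Sup_upper) auto
qed

section \<open>Strongly stable sets of monomials\<close>

definition strongly_stable :: "'n monomial rel \<Rightarrow> 'n::finite monomial set \<Rightarrow> bool" where
  "strongly_stable r N \<longleftrightarrow> upc N \<and> (\<forall>e\<in>N. \<forall>i j. lookup e i > 0 \<longrightarrow> i \<noteq> j \<longrightarrow> (xvar i, xvar j) \<in> r \<longrightarrow> e - xvar i + xvar j \<in> N)"

lemma strongly_stableD:
  "strongly_stable r N \<Longrightarrow> e \<in> N \<Longrightarrow> lookup e i > 0 \<Longrightarrow> i \<noteq> j \<Longrightarrow> (xvar i, xvar j) \<in> r \<Longrightarrow> e - xvar i + xvar j \<in> N"
  by (simp add: strongly_stable_def)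

lemma lookup_swap:
  "lookup (e - xvar i + xvar j) k = lookup e k - (if k = i then 1 else 0) + (if k = j then 1 else 0)"
  by (auto simp: lookup_add lookup_minus lookup_single when_def)

text \<open>Genericity covers degrees up to \<open>D\<close> only. In higher degree the exchange is
  performed on a generator \<open>b\<close> dividing \<open>e\<close>; if \<open>x_i\<close> does
  not divide \<open>b\<close>, then \<open>b\<close> still divides the exchanged monomial.\<close>

lemma strongly_stable_leads:
  fixes I :: "('n::finite, 'k::field_char_0) mpoly set"
  assumes I: "pid.subspace I" "graded I" and D: "gen_bound I D" and g: "Dgen I D g" and r: "corder r"
  shows "strongly_stable r (leads r (act g ` I))"
  unfolding strongly_stable_def
proof (intro conjI ballI allI impI)
  let ?N = "leads r (act g ` I)"
  have inv: "invertible g" using g by (simp add: Dgen_def)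
  show up: "upc ?N" by (rule upc_leads[OF subspace_act[OF I(1) inv] r])
  fix e i j assume e: "e \<in> ?N" "lookup e i > 0" and ij: "i \<noteq> j" "(xvar i, xvar j) \<in> r"
  from bspec[OF deg_gen_leads[OF I D inv r, unfolded deg_gen_def] e(1)]
  obtain b where b: "b \<in> ?N" "mdegree b \<le> D" "mle b e" by (elim bexE conjE)
  show "e - xvar i + xvar j \<in> ?N"
  proof (cases "lookup b i > 0")
    case True
    have "b - xvar i + xvar j \<in> ?N" by (rule leads_strongly_stable[OF I g r b(1,2) True ij])
    moreover have "mle (b - xvar i + xvar j) (e - xvar i + xvar j)"
      using b(3) by (auto simp: mle_def lookup_swap intro!: add_mono diff_le_mono)
    ultimately show ?thesis by (rule upc_mle[OF up])
  next
    case False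
    have "mle b (e - xvar i + xvar j)"
      unfolding mle_def lookup_swap
    proof
      fix k
      have "lookup b k \<le> lookup e k" using b(3) by (simp add: mle_def)
      then show "lookup b k \<le> lookup e k - (if k = i then 1 else 0) + (if k = j then 1 else 0)"
        using False by (cases "k = i") auto
    qed
    then show ?thesis by (rule upc_mle[OF up b(1)])
  qed
qed

text \<open>Factors smaller than \<open>x_j\<close> are exchanged for \<open>x_j\<close> one at a
  time.\<close>

lemma strongly_stable_collect:
  assumes st: "strongly_stable r N" and P: "\<And>i. lookup e i > 0 \<Longrightarrow> i \<noteq> j \<Longrightarrow> (xvar i, xvar j) \<in> r" and "e \<in> N"
  shows "single j (mdegree e) \<in> N"
  using P \<open>e \<in> N\<close>
proof (induction "mdegree e - lookup e j" arbitrary: e rule: less_induct)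
  case less
  show ?case
  proof (cases "\<exists>i. i \<noteq> j \<and> lookup e i > 0")
    case True
    then obtain i where i: "i \<noteq> j" "lookup e i > 0" by auto
    let ?e = "e - xvar i + xvar j"
    have "?e + xvar i = e + xvar j" by (rule xvar_swap[OF i(2)])
    from arg_cong[OF this, of mdegree] have deg: "mdegree ?e = mdegree e" by (simp add: mdegree_add)
    have lj: "lookup ?e j = Suc (lookup e j)" using i by (simp add: lookup_swap)
    have "Suc (lookup e j) \<le> mdegree e"
      using lookup_le_mdegree[of ?e j] lj deg by simp
    then have "single j (mdegree ?e) \<in> N"
    proof (intro less.hyps)
      show "?e \<in> N" by (rule strongly_stableD[OF st less.prems(2) i(2) i(1) less.prems(1)[OF i(2,1)]])
      fix k assume k: "lookup ?e k > 0" "k \<noteq> j"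
      then have "lookup e k > 0" by (auto simp: lookup_swap split: if_splits)
      then show "(xvar k, xvar j) \<in> r" using k(2) by (rule less.prems(1))
    qed (simp add: deg lj)
    then show ?thesis by (simp add: deg)
  next
    case False
    have "e = single j (lookup e j)"
      by (rule monomial_eqI) (use False in \<open>auto simp: lookup_single when_def\<close>)
    moreover from arg_cong[OF this, of mdegree] have "mdegree e = lookup e j" by simp
    ultimately show ?thesis using less.prems(2) by simp
  qed
qed

definition ess :: "'n::finite monomial set \<Rightarrow> 'n set" where
  "ess N = {i. \<exists>u\<in>min_gens N. lookup u i > 0}"

text \<open>Exchange \<open>x_i\<close> for the larger \<open>x_j\<close> in a minimal generator
  \<open>u\<close>. A minimal generator dividing the result must involve \<open>x_j\<close>, since
  otherwise it would divide \<open>u\<close> with one \<open>x_i\<close> removed, against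
  minimality.\<close>

lemma ess_final:
  assumes st: "strongly_stable r N" and i: "i \<in> ess N" and ij: "(xvar i, xvar j) \<in> r"
  shows "j \<in> ess N"
proof (cases "i = j")
  case False
  obtain u where u: "u \<in> min_gens N" "lookup u i > 0" using i by (auto simp: ess_def)
  then have "u - xvar i + xvar j \<in> N"
    using False ij by (intro strongly_stableD[OF st]) (simp_all add: min_gens_def)
  then obtain b where b: "b \<in> min_gens N" "mle b (u - xvar i + xvar j)" using min_gens_below by blast
  have "lookup b j > 0"
  proof (rule ccontr)
    assume b0: "\<not> lookup b j > 0"
    have le: "lookup b k \<le> lookup u k - (if k = i then 1 else 0)" for k
    proof -
      have "lookup b k \<le> lookup (u - xvar i + xvar j) k" using b(2) by (simp add: mle_def)
      then show ?thesis unfolding lookup_swap using b0 by (cases "k = j") auto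
    qed
    have "mle b u" unfolding mle_def using le by (meson diff_le_self le_trans)
    then have "b = u" using u(1) b(1) by (simp add: min_gens_def)
    with le[of i] u(2) show False by simp
  qed
  with b(1) show ?thesis by (auto simp: ess_def)
qed (use i in simp)

lemma ess_free:
  assumes up: "upc N" and i: "i \<notin> ess N" and \<nu>: "\<nu> + xvar i \<in> N"
  shows "\<nu> \<in> N"
proof -
  obtain b where b: "b \<in> min_gens N" "mle b (\<nu> + xvar i)" using min_gens_below[OF \<nu>] by blast
  have "lookup b i = 0" using i b(1) by (auto simp: ess_def)
  have "mle b \<nu>"
    unfolding mle_def
  proof
    fix k
    have "lookup b k \<le> lookup (\<nu> + xvar i) k" using b(2) by (simp add: mle_def)
    then show "lookup b k \<le> lookup \<nu> k"
      using \<open>lookup b i = 0\<close> by (cases "k = i") (auto simp: lookup_add lookup_single when_def)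
  qed
  moreover have "b \<in> N" using b(1) by (simp add: min_gens_def)
  ultimately show ?thesis using up by (meson upc_mle)
qed

lemma corder_min:
  assumes r: "corder r" and A: "finite A" "A \<noteq> {}"
  shows "\<exists>e\<in>A. \<forall>\<mu>\<in>A. (e, \<mu>) \<in> r"
proof -
  have "corder (r\<inverse>)"
    by (rule corderI)
      (auto intro: corder_refl[OF r] corder_trans[OF r] corder_antisym[OF r] corder_add[OF r] simp: corder_total[OF r])
  from corder_max[OF this A] show ?thesis by simp
qed

text \<open>Dividing a minimal generator \<open>u\<close> by the smallest essential variable
  \<open>x_i0\<close> gives a monomial \<open>w\<close> outside \<open>N\<close>, and by strong
  stability every essential variable multiplies \<open>w\<close> into \<open>N\<close>. So only the
  remaining variables count in \<open>regseq_length_le\<close>.\<close>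

lemma depth_monoid_ideal_le:
  assumes st: "strongly_stable r N" and r: "corder r" and N: "N \<noteq> {}" "0 \<notin> N"
  shows "ideal_depth (monoid_ideal N :: ('n::finite, 'k::field) mpoly set) \<le> enat (card (- ess N))"
proof -
  let ?M = "monoid_ideal N :: ('n, 'k) mpoly set"
  have up: "upc N" using st by (simp add: strongly_stable_def)
  obtain \<nu> where "\<nu> \<in> N" using N by auto
  from min_gens_below[OF this] obtain u0 where "u0 \<in> min_gens N" by blast
  then have u0: "u0 \<in> min_gens N" "u0 \<noteq> 0" using N(2) by (auto simp: min_gens_def)
  then obtain i where "lookup u0 i > 0" using mono_degree_induct_add[of u0] by auto
  with u0 have "i \<in> ess N" by (auto simp: ess_def)
  then have "xvar ` ess N \<noteq> {}" by auto
  from corder_min[OF r _ this] obtain i0 where i0: "i0 \<in> ess N" "\<And>j. j \<in> ess N \<Longrightarrow> (xvar i0, xvar j) \<in> r"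
    by auto
  obtain u where u: "u \<in> min_gens N" "lookup u i0 > 0" using i0(1) by (auto simp: ess_def)
  have uN: "u \<in> N" using u(1) by (simp add: min_gens_def)
  define w where "w = u - xvar i0"
  have wu: "xvar i0 + w = u" unfolding w_def by (rule xvar_dvd[OF u(2)])
  have "w \<notin> N"
  proof
    assume "w \<in> N"
    moreover have "mle w u" using wu by (metis add.commute mle_add)
    ultimately have "w = u" using u(1) by (simp add: min_gens_def)
    with wu show False by simp
  qed
  have xw: "xvar i + w \<in> N" if i: "i \<in> ess N" for i
  proof (cases "i = i0")
    case False
    from strongly_stableD[OF st uN u(2) _ i0(2)[OF i]] False have "w + xvar i \<in> N" by (simp add: w_def)
    then show ?thesis by (simp add: add.commute)
  qed (simp add: wu uN)
  have "length ls \<le> card (- ess N)" if "\<forall>l\<in>set ls. linear_form l" "regseq ?M ls" for ls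
  proof (rule regseq_length_le[OF subspace_monoid_ideal[OF up] graded_monoid_ideal _ that(2)])
    show "single w 1 \<notin> ?M" using \<open>w \<notin> N\<close> by simp
    show "single (xvar i) 1 * single w 1 \<in> ?M" if "i \<in> ess N" for i
      using xw[OF that] by (simp add: mult_single)
  qed (use that in auto)
  then show ?thesis
    unfolding ideal_depth_eq[OF subspace_monoid_ideal[OF up]] by (auto intro!: Sup_least)
qed

text \<open>The variables outside \<open>ess\<close> form a regular sequence modulo
  \<open>g(I)\<close>; the inverse matrix turns them into linear forms that are regular modulo
  \<open>I\<close>.\<close>

lemma depth_ge_ess:
  fixes I :: "('n::finite, 'k::field) mpoly set"
  assumes I: "pid.subspace I" "graded I" and g: "invertible g" and J: "act g ` I \<noteq> UNIV" and r: "corder r"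
  shows "enat (card (- ess (leads r (act g ` I)))) \<le> ideal_depth I"
proof -
  let ?N = "leads r (act g ` I)"
  obtain vs where vs: "set vs = - ess ?N" "distinct vs" using finite_distinct_list[OF finite[of "- ess ?N"]] by (elim exE conjE)
  obtain g' where g': "g ** g' = mat 1" "invertible g'" by (rule invertible_inverse[OF g])
  define ls :: "('n, 'k) mpoly list" where "ls = map (\<lambda>i. act g' (single (xvar i) 1)) vs"
  have J': "pid.subspace (act g ` I)" "graded (act g ` I)" by (rule subspace_act[OF I(1) g], rule graded_act[OF I(2)])
  have "regseq (act g ` I) (map (\<lambda>i. single (xvar i) 1) vs)"
  proof (rule vars_regular[OF J' r J _ vs(2)])
    fix \<nu> i assume "i \<in> set vs" "\<nu> + xvar i \<in> ?N"
    then show "\<nu> \<in> ?N" unfolding vs(1) by (metis ComplD ess_free[OF upc_leads[OF J'(1) r]])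
  qed
  also have "map (\<lambda>i. single (xvar i) 1) vs = map (act g) ls" by (simp add: ls_def act_compose g'(1) o_def)
  finally have "regseq I ls" by (rule regseq_act[OF g])
  moreover have "\<forall>l\<in>set ls. linear_form l"
  proof
    fix l assume "l \<in> set ls"
    then obtain i where "l = lin_form_of g' i" by (auto simp: ls_def act_var)
    then show "linear_form l" by (auto simp: linear_form_def keys_lin_form_of)
  qed
  ultimately have "enat (length ls) \<le> ideal_depth I" unfolding ideal_depth_eq[OF I(1)] by (auto intro!: Sup_upper)
  moreover have "length ls = card (- ess ?N)" using vs distinct_card[of vs] by (simp add: ls_def)
  ultimately show ?thesis by simp
qed

section \<open>Dimension and strongly stable sets\<close>

text \<open>The variables of which no power lies in \<open>N\<close>; for leading monomials in
  generic coordinates they are parameters.\<close>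

definition pw :: "'n::finite monomial set \<Rightarrow> 'n set" where
  "pw N = {i. \<forall>k. single i k \<notin> N}"

lemma pure_monomials_subset:
  fixes N :: "'n::finite monomial set"
  assumes up: "upc N"
  shows "\<exists>M. pure_monomials M (pw N) \<subseteq> N"
proof -
  have "\<forall>i. \<exists>k. i \<notin> pw N \<longrightarrow> single i k \<in> N" by (auto simp: pw_def)
  from choice[OF this] obtain k where k: "\<And>i. i \<notin> pw N \<Longrightarrow> single i (k i) \<in> N" by blast
  define K where "K = Suc (Max (range k))"
  have K: "k i \<le> K" for i unfolding K_def by (simp add: le_SucI)
  \<comment> \<open>Pigeonhole: in degree \<open>CARD('n) * K\<close> some exponent is at least
    \<open>K\<close>, hence at least the exponent of the pure power available for that
    variable.\<close>
  have "pure_monomials (CARD('n) * K) (pw N) \<subseteq> N"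
  proof
    fix \<kappa> assume "\<kappa> \<in> pure_monomials (CARD('n) * K) (pw N)"
    then have \<kappa>: "mdegree \<kappa> = CARD('n) * K" "\<And>b. b \<in> pw N \<Longrightarrow> lookup \<kappa> b = 0" by (auto simp: pure_monomials_def)
    have "\<exists>i. K \<le> lookup \<kappa> i"
    proof (rule ccontr)
      assume "\<not> ?thesis"
      then have "mdegree \<kappa> < (\<Sum>i\<in>(UNIV :: 'n set). K)"
        unfolding mdegree_def by (intro sum_strict_mono) (auto simp: not_le)
      with \<kappa>(1) show False by simp
    qed
    then obtain i where i: "K \<le> lookup \<kappa> i" by blast
    then have "i \<notin> pw N" using \<kappa>(2)[of i] by (auto simp: K_def)
    from k[OF this] show "\<kappa> \<in> N"
      by (rule upc_mle[OF up]) (use i K[of i] in \<open>auto simp: mle_def lookup_single when_def\<close>)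
  qed
  then show ?thesis ..
qed

lemma pw_final:
  assumes st: "strongly_stable r N" and i: "i \<in> pw N" and ij: "(xvar j, xvar i) \<in> r"
  shows "j \<in> pw N"
proof -
  have "single j k \<notin> N" for k
  proof
    assume "single j k \<in> N"
    then have "single i (mdegree (single j k)) \<in> N"
      by (rule strongly_stable_collect[OF st, rotated]) (use ij in \<open>auto simp: lookup_single when_def split: if_splits\<close>)
    with i show False by (simp add: pw_def)
  qed
  then show ?thesis by (simp add: pw_def)
qed

text \<open>A leading monomial in the variables of \<open>pw\<close> could be collected into a power
  of the largest of them, but no such power is a leading monomial.\<close>

lemma polyB_pw:
  fixes J :: "('n::finite, 'k::field) mpoly set"
  assumes J: "pid.subspace J" and r: "corder r" and st: "strongly_stable r (leads r J)" and 0: "0 \<notin> leads r J"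
  shows "J \<inter> polyB (pw (leads r J)) = {0}"
proof -
  have "f = 0" if f: "f \<in> J" "f \<in> polyB (pw (leads r J))" for f
  proof (rule ccontr)
    assume "f \<noteq> 0"
    from is_lead_ex[OF r this] obtain e where e: "is_lead r f e" ..
    then have eN: "e \<in> leads r J" using f(1) by (auto simp: leads_def)
    have supp: "i \<in> pw (leads r J)" if "lookup e i > 0" for i
    proof (rule ccontr)
      assume "i \<notin> pw (leads r J)"
      moreover have "e \<in> keys f" using e by (simp add: is_lead_def)
      ultimately have "lookup e i = 0" using f(2) unfolding polyB_def by blast
      with that show False by simp
    qed
    from eN 0 have "e \<noteq> 0" by auto
    then obtain i where "lookup e i > 0" using mono_degree_induct_add[of e] by auto
    then have "xvar ` pw (leads r J) \<noteq> {}" using supp by auto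
    from corder_max[OF r _ this] obtain i0 where
      i0: "i0 \<in> pw (leads r J)" "\<And>i. i \<in> pw (leads r J) \<Longrightarrow> (xvar i, xvar i0) \<in> r" by auto
    have "single i0 (mdegree e) \<in> leads r J" by (rule strongly_stable_collect[OF st _ eN]) (rule i0(2)[OF supp])
    with i0(1) show False by (simp add: pw_def)
  qed
  moreover have "0 \<in> J" by (rule pid.subspace_0[OF J])
  moreover have "0 \<in> polyB (pw (leads r J))" by (simp add: polyB_def)
  ultimately show ?thesis by blast
qed

section \<open>The ideal in fixed generic coordinates\<close>

locale generic_ideal =
  fixes I :: "('n::finite, 'k::field_char_0) mpoly set" and D :: nat and g :: "'k ^ 'n ^ 'n" and m :: nat
  assumes subspace_I: "pid.subspace I" and graded_I: "graded I" and I_proper: "I \<noteq> UNIV"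
    and D: "gen_bound I D" and g: "Dgen I D g" and dim: "ideal_dim I = enat m"
begin

abbreviation J :: "('n, 'k) mpoly set" where "J \<equiv> act g ` I"

lemma inv_g: "invertible g"
  using g by (simp add: Dgen_def)

lemma J: "pid.subspace J" "graded J"
  by (rule subspace_act[OF subspace_I inv_g], rule graded_act[OF graded_I])

lemma J_proper: "J \<noteq> UNIV"
proof
  assume "J = UNIV"
  then have "f \<in> I" for f using act_mem_iff[OF inv_g, of f I] by simp
  with I_proper show False by auto
qed

lemma zero_leads:
  assumes r: "corder r"
  shows "0 \<notin> leads r J"
proof
  assume "0 \<in> leads r J"
  from leads_homogeneous[OF J this] obtain f where f: "f \<in> J" "lookup f 0 = 1" "\<And>\<mu>. \<mu> \<in> keys f \<Longrightarrow> mdegree \<mu> = mdegree (0 :: 'n monomial)"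
    by metis
  have "\<mu> = 0" if "\<mu> \<in> keys f" for \<mu> using f(3)[OF that] by (simp add: mdegree_eq_0_iff)
  then have "f = 1"
    by (intro poly_mapping_eqI) (use f(2) in \<open>auto simp: lookup_one when_def in_keys_iff\<close>)
  with f(1) J_proper one_mem_subspace[OF J(1)] show False by simp
qed

lemma stable: "corder r \<Longrightarrow> strongly_stable r (leads r J)"
  by (rule strongly_stable_leads[OF subspace_I graded_I D g])

lemma Ind_pure_pw:
  assumes r: "corder r"
  shows "\<exists>M. Ind J (pure_monomials M (pw (leads r J)))"
  using pure_monomials_subset[OF upc_leads[OF J(1) r]] Ind_leads[OF J r] by blast

text \<open>The variables of \<open>pw\<close> give a Noether normalization of \<open>J\<close>, and
  the dimension does not change with the coordinates.\<close>

lemma card_pw: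
  assumes r: "corder r"
  shows "card (pw (leads r J)) = m"
proof -
  obtain M where "Ind J (pure_monomials M (pw (leads r J)))" using Ind_pure_pw[OF r] by blast
  from ideal_dim_fin_over[OF J(1) fin_over_if_Ind[OF J this] polyB_pw[OF J(1) r stable[OF r] zero_leads[OF r]]]
  show ?thesis using ideal_dim_act[OF subspace_I inv_g] dim by simp
qed

text \<open>\<open>pw\<close> is closed under passing to smaller variables and has \<open>m\<close>
  elements, so it equals \<open>B\<close> for an order in which the variables of \<open>B\<close>
  are the smallest. Being generic for all orders at once, the same \<open>g\<close> works for every
  \<open>B\<close>.\<close>

lemma coordinate_parameters:
  assumes B: "card B = m"
  shows "J \<inter> polyB B = {0}" "\<exists>M. Ind J (pure_monomials M B)"
proof -
  \<comment> \<open>Weight 1 on \<open>B\<close> and 0 elsewhere: in \<open>ordr\<close> a larger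
    weight makes a variable smaller.\<close>
  define r where "r = ordr (\<chi> i. if i \<in> B then 1 else 0) (lexo :: 'n monomial rel)"
  have r: "corder r" unfolding r_def by (rule corder_ordr[OF corder_lexo])
  have "pw (leads r J) \<subseteq> B"
  proof (rule ccontr)
    assume "\<not> ?thesis"
    then obtain i where i: "i \<in> pw (leads r J)" "i \<notin> B" by auto
    have "j \<in> pw (leads r J)" if "j \<in> B" for j
      by (rule pw_final[OF stable[OF r] i(1)]) (use i that in \<open>simp add: r_def ordr_def\<close>)
    then have "insert i B \<subseteq> pw (leads r J)" using i by auto
    from card_mono[OF _ this] card_pw[OF r] B i show False by simp
  qed
  then have "pw (leads r J) = B" by (intro card_subset_eq) (auto simp: B card_pw[OF r])
  then show "J \<inter> polyB B = {0}" "\<exists>M. Ind J (pure_monomials M B)"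
    using polyB_pw[OF J(1) r stable[OF r] zero_leads[OF r]] Ind_pure_pw[OF r] by auto
qed

text \<open>A squeeze: the depth of \<open>I\<close> equals its gdepth, which is at most the depth
  of the generic initial ideal for \<open>r\<close>; this is at most the number of variables outside
  \<open>ess\<close>, which in turn is at most the depth of \<open>I\<close>.\<close>

lemma card_ess:
  assumes r: "term_order r" and gd: "maximal_gdepth I" and t: "ideal_depth I = enat t" and nz: "I \<noteq> {0}"
  shows "card (- ess (leads r J)) = t"
proof -
  have cr: "corder r" by (rule term_order_corder[OF r])
  obtain f where "f \<in> I" "f \<noteq> 0" using nz pid.subspace_0[OF subspace_I] by auto
  then have "act g f \<in> J" "act g f \<noteq> 0" using act_mem_iff[OF inv_g, of f "{0}"] by auto
  moreover obtain e where "is_lead r (act g f) e" using is_lead_ex[OF cr \<open>act g f \<noteq> 0\<close>] ..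
  ultimately have "leads r J \<noteq> {}" unfolding leads_def by blast
  then have "ideal_depth (monoid_ideal (leads r J) :: ('n, 'k) mpoly set) \<le> enat (card (- ess (leads r J)))"
    by (rule depth_monoid_ideal_le[OF stable[OF cr] cr _ zero_leads[OF cr]])
  moreover have "ideal_depth I \<le> ideal_depth (monoid_ideal (leads r J) :: ('n, 'k) mpoly set)"
    using gd r unfolding maximal_gdepth_def gdepth_def gin_eq[OF subspace_I graded_I D g cr, symmetric]
    by (auto intro!: Inf_lower)
  moreover have "enat (card (- ess (leads r J))) \<le> ideal_depth I"
    by (rule depth_ge_ess[OF subspace_I graded_I inv_g J_proper cr])
  ultimately have "enat (card (- ess (leads r J))) = enat t"
    unfolding t by (metis antisym order_trans)
  then show ?thesis by simp
qed

end

section \<open>Coordinates at which a weight is minimal\<close>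

definition minset :: "real ^ 'n \<Rightarrow> 'n::finite set" where
  "minset w = {i. \<forall>j. w $ i \<le> w $ j}"

lemma minset_nonempty: "minset w \<noteq> {}"
proof -
  obtain i where "is_arg_min (\<lambda>i. w $ i) (\<lambda>_. True) i"
    using ex_is_arg_min_if_finite[OF finite UNIV_not_empty, of "\<lambda>i. w $ i"] by auto
  then show ?thesis by (auto simp: minset_def is_arg_min_linorder)
qed

lemma card_add_compl: "card A + card (- A) = CARD('n)" for A :: "'n::finite set"
  using card_Un_disjoint[of A "- A"] by simp

text \<open>Shifting a weight by a constant vector changes the weights of all monomials of one
  degree alike, so comparisons within a degree are unaffected.\<close>

lemma weight_shift:
  assumes "\<And>i. u $ i = w $ i - c"
  shows "weight u \<nu> = weight w \<nu> - c * mdegree \<nu>"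
  by (simp add: weight_def mdegree_def assms left_diff_distrib sum_subtractf sum_distrib_left)

lemma eventually_at_right_pos: "eventually (\<lambda>\<epsilon>::real. 0 < \<epsilon>) (at_right 0)"
  by (rule eventually_at_right_less)

lemma eventually_perturb_less:
  fixes a b :: real
  assumes "a < b"
  shows "eventually (\<lambda>\<epsilon>. a + \<epsilon> * x < b + \<epsilon> * y) (at_right 0)"
proof -
  have "((\<lambda>\<epsilon>. b + \<epsilon> * y - (a + \<epsilon> * x)) \<longlongrightarrow> b + 0 * y - (a + 0 * x)) (at_right 0)"
    by (intro tendsto_intros)
  from order_tendstoD(1)[OF this, of 0] assms show ?thesis by simp
qed

text \<open>A small perturbation only breaks ties among the coordinates that are already
  minimal.\<close>

lemma minset_perturb:
  fixes w u :: "real ^ 'n::finite"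
  shows "eventually (\<lambda>\<epsilon>. minset (w + \<epsilon> *\<^sub>R u) = {i \<in> minset w. \<forall>j\<in>minset w. u $ i \<le> u $ j}) (at_right 0)"
proof -
  have "eventually (\<lambda>\<epsilon>. w $ i < w $ j \<longrightarrow> w $ i + \<epsilon> * u $ i < w $ j + \<epsilon> * u $ j) (at_right 0)" for i j
    using eventually_perturb_less[of "w $ i" "w $ j"] by (cases "w $ i < w $ j") simp_all
  then have "eventually (\<lambda>\<epsilon>. \<forall>i j. w $ i < w $ j \<longrightarrow> w $ i + \<epsilon> * u $ i < w $ j + \<epsilon> * u $ j) (at_right 0)"
    by (intro eventually_all_finite)
  from eventually_conj[OF this eventually_at_right_pos] show ?thesis
  proof (rule eventually_mono, elim conjE)
    fix \<epsilon> :: real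
    assume elim: "\<forall>i j. w $ i < w $ j \<longrightarrow> w $ i + \<epsilon> * u $ i < w $ j + \<epsilon> * u $ j" "0 < \<epsilon>"
    obtain k where k: "k \<in> minset w" using minset_nonempty[of w] by auto
    show "minset (w + \<epsilon> *\<^sub>R u) = {i \<in> minset w. \<forall>j\<in>minset w. u $ i \<le> u $ j}"
    proof (rule Set.set_eqI, rule iffI)
      fix i assume "i \<in> minset (w + \<epsilon> *\<^sub>R u)"
      then have i: "w $ i + \<epsilon> * u $ i \<le> w $ j + \<epsilon> * u $ j" for j by (simp add: minset_def)
      have "w $ i \<le> w $ k" using elim(1) i[of k] by (meson not_less)
      then have im: "i \<in> minset w" using k unfolding minset_def by (auto intro: order_trans)
      have "u $ i \<le> u $ j" if "j \<in> minset w" for j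
      proof -
        have "w $ i = w $ j" using im that unfolding minset_def by (auto intro: antisym)
        with i[of j] elim(2) show ?thesis by simp
      qed
      with im show "i \<in> {i \<in> minset w. \<forall>j\<in>minset w. u $ i \<le> u $ j}" by simp
    next
      fix i assume i: "i \<in> {i \<in> minset w. \<forall>j\<in>minset w. u $ i \<le> u $ j}"
      have "w $ i + \<epsilon> * u $ i \<le> w $ j + \<epsilon> * u $ j" for j
      proof (cases "w $ i < w $ j")
        case True
        with elim(1) show ?thesis by (meson less_imp_le)
      next
        case False
        have "w $ i \<le> w $ j'" for j' using i by (simp add: minset_def)
        with False have wj: "w $ j = w $ i" by (metis antisym not_less)
        with i have "j \<in> minset w" by (simp add: minset_def)
        with wj i elim(2) show ?thesis by simp
      qed
      then show "i \<in> minset (w + \<epsilon> *\<^sub>R u)" by (simp add: minset_def)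
    qed
  qed
qed

section \<open>The tropical variety in generic coordinates\<close>

context generic_ideal
begin
text \<open>If \<open>m\<close> coordinates lie off the minimum, they are parameters, and some power
  of a minimal variable \<open>x_a\<close> is congruent modulo \<open>J\<close> to a sum of
  monomials of the same degree that involve them. Those have larger weight, so the power of
  \<open>x_a\<close> lies in the initial ideal.\<close>

lemma card_minset_if_tropical:
  assumes w: "w \<in> tropical_variety J"
  shows "CARD('n) < card (minset w) + m"
proof (rule ccontr)
  assume "\<not> ?thesis"
  then have "m \<le> card (- minset w)" using card_add_compl[of "minset w"] by simp
  then obtain B where B: "B \<subseteq> - minset w" "card B = m" by (meson obtain_subset_with_card_n)
  obtain a where a: "a \<in> minset w" using minset_nonempty[of w] by auto
  from coordinate_parameters(2)[OF B(2)] obtain M where M: "Ind J (pure_monomials M B)" ..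
  let ?e = "single a M"
  have e: "?e \<in> pure_monomials M B" using a B(1) by (auto simp: pure_monomials_def lookup_single when_def)
  from bspec[OF M[unfolded Ind_def] e] obtain f where
    f: "f \<in> J" "\<And>c. c \<in> pure_monomials M B \<Longrightarrow> lookup f c = (if c = ?e then 1 else 0)" by (elim bexE) blast
  have "single ?e 1 \<in> initial_ideal w J"
    unfolding single_mem_initial_ideal[OF J]
  proof (intro bexI conjI ballI impI)
    show "hcomp M f \<in> J" by (rule graded_hcomp[OF J(2) f(1)])
    show "lookup (hcomp M f) ?e = 1" using f(2)[OF e] by (simp add: lookup_restrict_terms)
    fix \<mu> assume \<mu>: "\<mu> \<in> keys (hcomp M f)"
    then have deg: "mdegree \<mu> = M" and k: "\<mu> \<in> keys f" by (auto simp: keys_restrict_terms)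
    then show "mdegree \<mu> = mdegree ?e" by simp
    assume "\<mu> \<noteq> ?e"
    then have "\<mu> \<notin> pure_monomials M B" using f(2)[of \<mu>] k by (auto simp: in_keys_iff)
    then obtain b where b: "b \<in> B" "0 < lookup \<mu> b" using deg by (auto simp: pure_monomials_def)
    have "weight w ?e = (\<Sum>i\<in>UNIV. w $ a * real (lookup \<mu> i))"
      using deg by (simp add: mdegree_def flip: sum_distrib_left of_nat_sum)
    also have "\<dots> < (\<Sum>i\<in>UNIV. w $ i * real (lookup \<mu> i))"
    proof (rule sum_strict_mono_ex1)
      show "\<forall>i\<in>UNIV. w $ a * real (lookup \<mu> i) \<le> w $ i * real (lookup \<mu> i)"
        using a by (auto simp: minset_def intro: mult_right_mono)
      have "b \<notin> minset w" using b(1) B(1) by auto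
      then have "w $ a < w $ b" using a by (fastforce simp: minset_def not_le intro: le_less_trans)
      then show "\<exists>i\<in>UNIV. w $ a * real (lookup \<mu> i) < w $ i * real (lookup \<mu> i)"
        using b(2) by (intro bexI[of _ b]) simp_all
    qed simp
    finally show "weight w ?e < weight w \<mu>" by (simp add: weight_def)
  qed
  with w show False by (simp add: tropical_variety_def)
qed


lemma vars_multiple_split:
  fixes f :: "('n, 'k) mpoly"
  assumes "\<And>\<mu>. \<mu> \<in> keys f \<Longrightarrow> \<exists>i\<in>B. lookup \<mu> i > 0"
  shows "f \<in> pid.span ((\<lambda>i. single (xvar i) 1) ` B)"
proof -
  have "single \<mu> c \<in> pid.span ((\<lambda>i. single (xvar i) 1) ` B)" if \<mu>: "\<mu> \<in> keys f" for \<mu> and c :: 'k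
  proof -
    from assms[OF \<mu>] obtain i where i: "i \<in> B" "lookup \<mu> i > 0" by auto
    have "single \<mu> c = single (\<mu> - xvar i) c * single (xvar i) 1"
      using xvar_dvd[OF i(2)] by (simp add: mult_single add.commute)
    also have "\<dots> \<in> pid.span ((\<lambda>i. single (xvar i) 1) ` B)"
      by (rule pid.span_scale) (rule pid.span_base, use i(1) in simp)
    finally show ?thesis .
  qed
  then have "(\<Sum>\<mu>\<in>keys f. single \<mu> (lookup f \<mu>)) \<in> pid.span ((\<lambda>i. single (xvar i) 1) ` B)"
    by (intro pid.span_sum)
  then show ?thesis by (simp flip: mpoly_expansion)
qed

text \<open>The variables off \<open>A\<close> together with \<open>x_i\<close> are \<open>m\<close>
  parameters, so a power of \<open>x_j\<close> lies in the ideal generated by them and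
  \<open>J\<close>; the part divisible by \<open>x_i\<close> is split off.\<close>

lemma span_power_step:
  assumes A: "card (- A) + 1 = m" and ij: "i \<in> A" "j \<in> A"
  shows "\<exists>k h. single (single j k) 1 - single (xvar i) 1 * h \<in> pid.span (J \<union> (\<lambda>l. single (xvar l) 1) ` (- A))"
proof (cases "i = j")
  case True
  have "single (single j 1) 1 - single (xvar i) 1 * (1 :: ('n, 'k) mpoly) = 0" unfolding True by simp
  then show ?thesis by (metis pid.span_zero)
next
  case False
  let ?B = "insert i (- A)" and ?x = "\<lambda>l. single (xvar l) (1 :: 'k)"
  have "card ?B = m" using A ij by simp
  from coordinate_parameters(2)[OF this] obtain M where M: "Ind J (pure_monomials M ?B)" ..
  let ?e = "single j M"
  have e: "?e \<in> pure_monomials M ?B" using ij False by (auto simp: pure_monomials_def lookup_single when_def)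
  from bspec[OF M[unfolded Ind_def] e] obtain f where
    f: "f \<in> J" "\<And>c. c \<in> pure_monomials M ?B \<Longrightarrow> lookup f c = (if c = ?e then 1 else 0)" by (elim bexE) blast
  let ?f = "single ?e 1 - hcomp M f"
  have "?f \<in> pid.span (?x ` ?B)"
  proof (rule vars_multiple_split)
    fix \<mu> assume "\<mu> \<in> keys ?f"
    then have nz: "lookup ?f \<mu> \<noteq> 0" by (simp add: in_keys_iff)
    then have "mdegree \<mu> = M" by (auto simp: lookup_minus lookup_restrict_terms lookup_single when_def split: if_splits)
    moreover have "\<mu> \<notin> pure_monomials M ?B"
      using nz f(2)[of \<mu>] \<open>mdegree \<mu> = M\<close>
      by (auto simp: lookup_minus lookup_restrict_terms lookup_single when_def split: if_splits)
    ultimately show "\<exists>i\<in>?B. lookup \<mu> i > 0" by (auto simp: pure_monomials_def)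
  qed
  then obtain h where h: "?f - h * ?x i \<in> pid.span (?x ` (- A))"
    unfolding image_insert pid.span_insert by auto
  have "hcomp M f \<in> pid.span (J \<union> ?x ` (- A))" by (intro pid.span_base UnI1 graded_hcomp[OF J(2) f(1)])
  moreover have "?f - h * ?x i \<in> pid.span (J \<union> ?x ` (- A))" using h pid.span_mono[of "?x ` (- A)"] by blast
  ultimately have "hcomp M f + (?f - h * ?x i) \<in> pid.span (J \<union> ?x ` (- A))" by (rule pid.span_add)
  then have "single ?e 1 - ?x i * h \<in> pid.span (J \<union> ?x ` (- A))" by (simp add: mult.commute)
  then show ?thesis by blast
qed

text \<open>The steps for single variables are multiplied together: modulo \<open>J\<close> and the
  variables off \<open>A\<close>, every monomial in the variables of \<open>A\<close> divides a
  power of \<open>x_j\<close>.\<close>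

lemma span_power_multiple:
  assumes A: "card (- A) + 1 = m" and j: "j \<in> A" and \<nu>: "\<And>i. i \<notin> A \<Longrightarrow> lookup \<nu> i = 0"
  shows "\<exists>k h. single (single j k) 1 - single \<nu> 1 * h \<in> pid.span (J \<union> (\<lambda>l. single (xvar l) 1) ` (- A))"
  using \<nu>
proof (induction \<nu> rule: monomial_induct)
  case zero
  have "single (single j 0) 1 - single 0 1 * (1 :: ('n, 'k) mpoly) = 0" by simp
  then show ?case by (metis pid.span_zero)
next
  case (add \<nu> i)
  let ?Q = "pid.span (J \<union> (\<lambda>l. single (xvar l) (1 :: 'k)) ` (- A))"
  have "lookup (\<nu> + xvar i) i \<noteq> 0" by (simp add: lookup_add)
  with add.prems[of i] have i: "i \<in> A" by blast
  have "lookup \<nu> l = 0" if "l \<notin> A" for l using add.prems[OF that] by (simp add: lookup_add)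
  from add.IH[OF this] obtain k h where 1: "single (single j k) 1 - single \<nu> 1 * h \<in> ?Q" by auto
  from span_power_step[OF A i j] obtain k' h' where 2: "single (single j k') 1 - single (xvar i) 1 * h' \<in> ?Q" by auto
  have "single (single j k') 1 * (single (single j k) 1 - single \<nu> 1 * h)
      + (single \<nu> 1 * h) * (single (single j k') 1 - single (xvar i) 1 * h') \<in> ?Q" (is "?s \<in> _")
    by (intro pid.span_add pid.span_scale 1 2)
  also have "?s = single (single j k') 1 * single (single j k) 1 - (single \<nu> 1 * single (xvar i) 1) * (h * h')"
    by (simp add: algebra_simps)
  also have "\<dots> = single (single j (k' + k)) 1 - single (\<nu> + xvar i) 1 * (h * h')"
    by (simp add: mult_single single_add)
  finally show ?case by blast
qed

text \<open>
  If an initial form in \<open>J\<close> were the monomial \<open>x^\<nu>\<close>, then modulo \<open>J\<close> a monomial in the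
  coordinate parameters of the same weight as \<open>x^\<nu>\<close> would be congruent to a polynomial
  of larger weight, contradicting \<open>weight_filtration\<close>.
\<close>

lemma tropical_if_card_minset_eq:
  assumes w: "card (- minset w) + 1 = m"
  shows "w \<in> tropical_variety J"
proof -
  let ?A = "minset w" and ?x = "\<lambda>l. single (xvar l) (1 :: 'k)"
  have "single \<nu> 1 \<notin> initial_ideal w J" for \<nu>
  proof
    assume "single \<nu> 1 \<in> initial_ideal w J"
    then obtain f where f: "f \<in> J" "lookup f \<nu> = 1"
      "\<And>\<mu>. \<mu> \<in> keys f \<Longrightarrow> mdegree \<mu> = mdegree \<nu>" "\<And>\<mu>. \<mu> \<in> keys f \<Longrightarrow> \<mu> \<noteq> \<nu> \<Longrightarrow> weight w \<nu> < weight w \<mu>"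
      unfolding single_mem_initial_ideal[OF J] by auto
    obtain j where j: "j \<in> ?A" using minset_nonempty[of w] by auto
    \<comment> \<open>Within one degree \<open>u\<close> compares monomials as \<open>w\<close>
      does, but it is 0 on \<open>?A\<close> and positive elsewhere, as
      \<open>weight_filtration\<close> requires.\<close>
    define u :: "real ^ 'n" where "u = (\<chi> i. w $ i - w $ j)"
    have u: "weight u \<mu> = weight w \<mu> - w $ j * mdegree \<mu>" for \<mu> by (rule weight_shift) (simp add: u_def)
    have u0: "u $ i = 0" if "i \<in> ?A" for i using that j by (auto simp: u_def minset_def intro: antisym)
    have upos: "0 < u $ i" if "i \<notin> ?A" for i
      using that j unfolding u_def minset_def by (fastforce simp: not_le intro: le_less_trans)
    have unn: "0 \<le> u $ i" for i using u0[of i] upos[of i] by (cases "i \<in> ?A") auto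
    \<comment> \<open>Only \<open>\<beta>\<close> contributes to the weight. The factor
      \<open>\<alpha>\<close> in the variables of \<open>?A\<close> is traded for a power of the
      single variable \<open>x_j\<close>.\<close>
    define \<alpha> \<beta> where "\<alpha> = mrestr ?A \<nu>" and "\<beta> = mrestr (- ?A) \<nu>"
    have \<nu>: "\<nu> = \<alpha> + \<beta>" by (simp add: \<alpha>_def \<beta>_def mrestr_split)
    have "lookup \<alpha> i = 0" if "i \<notin> ?A" for i using that by (simp add: \<alpha>_def lookup_mrestr)
    from span_power_multiple[OF w j this] obtain k h where
      kh: "single (single j k) 1 - single \<alpha> 1 * h \<in> pid.span (J \<union> ?x ` (- ?A))" by auto
    then obtain q p where q: "q \<in> J" and p: "p \<in> pid.span (?x ` (- ?A))"
      and qp: "single (single j k) 1 - single \<alpha> 1 * h = q + p"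
      unfolding pid.span_Un pid.span_eq_iff[THEN iffD2, OF J(1)] by auto
    have w\<beta>: "weight u \<beta> = weight u \<nu>"
    proof -
      have "weight u \<alpha> = 0" by (auto simp: weight_def \<alpha>_def lookup_mrestr u0 intro!: sum.neutral)
      then show ?thesis by (simp add: \<nu> weight_add)
    qed
    have pw: "0 < weight u \<mu>" if "\<mu> \<in> keys p" for \<mu>
    proof -
      have "\<forall>\<mu>\<in>keys p. \<exists>i. i \<notin> ?A \<and> lookup \<mu> i > 0" using p
      proof (induction rule: pid.span_induct_alt)
        case base
        show ?case by simp
      next
        case (step c x y)
        obtain i where i: "i \<notin> ?A" "x = ?x i" using step(1) by auto
        show ?case
        proof
          fix \<mu> assume "\<mu> \<in> keys (c * x + y)"
          then have "\<mu> \<in> keys (?x i * c) \<or> \<mu> \<in> keys y" using keys_add[of "c * x" y] by (auto simp: i(2) mult.commute)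
          then show "\<exists>i. i \<notin> ?A \<and> lookup \<mu> i > 0"
          proof
            assume "\<mu> \<in> keys (?x i * c)"
            with keys_single_mult[of "xvar i" 1 c] obtain \<kappa> where "\<mu> = xvar i + \<kappa>" by blast
            then have "lookup \<mu> i > 0" by (simp add: lookup_add)
            with i(1) show ?thesis by blast
          qed (use step in blast)
        qed
      qed
      with that obtain i where i: "i \<notin> ?A" "lookup \<mu> i > 0" by blast
      have "0 < u $ i * lookup \<mu> i" using upos[OF i(1)] i(2) by simp
      also have "\<dots> \<le> weight u \<mu>" unfolding weight_def
        by (rule member_le_sum) (use unn in \<open>auto\<close>)
      finally show ?thesis .
    qed
    define h1 where "h1 = f - single \<nu> 1"
    have h1: "weight u \<nu> < weight u \<mu>" if "\<mu> \<in> keys h1" for \<mu>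
    proof -
      have "\<mu> \<noteq> \<nu>" using that f(2) by (auto simp: h1_def in_keys_iff lookup_minus)
      then have "\<mu> \<in> keys f" using that by (auto simp: h1_def in_keys_iff lookup_minus lookup_single when_def)
      with f(3,4)[of \<mu>] \<open>\<mu> \<noteq> \<nu>\<close> show ?thesis by (simp add: u)
    qed
    define a where "a = single (single j k + \<beta>) (1 :: 'k)"
    \<comment> \<open>\<open>a = x_j^k x^\<beta>\<close> is congruent to \<open>H\<close> modulo
      \<open>J\<close>: replace \<open>x_j^k\<close> by \<open>x^\<alpha> h + p\<close>, and then
      \<open>x^\<nu>\<close> by \<open>- h1\<close>.\<close>
    define H where "H = single \<beta> 1 * p - h1 * h"
    have wnn: "0 \<le> weight u \<mu>" for \<mu> unfolding weight_def by (intro sum_nonneg) (simp add: unn)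
    have H: "weight u \<nu> < weight u \<mu>" if "\<mu> \<in> keys H" for \<mu>
    proof -
      have "\<mu> \<in> keys (single \<beta> 1 * p) \<or> \<mu> \<in> keys (h1 * h)"
        using that keys_diff[of "single \<beta> 1 * p" "h1 * h"] unfolding H_def by blast
      then show ?thesis
      proof
        assume "\<mu> \<in> keys (single \<beta> 1 * p)"
        with keys_single_mult[of \<beta> 1 p] obtain \<kappa> where "\<mu> = \<beta> + \<kappa>" "\<kappa> \<in> keys p" by blast
        then show ?thesis using pw[of \<kappa>] by (simp add: weight_add w\<beta>)
      next
        assume "\<mu> \<in> keys (h1 * h)"
        from subsetD[OF keys_mult this] obtain x y where "\<mu> = x + y" "x \<in> keys h1" by auto
        then show ?thesis using h1[of x] wnn[of y] by (simp add: weight_add)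
      qed
    qed
    have "a = single \<beta> 1 * single (single j k) 1" by (simp add: a_def mult_single add.commute)
    also have "single (single j k) 1 = single \<alpha> 1 * h + q + p" using qp by (simp add: algebra_simps)
    also have "single \<beta> 1 * (single \<alpha> 1 * h + q + p) = (single \<beta> 1 * single \<alpha> 1) * h + single \<beta> 1 * q + single \<beta> 1 * p"
      by (simp add: distrib_left mult.assoc)
    also have "single \<beta> 1 * single \<alpha> 1 = f - h1" by (simp add: h1_def \<nu> mult_single add.commute)
    finally have "a - H = h * f + single \<beta> 1 * q" by (simp add: H_def algebra_simps)
    also have "\<dots> \<in> J" by (intro pid.subspace_add[OF J(1)] pid.subspace_scale[OF J(1)] f(1) q)
    finally have aH: "a - H \<in> J" .
    let ?B = "insert j (- ?A)"
    have B: "card ?B = m" using w j by simp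
    note par = coordinate_parameters[OF B]
    from par(2) obtain M where M: "Ind J (pure_monomials M ?B)" ..
    have aB: "a \<in> polyB ?B"
      by (auto simp: polyB_def a_def \<beta>_def lookup_add lookup_mrestr lookup_single when_def)
    \<comment> \<open>A number above \<open>weight u \<nu>\<close> and at most the weight of every
      term of \<open>H\<close>; the inserted value covers \<open>H = 0\<close>.\<close>
    define c where "c = Min (insert (weight u \<nu> + 1) (weight u ` keys H))"
    have c: "weight u \<nu> < c" unfolding c_def using H by simp
    have "c \<le> weight u (single j k + \<beta>)"
    proof (rule weight_filtration[OF J(1) fin_over_if_Ind[OF J M] par(1) _ unn aB aH])
      show "u $ i = 0" if "i \<notin> ?B" for i using that u0[of i] by simp
      show "c \<le> weight u \<mu>" if "\<mu> \<in> keys H" for \<mu> unfolding c_def using that by (intro Min_le) auto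
    qed (simp add: a_def)
    also have "\<dots> = weight u \<nu>" using u0[OF j] by (simp add: weight_add w\<beta>)
    finally show False using c by simp
  qed
  then show ?thesis by (simp add: tropical_variety_def)
qed

end

lemma closed_minset_card: "closed {w :: real ^ 'n::finite. k < card (minset w) + m}"
proof -
  have "{w :: real ^ 'n. k < card (minset w) + m} = (\<Union>A\<in>{A. k < card A + m}. \<Inter>i\<in>A. \<Inter>j. {w. w $ i \<le> w $ j})" (is "_ = ?U")
  proof (rule Set.set_eqI, rule iffI)
    fix w :: "real ^ 'n"
    assume "w \<in> {w. k < card (minset w) + m}"
    then show "w \<in> ?U" by (intro UN_I[of "minset w"]) (auto simp: minset_def)
  next
    fix w :: "real ^ 'n"
    assume "w \<in> ?U"
    then obtain A where A: "k < card A + m" "A \<subseteq> minset w" by (auto simp: minset_def)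
    from card_mono[OF _ A(2)] A(1) show "w \<in> {w. k < card (minset w) + m}" by simp
  qed
  also have "closed ?U"
    by (intro closed_UN closed_INT ballI finite closed_Collect_le continuous_intros)
  finally show ?thesis .
qed

text \<open>Take powers of a real number that is a root of none of the nonzero integer polynomials
  \<open>p z\<close>. There are countably many of these, each with finitely many roots, so the
  interval from 0 to 1 is not exhausted.\<close>

lemma independent_weights:
  obtains x :: real where "x > 0"
    "\<And>z :: 'n::finite \<Rightarrow> int. (\<Sum>i\<in>UNIV. of_int (z i) * x ^ idx i) = 0 \<Longrightarrow> z = (\<lambda>_. 0)"
proof -
  define p :: "('n \<Rightarrow> int) \<Rightarrow> real poly" where "p z = (\<Sum>i\<in>UNIV. Polynomial.monom (of_int (z i)) (idx i))" for z :: "'n \<Rightarrow> int"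
  have co: "poly.coeff (p z) (idx i) = of_int (z i)" for z i
    by (simp add: p_def coeff_sum inj_eq[OF inj_idx])
  have nz: "p z \<noteq> 0" if "z \<noteq> (\<lambda>_. 0)" for z
  proof
    assume "p z = 0"
    then have "z i = 0" for i using co[of z i] by simp
    with that show False by auto
  qed
  let ?R = "\<Union>z\<in>{z. z \<noteq> (\<lambda>_. 0)}. {x :: real. poly (p z) x = 0}"
  have "countable ?R" 
    by (rule countable_UN[OF countableI_type]) (rule countable_finite[OF poly_roots_finite[OF nz]], simp)
  then have "\<not> {0<..<1} \<subseteq> ?R" using uncountable_open_interval[of 0 "1::real"] countable_subset by auto
  then obtain x where "x \<in> {0<..<1}" "x \<notin> ?R" by blast
  then have x: "0 < x" "\<And>z. z \<noteq> (\<lambda>_. 0) \<Longrightarrow> poly (p z) x \<noteq> 0" by auto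
  show ?thesis
  proof (rule that[OF x(1)])
    fix z :: "'n \<Rightarrow> int" assume "(\<Sum>i\<in>UNIV. of_int (z i) * x ^ idx i) = 0"
    then have "poly (p z) x = 0" by (simp add: p_def poly_sum poly_monom)
    with x(2) show "z = (\<lambda>_. 0)" by blast
  qed
qed

text \<open>A weight that sees the exponents off \<open>A\<close> completely and those on
  \<open>A\<close> not at all.\<close>

lemma independent_weights_off:
  fixes A :: "'n::finite set"
  obtains v :: "real ^ 'n" where "\<And>i. i \<in> A \<Longrightarrow> v $ i = 0" "\<And>i. i \<notin> A \<Longrightarrow> 0 < v $ i"
    "\<And>\<mu> \<nu> i. weight v \<mu> = weight v \<nu> \<Longrightarrow> i \<notin> A \<Longrightarrow> lookup \<mu> i = lookup \<nu> i"
proof -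
  obtain x :: real where x: "x > 0" "\<And>z :: 'n \<Rightarrow> int. (\<Sum>i\<in>UNIV. of_int (z i) * x ^ idx i) = 0 \<Longrightarrow> z = (\<lambda>_. 0)"
    by (rule independent_weights) (rule that, assumption+)
  define v :: "real ^ 'n" where "v = (\<chi> i. if i \<in> A then 0 else x ^ idx i)"
  show ?thesis
  proof (rule that)
    show "v $ i = 0" if "i \<in> A" for i using that by (simp add: v_def)
    show "0 < v $ i" if "i \<notin> A" for i using that x(1) by (simp add: v_def)
    fix \<mu> \<nu> :: "'n monomial" and i
    assume eq: "weight v \<mu> = weight v \<nu>" and i: "i \<notin> A"
    define z where "z i = (if i \<in> A then 0 else int (lookup \<mu> i) - int (lookup \<nu> i))" for i
    have "(\<Sum>i\<in>UNIV. of_int (z i) * x ^ idx i) = weight v \<mu> - weight v \<nu>"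
      unfolding weight_def sum_subtractf[symmetric]
      by (intro sum.cong) (auto simp: z_def v_def algebra_simps)
    then have "z = (\<lambda>_. 0)" using eq by (intro x(2)) simp
    then have "z i = 0" by simp
    with i show "lookup \<mu> i = lookup \<nu> i" by (simp add: z_def)
  qed
qed

text \<open>Each element of \<open>J\<close> is a sum of parts in \<open>J\<close> of fixed degree
  and \<open>v\<close>-weight; \<open>u\<close> is constant on the terms of a part, which is
  therefore its own \<open>u\<close>-initial form. This gives one inclusion, and equal Hilbert
  functions give the other.\<close>

lemma initial_ideal_constant_weight:
  fixes J :: "('n::finite, 'k::field) mpoly set"
  assumes J: "pid.subspace J" "graded J"
    and v: "\<And>p d c. p \<in> J \<Longrightarrow> wcomp v d c p \<in> J"
    and u: "\<And>\<mu> \<nu>. mdegree \<mu> = mdegree \<nu> \<Longrightarrow> weight v \<mu> = weight v \<nu> \<Longrightarrow> weight u \<mu> = weight u \<nu>"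
  shows "initial_ideal u J = J"
proof -
  have "p \<in> initial_ideal u J" if p: "p \<in> J" for p
  proof -
    let ?S = "(\<lambda>\<nu>. (mdegree \<nu>, weight v \<nu>)) ` keys p"
    have "p = (\<Sum>x\<in>?S. wcomp v (fst x) (snd x) p)"
    proof (rule poly_mapping_eqI)
      fix \<nu>
      have "lookup (\<Sum>x\<in>?S. wcomp v (fst x) (snd x) p) \<nu> = (\<Sum>x\<in>?S. if x = (mdegree \<nu>, weight v \<nu>) then lookup p \<nu> else 0)"
        unfolding lookup_sum lookup_wcomp by (intro sum.cong) auto
      also have "\<dots> = (if (mdegree \<nu>, weight v \<nu>) \<in> ?S then lookup p \<nu> else 0)" by (rule sum.delta) simp
      also have "\<dots> = lookup p \<nu>" by (cases "\<nu> \<in> keys p") (auto simp: in_keys_iff)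
      finally show "lookup p \<nu> = lookup (\<Sum>x\<in>?S. wcomp v (fst x) (snd x) p) \<nu>" ..
    qed
    also have "\<dots> \<in> initial_ideal u J"
    proof (rule pid.subspace_sum[OF subspace_initial_ideal[OF J]])
      fix x assume "x \<in> ?S"
      then obtain \<nu> where \<nu>: "x = (mdegree \<nu>, weight v \<nu>)" by auto
      let ?q = "wcomp v (fst x) (snd x) p"
      have k: "mdegree \<mu> = mdegree \<nu> \<and> weight u \<mu> = weight u \<nu>" if "\<mu> \<in> keys ?q" for \<mu>
        using that u[of \<mu> \<nu>] by (simp add: keys_wcomp \<nu>)
      then have "wcomp u (mdegree \<nu>) (weight u \<nu>) ?q \<in> initial_ideal u J"
        by (intro wcomp_initial_mem[OF J v[OF p]]) simp
      also have "wcomp u (mdegree \<nu>) (weight u \<nu>) ?q = ?q"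
        by (rule poly_mapping_eqI) (use k in \<open>auto simp: lookup_wcomp[of u] in_keys_iff\<close>)
      finally show "?q \<in> initial_ideal u J" .
    qed
    finally show ?thesis .
  qed
  then have sub: "J \<subseteq> initial_ideal u J" by auto
  have "leads lexo J = leads lexo (initial_ideal u J)"
  proof (rule hilb_set_subset_eq[OF _ _ leads_mono[OF sub]])
    show "hilb_set (hilb J) (leads lexo J)" by (rule hilb_set_leads[OF J corder_lexo])
    show "hilb_set (hilb J) (leads lexo (initial_ideal u J))"
      unfolding leads_initial_ideal[OF J corder_lexo] by (rule hilb_set_leads[OF J corder_ordr[OF corder_lexo]])
  qed
  then show ?thesis
    by (intro ideal_eq_if_leads_eq[OF corder_lexo J sub subspace_initial_ideal[OF J], symmetric]) simp
qed

context generic_ideal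
begin

text \<open>A weight with more than \<open>n - m + 1\<close> minimal coordinates is perturbed until
  exactly that many are left. A monomial in its initial ideal would survive in the initial ideal of
  the perturbed weight, which is tropical.\<close>

lemma tropical_variety_eq: "tropical_variety J = {w :: real ^ 'n. CARD('n) < card (minset w) + m}"
proof (rule Set.set_eqI, rule iffI)
  fix w :: "real ^ 'n" assume "w \<in> {w. CARD('n) < card (minset w) + m}"
  then have w: "CARD('n) < card (minset w) + m" by simp
  show "w \<in> tropical_variety J"
  proof (cases "m = 0")
    \<comment> \<open>For \<open>m = 0\<close> no weight satisfies the cardinality
      condition.\<close>
    case True
    with w card_mono[OF finite subset_UNIV, of "minset w"] show ?thesis by simp
  next
    case False
    have "card (minset w) \<ge> Suc (CARD('n) - m)" using w False card_gt_0_iff[of "minset w"] minset_nonempty[of w] by auto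
    then obtain A where A: "A \<subseteq> minset w" "card A = Suc (CARD('n) - m)" by (meson obtain_subset_with_card_n)
    have mle: "m \<le> CARD('n)"
      using card_pw[OF corder_lexo] card_mono[OF finite subset_UNIV, of "pw (leads lexo J)"] by simp
    define v :: "real ^ 'n" where "v = (\<chi> i. if i \<in> A then 0 else 1)"
    have "A \<noteq> {}" using A(2) by auto
    have "eventually (\<lambda>\<epsilon>. w + \<epsilon> *\<^sub>R v \<in> tropical_variety J) (at_right 0)"
      using minset_perturb[of w v]
    proof (rule eventually_mono)
      fix \<epsilon> assume m: "minset (w + \<epsilon> *\<^sub>R v) = {i \<in> minset w. \<forall>j\<in>minset w. v $ i \<le> v $ j}"
      have "minset (w + \<epsilon> *\<^sub>R v) = A" unfolding m using A(1) \<open>A \<noteq> {}\<close> by (force simp: v_def split: if_splits)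
      then have "card (- minset (w + \<epsilon> *\<^sub>R v)) + 1 = m" using card_add_compl[of A] A(2) mle False by simp
      then show "w + \<epsilon> *\<^sub>R v \<in> tropical_variety J" by (rule tropical_if_card_minset_eq)
    qed
    from eventually_conj[OF this initial_ideal_perturb[OF J, of w v]]
    obtain \<epsilon> where \<epsilon>: "w + \<epsilon> *\<^sub>R v \<in> tropical_variety J" "initial_ideal (w + \<epsilon> *\<^sub>R v) J = initial_ideal v (initial_ideal w J)"
      by (rule exE[OF eventually_happens'[OF trivial_limit_at_right_real]], elim conjE)
    have "single \<nu> 1 \<notin> initial_ideal w J" for \<nu>
    proof
      assume \<nu>: "single \<nu> 1 \<in> initial_ideal w J"
      have "single \<nu> 1 \<in> initial_ideal v (initial_ideal w J)"
        unfolding single_mem_initial_ideal[OF subspace_initial_ideal[OF J] graded_initial_ideal[OF J]]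
        by (rule bexI[OF _ \<nu>]) simp
      with \<epsilon> show False by (simp add: tropical_variety_def)
    qed
    then show ?thesis by (simp add: tropical_variety_def)
  qed
qed (use card_minset_if_tropical in simp)

lemma closed_tropical_variety: "closed (tropical_variety J)"
  unfolding tropical_variety_eq by (rule closed_minset_card)

text \<open>The Groebner fan is constant on generic matrices, and \<open>tropical_variety_eq\<close>
  describes the tropical variety without reference to \<open>g\<close>.\<close>

lemma generic_tropical_fan_eq: "generic_tropical_fan I = tropical_fan J"
  unfolding generic_tropical_fan_def
proof (rule generically_unique, rule generically_mono[OF generically_Dgen[OF subspace_I, of D]])
  fix g' :: "'k ^ 'n ^ 'n" assume g': "Dgen I D g'"
  then interpret g': generic_ideal I D g' m
    by (rule generic_ideal.intro[OF subspace_I graded_I I_proper D _ dim])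
  show "tropical_fan (act g' ` I) = tropical_fan J"
    unfolding tropical_fan_def groebner_fan_Dgen[OF subspace_I graded_I D g' g] g'.tropical_variety_eq tropical_variety_eq ..
qed

end

section \<open>Maximal cones of the generic tropical fan\<close>

context generic_ideal
begin

text \<open>
  Perturbing a weight in a maximal cone by weights that are independent off \<open>A\<close> makes its
  initial ideal homogeneous for every weight that is constant on \<open>A\<close>.
\<close>

lemma maximal_cone_weight:
  assumes C: "maximal_cone (tropical_fan J) C" and m: "0 < m" "m < CARD('n)"
  obtains A w where "card A + m = Suc CARD('n)" "minset w = A"
    "C = closure {w'. initial_ideal w' J = initial_ideal w J}"
    "\<And>u. \<forall>i\<in>A. \<forall>j\<in>A. u $ i = u $ j \<Longrightarrow> initial_ideal u (initial_ideal w J) = initial_ideal w J"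
proof -
  obtain w0 where C0: "C = closure {w'. initial_ideal w' J = initial_ideal w0 J}" and CT: "C \<subseteq> tropical_variety J"
    using C by (auto simp: maximal_cone_def tropical_fan_def groebner_fan_def)
  have "w0 \<in> C" unfolding C0 by (rule subsetD[OF closure_subset]) simp
  then have "w0 \<in> tropical_variety J" using CT by auto
  then have "Suc (CARD('n) - m) \<le> card (minset w0)" using card_minset_if_tropical[of w0] m by linarith
  then obtain A where A: "A \<subseteq> minset w0" "card A = Suc (CARD('n) - m)" by (meson obtain_subset_with_card_n)
  have cA: "card A + m = Suc CARD('n)" using A(2) m by simp
  have A0: "A \<noteq> {}" using A(2) by auto
  obtain v where v: "\<And>i. i \<in> A \<Longrightarrow> v $ i = 0" "\<And>i. i \<notin> A \<Longrightarrow> 0 < v $ i"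
    "\<And>\<mu> \<nu> i. weight v \<mu> = weight v \<nu> \<Longrightarrow> i \<notin> A \<Longrightarrow> lookup \<mu> i = lookup \<nu> i"
    by (rule independent_weights_off[of A]) (rule that, assumption+)
  let ?W = "initial_ideal v (initial_ideal w0 J)"
  have I0: "pid.subspace (initial_ideal w0 J)" "graded (initial_ideal w0 J)"
    by (rule subspace_initial_ideal[OF J], rule graded_initial_ideal[OF J])
  from eventually_conj[OF minset_perturb[of w0 v] initial_ideal_perturb[OF J, of w0 v]]
  obtain \<epsilon> where \<epsilon>: "minset (w0 + \<epsilon> *\<^sub>R v) = {i \<in> minset w0. \<forall>j\<in>minset w0. v $ i \<le> v $ j}"
    "initial_ideal (w0 + \<epsilon> *\<^sub>R v) J = ?W"
    by (rule exE[OF eventually_happens'[OF trivial_limit_at_right_real]], elim conjE)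
  define w where "w = w0 + \<epsilon> *\<^sub>R v"
  have W: "initial_ideal w J = ?W" unfolding w_def by (rule \<epsilon>(2))
  have minw: "minset w = A"
  proof -
    obtain a where a: "a \<in> A" using A0 by auto
    have "v $ i \<le> v $ j" if "i \<in> A" for i j using v(1)[OF that] v(1,2)[of j] by (cases "j \<in> A") auto
    moreover have "i \<in> A" if "v $ i \<le> v $ a" for i using that v(1)[OF a] v(2)[of i] by fastforce
    ultimately show ?thesis unfolding w_def \<epsilon>(1) using A(1) a by blast
  qed
  have wT: "w \<in> tropical_variety J" unfolding tropical_variety_eq using minw cA by simp
  let ?C = "closure {w'. initial_ideal w' J = initial_ideal w J}"
  \<comment> \<open>Every weight of the old class is a limit of its perturbations by
    \<open>v\<close>, which have initial ideal \<open>?W\<close> when small. So \<open>C\<close>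
    lies in the cone of \<open>w\<close>, and maximality makes the two equal.\<close>
  have "{w'. initial_ideal w' J = initial_ideal w0 J} \<subseteq> ?C"
  proof
    fix w' assume w': "w' \<in> {w'. initial_ideal w' J = initial_ideal w0 J}"
    have "((\<lambda>\<epsilon>. w' + \<epsilon> *\<^sub>R v) \<longlongrightarrow> w' + 0 *\<^sub>R v) (at_right (0::real))" by (intro tendsto_intros)
    moreover have "eventually (\<lambda>\<epsilon>. w' + \<epsilon> *\<^sub>R v \<in> ?C) (at_right 0)"
      using initial_ideal_perturb[OF J, of w' v]
      by (rule eventually_mono) (use w' W in \<open>auto intro!: subsetD[OF closure_subset]\<close>)
    ultimately have "w' + 0 *\<^sub>R v \<in> ?C"
      by (intro Lim_in_closed_set[OF closed_closure _ trivial_limit_at_right_real])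
    then show "w' \<in> ?C" by simp
  qed
  then have "C \<subseteq> ?C" unfolding C0 by (intro closure_minimal closed_closure)
  moreover have "?C \<in> tropical_fan J"
  proof -
    have "?C \<subseteq> tropical_variety J"
      using wT by (intro closure_minimal closed_tropical_variety) (auto simp: tropical_variety_def)
    then show ?thesis by (auto simp: tropical_fan_def groebner_fan_def)
  qed
  ultimately have "C = ?C" using C by (auto simp: maximal_cone_def)
  moreover have "initial_ideal u (initial_ideal w J) = initial_ideal w J"
    if u: "\<forall>i\<in>A. \<forall>j\<in>A. u $ i = u $ j" for u
    unfolding W
  proof (rule initial_ideal_constant_weight[OF subspace_initial_ideal[OF I0] graded_initial_ideal[OF I0]])
    show "wcomp v d c p \<in> ?W" if "p \<in> ?W" for p d c by (rule wcomp_mem_initial_ideal[OF I0 that])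
    fix \<mu> \<nu> :: "'n monomial" assume eq: "mdegree \<mu> = mdegree \<nu>" "weight v \<mu> = weight v \<nu>"
    obtain a where a: "a \<in> A" using A0 by auto
    \<comment> \<open>Subtracting the common value on \<open>A\<close> is harmless in equal degrees;
      off \<open>A\<close>, equal \<open>v\<close>-weights force equal exponents.\<close>
    define u' where "u' = (\<chi> i. u $ i - u $ a)"
    have "weight u' \<mu> = weight u' \<nu>"
      unfolding weight_def
    proof (rule sum.cong[OF refl])
      fix i
      have "u $ i = u $ a" if "i \<in> A" using u a that by blast
      then show "u' $ i * real (lookup \<mu> i) = u' $ i * real (lookup \<nu> i)"
        using v(3)[OF eq(2), of i] by (cases "i \<in> A") (simp_all add: u'_def)
    qed
    moreover have "weight u' \<mu> = weight u \<mu> - u $ a * mdegree \<mu>" for \<mu> by (rule weight_shift) (simp add: u'_def)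
    ultimately show "weight u \<mu> = weight u \<nu>" using eq(1) by simp
  qed
  ultimately show ?thesis by (rule that[OF cA minw])
qed

text \<open>\<open>T\<close> is read off from the common initial ideal \<open>?W\<close> and so is
  one set for all \<open>w\<close> in \<open>P\<close>, although each \<open>w\<close> refines to
  its own term order and imposes its own condition on \<open>T\<close>.\<close>

lemma maximal_cone_weights:
  assumes C: "maximal_cone (tropical_fan J) C" and m: "0 < m" "m < CARD('n)"
    and gd: "maximal_gdepth I" and t: "ideal_depth I = enat t" and nz: "I \<noteq> {0}" and tm: "t < m - 1"
  obtains A T P where "card A + m = Suc CARD('n)" "card T = t" "A \<inter> T = {}" "P \<noteq> {}" "C = closure P"
    "\<And>w i j. w \<in> P \<Longrightarrow> i \<in> A \<Longrightarrow> j \<in> A \<Longrightarrow> w $ i = w $ j"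
    "\<And>w i j. w \<in> P \<Longrightarrow> i \<in> A \<Longrightarrow> j \<notin> A \<Longrightarrow> w $ i < w $ j"
    "\<And>w i j. w \<in> P \<Longrightarrow> i \<in> T \<Longrightarrow> j \<notin> T \<Longrightarrow> w $ j < w $ i"
    "\<And>w u. w \<in> P \<Longrightarrow> \<forall>i\<in>A. \<forall>j\<in>A. u $ i = u $ j \<Longrightarrow> \<exists>\<epsilon>>0. w + \<epsilon> *\<^sub>R u \<in> P"
proof -
  obtain A w0 where cA: "card A + m = Suc CARD('n)" and w0: "minset w0 = A"
    and Ceq: "C = closure {w'. initial_ideal w' J = initial_ideal w0 J}"
    and const: "\<And>u. \<forall>i\<in>A. \<forall>j\<in>A. u $ i = u $ j \<Longrightarrow> initial_ideal u (initial_ideal w0 J) = initial_ideal w0 J"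
    by (rule maximal_cone_weight[OF C m]) (rule that, assumption+)
  let ?W = "initial_ideal w0 J"
  define P where "P = {w'. initial_ideal w' J = ?W}"
  define T where "T = - ess (leads lexo ?W)"
  have w0P: "w0 \<in> P" by (simp add: P_def)
  have "w0 \<in> tropical_variety J" unfolding tropical_variety_eq using w0 cA by simp
  then have PT: "P \<subseteq> tropical_variety J" by (auto simp: P_def tropical_variety_def)
  have move: "eventually (\<lambda>\<epsilon>. w + \<epsilon> *\<^sub>R u \<in> P) (at_right 0)"
    if w: "w \<in> P" and u: "\<forall>i\<in>A. \<forall>j\<in>A. u $ i = u $ j" for w u
    using initial_ideal_perturb[OF J, of w u]
    by (rule eventually_mono) (use w const[OF u] in \<open>simp add: P_def\<close>)
  have moveE: "\<exists>\<epsilon>>0. w + \<epsilon> *\<^sub>R u \<in> P"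
    if w: "w \<in> P" and u: "\<forall>i\<in>A. \<forall>j\<in>A. u $ i = u $ j" for w u
    using eventually_happens'[OF trivial_limit_at_right_real eventually_conj[OF eventually_at_right_pos move[OF w u]]] by auto
  have minP: "minset w = A" if w: "w \<in> P" for w
  proof (rule ccontr)
    assume ne: "minset w \<noteq> A"
    have "CARD('n) < card (minset w) + m" using card_minset_if_tropical[of w] PT w by auto
    then have le: "card A \<le> card (minset w)" using cA by simp
    have "\<not> minset w \<subseteq> A" using card_seteq[OF finite _ le] ne by auto
    then obtain b where b: "b \<in> minset w" "b \<notin> A" by auto
    \<comment> \<open>Lowering the extra minimal coordinate \<open>b\<close> would leave it as the
      only minimum, while a tropical weight has at least \<open>n - m + 1 > 1\<close> minimal
      coordinates.\<close>
    define u :: "real ^ 'n" where "u = (\<chi> i. if i = b then - 1 else 0)"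
    have u: "\<forall>i\<in>A. \<forall>j\<in>A. u $ i = u $ j" using b(2) by (auto simp: u_def)
    from eventually_happens'[OF trivial_limit_at_right_real eventually_conj[OF minset_perturb[of w u] move[OF w u]]]
    obtain \<epsilon> where \<epsilon>: "minset (w + \<epsilon> *\<^sub>R u) = {i \<in> minset w. \<forall>j\<in>minset w. u $ i \<le> u $ j}" "w + \<epsilon> *\<^sub>R u \<in> P"
      by auto
    have "minset (w + \<epsilon> *\<^sub>R u) = {b}"
      unfolding \<epsilon>(1) using b(1) by (auto simp: u_def split: if_splits)
    with card_minset_if_tropical[of "w + \<epsilon> *\<^sub>R u"] PT \<epsilon>(2) m show False by auto
  qed
  have minP1: "w $ i \<le> w $ j" if "w \<in> P" "i \<in> A" for w i j
    using minP[OF that(1)] that(2) by (auto simp: minset_def)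
  have minP2: "w $ i < w $ j" if "w \<in> P" "i \<in> A" "j \<notin> A" for w i j
  proof (rule ccontr)
    assume "\<not> w $ i < w $ j"
    then have "w $ j \<le> w $ i" by simp
    then have "j \<in> minset w" using minP1[OF that(1,2)] unfolding minset_def by (auto intro: order_trans)
    with minP[OF that(1)] that(3) show False by simp
  qed
  \<comment> \<open>The same set consists of the leading monomials of \<open>J\<close> for a term
    order depending on \<open>w\<close>, so stability holds for all these orders
    simultaneously.\<close>
  have "w \<in> P \<Longrightarrow> leads lexo ?W = leads (ordr w lexo) J" for w
    using leads_initial_ideal[OF J corder_lexo, of w] by (simp add: P_def)
  note leadsW = this
  have cT: "card T = t"
    unfolding T_def leadsW[OF w0P] by (rule card_ess[OF term_order_ordr[OF corder_lexo] gd t nz])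
  have weak: "w $ j \<le> w $ i" if w: "w \<in> P" and ij: "i \<in> T" "j \<notin> T" for w i j
  proof (rule ccontr)
    assume "\<not> ?thesis"
    then have "(xvar j, xvar i) \<in> ordr w lexo" by (simp add: ordr_def)
    from ess_final[OF stable[OF corder_ordr[OF corder_lexo]] _ this] ij show False
      unfolding T_def leadsW[OF w] by auto
  qed
  have AT: "A \<inter> T = {}"
  proof (rule ccontr)
    assume "A \<inter> T \<noteq> {}"
    then obtain a where a: "a \<in> A" "a \<in> T" by auto
    \<comment> \<open>An index outside \<open>T\<close> would have weight at most
      \<open>w0 $ a\<close>, the minimum, and hence lie in \<open>A\<close>. Then
      \<open>n - t \<le> n - m + 1\<close>, against \<open>t < m - 1\<close>.\<close>
    have "- T \<subseteq> A" using weak[OF w0P a(2)] minP2[OF w0P a(1)] by (fastforce simp: not_less)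
    from card_mono[OF finite this] card_add_compl[of T] cT cA tm show False by simp
  qed
  have strict: "w $ j < w $ i" if w: "w \<in> P" and ij: "i \<in> T" "j \<notin> T" for w i j
  proof -
    \<comment> \<open>Lowering \<open>w $ i\<close> by a small \<open>\<epsilon>\<close> stays
      inside \<open>P\<close>, and the weak inequality there gives the strict one at
      \<open>w\<close>.\<close>
    define u :: "real ^ 'n" where "u = (\<chi> k. if k = i then - 1 else 0)"
    have "\<forall>k\<in>A. \<forall>l\<in>A. u $ k = u $ l" using AT ij(1) by (auto simp: u_def)
    from moveE[OF w this] obtain \<epsilon> where \<epsilon>: "\<epsilon> > 0" "w + \<epsilon> *\<^sub>R u \<in> P" by auto
    from weak[OF \<epsilon>(2) ij] have "w $ j \<le> w $ i - \<epsilon>" using ij by (auto simp: u_def split: if_splits)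
    with \<epsilon>(1) show ?thesis by simp
  qed
  show ?thesis
  proof (rule that[OF cA cT AT])
    show "P \<noteq> {}" using w0P by auto
    show "C = closure P" by (simp add: Ceq P_def)
    show "w $ i = w $ j" if "w \<in> P" "i \<in> A" "j \<in> A" for w i j
      using minP1[OF that(1)] that by (intro antisym) auto
    show "w $ i < w $ j" if "w \<in> P" "i \<in> A" "j \<notin> A" for w i j by (rule minP2[OF that])
    show "w $ j < w $ i" if "w \<in> P" "i \<in> T" "j \<notin> T" for w i j by (rule strict[OF that])
    show "\<exists>\<epsilon>>0. w + \<epsilon> *\<^sub>R u \<in> P" if "w \<in> P" "\<forall>i\<in>A. \<forall>j\<in>A. u $ i = u $ j" for w u by (rule moveE[OF that])
  qed
qed

end

section \<open>Comparison with the cones of W\<close>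

lemma convex_W_open_cone: "convex (W_open_cone m t \<sigma> :: (real ^ 'n::finite) set)"
proof -
  have lt: "convex {\<omega>::real^'n. \<omega> $ i < \<omega> $ j}" for i j
    using convex_halfspace_lt[of "axis i 1 - axis j 1 :: real ^ 'n" 0] by (simp add: inner_diff_left inner_axis')
  have eq: "convex {\<omega>::real^'n. \<omega> $ i = \<omega> $ j}" for i j
    using convex_hyperplane[of "axis i 1 - axis j 1 :: real ^ 'n" 0] by (simp add: inner_diff_left inner_axis')
  have "W_open_cone m t \<sigma> =
    (\<Inter>p\<in>{1..CARD('n)-m+1}. \<Inter>q\<in>{1..CARD('n)-m+1}. {\<omega>::real^'n. \<omega> $ \<sigma> p = \<omega> $ \<sigma> q}) \<inter>
    (\<Inter>p\<in>{1..CARD('n)-m+1}. \<Inter>q\<in>{CARD('n)-m+2..CARD('n)-t}. {\<omega>. \<omega> $ \<sigma> p < \<omega> $ \<sigma> q}) \<inter>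
    (\<Inter>p\<in>{CARD('n)-m+2..CARD('n)-t}. \<Inter>q\<in>{CARD('n)-t+1..CARD('n)}. {\<omega>. \<omega> $ \<sigma> p < \<omega> $ \<sigma> q})"
    unfolding W_open_cone_def Let_def by blast
  also have "convex \<dots>" by (intro convex_Int convex_INT lt eq)
  finally show ?thesis .
qed

lemma partition_enumeration:
  fixes A T :: "'n::finite set"
  assumes AT: "A \<inter> T = {}"
  obtains \<sigma> where "bij_betw \<sigma> {1..CARD('n)} (UNIV :: 'n set)" "\<sigma> ` {1..card A} = A"
    "\<sigma> ` {card A + 1..CARD('n) - card T} = - (A \<union> T)" "\<sigma> ` {CARD('n) - card T + 1..CARD('n)} = T"
proof -
  let ?n = "CARD('n)" and ?a = "card A" and ?t = "card T"
  have AT': "card (A \<union> T) = ?a + ?t" by (simp add: card_Un_disjoint AT)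
  then have le: "?a + ?t \<le> ?n" using card_mono[OF finite subset_UNIV, of "A \<union> T"] by simp
  have R: "card (- (A \<union> T)) = ?n - ?t - ?a" using card_add_compl[of "A \<union> T"] AT' by simp
  obtain f1 where f1: "bij_betw f1 {1..?a} A" using finite_same_card_bij[of "{1..?a}" A] by auto
  obtain f2 where f2: "bij_betw f2 {?a + 1..?n - ?t} (- (A \<union> T))"
    using finite_same_card_bij[of "{?a + 1..?n - ?t}" "- (A \<union> T)"] R by auto
  obtain f3 where f3: "bij_betw f3 {?n - ?t + 1..?n} T"
    using finite_same_card_bij[of "{?n - ?t + 1..?n}" T] le by auto
  define \<sigma> where "\<sigma> p = (if p \<le> ?a then f1 p else if p \<le> ?n - ?t then f2 p else f3 p)" for p
  have "\<sigma> ` {1..?a} = f1 ` {1..?a}" by (intro image_cong) (auto simp: \<sigma>_def)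
  then have 1: "\<sigma> ` {1..?a} = A" using f1 by (simp add: bij_betw_def)
  have "\<sigma> ` {?a + 1..?n - ?t} = f2 ` {?a + 1..?n - ?t}" by (intro image_cong) (auto simp: \<sigma>_def)
  then have 2: "\<sigma> ` {?a + 1..?n - ?t} = - (A \<union> T)" using f2 by (simp add: bij_betw_def)
  have "\<sigma> ` {?n - ?t + 1..?n} = f3 ` {?n - ?t + 1..?n}" using le by (intro image_cong) (auto simp: \<sigma>_def)
  then have 3: "\<sigma> ` {?n - ?t + 1..?n} = T" using f3 by (simp add: bij_betw_def)
  have "{1..?n} = {1..?a} \<union> {?a + 1..?n - ?t} \<union> {?n - ?t + 1..?n}" using le by auto
  then have "\<sigma> ` {1..?n} = A \<union> - (A \<union> T) \<union> T" by (simp only: image_Un 1 2 3)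
  then have "\<sigma> ` {1..?n} = UNIV" by auto
  moreover from this have "inj_on \<sigma> {1..?n}" by (intro eq_card_imp_inj_on) simp_all
  ultimately have "bij_betw \<sigma> {1..?n} UNIV" by (simp add: bij_betw_def)
  then show ?thesis by (rule that[OF _ 1 2 3])
qed

text \<open>From any point of \<open>P\<close> a small step is possible in every direction constant
  on \<open>A\<close>, so the affine hull is the whole space of such vectors. It is applied to
  \<open>P\<close> itself and to the W cone, to give both the same hull.\<close>

lemma affine_hull_eq_constant_on:
  fixes A :: "'n::finite set" and P S :: "(real ^ 'n) set"
  assumes P: "P \<noteq> {}" "\<And>w u. w \<in> P \<Longrightarrow> \<forall>i\<in>A. \<forall>j\<in>A. u $ i = u $ j \<Longrightarrow> \<exists>\<epsilon>>0. w + \<epsilon> *\<^sub>R u \<in> P"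
    and PS: "P \<subseteq> S" and S: "S \<subseteq> {u. \<forall>i\<in>A. \<forall>j\<in>A. u $ i = u $ j}"
  shows "affine hull closure S = {u. \<forall>i\<in>A. \<forall>j\<in>A. u $ i = u $ j}" (is "_ = ?L")
proof (rule antisym)
  have sub: "subspace ?L"
  proof (rule subspaceI)
    fix x y :: "real ^ 'n" and c :: real assume x: "x \<in> ?L" and y: "y \<in> ?L"
    show "x + y \<in> ?L"
    proof (intro CollectI ballI)
      fix i j assume "i \<in> A" "j \<in> A"
      then have "x $ i = x $ j" "y $ i = y $ j" using x y by blast+
      then show "(x + y) $ i = (x + y) $ j" by simp
    qed
  next
    fix x :: "real ^ 'n" and c :: real assume x: "x \<in> ?L"
    show "c *\<^sub>R x \<in> ?L"
    proof (intro CollectI ballI)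
      fix i j assume "i \<in> A" "j \<in> A"
      then have "x $ i = x $ j" using x by blast
      then show "(c *\<^sub>R x) $ i = (c *\<^sub>R x) $ j" by simp
    qed
  qed simp
  have "closure S \<subseteq> ?L" by (intro closure_minimal S closed_subspace sub)
  then show "affine hull closure S \<subseteq> ?L" by (intro hull_minimal subspace_imp_affine sub)
  show "?L \<subseteq> affine hull closure S"
  proof
    fix u assume u: "u \<in> ?L"
    obtain w where w: "w \<in> P" using P(1) by auto
    then have "w \<in> ?L" using PS S by auto
    from subspace_diff[OF sub u this] have "\<forall>i\<in>A. \<forall>j\<in>A. (u - w) $ i = (u - w) $ j" by blast
    from P(2)[OF w this] obtain \<epsilon> where \<epsilon>: "\<epsilon> > 0" "w + \<epsilon> *\<^sub>R (u - w) \<in> P" by auto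
    have in_hull: "x \<in> affine hull closure S" if "x \<in> P" for x
      using that PS closure_subset[of S] by (intro hull_inc) auto
    \<comment> \<open>\<open>u\<close> is recovered by extrapolation along the line through
      \<open>w\<close> and the nearby point of \<open>P\<close>.\<close>
    have "(1 - 1 / \<epsilon>) *\<^sub>R w + (1 / \<epsilon>) *\<^sub>R (w + \<epsilon> *\<^sub>R (u - w)) \<in> affine hull closure S"
      by (intro mem_affine[OF affine_affine_hull] in_hull w \<epsilon>(2)) simp
    also have "(1 - 1 / \<epsilon>) *\<^sub>R w + (1 / \<epsilon>) *\<^sub>R (w + \<epsilon> *\<^sub>R (u - w)) = u"
      using \<epsilon>(1) by (simp add: algebra_simps)
    finally show "u \<in> affine hull closure S" .
  qed
qed

lemma (in generic_ideal) maximal_cone_in_W_cone: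
  assumes C: "maximal_cone (tropical_fan J) C" and m: "0 < m" "m < CARD('n)"
    and gd: "maximal_gdepth I" and t: "ideal_depth I = enat t" and nz: "I \<noteq> {0}" and tm: "t < m - 1"
  shows "\<exists>D\<in>W_fan m t. rel_interior C \<subseteq> rel_interior D"
proof -
  obtain A T P where cA: "card A + m = Suc CARD('n)" and cT: "card T = t" and AT: "A \<inter> T = {}"
    and P0: "P \<noteq> {}" and CP: "C = closure P"
    and PA: "\<And>w i j. w \<in> P \<Longrightarrow> i \<in> A \<Longrightarrow> j \<in> A \<Longrightarrow> w $ i = w $ j"
    and PR: "\<And>w i j. w \<in> P \<Longrightarrow> i \<in> A \<Longrightarrow> j \<notin> A \<Longrightarrow> w $ i < w $ j"
    and PT: "\<And>w i j. w \<in> P \<Longrightarrow> i \<in> T \<Longrightarrow> j \<notin> T \<Longrightarrow> w $ j < w $ i"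
    and Pm: "\<And>w u. w \<in> P \<Longrightarrow> \<forall>i\<in>A. \<forall>j\<in>A. u $ i = u $ j \<Longrightarrow> \<exists>\<epsilon>>0. w + \<epsilon> *\<^sub>R u \<in> P"
    by (rule maximal_cone_weights[OF C m gd t nz tm]) (rule that, assumption+)
  obtain \<sigma> where \<sigma>: "bij_betw \<sigma> {1..CARD('n)} (UNIV :: 'n set)" "\<sigma> ` {1..card A} = A"
    "\<sigma> ` {card A + 1..CARD('n) - card T} = - (A \<union> T)" "\<sigma> ` {CARD('n) - card T + 1..CARD('n)} = T"
    by (rule partition_enumeration[OF AT]) (rule that, assumption+)
  let ?W = "W_open_cone m t \<sigma>"
  \<comment> \<open>The first block of \<open>W_open_cone\<close> has
    \<open>n - m + 1 = card A\<close> indices, so the coordinates of \<open>A\<close> fill it and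
    the middle block starts right after.\<close>
  have ca: "CARD('n) - m + 1 = card A" "CARD('n) - m + 2 = card A + 1" using cA m by simp_all
  have \<sigma>1: "\<sigma> p \<in> A" if "p \<in> {1..card A}" for p using that \<sigma>(2) by blast
  have \<sigma>2: "\<sigma> p \<in> - (A \<union> T)" if "p \<in> {card A + 1..CARD('n) - t}" for p using that \<sigma>(3) cT by blast
  have \<sigma>3: "\<sigma> p \<in> T" if "p \<in> {CARD('n) - t + 1..CARD('n)}" for p using that \<sigma>(4) cT by blast
  have PW: "P \<subseteq> ?W"
    unfolding W_open_cone_def Let_def ca
  proof (intro subsetI CollectI conjI ballI)
    fix w p q assume w: "w \<in> P"
    show "w $ \<sigma> p = w $ \<sigma> q" if "p \<in> {1..card A}" "q \<in> {1..card A}"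
      by (rule PA[OF w \<sigma>1[OF that(1)] \<sigma>1[OF that(2)]])
    show "w $ \<sigma> p < w $ \<sigma> q" if "p \<in> {1..card A}" "q \<in> {card A + 1..CARD('n) - t}"
      by (rule PR[OF w \<sigma>1[OF that(1)]]) (use \<sigma>2[OF that(2)] in simp)
    show "w $ \<sigma> p < w $ \<sigma> q" if "p \<in> {card A + 1..CARD('n) - t}" "q \<in> {CARD('n) - t + 1..CARD('n)}"
      by (rule PT[OF w \<sigma>3[OF that(2)]]) (use \<sigma>2[OF that(1)] in simp)
  qed
  have WL: "?W \<subseteq> {u. \<forall>i\<in>A. \<forall>j\<in>A. u $ i = u $ j}"
  proof (intro subsetI CollectI ballI)
    fix w i j assume w: "w \<in> ?W" and ij: "i \<in> A" "j \<in> A"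
    obtain p q where "p \<in> {1..card A}" "q \<in> {1..card A}" "i = \<sigma> p" "j = \<sigma> q" using ij \<sigma>(2) by blast
    then show "w $ i = w $ j" using w unfolding W_open_cone_def Let_def ca by blast
  qed
  have 1: "affine hull closure ?W = {u. \<forall>i\<in>A. \<forall>j\<in>A. u $ i = u $ j}"
    by (rule affine_hull_eq_constant_on[OF P0 _ PW WL]) (rule Pm)
  have 2: "affine hull closure P = {u. \<forall>i\<in>A. \<forall>j\<in>A. u $ i = u $ j}"
    by (rule affine_hull_eq_constant_on[OF P0 _ order_refl order_trans[OF PW WL]]) (rule Pm)
  \<comment> \<open>Inclusion passes to relative interiors because both closures have the same
    affine hull.\<close>
  have "rel_interior C \<subseteq> rel_interior (closure ?W)"
    unfolding CP by (rule subset_rel_interior[OF closure_mono[OF PW] trans[OF 2 1[symmetric]]])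
  moreover have "closure ?W \<in> W_fan m t"
    unfolding W_fan_def
  proof (intro CollectI conjI exI)
    show "closure ?W \<noteq> {}" using P0 PW closure_subset[of ?W] by blast
    show "closure ?W face_of closure ?W" by (rule face_of_refl[OF convex_closure[OF convex_W_open_cone]])
  qed (rule \<sigma>(1))
  ultimately show ?thesis by blast
qed

theorem proposition5p6:
  fixes I :: "('n::finite, 'k::{alg_closed_field, field_char_0}) mpoly set"
    and C :: "(real ^ 'n) set"
    and m t :: nat
  assumes "ideal I mpoly_ring"
    and "I \<noteq> {0}"
    and "graded I"
    and "maximal_gdepth I"
    and "ideal_dim I = enat m"
    and "m < CARD('n)"
    and "ideal_depth I = enat t"
    and "0 < t"
    and "t < m - 1"
    and "maximal_cone (generic_tropical_fan I) C"
  shows "\<exists>D\<in>W_fan m t. rel_interior C \<subseteq> rel_interior D"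
proof -
  have I: "pid.subspace I" using assms(1) by (simp add: ideal_iff_subspace)
  \<comment> \<open>Modulo the unit ideal no sequence is regular, not even the empty one, so the
    depth would be 0, against \<open>0 < t\<close>.\<close>
  have proper: "I \<noteq> UNIV"
  proof
    assume "I = UNIV"
    then have "ls = []" if "regseq I ls" for ls
      using that pid.span_superset[of "I \<union> set ls"] by (auto simp: regseq_def)
    then have "ideal_depth I \<le> enat 0"
      unfolding ideal_depth_eq[OF I] by (intro Sup_least) auto
    with assms(7,8) show False by simp
  qed
  obtain D where D: "gen_bound I D" using gen_bound_ex by blast
  obtain g where g: "Dgen I D g" using generically_ex[OF generically_Dgen[OF I]] by blast
  interpret generic_ideal I D g m
    by (rule generic_ideal.intro[OF I assms(3) proper D g assms(5)])
  show ?thesis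
    by (rule maximal_cone_in_W_cone) (use assms generic_tropical_fan_eq in simp_all)
qed

end
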